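(* Let $n>1$. Consider a semi-coherent system with $n$ components, structure function $\Phi$ and structural signature $\mathbf s=(s_1,\dots,s_n)$, whose components' lifetimes follow a Lévy-frailty Marshall-Olkin (LFMO) distribution with Laplace exponent $\Psi$. Let $r\in\{1,\dots,n\}$ and assume that the system operates under the $r$-out-of-$n$:R repair policy, starting at time $0$ with all components working, with costs $c_{cmp}(j)$ ($1\le j\le n$) and $c_{sys}$. Let $T_{fail}^{(r)}$ and $T_{rep}^{(r)}$ be the first system-failure time and the first repair time under this policy, and let $C[0,t]$ be the total cost incurred during $[0,t]$. Write $a\wedge b=\min\{a,b\}$. The following hold. 1. Let $p^{(r)}:=\mathbb P(T_{rep}^{(r)}=T_{fail}^{(r)})$. Then $$p^{(r)}=\sum_{k=1}^n s_k\,\mathbb P(T_{k\wedge r:n}=T_{k:n})=\sum_{k=1}^r s_k+\sum_{k=r+1}^n s_k\,\mathbb P(T_{r:n}=T_{k:n}),$$ $$1-p^{(r)}=\sum_{k=1}^n s_k\,\mathbb P(T_{k\wedge r:n}<T_{k:n})=\sum_{k=r+1}^n s_k\,\mathbb P(T_{r:n}<T_{k:n}),$$ where, for $r<k$, $\mathbb P(T_{r:n}=T_{k:n})=F_{[0,r-1],[k,n]}$ and $\mathbb P(T_{r:n}<T_{k:n})=F_{[0,r-1],[r,k-1]}$. 2. For $1\le j\le n$, $$\mathbb P\big(N(T_{rep}^{(r)})=j\big)=\sum_{k=1}^n s_k\,\mathbb P\big(N(T_{r\wedge k:n})=j\big)=\sum_{k=1}^{j\mathbf 1_{\{j<r\}}+n\mathbf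 1_{\{j\ge r\}}} s_k\,\mathbb P\big(N(T_{r\wedge k:n})=j\big),$$ where, for $1\le m\le n$, $\mathbb P(N(T_{m:n})=j)=F_{[0,m-1],j}$ if $m\le j$ and $0$ if $m>j$. 3. When $p^{(r)}>0$, for $j=1,\dots,n$ it holds that $$\mathbb P\big(N(T_{rep}^{(r)})=j\,\big|\,T_{rep}^{(r)}=T_{fail}^{(r)}\big)=\mathbb P\big(N(T_{fail}^{(r)})=j\big)=\frac1{p^{(r)}}\sum_{k=1}^j s_k\,\mathbb P\big(N(T_{r\wedge k:n})=j\big);$$ and for $j=r,\dots,n$, $$\mathbb P\big(N(T_{rep}^{(r)})=j\,\big|\,T_{rep}^{(r)}<T_{fail}^{(r)}\big)=\frac1{1-p^{(r)}}\sum_{k=j+1}^n s_k\,\mathbb P\big(N(T_{r:n})=j\big),$$ where the empty sum $\sum_{k=n+1}^n$ is zero, while $\mathbb P(N(T_{rep}^{(r)})=j\,|\,T_{rep}^{(r)}<T_{fail}^{(r)})=0$ for $j<r$. 4. When $p^{(r)}>0$, the system will eventually fail, i.e. $T_{fail}^{(r)}<+\infty$ almost surely, and $$\lim_{t\to\infty}\frac{C[0,t]}{t}=\frac{\mathbb E\,C[0,T_{fail}^{(r)}]}{\mathbb E\,T_{fail}^{(r)}}=\frac{\mathbb E\,C[0,T_{rep}^{(r)}]}{\mathbb E\,T_{rep}^{(r)}}\qquad\text{almost surely},$$ where $$\mathbb E\,C[0,T_{fail}^{(r)}]=\frac1{p^{(r)}}\mathbb E\,C[0,T_{rep}^{(r)}]=c_{sys}+\frac1{p^{(r)}}\sum_{j=1}^n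 c_{cmp}(j)\,\mathbb P\big(N(T_{rep}^{(r)})=j\big),$$ $$\mathbb E\,T_{fail}^{(r)}=\frac1{p^{(r)}}\mathbb E\,T_{rep}^{(r)}=\frac1{p^{(r)}}\sum_{k=1}^n s_k\,\mathbb E[T_{k\wedge r:n}],$$ and, for $1\le m\le n$, $\mathbb E[T_{m:n}]=\sum_{i=n-m+1}^n\binom ni\binom{i-1}{n-m}(-1)^{i-n+m-1}\frac1{\Psi(i)}$. 5. When $p^{(r)}=0$, the system never fails, i.e. $T_{fail}^{(r)}=+\infty$ almost surely, and $\lim_{t\to\infty}C[0,t]/t=\mathbb E\,C[0,T_{rep}^{(r)}]/\mathbb E\,T_{rep}^{(r)}$ almost surely, where $\mathbb E\,C[0,T_{rep}^{(r)}]=\sum_{j=1}^n c_{cmp}(j)\,\mathbb P(N(T_{rep}^{(r)})=j)$ and $\mathbb E\,T_{rep}^{(r)}=\sum_{k=1}^n s_k\,\mathbb E[T_{k\wedge r:n}]$.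
   Context: **LFMO lifetimes.** $\mathbf L=(L_t)_{t\ge0}$ is a (real-valued) Lévy subordinator, i.e. a nondecreasing Lévy process with $L_0=0$, not identically zero, with Laplace exponent $\Psi(x)=-\log\mathbb E[e^{-xL_1}]$ (so $\Psi(0)=0$). $\varepsilon_1,\dots,\varepsilon_n$ are iid standard exponential, independent of $\mathbf L$. Without repairs, component $i$ fails at $T_i:=\inf\{t\ge0:L_t>\varepsilon_i\}$; the law of $(T_1,\dots,T_n)$ is called LFMO. $T_{1:n}\le\dots\le T_{n:n}$ are the ordered values of $T_1,\dots,T_n$. Without repairs, $N(t):=\sum_{i=1}^n\mathbf 1_{\{L_t\ge\varepsilon_i\}}$ is the number of failed components at time $t$; the quantities $T_{k:n}$ and $N(T_{k:n})$ always refer to this no-repair setting. **Probabilities $F$.** For $1\le k\le l$ let $\lambda_k^{(l)}:=\sum_{i=0}^{k-1}\binom{k-1}{i}(-1)^i(\Psi(l-k+i+1)-\Psi(l-k+i))$. For $0\le i<j\le n$ let $P_{i,j}:=\binom{n-i}{j-i}\lambda_{j-i}^{(n-i)}/\Psi(n-i)$. Define recursively $F_{[0,0],j}:=P_{0,j}$ for $j>0$; $F_{[0,i],j}:=F_{[0,i-1],j}+F_{[0,i-1],i}P_{i,j}$ for $i\ge1$, $j>i$; and $F_{[0,i],j}:=0$ for $j\le i$. Let $F_{[0,i],[j,k]}:=\sum_{l=j}^kF_{[0,i],l}$. **System structure.** A state is $\mathbf x\in\{0,1\}^n$ ($x_i=1$ iff component $i$ works) and the system works in state $\mathbf x$ iff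 $\Phi(\mathbf x)=1$, where $\Phi:\{0,1\}^n\to\{0,1\}$. The system is semi-coherent iff $\Phi$ is monotone ($\mathbf x\le\mathbf y$ componentwise implies $\Phi(\mathbf x)\le\Phi(\mathbf y)$), $\Phi(\mathbf 0)=0$ and $\Phi(\mathbf 1)=1$. With $|\mathbf x|=\sum_ix_i$ and $\overline S_k:=\binom{n}{n-k}^{-1}\sum_{|\mathbf x|=n-k}\Phi(\mathbf x)$ for $k=0,\dots,n$, the structural signature is $s_k:=\overline S_{k-1}-\overline S_k$, $k=1,\dots,n$. **Repair policy and costs.** Under the $r$-out-of-$n$:R repair policy, all failed components (and the system, if failed) are repaired whenever $r$ or more components are failed or the system is failed. Failures are detected instantly, repairs are instantaneous and perfect (a repaired component is as good as new). A repair of $j$ failed components costs $c_{cmp}(j)$, plus an additional $c_{sys}$ if the system is failed (costs are deterministic real numbers). Formally, let $E_{i,m}$ ($1\le i\le n$, $m\ge0$) be iid standard exponential, independent of $\mathbf L$; put $T_{rep}^{(r)}[0]=0$, $\varepsilon_i[0]=E_{i,0}$, and inductively for $m\ge0$: $\chi_i[m](t)=1$ if $L_t<\varepsilon_i[m]$ and $0$ otherwise, $\chi[m](t)=(\chi_1[m](t),\dots,\chi_n[m](t))$, $T_{rep}^{(r)}[m+1]=\inf\{t>T_{rep}^{(r)}[m]:\sum_i(1-\chi_i[m](t))\ge r\text{ or }\Phi(\chi[m](t))=0\}$, and $\varepsilon_i[m+1]=L_{T_{rep}^{(r)}[m+1]}+E_{i,m+1}$ if $\chi_i[m](T_{rep}^{(r)}[m+1])=0$,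 $\varepsilon_i[m+1]=\varepsilon_i[m]$ otherwise. The $m$-th repair ($m\ge1$) occurs at $T_{rep}^{(r)}[m]$; it is due to a system failure iff $\Phi(\chi[m-1](T_{rep}^{(r)}[m]))=0$. Then $T_{rep}^{(r)}=T_{rep}^{(r)}[1]$, and $T_{fail}^{(r)}$ is the first repair time due to a system failure ($+\infty$ if there is none). $N(T_{rep}^{(r)})$ and $N(T_{fail}^{(r)})$ denote the number of components found failed (and then repaired) at the corresponding repair time, i.e. $\sum_i(1-\chi_i[m-1](T_{rep}^{(r)}[m]))$ for the corresponding $m$. $C[0,t]$ is the sum of the costs of all repairs made at times in $[0,t]$ (endpoints included). *)

theory Defs
  imports "HOL-Probability.Probability"
begin

(* Paths are required to be cadlag and to start at 0 surely, not just almost surely, so that hitting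
   times are measurable without completing M.  Stochastic continuity follows from right-continuity
   and stationarity. *)
definition levy_process :: "'a measure \<Rightarrow> (real \<Rightarrow> 'a \<Rightarrow> real) \<Rightarrow> bool" where
  "levy_process M L \<longleftrightarrow>
     prob_space M \<and>
     (\<forall>t\<ge>0. L t \<in> borel_measurable M) \<and>
     (\<forall>\<omega>\<in>space M. L 0 \<omega> = 0) \<and>
     (\<forall>(k::nat) ts. 0 \<le> ts 0 \<and> (\<forall>i<k. ts i \<le> ts (Suc i)) \<longrightarrow>
        prob_space.indep_vars M (\<lambda>_. borel) (\<lambda>i \<omega>. L (ts (Suc i)) \<omega> - L (ts i) \<omega>) {..<k}) \<and>
     (\<forall>s\<ge>0. \<forall>h\<ge>0. distr M borel (\<lambda>\<omega>. L (s + h) \<omega> - L s \<omega>) = distr M borel (L h)) \<and>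
     (\<forall>\<omega>\<in>space M. \<forall>t\<ge>0. ((\<lambda>u. L u \<omega>) \<longlongrightarrow> L t \<omega>) (at_right t)) \<and>
     (\<forall>\<omega>\<in>space M. \<forall>t>0. \<exists>l. ((\<lambda>u. L u \<omega>) \<longlongrightarrow> l) (at_left t))"

definition levy_subordinator :: "'a measure \<Rightarrow> (real \<Rightarrow> 'a \<Rightarrow> real) \<Rightarrow> bool" where
  "levy_subordinator M L \<longleftrightarrow>
     levy_process M L \<and>
     (\<forall>\<omega>\<in>space M. \<forall>s t. 0 \<le> s \<and> s \<le> t \<longrightarrow> L s \<omega> \<le> L t \<omega>) \<and>
     \<not> (AE \<omega> in M. \<forall>t\<ge>0. L t \<omega> = 0)"

definition laplace_exponent :: "'a measure \<Rightarrow> (real \<Rightarrow> 'a \<Rightarrow> real) \<Rightarrow> real \<Rightarrow> real" where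
  "laplace_exponent M L x = - ln (\<integral>\<omega>. exp (- x * L 1 \<omega>) \<partial>M)"

(* The last conjunct is independence of the \<sigma>-algebras generated by the whole family E and by the
   whole process L; indep_var does not apply because the two have different value types. *)
definition exponential_triggers ::
  "'a measure \<Rightarrow> nat \<Rightarrow> (real \<Rightarrow> 'a \<Rightarrow> real) \<Rightarrow> (nat \<Rightarrow> nat \<Rightarrow> 'a \<Rightarrow> real) \<Rightarrow> bool" where
  "exponential_triggers M n L E \<longleftrightarrow>
     (\<forall>i\<in>{1..n}. \<forall>m. distributed M lborel (E i m) (exponential_density 1)) \<and>
     prob_space.indep_vars M (\<lambda>_. borel) (\<lambda>(i, m). E i m) ({1..n} \<times> UNIV) \<and>
     prob_space.indep_set M
       (sets (vimage_algebra (space M)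
          (\<lambda>\<omega>. \<lambda>(i, m)\<in>{1..n} \<times> UNIV. E i m \<omega>) (\<Pi>\<^sub>M q\<in>{1..n} \<times> UNIV. borel)))
       (sets (vimage_algebra (space M)
          (\<lambda>\<omega>. \<lambda>t\<in>{0..}. L t \<omega>) (\<Pi>\<^sub>M t\<in>{0..}. borel)))"


(* Without repairs, the trigger of component i is E i 0. *)
definition lifetime ::
  "(real \<Rightarrow> 'a \<Rightarrow> real) \<Rightarrow> (nat \<Rightarrow> nat \<Rightarrow> 'a \<Rightarrow> real) \<Rightarrow> nat \<Rightarrow> 'a \<Rightarrow> ereal" where
  "lifetime L E i \<omega> = (INF t\<in>{t. 0 \<le> t \<and> E i 0 \<omega> < L t \<omega>}. ereal t)"

definition ord_lifetime ::
  "nat \<Rightarrow> (real \<Rightarrow> 'a \<Rightarrow> real) \<Rightarrow> (nat \<Rightarrow> nat \<Rightarrow> 'a \<Rightarrow> real) \<Rightarrow> nat \<Rightarrow> 'a \<Rightarrow> ereal" where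
  "ord_lifetime n L E k \<omega> = sort (map (\<lambda>i. lifetime L E i \<omega>) [1..<Suc n]) ! (k - 1)"

definition num_failed ::
  "nat \<Rightarrow> (real \<Rightarrow> 'a \<Rightarrow> real) \<Rightarrow> (nat \<Rightarrow> nat \<Rightarrow> 'a \<Rightarrow> real) \<Rightarrow> real \<Rightarrow> 'a \<Rightarrow> nat" where
  "num_failed n L E t \<omega> = (\<Sum>i=1..n. of_bool (E i 0 \<omega> \<le> L t \<omega>))"

(* N(T_{k:n}); the value where T_{k:n} is infinite (a null event) is arbitrary. *)
definition num_failed_ord ::
  "nat \<Rightarrow> (real \<Rightarrow> 'a \<Rightarrow> real) \<Rightarrow> (nat \<Rightarrow> nat \<Rightarrow> 'a \<Rightarrow> real) \<Rightarrow> nat \<Rightarrow> 'a \<Rightarrow> nat" where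
  "num_failed_ord n L E k \<omega> = num_failed n L E (real_of_ereal (ord_lifetime n L E k \<omega>)) \<omega>"


definition lam :: "(real \<Rightarrow> real) \<Rightarrow> nat \<Rightarrow> nat \<Rightarrow> real" where
  "lam \<Psi> k l = (\<Sum>i=0..k-1. real ((k - 1) choose i) * (-1) ^ i *
                    (\<Psi> (real (l - k + i + 1)) - \<Psi> (real (l - k + i))))"

definition trans_prob :: "(real \<Rightarrow> real) \<Rightarrow> nat \<Rightarrow> nat \<Rightarrow> nat \<Rightarrow> real" where
  "trans_prob \<Psi> n i j =
     real ((n - i) choose (j - i)) * lam \<Psi> (j - i) (n - i) / \<Psi> (real (n - i))"

(* exit_prob \<Psi> n i j is F_{[0,i],j}, meant for i < n and j \<le> n. *)
primrec exit_prob :: "(real \<Rightarrow> real) \<Rightarrow> nat \<Rightarrow> nat \<Rightarrow> nat \<Rightarrow> real" where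
  "exit_prob \<Psi> n 0 j = (if 0 < j then trans_prob \<Psi> n 0 j else 0)"
| "exit_prob \<Psi> n (Suc i) j =
     (if Suc i < j
      then exit_prob \<Psi> n i j + exit_prob \<Psi> n i (Suc i) * trans_prob \<Psi> n (Suc i) j
      else 0)"

definition exit_prob_range :: "(real \<Rightarrow> real) \<Rightarrow> nat \<Rightarrow> nat \<Rightarrow> nat \<Rightarrow> nat \<Rightarrow> real" where
  "exit_prob_range \<Psi> n i j k = (\<Sum>l=j..k. exit_prob \<Psi> n i l)"


(* The state space {0,1}^n, as extensional functions on {1..n}. *)
abbreviation states :: "nat \<Rightarrow> (nat \<Rightarrow> nat) set" where
  "states n \<equiv> {1..n} \<rightarrow>\<^sub>E {0, 1}"

definition semi_coherent :: "nat \<Rightarrow> ((nat \<Rightarrow> nat) \<Rightarrow> nat) \<Rightarrow> bool" where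
  "semi_coherent n \<Phi> \<longleftrightarrow>
     \<Phi> \<in> states n \<rightarrow> {0, 1} \<and>
     (\<forall>x\<in>states n. \<forall>y\<in>states n. (\<forall>i\<in>{1..n}. x i \<le> y i) \<longrightarrow> \<Phi> x \<le> \<Phi> y) \<and>
     \<Phi> (\<lambda>i\<in>{1..n}. 0) = 0 \<and>
     \<Phi> (\<lambda>i\<in>{1..n}. 1) = 1"

definition tail_signature :: "nat \<Rightarrow> ((nat \<Rightarrow> nat) \<Rightarrow> nat) \<Rightarrow> nat \<Rightarrow> real" where
  "tail_signature n \<Phi> k =
     (\<Sum>x\<in>{x\<in>states n. (\<Sum>i=1..n. x i) = n - k}. real (\<Phi> x)) / real (n choose (n - k))"

definition struct_signature :: "nat \<Rightarrow> ((nat \<Rightarrow> nat) \<Rightarrow> nat) \<Rightarrow> nat \<Rightarrow> real" where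
  "struct_signature n \<Phi> k = tail_signature n \<Phi> (k - 1) - tail_signature n \<Phi> k"


definition comp_state ::
  "nat \<Rightarrow> (real \<Rightarrow> 'a \<Rightarrow> real) \<Rightarrow> (nat \<Rightarrow> real) \<Rightarrow> real \<Rightarrow> 'a \<Rightarrow> nat \<Rightarrow> nat" where
  "comp_state n L \<epsilon> t \<omega> = (\<lambda>i\<in>{1..n}. if L t \<omega> < \<epsilon> i then 1 else 0)"

(* The m-th repair time, and the triggers \<epsilon>_i[m] in force after it.  If repair_time m is infinite,
   then so are all later ones and the triggers from m on are irrelevant; real_of_ereal then only
   supplies an arbitrary value. *)
function repair_time ::
    "nat \<Rightarrow> ((nat \<Rightarrow> nat) \<Rightarrow> nat) \<Rightarrow> nat \<Rightarrow> (real \<Rightarrow> 'a \<Rightarrow> real) \<Rightarrow> (nat \<Rightarrow> nat \<Rightarrow> 'a \<Rightarrow> real) \<Rightarrow>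
     nat \<Rightarrow> 'a \<Rightarrow> ereal"
  and trigger ::
    "nat \<Rightarrow> ((nat \<Rightarrow> nat) \<Rightarrow> nat) \<Rightarrow> nat \<Rightarrow> (real \<Rightarrow> 'a \<Rightarrow> real) \<Rightarrow> (nat \<Rightarrow> nat \<Rightarrow> 'a \<Rightarrow> real) \<Rightarrow>
     nat \<Rightarrow> 'a \<Rightarrow> nat \<Rightarrow> real"
where
  "repair_time n \<Phi> r L E 0 \<omega> = 0"
| "repair_time n \<Phi> r L E (Suc m) \<omega> =
     (let x = (\<lambda>t. comp_state n L (trigger n \<Phi> r L E m \<omega>) t \<omega>) in
      INF t\<in>{t. repair_time n \<Phi> r L E m \<omega> < ereal t \<and>
                (r \<le> (\<Sum>i=1..n. 1 - x t i) \<or> \<Phi> (x t) = 0)}. ereal t)"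
| "trigger n \<Phi> r L E 0 \<omega> = (\<lambda>i. E i 0 \<omega>)"
| "trigger n \<Phi> r L E (Suc m) \<omega> =
     (let t = real_of_ereal (repair_time n \<Phi> r L E (Suc m) \<omega>);
          \<epsilon> = trigger n \<Phi> r L E m \<omega> in
      (\<lambda>i. if comp_state n L \<epsilon> t \<omega> i = 0 then L t \<omega> + E i (Suc m) \<omega> else \<epsilon> i))"
  by pat_completeness auto
termination
  by (relation "Wellfounded.measure (\<lambda>x. case x of Inl (_, _, _, _, _, m, _) \<Rightarrow> 2 * m
                                                | Inr (_, _, _, _, _, m, _) \<Rightarrow> Suc (2 * m))") auto

(* The state found just before the m-th repair (m \<ge> 1) is carried out, i.e. \<chi>[m-1](T_rep[m]). *)
definition state_at_repair ::
  "nat \<Rightarrow> ((nat \<Rightarrow> nat) \<Rightarrow> nat) \<Rightarrow> nat \<Rightarrow> (real \<Rightarrow> 'a \<Rightarrow> real) \<Rightarrow> (nat \<Rightarrow> nat \<Rightarrow> 'a \<Rightarrow> real) \<Rightarrow>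
   nat \<Rightarrow> 'a \<Rightarrow> nat \<Rightarrow> nat" where
  "state_at_repair n \<Phi> r L E m \<omega> =
     comp_state n L (trigger n \<Phi> r L E (m - 1) \<omega>) (real_of_ereal (repair_time n \<Phi> r L E m \<omega>)) \<omega>"

definition num_repaired ::
  "nat \<Rightarrow> ((nat \<Rightarrow> nat) \<Rightarrow> nat) \<Rightarrow> nat \<Rightarrow> (real \<Rightarrow> 'a \<Rightarrow> real) \<Rightarrow> (nat \<Rightarrow> nat \<Rightarrow> 'a \<Rightarrow> real) \<Rightarrow>
   nat \<Rightarrow> 'a \<Rightarrow> nat" where
  "num_repaired n \<Phi> r L E m \<omega> = (\<Sum>i=1..n. 1 - state_at_repair n \<Phi> r L E m \<omega> i)"

definition system_failure ::
  "nat \<Rightarrow> ((nat \<Rightarrow> nat) \<Rightarrow> nat) \<Rightarrow> nat \<Rightarrow> (real \<Rightarrow> 'a \<Rightarrow> real) \<Rightarrow> (nat \<Rightarrow> nat \<Rightarrow> 'a \<Rightarrow> real) \<Rightarrow>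
   nat \<Rightarrow> 'a \<Rightarrow> bool" where
  "system_failure n \<Phi> r L E m \<omega> \<longleftrightarrow>
     1 \<le> m \<and> repair_time n \<Phi> r L E m \<omega> < \<infinity> \<and> \<Phi> (state_at_repair n \<Phi> r L E m \<omega>) = 0"

(* Arbitrary if there is no system failure. *)
definition first_failure ::
  "nat \<Rightarrow> ((nat \<Rightarrow> nat) \<Rightarrow> nat) \<Rightarrow> nat \<Rightarrow> (real \<Rightarrow> 'a \<Rightarrow> real) \<Rightarrow> (nat \<Rightarrow> nat \<Rightarrow> 'a \<Rightarrow> real) \<Rightarrow>
   'a \<Rightarrow> nat" where
  "first_failure n \<Phi> r L E \<omega> = (LEAST m. system_failure n \<Phi> r L E m \<omega>)"

definition fail_time ::
  "nat \<Rightarrow> ((nat \<Rightarrow> nat) \<Rightarrow> nat) \<Rightarrow> nat \<Rightarrow> (real \<Rightarrow> 'a \<Rightarrow> real) \<Rightarrow> (nat \<Rightarrow> nat \<Rightarrow> 'a \<Rightarrow> real) \<Rightarrow>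
   'a \<Rightarrow> ereal" where
  "fail_time n \<Phi> r L E \<omega> =
     (if \<exists>m. system_failure n \<Phi> r L E m \<omega>
      then repair_time n \<Phi> r L E (first_failure n \<Phi> r L E \<omega>) \<omega> else \<infinity>)"

(* C[0,t]; the time t may be infinite so that random times can be plugged in.  If infinitely many
   repairs occur in [0,t] (a null event for finite t), the value is 0. *)
definition total_cost ::
  "nat \<Rightarrow> ((nat \<Rightarrow> nat) \<Rightarrow> nat) \<Rightarrow> nat \<Rightarrow> (real \<Rightarrow> 'a \<Rightarrow> real) \<Rightarrow> (nat \<Rightarrow> nat \<Rightarrow> 'a \<Rightarrow> real) \<Rightarrow>
   (nat \<Rightarrow> real) \<Rightarrow> real \<Rightarrow> ereal \<Rightarrow> 'a \<Rightarrow> real" where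
  "total_cost n \<Phi> r L E c_cmp c_sys t \<omega> =
     (\<Sum>m\<in>{m. 1 \<le> m \<and> repair_time n \<Phi> r L E m \<omega> < \<infinity> \<and> repair_time n \<Phi> r L E m \<omega> \<le> t}.
        c_cmp (num_repaired n \<Phi> r L E m \<omega>) +
        (if system_failure n \<Phi> r L E m \<omega> then c_sys else 0))"


(* Expectation of an extended-real time; meaningful only together with has_finite_mean, since
   real_of_ereal \<infinity> = 0. *)
definition mean_time :: "'a measure \<Rightarrow> ('a \<Rightarrow> ereal) \<Rightarrow> real" where
  "mean_time M X = (\<integral>\<omega>. real_of_ereal (X \<omega>) \<partial>M)"

definition has_finite_mean :: "'a measure \<Rightarrow> ('a \<Rightarrow> ereal) \<Rightarrow> bool" where
  "has_finite_mean M X \<longleftrightarrow>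
     (AE \<omega> in M. \<bar>X \<omega>\<bar> \<noteq> \<infinity>) \<and> integrable M (\<lambda>\<omega>. real_of_ereal (X \<omega>))"

end

theory Submission
  imports Defs
begin

text \<open>Call a set of failed components working if it does not trigger a repair. Working sets are closed
  under subsets, and for any such family \<open>G\<close> the set \<open>X\<close> of failed components on leaving \<open>G\<close> has an explicit
  law: the Laplace transform gives the joint law of the sets failed at consecutive points of a dyadic
  grid by inclusion-exclusion, and refining the grid shows that the expected time with failed set
  exactly \<open>B\<close> is a finite difference of \<open>1 / \<Psi>\<close> and that the jump rate from \<open>B\<close> to \<open>A\<close> is a finite difference
  of \<open>\<Psi>\<close>. The ordered lifetimes are the exit times of \<open>{B. card B < m}\<close>, and the first repair is the exit time
  of \<open>{B. card B < r \<and> \<Phi> works on B}\<close>. Both expressions depend on the sizes of \<open>A\<close> and \<open>B\<close> only, so counting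
  the pairs \<open>B \<subseteq> A\<close> weighted with \<open>\<Phi>\<close> turns the law at the first repair into a mixture over the signature.

  Lack of memory of the exponential triggers and of the increments of \<open>L\<close> makes the system after a repair
  a new copy, independent of the past. Hence costs and lengths of the repair cycles are uncorrelated
  with bounded second moments, and a strong law yields the cost rate; Wald's identity for the
  geometric number of cycles up to the first system failure yields the expectations up to that time.\<close>

section \<open>Finite differences\<close>

text \<open>The obstacle is that the exit time depends on the process and on the triggers at once,
  so neither their independence nor the Levy property of \<open>L\<close> can be quoted at it. What
  can be carried across it is a family of numbers: the probabilities that finitely many triggers
  outlive finitely many increments of \<open>L\<close>. They are exponentials of sums of \<psi> over
  grid cells; the computations use nothing else, so nothing else has to be re-established after a
  repair. Such sums split at a grid point, which separates past and future at fixed times; the exit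
  time is reached by rounding it up to ever finer grids, where right continuity applies. The
  survival inequalities are strict and not stable under this limit, hence the continuous cut-offs
  and offsets. Independence of cycles is never phrased with \<sigma>-algebras: a nonnegative
  function of one cycle becomes a density, and under the tilted measure the shifted system satisfies
  the same hypotheses with the same \<psi>, so that products over cycles can be integrated by
  induction.\<close>

text \<open>A power of identity minus shift, so the sign is opposite to that of a forward difference
  when the order is odd. In the applications the argument counts components required to survive, and
  each further order turns the requirement on one more component into its failure.\<close>

primrec fdiff :: "(nat \<Rightarrow> real) \<Rightarrow> nat \<Rightarrow> nat \<Rightarrow> real" where
  "fdiff \<phi> 0 c = \<phi> c"
| "fdiff \<phi> (Suc p) c = fdiff \<phi> p c - fdiff \<phi> p (Suc c)"

lemma fdiff_cong:
  "(\<And>i. c \<le> i \<Longrightarrow> i \<le> c + p \<Longrightarrow> \<phi> i = \<eta> i) \<Longrightarrow> fdiff \<phi> p c = fdiff \<eta> p c"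
proof (induction p arbitrary: c)
  case (Suc p)
  have "fdiff \<phi> p c = fdiff \<eta> p c" "fdiff \<phi> p (Suc c) = fdiff \<eta> p (Suc c)"
    by (rule Suc.IH; use Suc.prems in auto)+
  then show ?case by simp
qed simp

lemma fdiff_add: "fdiff (\<lambda>i. \<phi> i + \<eta> i) p c = fdiff \<phi> p c + fdiff \<eta> p c"
  by (induction p arbitrary: c) auto

lemma fdiff_minus: "fdiff (\<lambda>i. - \<phi> i) p c = - fdiff \<phi> p c"
  by (induction p arbitrary: c) auto

lemma fdiff_cmult: "fdiff (\<lambda>i. a * \<phi> i) p c = a * fdiff \<phi> p c"
  by (induction p arbitrary: c) (auto simp: algebra_simps)

lemma fdiff_const: "0 < p \<Longrightarrow> fdiff (\<lambda>_. a) p c = 0"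
proof (induction p arbitrary: c)
  case (Suc p)
  then show ?case by (cases p) auto
qed simp

lemma fdiff_tendsto:
  assumes "\<And>i. c \<le> i \<Longrightarrow> i \<le> c + p \<Longrightarrow> ((\<lambda>x. \<phi> x i) \<longlongrightarrow> \<eta> i) F"
  shows "((\<lambda>x. fdiff (\<phi> x) p c) \<longlongrightarrow> fdiff \<eta> p c) F"
  using assms
proof (induction p arbitrary: c)
  case (Suc p)
  show ?case unfolding fdiff.simps
    by (intro tendsto_diff Suc.IH Suc.prems) auto
qed simp

lemma fdiff_sums:
  assumes "\<And>i. c \<le> i \<Longrightarrow> i \<le> c + p \<Longrightarrow> (\<lambda>a. \<phi> a i) sums \<eta> i"
  shows "(\<lambda>a. fdiff (\<phi> a) p c) sums fdiff \<eta> p c"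
  using assms
proof (induction p arbitrary: c)
  case (Suc p)
  show ?case unfolding fdiff.simps
    by (intro sums_diff Suc.IH Suc.prems) auto
qed simp

text \<open>Pascal's rule in the form shared by the two inductions on the order of a difference
  below.\<close>

lemma binomial_sum_Suc:
  fixes f :: "nat \<Rightarrow> real"
  shows "(\<Sum>i\<le>Suc p. real (Suc p choose i) * f i) =
    (\<Sum>i\<le>p. real (p choose i) * f i) + (\<Sum>i\<le>p. real (p choose i) * f (Suc i))"
proof -
  have "(\<Sum>i\<le>Suc p. real (Suc p choose i) * f i) = f 0 + (\<Sum>i\<le>p. real (Suc p choose Suc i) * f (Suc i))"
    by (subst sum.atMost_Suc_shift) simp
  also have "\<dots> = f 0 + (\<Sum>i\<le>p. real (p choose Suc i) * f (Suc i)) + (\<Sum>i\<le>p. real (p choose i) * f (Suc i))"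
    by (simp add: algebra_simps sum.distrib)
  also have "f 0 + (\<Sum>i\<le>p. real (p choose Suc i) * f (Suc i)) = (\<Sum>i\<le>Suc p. real (p choose i) * f i)"
    by (subst sum.atMost_Suc_shift) simp
  finally show ?thesis by simp
qed

lemma fdiff_eq_sum: "fdiff \<phi> p c = (\<Sum>l\<le>p. real (p choose l) * ((-1) ^ l * \<phi> (c + l)))"
proof (induction p arbitrary: c)
  case (Suc p)
  show ?case
    unfolding binomial_sum_Suc fdiff.simps Suc.IH
    by (simp add: sum_negf)
qed simp

text \<open>The Leibniz rule for identity minus shift; the two factors sit at different points. With
  \<open>c = n - m\<close> and \<open>p = m\<close> the first factor becomes a difference at
  \<open>n - i\<close>, which does not depend on \<open>m\<close>; this is what lets it be read as
  the time spent in a set of size \<open>i\<close>.\<close>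

lemma fdiff_mult:
  "fdiff (\<lambda>i. \<phi> i * \<eta> i) p c =
     (\<Sum>i\<le>p. real (p choose i) * (fdiff \<phi> i (c + p - i) * fdiff \<eta> (p - i) c))"
proof (induction p arbitrary: c)
  case (Suc p)
  have 1: "fdiff \<phi> i (c + Suc p - i) * fdiff \<eta> (Suc p - i) c =
      fdiff \<phi> i (Suc c + p - i) * (fdiff \<eta> (p - i) c - fdiff \<eta> (p - i) (Suc c))" if "i \<le> p" for i
    using that by (simp add: Suc_diff_le)
  have 2: "fdiff \<phi> (Suc i) (c + Suc p - Suc i) * fdiff \<eta> (Suc p - Suc i) c =
      (fdiff \<phi> i (c + p - i) - fdiff \<phi> i (Suc c + p - i)) * fdiff \<eta> (p - i) c" if "i \<le> p" for i
    using that by (simp add: Suc_diff_le)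
  have "(\<Sum>i\<le>Suc p. real (Suc p choose i) * (fdiff \<phi> i (c + Suc p - i) * fdiff \<eta> (Suc p - i) c)) =
     (\<Sum>i\<le>p. real (p choose i) * (fdiff \<phi> i (Suc c + p - i) * (fdiff \<eta> (p - i) c - fdiff \<eta> (p - i) (Suc c)))) +
     (\<Sum>i\<le>p. real (p choose i) * ((fdiff \<phi> i (c + p - i) - fdiff \<phi> i (Suc c + p - i)) * fdiff \<eta> (p - i) c))"
    unfolding binomial_sum_Suc using 1 2 by (intro arg_cong2[where f="(+)"] sum.cong) auto
  also have "\<dots> = fdiff (\<lambda>i. \<phi> i * \<eta> i) p c - fdiff (\<lambda>i. \<phi> i * \<eta> i) p (Suc c)"
    unfolding Suc.IH sum.distrib[symmetric] sum_subtractf[symmetric]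
    by (intro sum.cong) (auto simp: algebra_simps)
  finally show ?case by simp
qed simp

text \<open>The defining sum is a difference of order \<open>k - 1\<close> of the increments of
  \<Psi>, hence one of order \<open>k\<close> up to sign.\<close>

lemma lam_eq_fdiff:
  assumes "1 \<le> k"
  shows "lam \<Psi> k l = - fdiff (\<lambda>i. \<Psi> (real i)) k (l - k)"
proof -
  obtain k' where k: "k = Suc k'" using assms by (cases k) auto
  have "lam \<Psi> k l = - (fdiff (\<lambda>i. \<Psi> (real i)) k' (l - k) - fdiff (\<lambda>i. \<Psi> (real i)) k' (Suc (l - k)))"
    unfolding lam_def fdiff_eq_sum sum_subtractf[symmetric] sum_negf[symmetric] k
    by (intro sum.cong) (auto simp: algebra_simps atLeast0AtMost)
  then show ?thesis by (simp add: k)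
qed

text \<open>The balance equation at level \<open>m\<close>: both sides are the probability that the number of failed
  components ever equals \<open>m\<close>. It is the Leibniz rule applied to \<open>\<psi> * (1 / \<psi>) = 1\<close>.\<close>

lemma balance:
  assumes "1 \<le> m" "m < n" "\<And>i. 1 \<le> i \<Longrightarrow> \<psi> i \<noteq> 0"
  shows "(\<Sum>i<m. real (m choose i) * (fdiff (\<lambda>i. 1 / \<psi> i) i (n - i) * - fdiff \<psi> (m - i) (n - m))) =
    fdiff (\<lambda>i. 1 / \<psi> i) m (n - m) * \<psi> (n - m)"
proof -
  \<comment> \<open>The arguments run from \<open>n - m\<close> to \<open>n\<close>; as
    \<open>m < n\<close> they are positive, so the product is 1 at all of them.\<close>
  have "fdiff (\<lambda>i. 1 / \<psi> i * \<psi> i) m (n - m) = fdiff (\<lambda>_. 1) m (n - m)"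
    using assms by (intro fdiff_cong) auto
  then have "0 = fdiff (\<lambda>i. 1 / \<psi> i * \<psi> i) m (n - m)"
    using assms by (simp add: fdiff_const)
  also have "\<dots> = (\<Sum>i\<le>m. real (m choose i) * (fdiff (\<lambda>i. 1 / \<psi> i) i (n - i) * fdiff \<psi> (m - i) (n - m)))"
    unfolding fdiff_mult using assms by (intro sum.cong) auto
  also have "\<dots> = (\<Sum>i<m. real (m choose i) * (fdiff (\<lambda>i. 1 / \<psi> i) i (n - i) * fdiff \<psi> (m - i) (n - m)))
     + fdiff (\<lambda>i. 1 / \<psi> i) m (n - m) * \<psi> (n - m)"
    by (simp add: lessThan_Suc_atMost[symmetric])
  finally show ?thesis by (simp add: sum_negf)
qed

text \<open>The probability that the failed set jumps from a given set of size \<open>i\<close> to a given superset of size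
  \<open>j\<close>: the expected time spent in the first set times the jump rate.\<close>

definition jump_prob :: "(nat \<Rightarrow> real) \<Rightarrow> nat \<Rightarrow> nat \<Rightarrow> nat \<Rightarrow> real" where
  "jump_prob \<psi> n i j = fdiff (\<lambda>c. 1 / \<psi> c) i (n - i) * - fdiff \<psi> (j - i) (n - j)"

section \<open>Closed forms of the recursion and of the mean of an ordered lifetime\<close>

text \<open>\<open>exit_prob\<close> is the probability that the number of failed components equals
  \<open>j\<close> when it first exceeds \<open>i\<close>. The sum splits this by the last number
  \<open>b\<close> before the jump, the binomials counting pairs of sets of sizes \<open>b\<close>
  and \<open>j\<close>. The recursion adds the paths through \<open>Suc i\<close>: by
  \<open>balance\<close> the probability of ever having \<open>Suc i\<close> failures is the
  expected time there times the total jump rate, and that rate cancels the denominator of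
  \<open>trans_prob\<close>.\<close>

lemma exit_prob_eq:
  fixes \<Psi> :: "real \<Rightarrow> real"
  defines "\<psi> \<equiv> (\<lambda>c. \<Psi> (real c))"
  assumes "i < j" "j \<le> n" and pos: "\<And>c. 1 \<le> c \<Longrightarrow> \<psi> c \<noteq> 0"
  shows "exit_prob \<Psi> n i j =
    (\<Sum>b\<le>i. real (n choose b) * real ((n - b) choose (j - b)) * jump_prob \<psi> n b j)"
  using assms(2,3)
proof (induction i arbitrary: j)
  case 0
  have "trans_prob \<Psi> n 0 j = real (n choose j) * - fdiff \<psi> j (n - j) / \<psi> n"
    using 0 by (simp add: trans_prob_def lam_eq_fdiff \<psi>_def)
  then show ?case using 0 by (simp add: jump_prob_def)
next
  case (Suc i)
  have *: "real (n choose b) * real ((n - b) choose (m - b)) = real (n choose m) * real (m choose b)"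
    if "b \<le> m" "m \<le> n" for b m
    using choose_mult[OF that] by (metis of_nat_mult)
  have "exit_prob \<Psi> n i (Suc i) =
      (\<Sum>b\<le>i. real (n choose b) * real ((n - b) choose (Suc i - b)) * jump_prob \<psi> n b (Suc i))"
    using Suc by (intro Suc.IH) auto
  also have "\<dots> = real (n choose Suc i) * (\<Sum>b<Suc i. real (Suc i choose b) * jump_prob \<psi> n b (Suc i))"
    unfolding sum_distrib_left lessThan_Suc_atMost using Suc.prems by (intro sum.cong) (auto simp: *)
  also have "\<dots> = real (n choose Suc i) * (fdiff (\<lambda>c. 1 / \<psi> c) (Suc i) (n - Suc i) * \<psi> (n - Suc i))"
    unfolding jump_prob_def using Suc.prems pos by (subst balance) auto
  finally have 1: "exit_prob \<Psi> n i (Suc i) = \<dots>" .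
  have "\<psi> (n - Suc i) \<noteq> 0" using pos Suc.prems by auto
  then have 2: "exit_prob \<Psi> n i (Suc i) * trans_prob \<Psi> n (Suc i) j =
      real (n choose Suc i) * real ((n - Suc i) choose (j - Suc i)) * jump_prob \<psi> n (Suc i) j"
    using Suc.prems unfolding 1 by (simp add: trans_prob_def lam_eq_fdiff \<psi>_def jump_prob_def)
  have "exit_prob \<Psi> n i j = (\<Sum>b\<le>i. real (n choose b) * real ((n - b) choose (j - b)) * jump_prob \<psi> n b j)"
    using Suc by (intro Suc.IH) auto
  then show ?case using Suc.prems 2 by simp
qed

lemma alternating_binomial_partial_sum:
  "0 < i \<Longrightarrow> (\<Sum>l\<le>k. (-1) ^ l * real (i choose l)) = (-1) ^ k * real ((i - 1) choose k)"
proof (induction k)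
  case (Suc k)
  then obtain i' where "i = Suc i'" by (cases i) auto
  then show ?case using Suc by (simp add: algebra_simps)
qed simp

text \<open>After expanding the differences and exchanging the sums, the coefficient of
  \<open>\<phi> i\<close> is \<open>n choose i\<close> times a partial alternating sum of binomials,
  which collapses to a single one. For \<phi> the reciprocal of \<psi> this becomes the formula for
  the mean of an ordered lifetime.\<close>

lemma sum_choose_fdiff:
  assumes "1 \<le> m" "m \<le> n"
  shows "(\<Sum>b<m. real (n choose b) * fdiff \<phi> b (n - b)) =
    (\<Sum>i=n-m+1..n. real (n choose i) * real ((i - 1) choose (n - m)) * (-1) ^ (i + m - n - 1) * \<phi> i)"
proof -
  have inner: "real (n choose b) * fdiff \<phi> b (n - b) =
      (\<Sum>i\<le>n. if n \<le> b + i then real (n choose i) * real (i choose (b + i - n)) * (-1) ^ (b + i - n) * \<phi> i else 0)"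
    if "b < m" for b
  proof -
    have "real (n choose b) * fdiff \<phi> b (n - b) =
      (\<Sum>l\<le>b. real (n choose b) * real (b choose l) * (-1) ^ l * \<phi> (n - b + l))"
      by (simp add: fdiff_eq_sum sum_distrib_left mult.assoc)
    also have "\<dots> = (\<Sum>i\<in>{n-b..n}. real (n choose b) * real (b choose (b + i - n)) * (-1) ^ (b + i - n) * \<phi> i)"
      using that assms
      by (intro sum.reindex_bij_witness[of _ "\<lambda>i. b + i - n" "\<lambda>l. n - b + l"]) auto
    also have "\<dots> = (\<Sum>i\<in>{n-b..n}. real (n choose i) * real (i choose (b + i - n)) * (-1) ^ (b + i - n) * \<phi> i)"
    proof (intro sum.cong refl)
      fix i assume i: "i \<in> {n-b..n}"
      have "(n choose b) * (b choose (n - i)) = (n choose (n - i)) * ((n - (n - i)) choose (b - (n - i)))"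
        using i that assms by (intro choose_mult) auto
      moreover have "b choose (n - i) = b choose (b + i - n)"
        using i that assms by (subst binomial_symmetric) (auto intro!: arg_cong2[where f=binomial])
      moreover have "n choose (n - i) = n choose i" using i by (subst binomial_symmetric[of i n]) auto
      moreover have "n - (n - i) = i" "b - (n - i) = b + i - n" using i that assms by auto
      ultimately have "(n choose b) * (b choose (b + i - n)) = (n choose i) * (i choose (b + i - n))" by metis
      then have "real (n choose b) * real (b choose (b + i - n)) = real (n choose i) * real (i choose (b + i - n))"
        by (metis of_nat_mult)
      then show "real (n choose b) * real (b choose (b + i - n)) * (-1) ^ (b + i - n) * \<phi> i =
         real (n choose i) * real (i choose (b + i - n)) * (-1) ^ (b + i - n) * \<phi> i" by simp
    qed
    also have "\<dots> = (\<Sum>i\<le>n. if n \<le> b + i then real (n choose i) * real (i choose (b + i - n)) * (-1) ^ (b + i - n) * \<phi> i else 0)"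
      by (subst sum.inter_filter[symmetric]) (auto intro!: sum.cong)
    finally show ?thesis .
  qed
  have "(\<Sum>b<m. real (n choose b) * fdiff \<phi> b (n - b)) =
    (\<Sum>i\<le>n. \<Sum>b<m. if n \<le> b + i then real (n choose i) * real (i choose (b + i - n)) * (-1) ^ (b + i - n) * \<phi> i else 0)"
    by (subst sum.swap) (simp add: inner)
  also have "\<dots> = (\<Sum>i\<le>n. if n < m + i then real (n choose i) * real ((i - 1) choose (n - m)) * (-1) ^ (i + m - n - 1) * \<phi> i else 0)"
  proof (intro sum.cong refl)
    fix i assume i: "i \<in> {..n}"
    show "(\<Sum>b<m. if n \<le> b + i then real (n choose i) * real (i choose (b + i - n)) * (-1) ^ (b + i - n) * \<phi> i else 0) =
      (if n < m + i then real (n choose i) * real ((i - 1) choose (n - m)) * (-1) ^ (i + m - n - 1) * \<phi> i else 0)"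
    proof (cases "n < m + i")
      case False
      then show ?thesis by (auto intro!: sum.neutral)
    next
      case True
      have "(\<Sum>b<m. if n \<le> b + i then real (n choose i) * real (i choose (b + i - n)) * (-1) ^ (b + i - n) * \<phi> i else 0)
         = (\<Sum>b\<in>{n-i..<m}. real (n choose i) * real (i choose (b + i - n)) * (-1) ^ (b + i - n) * \<phi> i)"
        by (subst sum.inter_filter[symmetric]) (auto intro!: sum.cong)
      \<comment> \<open>\<open>l\<close> counts from the smallest admissible \<open>b\<close>, which
        is \<open>n - i\<close>.\<close>
      also have "\<dots> = (\<Sum>l\<le>i + m - n - 1. real (n choose i) * real (i choose l) * (-1) ^ l * \<phi> i)"
        using i True assms by (intro sum.reindex_bij_witness[of _ "\<lambda>l. l + n - i" "\<lambda>b. b + i - n"]) auto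
      also have "\<dots> = real (n choose i) * (\<Sum>l\<le>i + m - n - 1. (-1) ^ l * real (i choose l)) * \<phi> i"
        by (simp add: sum_distrib_left sum_distrib_right mult_ac)
      also have "(\<Sum>l\<le>i + m - n - 1. (-1) ^ l * real (i choose l)) = (-1) ^ (i + m - n - 1) * real ((i - 1) choose (i + m - n - 1))"
        using True assms by (intro alternating_binomial_partial_sum) auto
      also have "(i - 1) choose (i + m - n - 1) = (i - 1) choose (n - m)"
        using i True assms by (subst binomial_symmetric) (auto intro!: arg_cong2[where f=binomial])
      finally show ?thesis using True by (simp add: mult_ac)
    qed
  qed
  also have "\<dots> = (\<Sum>i=n-m+1..n. real (n choose i) * real ((i - 1) choose (n - m)) * (-1) ^ (i + m - n - 1) * \<phi> i)"
    using assms by (subst sum.inter_filter[symmetric]) (auto intro!: sum.cong)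
  finally show ?thesis .
qed

section \<open>Exit times of families of working sets\<close>

text \<open>The comparison is non-strict, as in the repair process, where a component works as long
  as \<open>L\<close> is strictly below its trigger. Lifetimes use the strict comparison, so the two
  notions of failure time agree only almost surely.\<close>

definition failed ::
  "nat \<Rightarrow> (real \<Rightarrow> 'a \<Rightarrow> real) \<Rightarrow> (nat \<Rightarrow> nat \<Rightarrow> 'a \<Rightarrow> real) \<Rightarrow> real \<Rightarrow> 'a \<Rightarrow> nat set" where
  "failed n L E t \<omega> = {i\<in>{1..n}. E i 0 \<omega> \<le> L t \<omega>}"

text \<open>The empty set inside and the full set outside exclude an exit at once and force one when
  every component has failed. Closure under subsets makes leaving final, because failed sets only
  grow.\<close>

definition working_family :: "nat \<Rightarrow> nat set set \<Rightarrow> bool" where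
  "working_family n G \<longleftrightarrow> G \<subseteq> Pow {1..n} \<and> {} \<in> G \<and> {1..n} \<notin> G \<and> (\<forall>A\<in>G. \<forall>B\<subseteq>A. B \<in> G)"

text \<open>Real valued because it serves as a time argument of \<open>L\<close>. The default 0
  concerns paths that never leave \<open>G\<close>, a null event under the laws considered
  here.\<close>

definition exit_time ::
  "nat \<Rightarrow> nat set set \<Rightarrow> (real \<Rightarrow> 'a \<Rightarrow> real) \<Rightarrow> (nat \<Rightarrow> nat \<Rightarrow> 'a \<Rightarrow> real) \<Rightarrow> 'a \<Rightarrow> real" where
  "exit_time n G L E \<omega> =
     (if \<exists>t\<ge>0. failed n L E t \<omega> \<notin> G then Inf {t. 0 \<le> t \<and> failed n L E t \<omega> \<notin> G} else 0)"

definition exit_set ::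
  "nat \<Rightarrow> nat set set \<Rightarrow> (real \<Rightarrow> 'a \<Rightarrow> real) \<Rightarrow> (nat \<Rightarrow> nat \<Rightarrow> 'a \<Rightarrow> real) \<Rightarrow> 'a \<Rightarrow> nat set" where
  "exit_set n G L E \<omega> = failed n L E (exit_time n G L E \<omega>) \<omega>"

definition subordinator_path :: "(real \<Rightarrow> real) \<Rightarrow> bool" where
  "subordinator_path f \<longleftrightarrow> f 0 = 0 \<and> (\<forall>s t. 0 \<le> s \<and> s \<le> t \<longrightarrow> f s \<le> f t) \<and>
     (\<forall>t\<ge>0. (f \<longlongrightarrow> f t) (at_right t))"

lemma subordinator_pathD:
  assumes "subordinator_path f"
  shows "f 0 = 0" "0 \<le> s \<Longrightarrow> s \<le> t \<Longrightarrow> f s \<le> f t" "0 \<le> t \<Longrightarrow> (f \<longlongrightarrow> f t) (at_right t)"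
  using assms by (auto simp: subordinator_path_def)

lemma subordinator_path_nonneg: "subordinator_path f \<Longrightarrow> 0 \<le> t \<Longrightarrow> 0 \<le> f t"
  using subordinator_pathD(1)[of f] subordinator_pathD(2)[of f 0 t] by simp

text \<open>Right continuity along sequences that may hit the limit point itself, as the rounded
  times below may do.\<close>

lemma subordinator_path_limit:
  assumes "subordinator_path f" "0 \<le> t" "x \<longlonglongrightarrow> t" "\<And>k. t \<le> x k"
  shows "(\<lambda>k. f (x k)) \<longlonglongrightarrow> f t"
proof (rule LIMSEQ_I)
  fix e :: real assume "0 < e"
  have "eventually (\<lambda>u. dist (f u) (f t) < e) (at_right t)"
    using tendstoD[OF subordinator_pathD(3)[OF assms(1,2)] \<open>0 < e\<close>] .
  then obtain b where b: "t < b" "\<And>u. t < u \<Longrightarrow> u < b \<Longrightarrow> dist (f u) (f t) < e"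
    unfolding eventually_at_right_field by auto
  have "eventually (\<lambda>k. x k < b) sequentially"
    using assms(3) b(1) by (rule order_tendstoD(2))
  then obtain k0 where k0: "\<And>k. k0 \<le> k \<Longrightarrow> x k < b" by (auto simp: eventually_sequentially)
  have "norm (f (x k) - f t) < e" if "k0 \<le> k" for k
    using b(2)[of "x k"] k0[OF that] assms(4)[of k] \<open>0 < e\<close>
    by (cases "x k = t") (auto simp: dist_real_def)
  then show "\<exists>no. \<forall>k\<ge>no. norm (f (x k) - f t) < e" by blast
qed

section \<open>Pathwise behaviour of failed sets and exit times\<close>

context
  fixes n :: nat and L :: "real \<Rightarrow> 'a \<Rightarrow> real" and E :: "nat \<Rightarrow> nat \<Rightarrow> 'a \<Rightarrow> real" and \<omega> :: 'a
  assumes path: "subordinator_path (\<lambda>t. L t \<omega>)"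
begin

lemma failed_mono: "0 \<le> s \<Longrightarrow> s \<le> t \<Longrightarrow> failed n L E s \<omega> \<subseteq> failed n L E t \<omega>"
  using subordinator_pathD(2)[OF path] by (force simp: failed_def)

text \<open>By right continuity \<open>L\<close> stays below each trigger it has not yet reached for
  some time after \<open>t\<close>, and there are only finitely many of them.\<close>

lemma failed_right_constant:
  assumes "0 \<le> t"
  obtains b where "t < b" "\<And>u. t \<le> u \<Longrightarrow> u < b \<Longrightarrow> failed n L E u \<omega> = failed n L E t \<omega>"
proof -
  have "eventually (\<lambda>u. \<forall>i\<in>{i\<in>{1..n}. L t \<omega> < E i 0 \<omega>}. L u \<omega> < E i 0 \<omega>) (at_right t)"
    using subordinator_pathD(3)[OF path assms]
    by (intro eventually_ball_finite) (auto dest: order_tendstoD(2))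
  then obtain b where b: "t < b"
    "\<And>u i. t < u \<Longrightarrow> u < b \<Longrightarrow> i \<in> {1..n} \<Longrightarrow> L t \<omega> < E i 0 \<omega> \<Longrightarrow> L u \<omega> < E i 0 \<omega>"
    unfolding eventually_at_right_field by auto
  have "failed n L E u \<omega> = failed n L E t \<omega>" if "t \<le> u" "u < b" for u
  proof (cases "u = t")
    case False
    then have "failed n L E u \<omega> \<subseteq> failed n L E t \<omega>"
    proof (intro subsetI)
      fix i assume i: "i \<in> failed n L E u \<omega>"
      have "\<not> L t \<omega> < E i 0 \<omega>" using b(2)[of u i] i that False by (auto simp: failed_def)
      then show "i \<in> failed n L E t \<omega>" using i by (simp add: failed_def)
    qed
    then show ?thesis using failed_mono[OF assms that(1)] by blast
  qed simp
  with b(1) show thesis by (rule that)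
qed

text \<open>The infimum is attained, since times outside \<open>G\<close> occur in the interval on
  which the failed set is still the one at the infimum. Because failed sets grow, whether the exit
  has happened is then decided by the failed set at a single time; this gives the laws at fixed
  times access to the exit time.\<close>

lemma
  assumes G: "working_family n G" and ex: "\<exists>t\<ge>0. failed n L E t \<omega> \<notin> G"
  shows exit_set_notin: "exit_set n G L E \<omega> \<notin> G"
    and exit_time_le_iff: "0 \<le> t \<Longrightarrow> exit_time n G L E \<omega> \<le> t \<longleftrightarrow> failed n L E t \<omega> \<notin> G"
proof -
  let ?S = "{t. 0 \<le> t \<and> failed n L E t \<omega> \<notin> G}"
  have ne: "?S \<noteq> {}" and bdd: "bdd_below ?S" using ex by (auto intro!: bdd_belowI[of _ 0])
  have \<tau>: "exit_time n G L E \<omega> = Inf ?S" using ex by (simp add: exit_time_def)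
  have nonneg: "0 \<le> Inf ?S" using ne by (intro cInf_greatest) auto
  have mono: "failed n L E t \<omega> \<notin> G" if "0 \<le> s" "s \<le> t" "failed n L E s \<omega> \<notin> G" for s t
    using failed_mono[OF that(1,2)] that(3) G unfolding working_family_def by blast
  have at: "failed n L E (Inf ?S) \<omega> \<notin> G"
  proof -
    obtain b where b: "Inf ?S < b" "\<And>u. Inf ?S \<le> u \<Longrightarrow> u < b \<Longrightarrow> failed n L E u \<omega> = failed n L E (Inf ?S) \<omega>"
      using failed_right_constant[OF nonneg] by blast
    obtain u where "u \<in> ?S" "u < b" using cInf_lessD[OF ne b(1)] by blast
    moreover then have "Inf ?S \<le> u" by (intro cInf_lower bdd)
    ultimately show ?thesis using b(2)[of u] by auto
  qed
  then show "exit_set n G L E \<omega> \<notin> G" by (simp add: exit_set_def \<tau>)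
  show "exit_time n G L E \<omega> \<le> t \<longleftrightarrow> failed n L E t \<omega> \<notin> G" if "0 \<le> t"
    unfolding \<tau>
  proof
    show "failed n L E t \<omega> \<notin> G" if "Inf ?S \<le> t" by (rule mono[OF nonneg that at])
    show "Inf ?S \<le> t" if "failed n L E t \<omega> \<notin> G" using that \<open>0 \<le> t\<close> by (intro cInf_lower bdd) simp
  qed
qed

lemma exit_time_pos:
  assumes "working_family n G" "\<exists>t\<ge>0. failed n L E t \<omega> \<notin> G" "\<And>i. i \<in> {1..n} \<Longrightarrow> 0 < E i 0 \<omega>"
  shows "0 < exit_time n G L E \<omega>"
proof -
  have "\<not> E i 0 \<omega> \<le> 0" if "i \<in> {1..n}" for i using assms(3)[OF that] by simp
  then have "failed n L E 0 \<omega> = {}" using subordinator_pathD(1)[OF path] by (auto simp: failed_def)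
  then show ?thesis
    using exit_time_le_iff[OF assms(1,2), of 0] assms(1) by (auto simp: working_family_def)
qed

end

text \<open>The last assumption characterises the joint law of \<open>L\<close> and \<open>E\<close> at the points of dyadic grids, without
  reference to independence. In this form it can be shown to hold again after the exit time. Each
  trigger of the first generation starts at time 0, whereas later ones may be used from \<open>a q\<close> on.\<close>

locale frailty = prob_space M
  for M :: "'a measure" +
  fixes L :: "real \<Rightarrow> 'a \<Rightarrow> real" and E :: "nat \<Rightarrow> nat \<Rightarrow> 'a \<Rightarrow> real" and n :: nat
    and \<psi> :: "nat \<Rightarrow> real"
  assumes L_measurable: "0 \<le> t \<Longrightarrow> L t \<in> borel_measurable M"
    and E_measurable: "i \<in> {1..n} \<Longrightarrow> E i m \<in> borel_measurable M"
    and L_path: "\<omega> \<in> space M \<Longrightarrow> subordinator_path (\<lambda>t. L t \<omega>)"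
    and \<psi>_0: "\<psi> 0 = 0"
    and \<psi>_pos: "0 < c \<Longrightarrow> 0 < \<psi> c"
    and law: "\<lbrakk>finite F; F \<subseteq> {1..n} \<times> UNIV;
        \<And>q. q \<in> F \<Longrightarrow> a q \<le> b q \<and> b q \<le> J \<and> 0 \<le> u q \<and> (snd q = 0 \<longrightarrow> a q = 0)\<rbrakk> \<Longrightarrow>
      \<P>(\<omega> in M. \<forall>q\<in>F. L (real (b q) / 2 ^ k) \<omega> - L (real (a q) / 2 ^ k) \<omega> + u q < E (fst q) (snd q) \<omega>) =
      exp (- (\<Sum>q\<in>F. u q) - (\<Sum>j<J. \<psi> (card {q\<in>F. a q \<le> j \<and> j < b q})) / 2 ^ k)"
begin

lemma pred_less: "0 \<le> x \<Longrightarrow> i \<in> {1..n} \<Longrightarrow> Measurable.pred M (\<lambda>\<omega>. L x \<omega> < E i m \<omega>)"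
  using L_measurable[of x] E_measurable[of i m] by measurable

lemma pred_le': "0 \<le> x \<Longrightarrow> i \<in> {1..n} \<Longrightarrow> Measurable.pred M (\<lambda>\<omega>. E i m \<omega> \<le> L x \<omega>)"
  using L_measurable[of x] E_measurable[of i m] by measurable

lemma pred_failed: "0 \<le> t \<Longrightarrow> Measurable.pred M (\<lambda>\<omega>. failed n L E t \<omega> = A)"
proof -
  assume "0 \<le> t"
  have "(\<lambda>\<omega>. failed n L E t \<omega> = A) =
     (\<lambda>\<omega>. A \<subseteq> {1..n} \<and> (\<forall>i\<in>{1..n}. if i \<in> A then E i 0 \<omega> \<le> L t \<omega> else \<not> (E i 0 \<omega> \<le> L t \<omega>)))"
    by (auto simp: failed_def fun_eq_iff split: if_splits)
  moreover have "Measurable.pred M \<dots>"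
    using \<open>0 \<le> t\<close> by (intro pred_intros_logic pred_intros_finite measurable_If) (auto intro!: pred_le')
  ultimately show ?thesis by simp
qed

lemma pred_failed_in: "0 \<le> t \<Longrightarrow> Measurable.pred M (\<lambda>\<omega>. failed n L E t \<omega> \<in> G)"
proof -
  assume "0 \<le> t"
  have "(\<lambda>\<omega>. failed n L E t \<omega> \<in> G) = (\<lambda>\<omega>. \<exists>A\<in>G \<inter> Pow {1..n}. failed n L E t \<omega> = A)"
    by (auto simp: failed_def fun_eq_iff)
  moreover have "Measurable.pred M \<dots>"
    using \<open>0 \<le> t\<close> by (intro pred_intros_finite pred_failed) auto
  ultimately show ?thesis by simp
qed

text \<open>The assumption \<open>law\<close> with an empty time interval and offset 0 gives
  probability \<open>exp 0\<close>.\<close>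

lemma E_pos: "i \<in> {1..n} \<Longrightarrow> AE \<omega> in M. 0 < E i m \<omega>"
proof -
  assume i: "i \<in> {1..n}"
  have "\<P>(\<omega> in M. \<forall>q\<in>{(i, m)}. L 0 \<omega> - L 0 \<omega> + 0 < E (fst q) (snd q) \<omega>) = exp 0"
    using law[of "{(i, m)}" "\<lambda>_. 0" "\<lambda>_. 0" 0 "\<lambda>_. 0" 0] i by simp
  then have "\<P>(\<omega> in M. 0 < E i m \<omega>) = 1" by simp
  moreover have "Measurable.pred M (\<lambda>\<omega>. 0 < E i m \<omega>)" using E_measurable[OF i] by measurable
  ultimately show ?thesis by (subst (asm) prob_Collect_eq_1) (auto simp: pred_def)
qed

lemma E_pos_all: "AE \<omega> in M. \<forall>i\<in>{1..n}. \<forall>m. 0 < E i m \<omega>"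
  by (intro AE_ball_countable[THEN iffD2] AE_all_countable[THEN iffD2] ballI allI E_pos) auto

text \<open>First-generation triggers are exposed from time 0 on: those of \<open>R\<close> and
  \<open>C\<close> in the first \<open>a\<close> cells, only those of \<open>C\<close> in the
  remaining ones up to \<open>d\<close>. The exponent of \<open>law\<close> adds one value of \<psi>
  per cell.\<close>

lemma prob_two_levels:
  assumes "R \<union> C \<subseteq> {1..n}" "R \<inter> C = {}" "a \<le> d"
  shows "\<P>(\<omega> in M. (\<forall>i\<in>R. L (real a / 2 ^ k) \<omega> < E i 0 \<omega>) \<and> (\<forall>i\<in>C. L (real d / 2 ^ k) \<omega> < E i 0 \<omega>)) =
    exp (- (real a * \<psi> (card R + card C) + real (d - a) * \<psi> (card C)) / 2 ^ k)"
proof -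
  let ?F = "(R \<union> C) \<times> {0::nat}" and ?t = "\<lambda>q::nat \<times> nat. if fst q \<in> C then d else a"
  have fin: "finite R" "finite C" using assms(1) finite_subset by auto
  have "\<P>(\<omega> in M. \<forall>q\<in>?F. L (real (?t q) / 2 ^ k) \<omega> - L (real 0 / 2 ^ k) \<omega> + 0 < E (fst q) (snd q) \<omega>)
    = exp (- (\<Sum>q\<in>?F. 0) - (\<Sum>j<d. \<psi> (card {q\<in>?F. 0 \<le> j \<and> j < ?t q})) / 2 ^ k)"
    by (rule law[of ?F "\<lambda>_. 0" ?t d "\<lambda>_. 0" k]) (use assms fin in auto)
  also have "{\<omega>\<in>space M. \<forall>q\<in>?F. L (real (?t q) / 2 ^ k) \<omega> - L (real 0 / 2 ^ k) \<omega> + 0 < E (fst q) (snd q) \<omega>}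
     = {\<omega>\<in>space M. (\<forall>i\<in>R. L (real a / 2 ^ k) \<omega> < E i 0 \<omega>) \<and> (\<forall>i\<in>C. L (real d / 2 ^ k) \<omega> < E i 0 \<omega>)}"
  proof (intro Collect_cong conj_cong refl)
    fix \<omega> assume "\<omega> \<in> space M"
    then have "L 0 \<omega> = 0" using subordinator_pathD(1)[OF L_path] by simp
    then show "(\<forall>q\<in>?F. L (real (?t q) / 2 ^ k) \<omega> - L (real 0 / 2 ^ k) \<omega> + 0 < E (fst q) (snd q) \<omega>)
     \<longleftrightarrow> ((\<forall>i\<in>R. L (real a / 2 ^ k) \<omega> < E i 0 \<omega>) \<and> (\<forall>i\<in>C. L (real d / 2 ^ k) \<omega> < E i 0 \<omega>))"
      using assms(2) by (auto split: if_splits)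
  qed
  also have "(\<Sum>j<d. \<psi> (card {q\<in>?F. 0 \<le> j \<and> j < ?t q})) = real a * \<psi> (card R + card C) + real (d - a) * \<psi> (card C)"
  proof -
    have 1: "card {q\<in>?F. 0 \<le> j \<and> j < ?t q} = card R + card C" if "j < a" for j
    proof -
      have "{q\<in>?F. 0 \<le> j \<and> j < ?t q} = (R \<union> C) \<times> {0}" using that assms by auto
      then show ?thesis using assms(2) fin by (simp add: card_cartesian_product card_Un_disjoint)
    qed
    have 2: "card {q\<in>?F. 0 \<le> j \<and> j < ?t q} = card C" if "a \<le> j" "j < d" for j
    proof -
      have "{q\<in>?F. 0 \<le> j \<and> j < ?t q} = C \<times> {0}" using that assms by auto
      then show ?thesis by (simp add: card_cartesian_product)
    qed
    have "{..<d} = {..<a} \<union> {a..<d}" using assms(3) by auto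
    then have "(\<Sum>j<d. \<psi> (card {q\<in>?F. 0 \<le> j \<and> j < ?t q})) =
       (\<Sum>j<a. \<psi> (card {q\<in>?F. 0 \<le> j \<and> j < ?t q})) + (\<Sum>j=a..<d. \<psi> (card {q\<in>?F. 0 \<le> j \<and> j < ?t q}))"
      by (simp add: sum.union_disjoint ivl_disj_int)
    also have "\<dots> = (\<Sum>j<a. \<psi> (card R + card C)) + (\<Sum>j=a..<d. \<psi> (card C))"
      using 1 2 by (intro arg_cong2[where f="(+)"] sum.cong) auto
    finally show ?thesis by simp
  qed
  finally show ?thesis by (simp add: field_simps)
qed

end

section \<open>The law of the failed sets on a dyadic grid\<close>

text \<open>Rounding is upwards so that \<open>L\<close> at the rounded time converges by right
  continuity, and so that the failed set at the rounded exit time already lies outside the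
  family.\<close>

definition grid_step :: "nat \<Rightarrow> real \<Rightarrow> nat" where
  "grid_step k x = nat \<lceil>x * 2 ^ k\<rceil>"

abbreviation grid :: "nat \<Rightarrow> real \<Rightarrow> real" where
  "grid k x \<equiv> real (grid_step k x) / 2 ^ k"

lemma less_grid_step_iff: "a < grid_step k x \<longleftrightarrow> real a / 2 ^ k < x"
proof -
  have "a < grid_step k x \<longleftrightarrow> int a < \<lceil>x * 2 ^ k\<rceil>" unfolding grid_step_def by linarith
  also have "\<dots> \<longleftrightarrow> real a < x * 2 ^ k" by (simp add: less_ceiling_iff)
  finally show ?thesis by (simp add: field_simps)
qed

lemma grid_ge: "x \<le> grid k x"
  using less_grid_step_iff[of "grid_step k x" k x] by simp

lemma grid_le: "0 \<le> x \<Longrightarrow> grid k x \<le> x + 1 / 2 ^ k"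
proof (cases "grid_step k x")
  case (Suc a)
  then have "real a / 2 ^ k < x" using less_grid_step_iff[of a k x] by simp
  then show ?thesis using Suc by (simp add: field_simps)
qed simp

lemma grid_tendsto: "0 \<le> x \<Longrightarrow> (\<lambda>k. grid k x) \<longlonglongrightarrow> x"
proof (rule tendsto_sandwich[of "\<lambda>_. x" _ _ "\<lambda>k. x + 1 / 2 ^ k"])
  have "(\<lambda>k. x + (1 / 2) ^ k) \<longlonglongrightarrow> x + 0"
    by (intro tendsto_add tendsto_const LIMSEQ_power_zero) auto
  then show "(\<lambda>k. x + 1 / 2 ^ k) \<longlonglongrightarrow> x" by (simp add: power_divide)
qed (use grid_ge grid_le in auto)

text \<open>The derivative of an exponential at 0, sampled at \<open>1 / 2 ^ k\<close>. It turns
  one-step probabilities on the grid into rates.\<close>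

lemma exp_quotient_tendsto: "(\<lambda>k. (exp (- (c / 2 ^ k)) - 1) * 2 ^ k) \<longlonglongrightarrow> - c" for c :: real
proof -
  have "((\<lambda>x. exp (- c * x)) has_real_derivative - c) (at 0)"
    by (auto intro!: derivative_eq_intros)
  then have "((\<lambda>x. (exp (- c * x) - 1) / x) \<longlongrightarrow> - c) (at 0)"
    by (simp add: DERIV_def)
  moreover have "filterlim (\<lambda>k. (1 / 2) ^ k :: real) (at 0) sequentially"
    unfolding filterlim_at by (auto intro!: LIMSEQ_power_zero)
  ultimately have "(\<lambda>k. (exp (- c * (1 / 2) ^ k) - 1) / (1 / 2) ^ k) \<longlonglongrightarrow> - c"
    by (rule filterlim_compose)
  then show ?thesis by (simp add: power_divide)
qed

context frailty
begin

text \<open>Every condition that bounds a trigger from above is a difference of two survival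
  conditions, and survival probabilities are known; each such difference raises the order of one of
  the \<open>fdiff\<close> factors. The set \<open>R\<close> of components required only to survive
  \<open>x\<close> is there for the induction, which moves components into it.\<close>

lemma prob_intervals:
  fixes a d k :: nat
  defines "x \<equiv> real a / 2 ^ k" and "y \<equiv> real d / 2 ^ k"
  assumes "a \<le> d" "B \<subseteq> {1..n}" "I \<subseteq> {1..n}" "R \<subseteq> {1..n}" "C \<subseteq> {1..n}"
    "B \<inter> I = {}" "B \<inter> R = {}" "B \<inter> C = {}" "I \<inter> R = {}" "I \<inter> C = {}" "R \<inter> C = {}"
  shows "\<P>(\<omega> in M. (\<forall>i\<in>B. E i 0 \<omega> \<le> L x \<omega>) \<and> (\<forall>i\<in>I. L x \<omega> < E i 0 \<omega> \<and> E i 0 \<omega> \<le> L y \<omega>) \<and>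
      (\<forall>i\<in>R. L x \<omega> < E i 0 \<omega>) \<and> (\<forall>i\<in>C. L y \<omega> < E i 0 \<omega>)) =
    fdiff (\<lambda>c. exp (- (real a * \<psi> c / 2 ^ k))) (card B) (card I + card R + card C) *
    fdiff (\<lambda>c. exp (- (real (d - a) * \<psi> c / 2 ^ k))) (card I) (card C)"
proof -
  define ev where "ev = (\<lambda>B I R C. {\<omega>\<in>space M. (\<forall>i\<in>B. E i 0 \<omega> \<le> L x \<omega>) \<and>
      (\<forall>i\<in>I. L x \<omega> < E i 0 \<omega> \<and> E i 0 \<omega> \<le> L y \<omega>) \<and>
      (\<forall>i\<in>R. L x \<omega> < E i 0 \<omega>) \<and> (\<forall>i\<in>C. L y \<omega> < E i 0 \<omega>)})"
  have xy: "0 \<le> x" "x \<le> y" "0 \<le> y" using \<open>a \<le> d\<close> by (auto simp: x_def y_def divide_right_mono)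
  have fin: "finite S" if "S \<subseteq> {1..n}" for S using that finite_subset by auto
  have sets: "ev B I R C \<in> events" if "B \<subseteq> {1..n}" "I \<subseteq> {1..n}" "R \<subseteq> {1..n}" "C \<subseteq> {1..n}" for B I R C
    unfolding ev_def using that fin xy
    by (intro predE pred_intros_logic pred_intros_finite pred_less pred_le') auto
  have L_xy: "L x \<omega> \<le> L y \<omega>" if "\<omega> \<in> space M" for \<omega>
    using subordinator_pathD(2)[OF L_path[OF that] xy(1,2)] .
  let ?\<phi> = "\<lambda>c. exp (- (real a * \<psi> c / 2 ^ k))" and ?\<eta> = "\<lambda>c. exp (- (real (d - a) * \<psi> c / 2 ^ k))"
  \<comment> \<open>A failure between \<open>x\<close> and \<open>y\<close> is survival of
    \<open>x\<close> without survival of \<open>y\<close>, so the new component joins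
    \<open>R\<close> in one term and \<open>C\<close> in the other.\<close>
  have I: "prob (ev {} I R C) = ?\<phi> (card I + card R + card C) * fdiff ?\<eta> (card I) (card C)"
    if "I \<subseteq> {1..n}" "R \<subseteq> {1..n}" "C \<subseteq> {1..n}" "I \<inter> R = {}" "I \<inter> C = {}" "R \<inter> C = {}" for I R C
    using fin[OF that(1)] that
  proof (induction I arbitrary: R C rule: finite_induct)
    case empty
    then show ?case
      using prob_two_levels[of R C a d k] \<open>a \<le> d\<close>
      by (simp add: ev_def x_def y_def exp_add[symmetric] add_divide_distrib diff_divide_distrib)
  next
    case (insert i I)
    have "ev {} (insert i I) R C = ev {} I (insert i R) C - ev {} I R (insert i C)"
      using L_xy by (auto simp: ev_def not_le not_less)
    moreover have "ev {} I R (insert i C) \<subseteq> ev {} I (insert i R) C"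
      using L_xy by (force simp: ev_def)
    ultimately have "prob (ev {} (insert i I) R C) = prob (ev {} I (insert i R) C) - prob (ev {} I R (insert i C))"
      using insert.prems by (simp add: finite_measure_Diff sets)
    also have "prob (ev {} I (insert i R) C) = ?\<phi> (card I + card (insert i R) + card C) * fdiff ?\<eta> (card I) (card C)"
      by (rule insert.IH) (use insert in auto)
    also have "prob (ev {} I R (insert i C)) = ?\<phi> (card I + card R + card (insert i C)) * fdiff ?\<eta> (card I) (card (insert i C))"
      by (rule insert.IH) (use insert in auto)
    finally show ?case
      using insert fin[of R] fin[of C] by (simp add: algebra_simps)
  qed
  \<comment> \<open>A failure by time \<open>x\<close> is no condition at all minus survival of
    \<open>x\<close>, so the new component disappears in one term and joins \<open>R\<close> in the
    other.\<close>
  have "prob (ev B I R C) = fdiff ?\<phi> (card B) (card I + card R + card C) * fdiff ?\<eta> (card I) (card C)"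
    if "B \<subseteq> {1..n}" "I \<subseteq> {1..n}" "R \<subseteq> {1..n}" "C \<subseteq> {1..n}"
      "B \<inter> I = {}" "B \<inter> R = {}" "B \<inter> C = {}" "I \<inter> R = {}" "I \<inter> C = {}" "R \<inter> C = {}" for B R
    using fin[OF that(1)] that
  proof (induction B arbitrary: R rule: finite_induct)
    case empty
    then show ?case using I[of I R C] by simp
  next
    case (insert i B)
    have "ev (insert i B) I R C = ev B I R C - ev B I (insert i R) C"
      by (auto simp: ev_def not_le not_less)
    moreover have "ev B I (insert i R) C \<subseteq> ev B I R C"
      by (force simp: ev_def)
    ultimately have "prob (ev (insert i B) I R C) = prob (ev B I R C) - prob (ev B I (insert i R) C)"
      using insert.prems by (simp add: finite_measure_Diff sets)
    also have "prob (ev B I R C) = fdiff ?\<phi> (card B) (card I + card R + card C) * fdiff ?\<eta> (card I) (card C)"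
      by (rule insert.IH) (use insert in auto)
    also have "prob (ev B I (insert i R) C) = fdiff ?\<phi> (card B) (card I + card (insert i R) + card C) * fdiff ?\<eta> (card I) (card C)"
      by (rule insert.IH) (use insert in auto)
    finally show ?case
      using insert fin[of R] by (simp add: algebra_simps)
  qed
  from this[OF assms(4-)] show ?thesis by (simp add: ev_def)
qed

text \<open>The components split into \<open>B\<close>, \<open>A - B\<close> and the complement of
  \<open>A\<close>. The second factor depends on the times only through \<open>d - a\<close>: the
  failed sets form a homogeneous Markov chain along the grid.\<close>

lemma prob_failed_jump:
  assumes "B \<subseteq> A" "A \<subseteq> {1..n}" "a \<le> d"
  shows "\<P>(\<omega> in M. failed n L E (real a / 2 ^ k) \<omega> = B \<and> failed n L E (real d / 2 ^ k) \<omega> = A) =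
    fdiff (\<lambda>c. exp (- (real a * \<psi> c / 2 ^ k))) (card B) (n - card B) *
    fdiff (\<lambda>c. exp (- (real (d - a) * \<psi> c / 2 ^ k))) (card A - card B) (n - card A)"
proof -
  let ?x = "real a / 2 ^ k" and ?y = "real d / 2 ^ k"
  have fin: "finite A" "finite B" using assms finite_subset[OF _ finite_atLeastAtMost] by (blast intro: finite_subset)+
  have xy: "0 \<le> ?x" "?x \<le> ?y" using \<open>a \<le> d\<close> by (auto simp: divide_right_mono)
  have "{\<omega>\<in>space M. failed n L E ?x \<omega> = B \<and> failed n L E ?y \<omega> = A} =
     {\<omega>\<in>space M. (\<forall>i\<in>B. E i 0 \<omega> \<le> L ?x \<omega>) \<and> (\<forall>i\<in>A - B. L ?x \<omega> < E i 0 \<omega> \<and> E i 0 \<omega> \<le> L ?y \<omega>) \<and>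
      (\<forall>i\<in>{}. L ?x \<omega> < E i 0 \<omega>) \<and> (\<forall>i\<in>{1..n} - A. L ?y \<omega> < E i 0 \<omega>)}" 
  proof (rule Collect_cong, rule conj_cong[OF refl])
    fix \<omega> assume "\<omega> \<in> space M"
    then have L_xy: "L ?x \<omega> \<le> L ?y \<omega>"
      using subordinator_pathD(2)[OF L_path xy] by blast
    have eq: "failed n L E t \<omega> = S \<longleftrightarrow> (\<forall>i\<in>{1..n}. (i \<in> S) = (E i 0 \<omega> \<le> L t \<omega>))" if "S \<subseteq> {1..n}" for S t
      using that unfolding failed_def by blast
    have "B \<subseteq> {1..n}" using assms by blast
    then have "failed n L E ?x \<omega> = B \<and> failed n L E ?y \<omega> = A \<longleftrightarrow>
       (\<forall>i\<in>{1..n}. ((i \<in> B) = (E i 0 \<omega> \<le> L ?x \<omega>)) \<and> ((i \<in> A) = (E i 0 \<omega> \<le> L ?y \<omega>)))"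
      using assms(2) by (simp only: eq ball_conj_distrib)
    also have "\<dots> \<longleftrightarrow> (\<forall>i\<in>{1..n}. (i \<in> B \<longrightarrow> E i 0 \<omega> \<le> L ?x \<omega>) \<and>
        (i \<in> A - B \<longrightarrow> L ?x \<omega> < E i 0 \<omega> \<and> E i 0 \<omega> \<le> L ?y \<omega>) \<and> (i \<notin> A \<longrightarrow> L ?y \<omega> < E i 0 \<omega>))"
    proof (rule ball_cong[OF refl])
      fix i
      show "((i \<in> B) = (E i 0 \<omega> \<le> L ?x \<omega>)) \<and> ((i \<in> A) = (E i 0 \<omega> \<le> L ?y \<omega>)) \<longleftrightarrow>
        (i \<in> B \<longrightarrow> E i 0 \<omega> \<le> L ?x \<omega>) \<and>
        (i \<in> A - B \<longrightarrow> L ?x \<omega> < E i 0 \<omega> \<and> E i 0 \<omega> \<le> L ?y \<omega>) \<and> (i \<notin> A \<longrightarrow> L ?y \<omega> < E i 0 \<omega>)"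
        using L_xy assms(1) by (cases "i \<in> B"; cases "i \<in> A") auto
    qed
    also have "\<dots> \<longleftrightarrow> (\<forall>i\<in>B. E i 0 \<omega> \<le> L ?x \<omega>) \<and> (\<forall>i\<in>A - B. L ?x \<omega> < E i 0 \<omega> \<and> E i 0 \<omega> \<le> L ?y \<omega>) \<and>
      (\<forall>i\<in>{}. L ?x \<omega> < E i 0 \<omega>) \<and> (\<forall>i\<in>{1..n} - A. L ?y \<omega> < E i 0 \<omega>)"
    proof -
      have 1: "(\<forall>i\<in>{1..n}. i \<in> S \<longrightarrow> P i) \<longleftrightarrow> (\<forall>i\<in>S. P i)" if "S \<subseteq> {1..n}" for S P using that by blast
      have 2: "(\<forall>i\<in>{1..n}. i \<notin> A \<longrightarrow> P i) \<longleftrightarrow> (\<forall>i\<in>{1..n} - A. P i)" for P by blast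
      have 3: "A - B \<subseteq> {1..n}" using assms by blast
      show ?thesis by (simp only: ball_conj_distrib 1[OF \<open>B \<subseteq> {1..n}\<close>] 1[OF 3] 2) simp
    qed
    finally show "failed n L E ?x \<omega> = B \<and> failed n L E ?y \<omega> = A \<longleftrightarrow> \<dots>" .
  qed
  moreover have "card (A - B) + card {} + card ({1..n} - A) = n - card B" "card (A - B) = card A - card B"
    "card ({1..n} - A) = n - card A"
    using assms fin card_mono[OF fin(1) assms(1)] card_mono[OF _ assms(2)]
    by (auto simp: card_Diff_subset)
  moreover have "\<P>(\<omega> in M. (\<forall>i\<in>B. E i 0 \<omega> \<le> L ?x \<omega>) \<and> (\<forall>i\<in>A - B. L ?x \<omega> < E i 0 \<omega> \<and> E i 0 \<omega> \<le> L ?y \<omega>) \<and>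
      (\<forall>i\<in>{}. L ?x \<omega> < E i 0 \<omega>) \<and> (\<forall>i\<in>{1..n} - A. L ?y \<omega> < E i 0 \<omega>)) =
    fdiff (\<lambda>c. exp (- (real a * \<psi> c / 2 ^ k))) (card B) (card (A - B) + card ({}::nat set) + card ({1..n} - A)) *
    fdiff (\<lambda>c. exp (- (real (d - a) * \<psi> c / 2 ^ k))) (card (A - B)) (card ({1..n} - A))"
    by (rule prob_intervals) (use assms in auto)
  ultimately show ?thesis by simp
qed

lemma prob_failed:
  assumes "B \<subseteq> {1..n}"
  shows "\<P>(\<omega> in M. failed n L E (real a / 2 ^ k) \<omega> = B) =
    fdiff (\<lambda>c. exp (- (real a * \<psi> c / 2 ^ k))) (card B) (n - card B)"
  using prob_failed_jump[of B B a a k] assms by simp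

text \<open>A union bound over single components, whose survival probabilities decay geometrically
  along the integers. It is the source both of the almost sure exit and of the second moment
  bound.\<close>

lemma prob_not_all_failed:
  "\<P>(\<omega> in M. failed n L E (real a) \<omega> \<noteq> {1..n}) \<le> real n * exp (- \<psi> 1) ^ a"
proof -
  have "\<P>(\<omega> in M. L (real a) \<omega> < E i 0 \<omega>) = exp (- \<psi> 1) ^ a" if "i \<in> {1..n}" for i
    using prob_two_levels[of "{i}" "{}" a a 0] that \<psi>_0 by (simp add: exp_of_nat_mult[symmetric])
  then have sum: "(\<Sum>i\<in>{1..n}. \<P>(\<omega> in M. L (real a) \<omega> < E i 0 \<omega>)) = real n * exp (- \<psi> 1) ^ a"
    by simp
  have "failed n L E (real a) \<omega> \<noteq> {1..n} \<longleftrightarrow> (\<exists>i\<in>{1..n}. L (real a) \<omega> < E i 0 \<omega>)" for \<omega>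
    unfolding failed_def not_le[symmetric] by blast
  then have "{\<omega>\<in>space M. failed n L E (real a) \<omega> \<noteq> {1..n}} = (\<Union>i\<in>{1..n}. {\<omega>\<in>space M. L (real a) \<omega> < E i 0 \<omega>})"
    by blast
  moreover have "prob \<dots> \<le> (\<Sum>i\<in>{1..n}. \<P>(\<omega> in M. L (real a) \<omega> < E i 0 \<omega>))"
    by (intro finite_measure_subadditive_finite) (auto intro!: predE pred_less)
  ultimately show ?thesis using sum by simp
qed

lemma exp_\<psi>_less_1: "0 < c \<Longrightarrow> exp (- \<psi> c) < 1"
  using \<psi>_pos by simp

lemma eventually_all_failed: "AE \<omega> in M. \<exists>a::nat. failed n L E (real a) \<omega> = {1..n}"
proof -
  let ?N = "{\<omega>\<in>space M. \<forall>a::nat. failed n L E (real a) \<omega> \<noteq> {1..n}}"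
  have sets: "?N \<in> events"
    by (intro predE pred_intros_logic pred_intros_countable pred_failed) auto
  have "prob ?N \<le> real n * exp (- \<psi> 1) ^ a" for a
  proof (rule order_trans[OF _ prob_not_all_failed[of a]], rule finite_measure_mono)
    show "{\<omega>\<in>space M. failed n L E (real a) \<omega> \<noteq> {1..n}} \<in> events"
      by (intro predE pred_intros_logic pred_failed) auto
  qed auto
  moreover have "(\<lambda>a. real n * exp (- \<psi> 1) ^ a) \<longlonglongrightarrow> real n * 0"
    using exp_\<psi>_less_1[of 1] by (intro tendsto_mult tendsto_const LIMSEQ_power_zero) auto
  ultimately have "prob ?N \<le> 0" 
    using LIMSEQ_le_const[of "\<lambda>a. real n * exp (- \<psi> 1) ^ a" "real n * 0" "prob ?N"] by auto
  then have "prob ?N = 0" using measure_nonneg[of M ?N] by linarith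
  then have "AE \<omega> in M. \<omega> \<notin> ?N" using sets by (simp add: AE_iff_measurable[OF sets] emeasure_eq_measure)
  then show ?thesis by (rule AE_mp) (auto intro!: AE_I2)
qed

end

section \<open>Law and moments of the exit from a working family\<close>

text \<open>Splits the exit into \<open>A\<close> by the last failed set \<open>B\<close> inside
  \<open>G\<close>. It contains neither the measure nor the process, hence is the same for every
  cycle.\<close>

definition exit_law :: "(nat \<Rightarrow> real) \<Rightarrow> nat \<Rightarrow> nat set set \<Rightarrow> nat set \<Rightarrow> real" where
  "exit_law \<psi> n G A = (\<Sum>B | B \<in> G \<and> B \<subseteq> A. jump_prob \<psi> n (card B) (card A))"

definition exit_mean :: "(nat \<Rightarrow> real) \<Rightarrow> nat \<Rightarrow> nat set set \<Rightarrow> real" where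
  "exit_mean \<psi> n G = (\<Sum>B\<in>G. fdiff (\<lambda>c. 1 / \<psi> c) (card B) (n - card B))"

text \<open>Comes from writing a square as the sum of the first odd numbers, so that a second moment
  becomes a weighted sum of tail probabilities, which \<open>prob_not_all_failed\<close> bounds
  geometrically. It involves only \<psi> and \<open>n\<close> and is thus uniform over
  cycles.\<close>

definition exit_square_bound :: "(nat \<Rightarrow> real) \<Rightarrow> nat \<Rightarrow> real" where
  "exit_square_bound \<psi> n = (\<Sum>a. (2 * real a + 1) * (real n * exp (- \<psi> 1) ^ a))"

lemma working_family_finite: "working_family n G \<Longrightarrow> finite G"
  unfolding working_family_def by (meson finite_Pow_iff finite_atLeastAtMost finite_subset)

lemma working_family_card:
  assumes "working_family n G" "B \<in> G"
  shows "card B < n" "B \<subseteq> {1..n}" "finite B"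
proof -
  show 1: "B \<subseteq> {1..n}" using assms by (auto simp: working_family_def)
  then show "finite B" by (rule finite_subset) simp
  have "B \<noteq> {1..n}" using assms by (auto simp: working_family_def)
  then have "card B < card {1..n}" using 1 by (intro psubset_card_mono) auto
  then show "card B < n" by simp
qed

context frailty
begin

lemma failed_mono_space:
  "\<omega> \<in> space M \<Longrightarrow> 0 \<le> x \<Longrightarrow> x \<le> y \<Longrightarrow> failed n L E x \<omega> \<subseteq> failed n L E y \<omega>"
  using failed_mono[of L \<omega> x y n E, OF L_path] by blast

end

locale exiting = frailty +
  fixes G :: "nat set set"
  assumes G: "working_family n G"
begin

abbreviation \<tau> :: "'a \<Rightarrow> real" where "\<tau> \<equiv> exit_time n G L E"
abbreviation X :: "'a \<Rightarrow> nat set" where "X \<equiv> exit_set n G L E"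

text \<open>One almost sure condition under which the pathwise statements hold; a time at which
  every component has failed guarantees that the exit time is a genuine infimum.\<close>

definition regular :: "'a \<Rightarrow> bool" where
  "regular \<omega> \<longleftrightarrow> \<omega> \<in> space M \<and> (\<forall>i\<in>{1..n}. \<forall>m. 0 < E i m \<omega>) \<and> (\<exists>a::nat. failed n L E (real a) \<omega> = {1..n})"

lemma AE_regular: "AE \<omega> in M. regular \<omega>"
  using E_pos_all eventually_all_failed AE_space by eventually_elim (auto simp: regular_def)

lemma regularD:
  assumes "regular \<omega>"
  shows "\<omega> \<in> space M" "subordinator_path (\<lambda>t. L t \<omega>)" "i \<in> {1..n} \<Longrightarrow> 0 < E i m \<omega>"
    "\<exists>t\<ge>0. failed n L E t \<omega> \<notin> G"
proof -
  show 1: "\<omega> \<in> space M" and "i \<in> {1..n} \<Longrightarrow> 0 < E i m \<omega>" using assms by (auto simp: regular_def)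
  show "subordinator_path (\<lambda>t. L t \<omega>)" by (rule L_path[OF 1])
  obtain a :: nat where "failed n L E (real a) \<omega> = {1..n}" using assms by (auto simp: regular_def)
  then have "failed n L E (real a) \<omega> \<notin> G" using G by (simp add: working_family_def)
  then show "\<exists>t\<ge>0. failed n L E t \<omega> \<notin> G" by (intro exI[of _ "real a"]) simp
qed

lemma \<tau>_nonneg: "0 \<le> \<tau> \<omega>"
  by (auto simp: exit_time_def intro!: cInf_greatest)

lemma
  assumes "regular \<omega>"
  shows \<tau>_pos: "0 < \<tau> \<omega>"
    and X_notin: "X \<omega> \<notin> G"
    and \<tau>_le_iff: "0 \<le> t \<Longrightarrow> \<tau> \<omega> \<le> t \<longleftrightarrow> failed n L E t \<omega> \<notin> G"
    and less_\<tau>_iff: "0 \<le> t \<Longrightarrow> t < \<tau> \<omega> \<longleftrightarrow> failed n L E t \<omega> \<in> G"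
proof -
  note reg = regularD[OF assms]
  show "0 < \<tau> \<omega>" using reg(3) by (intro exit_time_pos[OF reg(2) G reg(4)]) auto
  show "X \<omega> \<notin> G" by (rule exit_set_notin[OF reg(2) G reg(4)])
  show *: "0 \<le> t \<Longrightarrow> \<tau> \<omega> \<le> t \<longleftrightarrow> failed n L E t \<omega> \<notin> G" by (rule exit_time_le_iff[OF reg(2) G reg(4)])
  show "0 \<le> t \<Longrightarrow> t < \<tau> \<omega> \<longleftrightarrow> failed n L E t \<omega> \<in> G" using * by (simp add: not_le[symmetric])
qed

lemma X_subset: "X \<omega> \<subseteq> {1..n}"
  by (auto simp: exit_set_def failed_def)

text \<open>Up to a fixed \<open>x\<close> only two cases matter: the path never leaves
  \<open>G\<close>, where the default 0 applies, or the failed set at \<open>x\<close> is outside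
  \<open>G\<close>. Since failed sets grow, never leaving can be tested at integer times.\<close>

lemma \<tau>_measurable [measurable]: "\<tau> \<in> borel_measurable M"
  unfolding borel_measurable_iff_le
proof
  fix x :: real
  have ex: "(\<exists>t\<ge>0. failed n L E t \<omega> \<notin> G) \<longleftrightarrow> (\<exists>a::nat. failed n L E (real a) \<omega> \<notin> G)" if "\<omega> \<in> space M" for \<omega>
  proof
    assume "\<exists>t\<ge>0. failed n L E t \<omega> \<notin> G"
    then obtain t where t: "0 \<le> t" "failed n L E t \<omega> \<notin> G" by blast
    obtain a :: nat where "t \<le> real a" using real_arch_simple by blast
    then have "failed n L E t \<omega> \<subseteq> failed n L E (real a) \<omega>" by (rule failed_mono_space[OF that t(1)])
    then show "\<exists>a::nat. failed n L E (real a) \<omega> \<notin> G" using t(2) G unfolding working_family_def by blast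
  next
    assume "\<exists>a::nat. failed n L E (real a) \<omega> \<notin> G"
    then obtain a :: nat where "failed n L E (real a) \<omega> \<notin> G" by blast
    then show "\<exists>t\<ge>0. failed n L E t \<omega> \<notin> G" by (intro exI[of _ "real a"]) simp
  qed
  show "{\<omega> \<in> space M. \<tau> \<omega> \<le> x} \<in> events"
  proof (cases "0 \<le> x")
    case False
    have "\<not> \<tau> \<omega> \<le> x" for \<omega> using \<tau>_nonneg[of \<omega>] False by linarith
    then show ?thesis by simp
  next
    case True
    have "\<tau> \<omega> \<le> x \<longleftrightarrow> (\<forall>a::nat. failed n L E (real a) \<omega> \<in> G) \<or> failed n L E x \<omega> \<notin> G" if "\<omega> \<in> space M" for \<omega>
    proof (cases "\<exists>t\<ge>0. failed n L E t \<omega> \<notin> G")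
      case True
      then show ?thesis using exit_time_le_iff[OF L_path[OF that] G True \<open>0 \<le> x\<close>] ex[OF that] by blast
    next
      case F: False
      then have "\<tau> \<omega> = 0" unfolding exit_time_def by (rule if_not_P)
      then show ?thesis using F \<open>0 \<le> x\<close> by simp
    qed
    then have "{\<omega> \<in> space M. \<tau> \<omega> \<le> x} = {\<omega> \<in> space M. (\<forall>a::nat. failed n L E (real a) \<omega> \<in> G) \<or> failed n L E x \<omega> \<notin> G}"
      by blast
    also have "\<dots> \<in> events"
      using True by (intro predE pred_intros_logic pred_intros_countable pred_failed_in) auto
    finally show ?thesis .
  qed
qed

lemma grid_step_measurable [measurable]: "(\<lambda>\<omega>. grid_step k (\<tau> \<omega>)) \<in> measurable M (count_space UNIV)"
  unfolding grid_step_def by measurable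

lemma L_grid_measurable:
  assumes "0 \<le> t" shows "(\<lambda>\<omega>. L (grid k (\<tau> \<omega>) + t) \<omega>) \<in> borel_measurable M"
  by (rule measurable_compose_countable[where f="\<lambda>a. L (real a / 2 ^ k + t)" and g="\<lambda>\<omega>. grid_step k (\<tau> \<omega>)"])
     (use assms in \<open>auto intro!: L_measurable\<close>)

lemma L_grid_tendsto:
  assumes "\<omega> \<in> space M" "0 \<le> t" shows "(\<lambda>k. L (grid k (\<tau> \<omega>) + t) \<omega>) \<longlonglongrightarrow> L (\<tau> \<omega> + t) \<omega>"
  by (rule subordinator_path_limit[OF L_path[OF assms(1)]])
     (use \<tau>_nonneg[of \<omega>] assms(2) in \<open>auto intro!: tendsto_add grid_tendsto grid_ge\<close>)

text \<open>The process at a random time is a limit of its values at the rounded times, each of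
  which takes countably many values.\<close>

lemma L_\<tau>_measurable:
  assumes "0 \<le> t" shows "(\<lambda>\<omega>. L (\<tau> \<omega> + t) \<omega>) \<in> borel_measurable M"
  by (rule borel_measurable_LIMSEQ_real[OF L_grid_tendsto L_grid_measurable]) (use assms in auto)

lemma pred_X_eq [measurable]: "Measurable.pred M (\<lambda>\<omega>. X \<omega> = A)"
proof -
  have "X \<omega> = A \<longleftrightarrow> A \<subseteq> {1..n} \<and> (\<forall>i\<in>{1..n}. (i \<in> A) = (E i 0 \<omega> \<le> L (\<tau> \<omega>) \<omega>))" for \<omega>
    unfolding exit_set_def failed_def by blast
  moreover have "Measurable.pred M (\<lambda>\<omega>. \<forall>i\<in>{1..n}. (i \<in> A) = (E i 0 \<omega> \<le> L (\<tau> \<omega>) \<omega>))"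
  proof (rule pred_intros_finite)
    fix i assume "i \<in> {1..n}"
    then show "Measurable.pred M (\<lambda>\<omega>. (i \<in> A) = (E i 0 \<omega> \<le> L (\<tau> \<omega>) \<omega>))"
      using E_measurable[of i 0] L_\<tau>_measurable[of 0, simplified] by measurable
  qed auto
  ultimately show ?thesis by (cases "A \<subseteq> {1..n}") simp_all
qed

lemma X_measurable [measurable]: "X \<in> measurable M (count_space UNIV)"
proof -
  have "X \<in> measurable M (count_space (Pow {1..n}))"
    using X_subset predE[OF pred_X_eq]
    by (subst measurable_count_space_eq2) (auto simp: vimage_def Int_def conj_commute)
  then show ?thesis by (rule measurable_compose) simp
qed

lemma pred_failed_grid: "Measurable.pred M (\<lambda>\<omega>. failed n L E (grid k (\<tau> \<omega>)) \<omega> = A)"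
  by (rule measurable_compose_countable[where f="\<lambda>a \<omega>. failed n L E (real a / 2 ^ k) \<omega> = A" and g="\<lambda>\<omega>. grid_step k (\<tau> \<omega>)"])
     (auto intro!: pred_failed)

lemma grid_step_pos: "regular \<omega> \<Longrightarrow> 0 < grid_step k (\<tau> \<omega>)"
  using \<tau>_pos by (simp add: less_grid_step_iff)

text \<open>Turns the position of the random exit into a condition at two fixed grid points, to
  which \<open>prob_failed_jump\<close> applies.\<close>

lemma grid_step_eq_Suc_iff:
  assumes "regular \<omega>"
  shows "grid_step k (\<tau> \<omega>) = Suc a \<longleftrightarrow>
    failed n L E (real a / 2 ^ k) \<omega> \<in> G \<and> failed n L E (real (Suc a) / 2 ^ k) \<omega> \<notin> G"
proof -
  have "grid_step k (\<tau> \<omega>) = Suc a \<longleftrightarrow> a < grid_step k (\<tau> \<omega>) \<and> \<not> Suc a < grid_step k (\<tau> \<omega>)" by auto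
  then show ?thesis unfolding less_grid_step_iff using less_\<tau>_iff[OF assms] by simp
qed

lemma eventually_failed_grid_eq:
  assumes "regular \<omega>"
  shows "eventually (\<lambda>k. failed n L E (grid k (\<tau> \<omega>)) \<omega> = X \<omega>) sequentially"
proof -
  obtain b where b: "\<tau> \<omega> < b" "\<And>u. \<tau> \<omega> \<le> u \<Longrightarrow> u < b \<Longrightarrow> failed n L E u \<omega> = failed n L E (\<tau> \<omega>) \<omega>"
    using failed_right_constant[of L \<omega> "\<tau> \<omega>" n E, OF regularD(2)[OF assms] \<tau>_nonneg] by blast
  have "eventually (\<lambda>k. grid k (\<tau> \<omega>) < b) sequentially"
    by (rule order_tendstoD(2)[OF grid_tendsto[OF \<tau>_nonneg] b(1)])
  then show ?thesis
    by eventually_elim (use b(2) grid_ge in \<open>auto simp: exit_set_def\<close>)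
qed

lemma exp_sums:
  assumes "0 < c"
  shows "(\<lambda>a. exp (- (real a * \<psi> c / 2 ^ k))) sums (1 / (1 - exp (- (\<psi> c / 2 ^ k))))"
proof -
  have "(\<lambda>a. exp (- (\<psi> c / 2 ^ k)) ^ a) sums (1 / (1 - exp (- (\<psi> c / 2 ^ k))))"
    using \<psi>_pos[OF assms] by (intro geometric_sums) simp
  then show ?thesis by (simp add: exp_of_nat_mult[symmetric])
qed

text \<open>Sums the probability of the failed set \<open>B\<close> over all grid times, giving the
  expected number of grid points spent there. A member of \<open>G\<close> leaves at least one
  component working, so all arguments are positive and the geometric series converge.\<close>

lemma green_sums:
  assumes "B \<in> G"
  shows "(\<lambda>a. fdiff (\<lambda>c. exp (- (real a * \<psi> c / 2 ^ k))) (card B) (n - card B)) sums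
    fdiff (\<lambda>c. 1 / (1 - exp (- (\<psi> c / 2 ^ k)))) (card B) (n - card B)"
  using working_family_card(1)[OF G assms] by (intro fdiff_sums exp_sums) auto

text \<open>The expected number of grid points times the mesh converges to the expected time with
  failed set \<open>B\<close>.\<close>

lemma green_tendsto:
  assumes "B \<in> G"
  shows "(\<lambda>k. fdiff (\<lambda>c. 1 / (1 - exp (- (\<psi> c / 2 ^ k)))) (card B) (n - card B) / 2 ^ k)
    \<longlonglongrightarrow> fdiff (\<lambda>c. 1 / \<psi> c) (card B) (n - card B)"
proof -
  have "(\<lambda>k. fdiff (\<lambda>c. - 1 / ((exp (- (\<psi> c / 2 ^ k)) - 1) * 2 ^ k)) (card B) (n - card B))
    \<longlonglongrightarrow> fdiff (\<lambda>c. - 1 / - \<psi> c) (card B) (n - card B)"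
  proof (intro fdiff_tendsto tendsto_divide tendsto_const exp_quotient_tendsto)
    fix c assume "n - card B \<le> c"
    then have "0 < c" using working_family_card(1)[OF G assms] by simp
    then show "- \<psi> c \<noteq> 0" using \<psi>_pos[of c] by simp
  qed
  moreover have "fdiff (\<lambda>c. - 1 / ((exp (- (\<psi> c / 2 ^ k)) - 1) * 2 ^ k)) (card B) (n - card B) =
     fdiff (\<lambda>c. 1 / (1 - exp (- (\<psi> c / 2 ^ k)))) (card B) (n - card B) / 2 ^ k" for k
  proof -
    have "(\<lambda>c. - 1 / ((exp (- (\<psi> c / 2 ^ k)) - 1) * 2 ^ k)) = (\<lambda>c. (1 / 2 ^ k) * (1 / (1 - exp (- (\<psi> c / 2 ^ k)))))"
      by (simp add: fun_eq_iff divide_simps)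
    then show ?thesis by (simp only: fdiff_cmult) simp
  qed
  ultimately show ?thesis by simp
qed

text \<open>Splits by the cell that contains the exit and by the failed set at its left end. Further
  failures may occur in the same cell after the exit, so the set seen at the right end has the law
  of the exit set only in the limit.\<close>

lemma prob_grid_exit:
  assumes A: "A \<subseteq> {1..n}" "A \<notin> G"
  shows "\<P>(\<omega> in M. failed n L E (grid k (\<tau> \<omega>)) \<omega> = A) =
    (\<Sum>B | B \<in> G \<and> B \<subseteq> A. fdiff (\<lambda>c. 1 / (1 - exp (- (\<psi> c / 2 ^ k)))) (card B) (n - card B) *
       fdiff (\<lambda>c. exp (- (\<psi> c / 2 ^ k))) (card A - card B) (n - card A))"
proof -
  let ?p = "\<lambda>a. \<P>(\<omega> in M. grid_step k (\<tau> \<omega>) = Suc a \<and> failed n L E (real (Suc a) / 2 ^ k) \<omega> = A)"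
  let ?G = "{B. B \<in> G \<and> B \<subseteq> A}"
  have fin: "finite ?G" using working_family_finite[OF G] by simp
  have "?p a = (\<Sum>B\<in>?G. \<P>(\<omega> in M. failed n L E (real a / 2 ^ k) \<omega> = B \<and> failed n L E (real (Suc a) / 2 ^ k) \<omega> = A))" for a
  proof -
    let ?ev = "\<lambda>B. {\<omega>\<in>space M. failed n L E (real a / 2 ^ k) \<omega> = B \<and> failed n L E (real (Suc a) / 2 ^ k) \<omega> = A}"
    have sets: "?ev B \<in> events" for B
      by (intro predE pred_intros_logic pred_failed) auto
    have "?p a = prob (\<Union>B\<in>?G. ?ev B)"
    proof (rule measure_eq_AE)
      show "AE \<omega> in M. (\<omega> \<in> {\<omega>\<in>space M. grid_step k (\<tau> \<omega>) = Suc a \<and> failed n L E (real (Suc a) / 2 ^ k) \<omega> = A}) =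
          (\<omega> \<in> (\<Union>B\<in>?G. ?ev B))"
        using AE_regular
      proof eventually_elim
        case (elim \<omega>)
        have "failed n L E (real a / 2 ^ k) \<omega> \<subseteq> failed n L E (real (Suc a) / 2 ^ k) \<omega>"
          by (rule failed_mono_space[OF regularD(1)[OF elim]]) (auto simp: divide_right_mono)
        then show ?case using grid_step_eq_Suc_iff[OF elim, of k a] A by auto
      qed
      show "{\<omega>\<in>space M. grid_step k (\<tau> \<omega>) = Suc a \<and> failed n L E (real (Suc a) / 2 ^ k) \<omega> = A} \<in> events"
        by (intro predE pred_intros_logic pred_failed) auto
    qed (use sets fin in auto)
    also have "\<dots> = (\<Sum>B\<in>?G. prob (?ev B))"
      using sets fin by (intro finite_measure_finite_Union) (auto simp: disjoint_family_on_def)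
    finally show ?thesis .
  qed
  also have "\<dots>a = (\<Sum>B\<in>?G. fdiff (\<lambda>c. exp (- (real a * \<psi> c / 2 ^ k))) (card B) (n - card B) *
       fdiff (\<lambda>c. exp (- (\<psi> c / 2 ^ k))) (card A - card B) (n - card A))" for a
  proof (rule sum.cong[OF refl])
    fix B assume "B \<in> ?G"
    then show "\<P>(\<omega> in M. failed n L E (real a / 2 ^ k) \<omega> = B \<and> failed n L E (real (Suc a) / 2 ^ k) \<omega> = A) =
       fdiff (\<lambda>c. exp (- (real a * \<psi> c / 2 ^ k))) (card B) (n - card B) *
       fdiff (\<lambda>c. exp (- (\<psi> c / 2 ^ k))) (card A - card B) (n - card A)"
      using prob_failed_jump[of B A a "Suc a" k] A by simp
  qed
  finally have p: "?p = (\<lambda>a. (\<Sum>B\<in>?G. fdiff (\<lambda>c. exp (- (real a * \<psi> c / 2 ^ k))) (card B) (n - card B) *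
       fdiff (\<lambda>c. exp (- (\<psi> c / 2 ^ k))) (card A - card B) (n - card A)))" by (rule ext)
  have sums1: "?p sums (\<Sum>B\<in>?G. fdiff (\<lambda>c. 1 / (1 - exp (- (\<psi> c / 2 ^ k)))) (card B) (n - card B) *
       fdiff (\<lambda>c. exp (- (\<psi> c / 2 ^ k))) (card A - card B) (n - card A))"
    unfolding p by (intro sums_sum sums_mult2 green_sums) auto
  have sums2: "?p sums prob (\<Union>a. {\<omega>\<in>space M. grid_step k (\<tau> \<omega>) = Suc a \<and> failed n L E (real (Suc a) / 2 ^ k) \<omega> = A})"
  proof (rule finite_measure_UNION)
    show "range (\<lambda>a. {\<omega>\<in>space M. grid_step k (\<tau> \<omega>) = Suc a \<and> failed n L E (real (Suc a) / 2 ^ k) \<omega> = A}) \<subseteq> events"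
      by (intro image_subsetI predE pred_intros_logic pred_failed) auto
  qed (auto simp: disjoint_family_on_def)
  have "prob (\<Union>a. {\<omega>\<in>space M. grid_step k (\<tau> \<omega>) = Suc a \<and> failed n L E (real (Suc a) / 2 ^ k) \<omega> = A}) =
     \<P>(\<omega> in M. failed n L E (grid k (\<tau> \<omega>)) \<omega> = A)"
  proof (rule measure_eq_AE)
    show "AE \<omega> in M. (\<omega> \<in> (\<Union>a. {\<omega>\<in>space M. grid_step k (\<tau> \<omega>) = Suc a \<and> failed n L E (real (Suc a) / 2 ^ k) \<omega> = A})) =
        (\<omega> \<in> {\<omega>\<in>space M. failed n L E (grid k (\<tau> \<omega>)) \<omega> = A})"
      using AE_regular
    proof eventually_elim
      case (elim \<omega>)
      then obtain a where "grid_step k (\<tau> \<omega>) = Suc a" using grid_step_pos[of \<omega> k] gr0_implies_Suc by blast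
      then show ?case by auto
    qed
    show "(\<Union>a. {\<omega>\<in>space M. grid_step k (\<tau> \<omega>) = Suc a \<and> failed n L E (real (Suc a) / 2 ^ k) \<omega> = A}) \<in> events"
      by (intro sets.countable_UN'' predE pred_intros_logic pred_failed) auto
    show "{\<omega>\<in>space M. failed n L E (grid k (\<tau> \<omega>)) \<omega> = A} \<in> events"
      by (rule predE[OF pred_failed_grid])
  qed
  then show ?thesis using sums_unique2[OF sums1 sums2] by simp
qed

text \<open>The failed set at the rounded exit time is eventually the exit set, so the grid formula
  passes to the limit on both sides.\<close>

lemma prob_X:
  assumes A: "A \<subseteq> {1..n}" "A \<notin> G"
  shows "\<P>(\<omega> in M. X \<omega> = A) = exit_law \<psi> n G A"
proof -
  let ?ev = "\<lambda>k. {\<omega>\<in>space M. failed n L E (grid k (\<tau> \<omega>)) \<omega> = A}" and ?lim = "{\<omega>\<in>space M. X \<omega> = A}"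
  have sets: "?ev k \<in> events" "?lim \<in> events" for k
    by (auto intro!: predE pred_failed_grid pred_X_eq)
  have "(\<lambda>k. \<integral>\<omega>. indicator (?ev k) \<omega> \<partial>M) \<longlonglongrightarrow> (\<integral>\<omega>. indicator ?lim \<omega> \<partial>M :: real)"
  proof (rule integral_dominated_convergence[where w="\<lambda>_. 1"])
    show "AE \<omega> in M. (\<lambda>k. indicator (?ev k) \<omega> :: real) \<longlonglongrightarrow> indicator ?lim \<omega>"
      using AE_regular
    proof eventually_elim
      case (elim \<omega>)
      show ?case
        by (rule tendsto_eventually, rule eventually_mono[OF eventually_failed_grid_eq[OF elim]]) (auto simp: indicator_def)
    qed
  qed (use sets in \<open>auto simp: indicator_def\<close>)
  then have 1: "(\<lambda>k. prob (?ev k)) \<longlonglongrightarrow> prob ?lim"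
    using sets by simp
  \<comment> \<open>A factor \<open>2 ^ k\<close> is moved from the count of grid points to the
    one-step probability: the former becomes a time and the latter a rate, and both
    converge.\<close>
  have "(\<lambda>k. \<Sum>B | B \<in> G \<and> B \<subseteq> A. fdiff (\<lambda>c. 1 / (1 - exp (- (\<psi> c / 2 ^ k)))) (card B) (n - card B) / 2 ^ k *
       fdiff (\<lambda>c. (exp (- (\<psi> c / 2 ^ k)) - 1) * 2 ^ k) (card A - card B) (n - card A)) \<longlonglongrightarrow>
     (\<Sum>B | B \<in> G \<and> B \<subseteq> A. fdiff (\<lambda>c. 1 / \<psi> c) (card B) (n - card B) * fdiff (\<lambda>c. - \<psi> c) (card A - card B) (n - card A))"
    by (intro tendsto_sum tendsto_mult green_tendsto fdiff_tendsto exp_quotient_tendsto) auto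
  also have "(\<Sum>B | B \<in> G \<and> B \<subseteq> A. fdiff (\<lambda>c. 1 / \<psi> c) (card B) (n - card B) * fdiff (\<lambda>c. - \<psi> c) (card A - card B) (n - card A))
     = exit_law \<psi> n G A"
    by (simp add: exit_law_def jump_prob_def fdiff_minus)
  also have "(\<lambda>k. \<Sum>B | B \<in> G \<and> B \<subseteq> A. fdiff (\<lambda>c. 1 / (1 - exp (- (\<psi> c / 2 ^ k)))) (card B) (n - card B) / 2 ^ k *
       fdiff (\<lambda>c. (exp (- (\<psi> c / 2 ^ k)) - 1) * 2 ^ k) (card A - card B) (n - card A)) = (\<lambda>k. prob (?ev k))"
  proof (rule ext, unfold prob_grid_exit[OF A], rule sum.cong[OF refl])
    fix k B assume "B \<in> {B. B \<in> G \<and> B \<subseteq> A}"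
    then have "B \<subset> A" using A by auto
    then have "card B < card A" using A finite_subset by (intro psubset_card_mono) auto
    \<comment> \<open>\<open>A\<close> is outside \<open>G\<close> and \<open>B\<close> inside, so
      the difference has positive order and annihilates the constant needed to form the
      rate.\<close>
    then have p: "0 < card A - card B" by simp
    have "fdiff (\<lambda>c. (exp (- (\<psi> c / 2 ^ k)) - 1) * 2 ^ k) (card A - card B) (n - card A) =
       fdiff (\<lambda>c. 2 ^ k * (exp (- (\<psi> c / 2 ^ k)) + (- 1))) (card A - card B) (n - card A)"
      by (simp add: algebra_simps)
    also have "\<dots> = 2 ^ k * fdiff (\<lambda>c. exp (- (\<psi> c / 2 ^ k))) (card A - card B) (n - card A)"
      unfolding fdiff_cmult fdiff_add using p by (simp add: fdiff_const)
    finally show "fdiff (\<lambda>c. 1 / (1 - exp (- (\<psi> c / 2 ^ k)))) (card B) (n - card B) / 2 ^ k *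
       fdiff (\<lambda>c. (exp (- (\<psi> c / 2 ^ k)) - 1) * 2 ^ k) (card A - card B) (n - card A) =
       fdiff (\<lambda>c. 1 / (1 - exp (- (\<psi> c / 2 ^ k)))) (card B) (n - card B) *
       fdiff (\<lambda>c. exp (- (\<psi> c / 2 ^ k))) (card A - card B) (n - card A)"
      by simp
  qed
  finally show ?thesis by (rule LIMSEQ_unique[OF 1])
qed

lemma prob_less_grid_step:
  "\<P>(\<omega> in M. a < grid_step k (\<tau> \<omega>)) =
    (\<Sum>B\<in>G. fdiff (\<lambda>c. exp (- (real a * \<psi> c / 2 ^ k))) (card B) (n - card B))"
proof -
  let ?ev = "\<lambda>B. {\<omega>\<in>space M. failed n L E (real a / 2 ^ k) \<omega> = B}"
  have sets: "?ev B \<in> events" for B by (intro predE pred_failed) auto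
  have fin: "finite G" by (rule working_family_finite[OF G])
  have "\<P>(\<omega> in M. a < grid_step k (\<tau> \<omega>)) = prob (\<Union>B\<in>G. ?ev B)"
  proof (rule measure_eq_AE)
    show "AE \<omega> in M. (\<omega> \<in> {\<omega>\<in>space M. a < grid_step k (\<tau> \<omega>)}) = (\<omega> \<in> (\<Union>B\<in>G. ?ev B))"
      using AE_regular by eventually_elim (auto simp: less_grid_step_iff less_\<tau>_iff)
  qed (use sets fin in auto)
  also have "\<dots> = (\<Sum>B\<in>G. prob (?ev B))"
    using sets fin by (intro finite_measure_finite_Union) (auto simp: disjoint_family_on_def)
  also have "\<dots> = (\<Sum>B\<in>G. fdiff (\<lambda>c. exp (- (real a * \<psi> c / 2 ^ k))) (card B) (n - card B))"
    by (intro sum.cong refl prob_failed) (use working_family_card[OF G] in auto)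
  finally show ?thesis .
qed

lemma nn_integral_grid_step:
  "(\<integral>\<^sup>+\<omega>. of_nat (grid_step k (\<tau> \<omega>)) \<partial>M) =
    ennreal (\<Sum>B\<in>G. fdiff (\<lambda>c. 1 / (1 - exp (- (\<psi> c / 2 ^ k)))) (card B) (n - card B))"
proof -
  have "(\<integral>\<^sup>+\<omega>. of_nat (grid_step k (\<tau> \<omega>)) \<partial>M) = (\<Sum>a. ennreal \<P>(\<omega> in M. a < grid_step k (\<tau> \<omega>)))"
    by (subst nn_integral_nat_function) (auto simp: emeasure_eq_measure)
  also have "\<dots> = ennreal (\<Sum>B\<in>G. fdiff (\<lambda>c. 1 / (1 - exp (- (\<psi> c / 2 ^ k)))) (card B) (n - card B))"
  proof (rule suminf_ennreal_eq)
    show "(\<lambda>a. \<P>(\<omega> in M. a < grid_step k (\<tau> \<omega>))) sums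
      (\<Sum>B\<in>G. fdiff (\<lambda>c. 1 / (1 - exp (- (\<psi> c / 2 ^ k)))) (card B) (n - card B))"
      unfolding prob_less_grid_step by (intro sums_sum green_sums)
  qed auto
  finally show ?thesis .
qed

text \<open>The coarsest rounding dominates the exit time and has finite mean by summation of tails.
  The exit time plus 1 then dominates all roundings, which identifies the mean as a limit.\<close>

lemma
  shows integrable_\<tau>: "integrable M \<tau>"
    and integral_\<tau>: "(\<integral>\<omega>. \<tau> \<omega> \<partial>M) = exit_mean \<psi> n G"
proof -
  let ?m = "\<lambda>k. (\<Sum>B\<in>G. fdiff (\<lambda>c. 1 / (1 - exp (- (\<psi> c / 2 ^ k)))) (card B) (n - card B))"
  have int: "integrable M (\<lambda>\<omega>. real (grid_step k (\<tau> \<omega>)))"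
    "(\<integral>\<omega>. real (grid_step k (\<tau> \<omega>)) \<partial>M) = ?m k" for k
  proof -
    have nn: "(\<integral>\<^sup>+\<omega>. ennreal (real (grid_step k (\<tau> \<omega>))) \<partial>M) = ennreal (?m k)"
      using nn_integral_grid_step[of k] by (simp only: ennreal_of_nat_eq_real_of_nat)
    show "integrable M (\<lambda>\<omega>. real (grid_step k (\<tau> \<omega>)))"
      by (rule integrableI_nn_integral_finite[OF _ _ nn]) auto
    have "0 \<le> ?m k"
    proof (rule sums_le[OF _ sums_zero])
      show "(\<lambda>a. \<P>(\<omega> in M. a < grid_step k (\<tau> \<omega>))) sums ?m k"
        unfolding prob_less_grid_step by (intro sums_sum green_sums)
    qed auto
    then show "(\<integral>\<omega>. real (grid_step k (\<tau> \<omega>)) \<partial>M) = ?m k"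
      by (subst integral_eq_nn_integral) (auto simp: nn)
  qed
  have bound: "norm (\<tau> \<omega>) \<le> norm (real (grid_step 0 (\<tau> \<omega>)))" for \<omega>
    using grid_ge[of "\<tau> \<omega>" 0] \<tau>_nonneg[of \<omega>] by simp
  show \<tau>: "integrable M \<tau>"
    by (rule Bochner_Integration.integrable_bound[OF int(1)[of 0]]) (use bound in auto)
  have "(\<lambda>k. \<integral>\<omega>. grid k (\<tau> \<omega>) \<partial>M) \<longlonglongrightarrow> (\<integral>\<omega>. \<tau> \<omega> \<partial>M)"
  proof (rule integral_dominated_convergence[where w="\<lambda>\<omega>. \<tau> \<omega> + 1"])
    show "AE \<omega> in M. norm (grid k (\<tau> \<omega>)) \<le> \<tau> \<omega> + 1" for k
    proof (rule AE_I2)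
      fix \<omega>
      have "grid k (\<tau> \<omega>) \<le> \<tau> \<omega> + 1 / 2 ^ k" by (rule grid_le[OF \<tau>_nonneg])
      also have "(1::real) / 2 ^ k \<le> 1" by simp
      finally show "norm (grid k (\<tau> \<omega>)) \<le> \<tau> \<omega> + 1" by simp
    qed
  qed (use \<tau> grid_tendsto[OF \<tau>_nonneg] in auto)
  moreover have "(\<integral>\<omega>. grid k (\<tau> \<omega>) \<partial>M) = (\<Sum>B\<in>G. fdiff (\<lambda>c. 1 / (1 - exp (- (\<psi> c / 2 ^ k)))) (card B) (n - card B) / 2 ^ k)" for k
    by (simp add: int(2) sum_divide_distrib)
  moreover have "(\<lambda>k. \<Sum>B\<in>G. fdiff (\<lambda>c. 1 / (1 - exp (- (\<psi> c / 2 ^ k)))) (card B) (n - card B) / 2 ^ k) \<longlonglongrightarrow> exit_mean \<psi> n G"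
    unfolding exit_mean_def by (intro tendsto_sum green_tendsto)
  ultimately show "(\<integral>\<omega>. \<tau> \<omega> \<partial>M) = exit_mean \<psi> n G"
    using LIMSEQ_unique by simp
qed

text \<open>Positivity is not visible in the alternating sums; it comes from the positivity of the
  exit time. The cost rate is divided by this mean.\<close>

lemma exit_mean_pos: "0 < exit_mean \<psi> n G"
proof -
  have "(\<integral>\<omega>. \<tau> \<omega> \<partial>M) \<noteq> 0"
  proof
    assume "(\<integral>\<omega>. \<tau> \<omega> \<partial>M) = 0"
    then have "AE \<omega> in M. \<tau> \<omega> = 0"
      using integral_nonneg_eq_0_iff_AE[OF integrable_\<tau>] \<tau>_nonneg by simp
    then have "AE \<omega> in M. False" using AE_regular by eventually_elim (use \<tau>_pos in fastforce)
    then show False by simp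
  qed
  moreover have "0 \<le> (\<integral>\<omega>. \<tau> \<omega> \<partial>M)" using \<tau>_nonneg by simp
  ultimately show ?thesis using integral_\<tau> by simp
qed

lemma nn_integral_\<tau>_square: "(\<integral>\<^sup>+\<omega>. ennreal ((\<tau> \<omega>)\<^sup>2) \<partial>M) \<le> ennreal (exit_square_bound \<psi> n)"
proof -
  have odd_sum: "(\<Sum>a<m. 2 * real a + 1) = (real m)\<^sup>2" for m
    by (induction m) (auto simp: power2_eq_square algebra_simps)
  have step: "ennreal ((\<tau> \<omega>)\<^sup>2) \<le> (\<Sum>a. ennreal (2 * real a + 1) * indicator {\<omega>\<in>space M. a < grid_step 0 (\<tau> \<omega>)} \<omega>)"
    if "\<omega> \<in> space M" for \<omega>
  proof -
    have "(\<tau> \<omega>)\<^sup>2 \<le> (real (grid_step 0 (\<tau> \<omega>)))\<^sup>2"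
      using grid_ge[of "\<tau> \<omega>" 0] \<tau>_nonneg[of \<omega>] by (intro power_mono) auto
    then have "ennreal ((\<tau> \<omega>)\<^sup>2) \<le> ennreal (\<Sum>a<grid_step 0 (\<tau> \<omega>). 2 * real a + 1)"
      unfolding odd_sum by (rule ennreal_leI)
    also have "\<dots> = (\<Sum>a<grid_step 0 (\<tau> \<omega>). ennreal (2 * real a + 1) * indicator {\<omega>\<in>space M. a < grid_step 0 (\<tau> \<omega>)} \<omega>)"
      using that by (subst sum_ennreal[symmetric]) (auto intro!: sum.cong)
    also have "\<dots> \<le> (\<Sum>a. ennreal (2 * real a + 1) * indicator {\<omega>\<in>space M. a < grid_step 0 (\<tau> \<omega>)} \<omega>)"
      by (intro sum_le_suminf) auto
    finally show ?thesis .
  qed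
  have prob: "\<P>(\<omega> in M. a < grid_step 0 (\<tau> \<omega>)) \<le> real n * exp (- \<psi> 1) ^ a" for a
  proof -
    have "\<P>(\<omega> in M. a < grid_step 0 (\<tau> \<omega>)) \<le> \<P>(\<omega> in M. failed n L E (real a) \<omega> \<noteq> {1..n})"
    proof (rule finite_measure_mono_AE)
      show "AE \<omega> in M. \<omega> \<in> {\<omega>\<in>space M. a < grid_step 0 (\<tau> \<omega>)} \<longrightarrow> \<omega> \<in> {\<omega>\<in>space M. failed n L E (real a) \<omega> \<noteq> {1..n}}"
        using AE_regular by eventually_elim (use G in \<open>auto simp: less_grid_step_iff less_\<tau>_iff working_family_def\<close>)
    qed (auto intro!: predE pred_intros_logic pred_failed)
    then show ?thesis using prob_not_all_failed[of a] by linarith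
  qed
  have z: "norm (exp (- \<psi> 1)) < 1" "0 \<le> exp (- \<psi> 1)" using exp_\<psi>_less_1[of 1] by auto
  \<comment> \<open>With \<open>2 * a + 1 = 2 * (a + 1) - 1\<close> the series is a differentiated
    geometric series minus a geometric one.\<close>
  have "summable (\<lambda>a. 2 * real n * (of_nat (Suc a) * exp (- \<psi> 1) ^ a) - real n * exp (- \<psi> 1) ^ a)"
    using geometric_deriv_sums[OF z(1)] z(1)
    by (intro summable_diff summable_mult summable_geometric) (auto simp: sums_iff)
  then have summable: "summable (\<lambda>a. (2 * real a + 1) * (real n * exp (- \<psi> 1) ^ a))"
    by (simp add: algebra_simps)
  have "(\<integral>\<^sup>+\<omega>. ennreal ((\<tau> \<omega>)\<^sup>2) \<partial>M) \<le>
      (\<integral>\<^sup>+\<omega>. (\<Sum>a. ennreal (2 * real a + 1) * indicator {\<omega>\<in>space M. a < grid_step 0 (\<tau> \<omega>)} \<omega>) \<partial>M)"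
    by (intro nn_integral_mono step)
  also have "\<dots> = (\<Sum>a. ennreal (2 * real a + 1) * emeasure M {\<omega>\<in>space M. a < grid_step 0 (\<tau> \<omega>)})"
    by (subst nn_integral_suminf) (auto simp: nn_integral_cmult_indicator)
  also have "\<dots> \<le> (\<Sum>a. ennreal ((2 * real a + 1) * (real n * exp (- \<psi> 1) ^ a)))"
  proof (intro suminf_le)
    show "ennreal (2 * real a + 1) * emeasure M {\<omega>\<in>space M. a < grid_step 0 (\<tau> \<omega>)} \<le>
        ennreal ((2 * real a + 1) * (real n * exp (- \<psi> 1) ^ a))" for a
      unfolding emeasure_eq_measure using prob[of a]
      by (subst ennreal_mult'[symmetric]) (auto intro!: ennreal_leI mult_left_mono)
  qed auto
  also have "\<dots> = ennreal (exit_square_bound \<psi> n)"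
    unfolding exit_square_bound_def using summable by (intro suminf_ennreal2) auto
  finally show ?thesis .
qed

end

section \<open>Regeneration at the exit time\<close>

text \<open>The triggers seen after a repair of the set \<open>A\<close> at time \<open>x\<close>. A failed component discards its first
  trigger; for the others, the trigger of index 1 is dropped as well, which keeps the law and the indices
  uniform.\<close>

definition resumed ::
  "(real \<Rightarrow> 'a \<Rightarrow> real) \<Rightarrow> (nat \<Rightarrow> nat \<Rightarrow> 'a \<Rightarrow> real) \<Rightarrow> real \<Rightarrow> nat set \<Rightarrow> nat \<times> nat \<Rightarrow> 'a \<Rightarrow> real" where
  "resumed L E x A q \<omega> =
     (if snd q = 0 then if fst q \<in> A then E (fst q) 1 \<omega> else E (fst q) 0 \<omega> - L x \<omega>
      else E (fst q) (Suc (snd q)) \<omega>)"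

definition shiftL ::
  "nat \<Rightarrow> nat set set \<Rightarrow> (real \<Rightarrow> 'a \<Rightarrow> real) \<Rightarrow> (nat \<Rightarrow> nat \<Rightarrow> 'a \<Rightarrow> real) \<Rightarrow> real \<Rightarrow> 'a \<Rightarrow> real" where
  "shiftL n G L E t \<omega> = L (exit_time n G L E \<omega> + t) \<omega> - L (exit_time n G L E \<omega>) \<omega>"

definition shiftE ::
  "nat \<Rightarrow> nat set set \<Rightarrow> (real \<Rightarrow> 'a \<Rightarrow> real) \<Rightarrow> (nat \<Rightarrow> nat \<Rightarrow> 'a \<Rightarrow> real) \<Rightarrow> nat \<Rightarrow> nat \<Rightarrow> 'a \<Rightarrow> real" where
  "shiftE n G L E i m \<omega> = resumed L E (exit_time n G L E \<omega>) (exit_set n G L E \<omega>) (i, m) \<omega>"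

text \<open>The right side of the assumption \<open>law\<close>, named because it must be split,
  shifted and refined; \<open>law_index\<close> collects the side conditions of that
  assumption.\<close>

definition law_weight ::
  "(nat \<Rightarrow> real) \<Rightarrow> nat \<Rightarrow> (nat \<times> nat) set \<Rightarrow> (nat \<times> nat \<Rightarrow> nat) \<Rightarrow> (nat \<times> nat \<Rightarrow> nat) \<Rightarrow> nat \<Rightarrow> (nat \<times> nat \<Rightarrow> real) \<Rightarrow> real" where
  "law_weight \<psi> k F a b J u =
     exp (- (\<Sum>q\<in>F. u q) - (\<Sum>j<J. \<psi> (card {q\<in>F. a q \<le> j \<and> j < b q})) / 2 ^ k)"

definition law_index :: "nat \<Rightarrow> (nat \<times> nat) set \<Rightarrow> (nat \<times> nat \<Rightarrow> nat) \<Rightarrow> (nat \<times> nat \<Rightarrow> nat) \<Rightarrow> nat \<Rightarrow> (nat \<times> nat \<Rightarrow> real) \<Rightarrow> bool" where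
  "law_index n F a b J u \<longleftrightarrow> finite F \<and> F \<subseteq> {1..n} \<times> UNIV \<and>
     (\<forall>q\<in>F. a q \<le> b q \<and> b q \<le> J \<and> 0 \<le> u q \<and> (snd q = 0 \<longrightarrow> a q = 0))"

context frailty
begin

lemma law':
  assumes "law_index n F a b J u"
  shows "\<P>(\<omega> in M. \<forall>q\<in>F. L (real (b q) / 2 ^ k) \<omega> - L (real (a q) / 2 ^ k) \<omega> + u q < E (fst q) (snd q) \<omega>) =
      law_weight \<psi> k F a b J u"
  unfolding law_weight_def by (rule law) (use assms in \<open>auto simp: law_index_def\<close>)

section \<open>Past and future at a fixed grid time\<close>

text \<open>The event of \<open>law\<close> for the system restarted at the deterministic grid time
  \<open>d\<close> after a repair of \<open>A\<close>. The random exit time will later select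
  \<open>d\<close> and \<open>A\<close>.\<close>

definition future_event ::
  "nat \<Rightarrow> nat \<Rightarrow> nat set \<Rightarrow> (nat \<times> nat) set \<Rightarrow> (nat \<times> nat \<Rightarrow> nat) \<Rightarrow> (nat \<times> nat \<Rightarrow> nat) \<Rightarrow> (nat \<times> nat \<Rightarrow> real) \<Rightarrow> 'a \<Rightarrow> bool" where
  "future_event k d A F a b u \<omega> \<longleftrightarrow>
     (\<forall>q\<in>F. L (real (d + b q) / 2 ^ k) \<omega> - L (real (d + a q) / 2 ^ k) \<omega> + u q < resumed L E (real d / 2 ^ k) A q \<omega>)"

lemma pred_future_event:
  assumes "law_index n F a b J u"
  shows "Measurable.pred M (future_event k d A F a b u)"
proof -
  have "Measurable.pred M (\<lambda>\<omega>. \<forall>q\<in>F. L (real (d + b q) / 2 ^ k) \<omega> - L (real (d + a q) / 2 ^ k) \<omega> + u q < resumed L E (real d / 2 ^ k) A q \<omega>)"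
  proof (rule pred_intros_finite)
    fix q assume "q \<in> F"
    then have "fst q \<in> {1..n}" using assms by (auto simp: law_index_def)
    then show "Measurable.pred M (\<lambda>\<omega>. L (real (d + b q) / 2 ^ k) \<omega> - L (real (d + a q) / 2 ^ k) \<omega> + u q < resumed L E (real d / 2 ^ k) A q \<omega>)"
      using L_measurable[of "real (d + b q) / 2 ^ k"] L_measurable[of "real (d + a q) / 2 ^ k"] L_measurable[of "real d / 2 ^ k"]
        E_measurable[of "fst q"]
      unfolding resumed_def by (cases "snd q = 0"; cases "fst q \<in> A") simp_all
  qed (use assms in \<open>auto simp: law_index_def\<close>)
  then show ?thesis unfolding future_event_def[abs_def] .
qed

text \<open>Past survival conditions and the future event together are again an event covered by
  \<open>law\<close>, for a larger set of triggers of the original system. Its exponent is a sum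
  over cells: those before \<open>d\<close> see only the past conditions and those from
  \<open>d\<close> on only the future ones, so it factorises.\<close>

lemma past_future_lower:
  assumes F: "law_index n F a b J u" and A: "A \<subseteq> {1..n}" and low: "\<And>i. i \<in> A \<Longrightarrow> low i \<le> d"
  shows "\<P>(\<omega> in M. (\<forall>i\<in>A. L (real (low i) / 2 ^ k) \<omega> < E i 0 \<omega>) \<and> (\<forall>i\<in>{1..n} - A. L (real d / 2 ^ k) \<omega> < E i 0 \<omega>) \<and>
       future_event k d A F a b u \<omega>) =
     \<P>(\<omega> in M. (\<forall>i\<in>A. L (real (low i) / 2 ^ k) \<omega> < E i 0 \<omega>) \<and> (\<forall>i\<in>{1..n} - A. L (real d / 2 ^ k) \<omega> < E i 0 \<omega>)) *
     law_weight \<psi> k F a b J u"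
proof -
  note Fd = F[unfolded law_index_def]
  define \<rho> where "\<rho> = (\<lambda>q::nat \<times> nat. if snd q = 0 \<and> fst q \<notin> A then q else (fst q, Suc (snd q)))"
  define as where "as = (\<lambda>q::nat \<times> nat. if snd q = 0 then 0 else d + a (fst q, snd q - 1))"
  define bs where "bs = (\<lambda>q::nat \<times> nat. if snd q = 0 then (if fst q \<in> A then low (fst q) else if q \<in> F then d + b q else d)
     else d + b (fst q, snd q - 1))"
  define us where "us = (\<lambda>q::nat \<times> nat. if snd q = 0 then (if fst q \<notin> A \<and> q \<in> F then u q else 0) else u (fst q, snd q - 1))"
  define bp where "bp = (\<lambda>q::nat \<times> nat. if fst q \<in> A then low (fst q) else d)"
  let ?P = "{1..n} \<times> {0::nat}"
  let ?Fs = "?P \<union> \<rho> ` F"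
  have \<rho>_inj: "inj_on \<rho> F" by (auto simp: inj_on_def \<rho>_def prod_eq_iff split: if_splits)
  have \<rho>_as: "as (\<rho> q) = (if snd q = 0 \<and> fst q \<notin> A then 0 else d + a q)" for q
    by (auto simp: as_def \<rho>_def)
  have \<rho>_bs: "bs (\<rho> q) = d + b q" if "q \<in> F" for q
    using that by (auto simp: bs_def \<rho>_def)
  have \<rho>_us: "us (\<rho> q) = u q" if "q \<in> F" for q
    using that by (auto simp: us_def \<rho>_def)
  have index: "law_index n ?Fs as bs (d + J) us"
    unfolding law_index_def
  proof (intro conjI ballI)
    show "finite ?Fs" using Fd by simp
    show "?Fs \<subseteq> {1..n} \<times> UNIV" using Fd by (force simp: \<rho>_def)
    fix q assume "q \<in> ?Fs"
    then consider "q \<in> ?P" "q \<notin> F \<or> fst q \<in> A" | q' where "q' \<in> F" "q = \<rho> q'"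
    proof (cases "q \<in> \<rho> ` F")
      case False
      then have P: "q \<in> ?P" using \<open>q \<in> ?Fs\<close> by blast
      have "q \<notin> F \<or> fst q \<in> A"
      proof (rule ccontr)
        assume h: "\<not> (q \<notin> F \<or> fst q \<in> A)"
        then have "\<rho> q = q" using P by (auto simp: \<rho>_def)
        then show False using h False by force
      qed
      then show ?thesis using P that(1) by blast
    qed (use that(2) in blast)
    then have "as q \<le> bs q \<and> bs q \<le> d + J \<and> 0 \<le> us q"
    proof cases
      case 1
      then show ?thesis using low by (cases "fst q \<in> A") (auto simp: as_def bs_def us_def trans_le_add1)
    next
      case 2
      then have "a q' \<le> b q' \<and> b q' \<le> J \<and> 0 \<le> u q'" using Fd by blast
      then show ?thesis using 2 by (simp add: \<rho>_as \<rho>_bs \<rho>_us)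
    qed
    then show "as q \<le> bs q" "bs q \<le> d + J" "0 \<le> us q" by auto
    show "snd q = 0 \<longrightarrow> as q = 0" by (simp add: as_def)
  qed
  have index_past: "law_index n ?P (\<lambda>_. 0) bp d (\<lambda>_. 0)"
    using low by (auto simp: law_index_def bp_def)
  have ev: "(\<forall>q\<in>?Fs. L (real (bs q) / 2 ^ k) \<omega> - L (real (as q) / 2 ^ k) \<omega> + us q < E (fst q) (snd q) \<omega>) \<longleftrightarrow>
      (\<forall>i\<in>A. L (real (low i) / 2 ^ k) \<omega> < E i 0 \<omega>) \<and> (\<forall>i\<in>{1..n} - A. L (real d / 2 ^ k) \<omega> < E i 0 \<omega>) \<and>
       future_event k d A F a b u \<omega>" (is "?l \<longleftrightarrow> ?r") if "\<omega> \<in> space M" for \<omega>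
  proof -
    note path = L_path[OF that]
    have L0: "L 0 \<omega> = 0" using subordinator_pathD(1)[OF path] by simp
    let ?T = "\<lambda>q. L (real (bs q) / 2 ^ k) \<omega> - L (real (as q) / 2 ^ k) \<omega> + us q < E (fst q) (snd q) \<omega>"
    have T: "?T (\<rho> q) \<longleftrightarrow> L (real (d + b q) / 2 ^ k) \<omega> - L (real (d + a q) / 2 ^ k) \<omega> + u q < resumed L E (real d / 2 ^ k) A q \<omega>"
      if "q \<in> F" for q
    proof (cases "snd q = 0 \<and> fst q \<notin> A")
      case True
      \<comment> \<open>For a trigger kept in use, starting its exposure at the restart makes the
        part consumed up to \<open>d\<close> cancel. This is why \<open>law\<close> ties generation
        0 to starting time 0.\<close>
      moreover have "a q = 0" using True Fd that by auto
      ultimately show ?thesis using \<rho>_bs[OF that] \<rho>_us[OF that] \<rho>_as[of q] L0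
        by (auto simp: resumed_def \<rho>_def)
    next
      case False
      then show ?thesis using \<rho>_bs[OF that] \<rho>_us[OF that] \<rho>_as[of q]
        by (auto simp: resumed_def \<rho>_def)
    qed
    have fut: "(\<forall>q\<in>\<rho> ` F. ?T q) \<longleftrightarrow> future_event k d A F a b u \<omega>"
      unfolding future_event_def using T by auto
    have TA: "?T (i, 0) \<longleftrightarrow> L (real (low i) / 2 ^ k) \<omega> < E i 0 \<omega>" if "i \<in> A" for i
      using that L0 by (simp add: as_def bs_def us_def)
    have TC: "?T (i, 0) \<longleftrightarrow> L (real d / 2 ^ k) \<omega> < E i 0 \<omega>" if "i \<notin> A" "(i, 0) \<notin> F" for i
      using that L0 by (simp add: as_def bs_def us_def)
    have TF: "L (real d / 2 ^ k) \<omega> < E i 0 \<omega>" if "i \<notin> A" "(i, 0) \<in> F" "?T (i, 0)" for i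
    proof -
      have "L (real d / 2 ^ k) \<omega> \<le> L (real (d + b (i, 0)) / 2 ^ k) \<omega>"
        by (rule subordinator_pathD(2)[OF path]) (auto simp: divide_right_mono)
      moreover have "0 \<le> u (i, 0)" using Fd that by auto
      ultimately show ?thesis using that L0 by (simp add: as_def bs_def us_def)
    qed
    show ?thesis
    proof
      assume l: ?l
      then have T0: "?T (i, 0)" if "i \<in> {1..n}" for i using that by blast
      have "L (real (low i) / 2 ^ k) \<omega> < E i 0 \<omega>" if "i \<in> A" for i
        using T0[of i] TA[OF that] A that by blast
      moreover have "L (real d / 2 ^ k) \<omega> < E i 0 \<omega>" if "i \<in> {1..n} - A" for i
      proof (cases "(i, 0) \<in> F")
        case True
        then show ?thesis using TF[OF _ True T0] that by blast
      next
        case False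
        then show ?thesis using TC[OF _ False] T0[of i] that by blast
      qed
      moreover have "future_event k d A F a b u \<omega>" using l fut by blast
      ultimately show ?r by blast
    next
      assume r: ?r
      have "?T q" if qP: "q \<in> ?P" for q
      proof -
        obtain i where i: "q = (i, 0)" "i \<in> {1..n}" using qP by auto
        show ?thesis
        proof (cases "i \<in> A")
          case True
          then show ?thesis using TA r i by blast
        next
          case False
          show ?thesis
          proof (cases "(i, 0) \<in> F")
            case True
            have "\<rho> (i, 0) = q" using False i by (simp add: \<rho>_def)
            then have "q \<in> \<rho> ` F" using True by force
            then show ?thesis using fut r by blast
          next
            case nF: False
            show ?thesis unfolding i(1) using TC[OF False nF] r i False by blast
          qed
        qed
      qed
      then show ?l using r fut by blast
    qed
  qed
  have past_ev: "(\<forall>q\<in>?P. L (real (bp q) / 2 ^ k) \<omega> - L (real 0 / 2 ^ k) \<omega> + 0 < E (fst q) (snd q) \<omega>) \<longleftrightarrow>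
      (\<forall>i\<in>A. L (real (low i) / 2 ^ k) \<omega> < E i 0 \<omega>) \<and> (\<forall>i\<in>{1..n} - A. L (real d / 2 ^ k) \<omega> < E i 0 \<omega>)" if "\<omega> \<in> space M" for \<omega>
  proof -
    have L0: "L 0 \<omega> = 0" using subordinator_pathD(1)[OF L_path[OF that]] by simp
    show ?thesis using A L0 by (auto simp: bp_def split: if_splits)
  qed
  have sum_us: "(\<Sum>q\<in>?Fs. us q) = (\<Sum>q\<in>F. u q)"
  proof -
    have "(\<Sum>q\<in>?Fs. us q) = (\<Sum>q\<in>\<rho> ` F. us q)"
    proof (rule sum.mono_neutral_right)
      show "\<forall>q\<in>?Fs - \<rho> ` F. us q = 0"
      proof
        fix q assume q: "q \<in> ?Fs - \<rho> ` F"
        then have "snd q = 0" by auto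
        moreover have "\<not> (fst q \<notin> A \<and> q \<in> F)"
        proof
          assume h: "fst q \<notin> A \<and> q \<in> F"
          then have "\<rho> q = q" using \<open>snd q = 0\<close> by (simp add: \<rho>_def)
          then show False using q h by force
        qed
        ultimately show "us q = 0" by (auto simp: us_def)
      qed
    qed (use Fd in auto)
    also have "\<dots> = (\<Sum>q\<in>F. u q)"
      using \<rho>_inj \<rho>_us by (simp add: sum.reindex)
    finally show ?thesis .
  qed
  \<comment> \<open>Renamed triggers of higher generation start at \<open>d\<close> or later, so
    before \<open>d\<close> exactly the first triggers are exposed.\<close>
  have count_past: "{q\<in>?Fs. as q \<le> j \<and> j < bs q} = {q\<in>?P. 0 \<le> j \<and> j < bp q}" if "j < d" for j
  proof (rule set_eqI)
    fix q :: "nat \<times> nat"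
    show "q \<in> {q\<in>?Fs. as q \<le> j \<and> j < bs q} \<longleftrightarrow> q \<in> {q\<in>?P. 0 \<le> j \<and> j < bp q}"
    proof (cases "snd q = 0")
      case True
      have "q \<in> ?Fs \<longleftrightarrow> q \<in> ?P"
        using Fd True by (auto simp: \<rho>_def split: if_splits)
      then show ?thesis using True that by (auto simp: as_def bs_def bp_def)
    next
      case False
      then show ?thesis using that by (auto simp: as_def)
    qed
  qed
  \<comment> \<open>A first trigger that is not the image of a future one has its bound at most
    \<open>d\<close> and is no longer exposed.\<close>
  have count_future: "card {q\<in>?Fs. as q \<le> d + j \<and> d + j < bs q} = card {q\<in>F. a q \<le> j \<and> j < b q}" for j
  proof -
    have "{q\<in>?Fs. as q \<le> d + j \<and> d + j < bs q} = \<rho> ` {q\<in>F. a q \<le> j \<and> j < b q}"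
    proof (rule set_eqI, rule iffI)
      fix q assume q: "q \<in> {q\<in>?Fs. as q \<le> d + j \<and> d + j < bs q}"
      have "q \<in> \<rho> ` F"
      proof (rule ccontr)
        assume "q \<notin> \<rho> ` F"
        then have P: "q \<in> ?P" using q by blast
        then have s: "snd q = 0" by auto
        have "\<not> (fst q \<notin> A \<and> q \<in> F)"
        proof
          assume h: "fst q \<notin> A \<and> q \<in> F"
          then have "\<rho> q = q" using s by (simp add: \<rho>_def)
          then show False using \<open>q \<notin> \<rho> ` F\<close> h by force
        qed
        then have "bs q \<le> d" using s low by (auto simp: bs_def)
        then show False using q by simp
      qed
      then obtain q' where q': "q' \<in> F" "q = \<rho> q'" by blast
      have "a q' \<le> j" using q q' \<rho>_as[of q'] Fd by (auto split: if_splits)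
      then show "q \<in> \<rho> ` {q\<in>F. a q \<le> j \<and> j < b q}" using q q' \<rho>_bs by auto
    next
      fix q assume "q \<in> \<rho> ` {q\<in>F. a q \<le> j \<and> j < b q}"
      then show "q \<in> {q\<in>?Fs. as q \<le> d + j \<and> d + j < bs q}"
        using \<rho>_bs by (auto simp: \<rho>_as)
    qed
    moreover have "inj_on \<rho> {q\<in>F. a q \<le> j \<and> j < b q}" by (rule inj_on_subset[OF \<rho>_inj]) auto
    ultimately show ?thesis by (simp add: card_image)
  qed
  have "(\<Sum>j<d + J. \<psi> (card {q\<in>?Fs. as q \<le> j \<and> j < bs q})) =
      (\<Sum>j<d. \<psi> (card {q\<in>?Fs. as q \<le> j \<and> j < bs q})) + (\<Sum>j<J. \<psi> (card {q\<in>?Fs. as q \<le> d + j \<and> d + j < bs q}))"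
  proof (induction J)
    case (Suc J)
    then show ?case by (simp only: add_Suc_right sum.lessThan_Suc add.assoc)
  qed simp
  also have "\<dots> = (\<Sum>j<d. \<psi> (card {q\<in>?P. 0 \<le> j \<and> j < bp q})) + (\<Sum>j<J. \<psi> (card {q\<in>F. a q \<le> j \<and> j < b q}))"
    unfolding count_future using count_past by simp
  finally have weight: "law_weight \<psi> k ?Fs as bs (d + J) us = law_weight \<psi> k ?P (\<lambda>_. 0) bp d (\<lambda>_. 0) * law_weight \<psi> k F a b J u"
    unfolding law_weight_def sum_us by (simp add: exp_add[symmetric] add_divide_distrib)
  have "\<P>(\<omega> in M. (\<forall>i\<in>A. L (real (low i) / 2 ^ k) \<omega> < E i 0 \<omega>) \<and> (\<forall>i\<in>{1..n} - A. L (real d / 2 ^ k) \<omega> < E i 0 \<omega>) \<and>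
       future_event k d A F a b u \<omega>) = law_weight \<psi> k ?Fs as bs (d + J) us"
    unfolding law'[OF index, of k, symmetric] using ev by (intro arg_cong[where f=prob] Collect_cong) blast
  moreover have "\<P>(\<omega> in M. (\<forall>i\<in>A. L (real (low i) / 2 ^ k) \<omega> < E i 0 \<omega>) \<and> (\<forall>i\<in>{1..n} - A. L (real d / 2 ^ k) \<omega> < E i 0 \<omega>)) =
      law_weight \<psi> k ?P (\<lambda>_. 0) bp d (\<lambda>_. 0)"
    unfolding law'[OF index_past, of k, symmetric] using past_ev by (intro arg_cong[where f=prob] Collect_cong) blast
  ultimately show ?thesis using weight by simp
qed

text \<open>Upper bounds on failures in \<open>A\<close> are added one component at a time: imposing
  \<open>up i\<close> removes the event in which \<open>low i\<close> is raised to
  \<open>up i\<close>. Both sides are additive under this removal, so the common factor is kept;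
  \<open>low\<close> varies along the induction for this reason.\<close>

lemma past_future_between:
  assumes F: "law_index n F a b J u" and A: "A \<subseteq> {1..n}" and I: "I \<subseteq> A"
    and low: "\<And>i. i \<in> A \<Longrightarrow> low i \<le> d" and up: "\<And>i. i \<in> I \<Longrightarrow> low i \<le> up i \<and> up i \<le> d"
  shows "\<P>(\<omega> in M. (\<forall>i\<in>A. L (real (low i) / 2 ^ k) \<omega> < E i 0 \<omega>) \<and> (\<forall>i\<in>{1..n} - A. L (real d / 2 ^ k) \<omega> < E i 0 \<omega>) \<and>
       (\<forall>i\<in>I. E i 0 \<omega> \<le> L (real (up i) / 2 ^ k) \<omega>) \<and> future_event k d A F a b u \<omega>) =
     \<P>(\<omega> in M. (\<forall>i\<in>A. L (real (low i) / 2 ^ k) \<omega> < E i 0 \<omega>) \<and> (\<forall>i\<in>{1..n} - A. L (real d / 2 ^ k) \<omega> < E i 0 \<omega>) \<and>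
       (\<forall>i\<in>I. E i 0 \<omega> \<le> L (real (up i) / 2 ^ k) \<omega>)) * law_weight \<psi> k F a b J u"
proof -
  define ev where "ev = (\<lambda>V low I. {\<omega>\<in>space M. (\<forall>i\<in>A. L (real (low i) / 2 ^ k) \<omega> < E i 0 \<omega>) \<and>
     (\<forall>i\<in>{1..n} - A. L (real d / 2 ^ k) \<omega> < E i 0 \<omega>) \<and> (\<forall>i\<in>I. E i 0 \<omega> \<le> L (real (up i) / 2 ^ k) \<omega>) \<and> V \<omega>})"
  have sets: "ev V low I \<in> events" if "Measurable.pred M V" "I \<subseteq> A" for V low I
    unfolding ev_def using that A finite_subset[OF A]
    by (intro predE pred_intros_logic pred_intros_finite pred_less pred_le') (auto intro: finite_subset)
  have step: "prob (ev V low (insert i I)) = prob (ev V low I) - prob (ev V (low(i := up i)) I)"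
    if V: "Measurable.pred M V" and "insert i I \<subseteq> A" "low i \<le> up i" "i \<notin> I" for V low I i
  proof -
    have i: "i \<in> A" "I \<subseteq> A" using that by auto
    have le: "L (real (low i) / 2 ^ k) \<omega> \<le> L (real (up i) / 2 ^ k) \<omega>" if "\<omega> \<in> space M" for \<omega>
      using subordinator_pathD(2)[OF L_path[OF that], of "real (low i) / 2 ^ k" "real (up i) / 2 ^ k"] \<open>low i \<le> up i\<close>
      by (simp add: divide_right_mono)
    have ball: "(\<forall>j\<in>A. L (real ((low(i := up i)) j) / 2 ^ k) \<omega> < E j 0 \<omega>) \<longleftrightarrow>
       L (real (up i) / 2 ^ k) \<omega> < E i 0 \<omega> \<and> (\<forall>j\<in>A. L (real (low j) / 2 ^ k) \<omega> < E j 0 \<omega>)" if "\<omega> \<in> space M" for \<omega>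
      using i le[OF that] by (auto split: if_splits)
    have mem1: "\<omega> \<in> ev V (low(i := up i)) I \<longleftrightarrow> L (real (up i) / 2 ^ k) \<omega> < E i 0 \<omega> \<and> \<omega> \<in> ev V low I" for \<omega>
      unfolding ev_def using ball by blast
    have mem2: "\<omega> \<in> ev V low (insert i I) \<longleftrightarrow> E i 0 \<omega> \<le> L (real (up i) / 2 ^ k) \<omega> \<and> \<omega> \<in> ev V low I" for \<omega>
      unfolding ev_def by auto
    have "ev V (low(i := up i)) I \<subseteq> ev V low I" using mem1 by blast
    moreover have "ev V low (insert i I) = ev V low I - ev V (low(i := up i)) I"
      by (auto simp: mem1 mem2 not_less)
    ultimately show ?thesis using sets[OF V i(2)] by (simp add: finite_measure_Diff)
  qed
  have "prob (ev (future_event k d A F a b u) low I) = prob (ev (\<lambda>_. True) low I) * law_weight \<psi> k F a b J u"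
    using finite_subset[OF I finite_subset[OF A finite_atLeastAtMost]] I low up
  proof (induction I arbitrary: low rule: finite_induct)
    case empty
    then show ?case using past_future_lower[OF F A, of low d k] by (simp add: ev_def)
  next
    case (insert i I)
    have l: "low i \<le> up i" using insert.prems by auto
    have IH1: "prob (ev (future_event k d A F a b u) low I) = prob (ev (\<lambda>_. True) low I) * law_weight \<psi> k F a b J u"
      by (rule insert.IH) (use insert.prems in auto)
    have IH2: "prob (ev (future_event k d A F a b u) (low(i := up i)) I) = prob (ev (\<lambda>_. True) (low(i := up i)) I) * law_weight \<psi> k F a b J u"
      by (rule insert.IH) (use insert.prems insert.hyps in auto)
    show ?case
      using step[of "future_event k d A F a b u" i I low, OF pred_future_event[OF F] insert.prems(1) l insert.hyps(2)]
        step[of "\<lambda>_. True" i I low, OF _ insert.prems(1) l insert.hyps(2)] IH1 IH2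
      by (simp add: left_diff_distrib)
  qed
  then show ?thesis by (simp add: ev_def)
qed

text \<open>The failed sets at two grid times amount to an interval for each trigger in
  \<open>A\<close> and survival of \<open>d\<close> for the others. Given these sets, the future
  event has the probability it would have for a new system.\<close>

lemma past_future:
  assumes F: "law_index n F a b J u" and A: "A \<subseteq> {1..n}" "B \<subseteq> A" "x \<le> d"
  shows "\<P>(\<omega> in M. failed n L E (real x / 2 ^ k) \<omega> = B \<and> failed n L E (real d / 2 ^ k) \<omega> = A \<and> future_event k d A F a b u \<omega>) =
     \<P>(\<omega> in M. failed n L E (real x / 2 ^ k) \<omega> = B \<and> failed n L E (real d / 2 ^ k) \<omega> = A) * law_weight \<psi> k F a b J u"
proof -
  \<comment> \<open>For members of \<open>B\<close> the lower bound is time 0, where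
    \<open>L\<close> vanishes; it is satisfied almost surely because triggers are positive, so the
    events agree only up to a null set.\<close>
  define low where "low = (\<lambda>i. if i \<in> B then 0 else x)"
  define up where "up = (\<lambda>i. if i \<in> B then x else d)"
  let ?Q = "\<lambda>\<omega>. (\<forall>i\<in>A. L (real (low i) / 2 ^ k) \<omega> < E i 0 \<omega>) \<and> (\<forall>i\<in>{1..n} - A. L (real d / 2 ^ k) \<omega> < E i 0 \<omega>) \<and>
       (\<forall>i\<in>A. E i 0 \<omega> \<le> L (real (up i) / 2 ^ k) \<omega>)"
  have "AE \<omega> in M. (failed n L E (real x / 2 ^ k) \<omega> = B \<and> failed n L E (real d / 2 ^ k) \<omega> = A) \<longleftrightarrow> ?Q \<omega>"
    using E_pos_all AE_space
  proof eventually_elim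
    case (elim \<omega>)
    have L0: "L 0 \<omega> = 0" using subordinator_pathD(1)[OF L_path[OF elim(2)]] by simp
    have L_xd: "L (real x / 2 ^ k) \<omega> \<le> L (real d / 2 ^ k) \<omega>"
      using subordinator_pathD(2)[OF L_path[OF elim(2)]] A(3) by (simp add: divide_right_mono)
    have eq: "failed n L E t \<omega> = S \<longleftrightarrow> (\<forall>i\<in>{1..n}. (i \<in> S) = (E i 0 \<omega> \<le> L t \<omega>))" if "S \<subseteq> {1..n}" for S t
      using that unfolding failed_def by blast
    have B: "B \<subseteq> {1..n}" using A by blast
    have "failed n L E (real x / 2 ^ k) \<omega> = B \<and> failed n L E (real d / 2 ^ k) \<omega> = A \<longleftrightarrow>
       (\<forall>i\<in>{1..n}. ((i \<in> B) = (E i 0 \<omega> \<le> L (real x / 2 ^ k) \<omega>)) \<and> ((i \<in> A) = (E i 0 \<omega> \<le> L (real d / 2 ^ k) \<omega>)))"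
      by (simp only: eq[OF B] eq[OF A(1)] ball_conj_distrib)
    also have "\<dots> \<longleftrightarrow> (\<forall>i\<in>{1..n}. (i \<in> A \<longrightarrow> L (real (low i) / 2 ^ k) \<omega> < E i 0 \<omega>) \<and>
       (i \<in> A \<longrightarrow> E i 0 \<omega> \<le> L (real (up i) / 2 ^ k) \<omega>) \<and> (i \<notin> A \<longrightarrow> L (real d / 2 ^ k) \<omega> < E i 0 \<omega>))"
    proof (rule ball_cong[OF refl])
      fix i assume i: "i \<in> {1..n}"
      have pos: "0 < E i 0 \<omega>" using elim(1) i by blast
      show "((i \<in> B) = (E i 0 \<omega> \<le> L (real x / 2 ^ k) \<omega>)) \<and> ((i \<in> A) = (E i 0 \<omega> \<le> L (real d / 2 ^ k) \<omega>)) \<longleftrightarrow>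
         (i \<in> A \<longrightarrow> L (real (low i) / 2 ^ k) \<omega> < E i 0 \<omega>) \<and>
         (i \<in> A \<longrightarrow> E i 0 \<omega> \<le> L (real (up i) / 2 ^ k) \<omega>) \<and> (i \<notin> A \<longrightarrow> L (real d / 2 ^ k) \<omega> < E i 0 \<omega>)"
        using A(2) L0 L_xd pos by (cases "i \<in> B"; cases "i \<in> A") (auto simp: low_def up_def)
    qed
    also have "\<dots> \<longleftrightarrow> ?Q \<omega>"
    proof -
      have 1: "(\<forall>i\<in>{1..n}. i \<in> A \<longrightarrow> P i) \<longleftrightarrow> (\<forall>i\<in>A. P i)" for P using A(1) by blast
      have 2: "(\<forall>i\<in>{1..n}. i \<notin> A \<longrightarrow> P i) \<longleftrightarrow> (\<forall>i\<in>{1..n} - A. P i)" for P by blast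
      show ?thesis by (simp only: ball_conj_distrib 1 2) (simp only: conj_ac)
    qed
    finally show ?case .
  qed
  note AE = this
  have Q: "Measurable.pred M (\<lambda>\<omega>. ?Q \<omega>)"
    using A finite_subset[OF A(1)] by (intro pred_intros_logic pred_intros_finite pred_less pred_le') auto
  note fut = pred_future_event[OF F, of k d A]
  have 1: "\<P>(\<omega> in M. failed n L E (real x / 2 ^ k) \<omega> = B \<and> failed n L E (real d / 2 ^ k) \<omega> = A) = \<P>(\<omega> in M. ?Q \<omega>)"
  proof (rule measure_eq_AE)
    show "AE \<omega> in M. (\<omega> \<in> {\<omega>\<in>space M. failed n L E (real x / 2 ^ k) \<omega> = B \<and> failed n L E (real d / 2 ^ k) \<omega> = A}) =
       (\<omega> \<in> {\<omega>\<in>space M. ?Q \<omega>})"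
      using AE by eventually_elim blast
    show "{\<omega>\<in>space M. failed n L E (real x / 2 ^ k) \<omega> = B \<and> failed n L E (real d / 2 ^ k) \<omega> = A} \<in> events"
      by (intro predE pred_intros_logic pred_failed) auto
  qed (rule predE[OF Q])
  have 2: "\<P>(\<omega> in M. failed n L E (real x / 2 ^ k) \<omega> = B \<and> failed n L E (real d / 2 ^ k) \<omega> = A \<and> future_event k d A F a b u \<omega>) =
     \<P>(\<omega> in M. ?Q \<omega> \<and> future_event k d A F a b u \<omega>)"
  proof (rule measure_eq_AE)
    show "AE \<omega> in M. (\<omega> \<in> {\<omega>\<in>space M. failed n L E (real x / 2 ^ k) \<omega> = B \<and> failed n L E (real d / 2 ^ k) \<omega> = A \<and> future_event k d A F a b u \<omega>}) =
       (\<omega> \<in> {\<omega>\<in>space M. ?Q \<omega> \<and> future_event k d A F a b u \<omega>})"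
      using AE by eventually_elim blast
    show "{\<omega>\<in>space M. failed n L E (real x / 2 ^ k) \<omega> = B \<and> failed n L E (real d / 2 ^ k) \<omega> = A \<and> future_event k d A F a b u \<omega>} \<in> events"
      by (intro predE pred_intros_logic pred_failed fut) auto
    show "{\<omega>\<in>space M. ?Q \<omega> \<and> future_event k d A F a b u \<omega>} \<in> events"
    proof -
      have "{\<omega>\<in>space M. ?Q \<omega> \<and> future_event k d A F a b u \<omega>} =
         {\<omega>\<in>space M. ?Q \<omega>} \<inter> {\<omega>\<in>space M. future_event k d A F a b u \<omega>}" by blast
      then show ?thesis using sets.Int[OF predE[OF Q] predE[OF fut]] by (simp only:)
    qed
  qed
  have "\<P>(\<omega> in M. ?Q \<omega> \<and> future_event k d A F a b u \<omega>) = \<P>(\<omega> in M. ?Q \<omega>) * law_weight \<psi> k F a b J u"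
    using past_future_between[OF F A(1) subset_refl, of low d up k] A(3)
    by (auto simp: low_def up_def conj_assoc)
  then show ?thesis using 1 2 by simp
qed

end

lemma (in frailty) law_weight_empty: "law_weight \<psi> k {} a b J u = 1"
  by (simp add: law_weight_def \<psi>_0)

lemma law_weight_nonneg: "0 \<le> law_weight \<psi> k F a b J u"
  by (simp add: law_weight_def)

text \<open>Lack of memory of the triggers: a common extra margin costs a factor that tends to 1
  with the margin. This controls the error made by the continuous cut-offs.\<close>

lemma law_weight_offset:
  "law_weight \<psi> k F a b J (\<lambda>q. u q + \<delta>) = law_weight \<psi> k F a b J u * exp (- (real (card F) * \<delta>))"
  by (simp add: law_weight_def sum.distrib exp_add[symmetric] algebra_simps)

text \<open>The same event described on a finer grid has the same probability; comparing
  probabilities avoids manipulating the cell sums.\<close>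

lemma (in frailty) law_weight_refine:
  assumes F: "law_index n F a b J u" and "k0 \<le> k"
  shows "law_weight \<psi> k F (\<lambda>q. a q * 2 ^ (k - k0)) (\<lambda>q. b q * 2 ^ (k - k0)) (J * 2 ^ (k - k0)) u = law_weight \<psi> k0 F a b J u"
proof -
  obtain i where i: "k = k0 + i" using assms(2) le_Suc_ex by blast
  have eq: "real (x * 2 ^ (k - k0)) / 2 ^ k = real x / 2 ^ k0" for x
    by (simp add: i power_add)
  have "law_index n F (\<lambda>q. a q * 2 ^ (k - k0)) (\<lambda>q. b q * 2 ^ (k - k0)) (J * 2 ^ (k - k0)) u"
    using F by (auto simp: law_index_def)
  from law'[OF this, of k] show ?thesis unfolding eq law'[OF F] by simp
qed

section \<open>Continuous cut-offs for strict inequalities\<close>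

text \<open>A continuous minorant of the indicator of the positive reals that is already 1 from
  \<delta> on. Convergence along the grid is preserved by it, but not by the indicator.\<close>

definition ramp :: "real \<Rightarrow> real \<Rightarrow> real" where
  "ramp \<delta> y = min 1 (max 0 (y / \<delta>))"

lemma ramp_bounds: "0 \<le> ramp \<delta> y" "ramp \<delta> y \<le> 1"
  by (auto simp: ramp_def)

lemma ramp_eq_0: "0 < \<delta> \<Longrightarrow> y \<le> 0 \<Longrightarrow> ramp \<delta> y = 0"
  by (simp add: ramp_def divide_nonpos_pos)

lemma ramp_eq_1: "0 < \<delta> \<Longrightarrow> \<delta> \<le> y \<Longrightarrow> ramp \<delta> y = 1"
  by (simp add: ramp_def)

lemma ramp_tendsto [tendsto_intros]:
  "(f \<longlongrightarrow> y) F \<Longrightarrow> 0 < \<delta> \<Longrightarrow> ((\<lambda>x. ramp \<delta> (f x)) \<longlongrightarrow> ramp \<delta> y) F"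
  unfolding ramp_def by (intro tendsto_intros) auto

lemma ramp_measurable [measurable (raw)]:
  "f \<in> borel_measurable M \<Longrightarrow> (\<lambda>x. ramp \<delta> (f x)) \<in> borel_measurable M"
  unfolding ramp_def by (intro borel_measurable_min borel_measurable_max borel_measurable_divide) auto

text \<open>Places the product between the indicators for the thresholds \<delta> and 0, for both of
  which exact formulas hold on the grid.\<close>

lemma prod_ramp_bounds:
  assumes "finite F" "0 < \<delta>"
  shows "of_bool (\<forall>q\<in>F. \<delta> < y q) \<le> (\<Prod>q\<in>F. ramp \<delta> (y q))"
    and "(\<Prod>q\<in>F. ramp \<delta> (y q)) \<le> of_bool (\<forall>q\<in>F. 0 < y q)"
    and "0 \<le> (\<Prod>q\<in>F. ramp \<delta> (y q))" "(\<Prod>q\<in>F. ramp \<delta> (y q)) \<le> 1"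
proof -
  show 0: "0 \<le> (\<Prod>q\<in>F. ramp \<delta> (y q))" by (intro prod_nonneg) (simp add: ramp_bounds)
  show 1: "(\<Prod>q\<in>F. ramp \<delta> (y q)) \<le> 1" by (intro prod_le_1) (simp add: ramp_bounds)
  show "of_bool (\<forall>q\<in>F. \<delta> < y q) \<le> (\<Prod>q\<in>F. ramp \<delta> (y q))"
  proof (cases "\<forall>q\<in>F. \<delta> < y q")
    case True
    then have "(\<Prod>q\<in>F. ramp \<delta> (y q)) = 1" using assms by (intro prod.neutral) (auto intro!: ramp_eq_1)
    then show ?thesis by simp
  next
    case False
    then have "of_bool (\<forall>q\<in>F. \<delta> < y q) = (0::real)" by simp
    then show ?thesis by (simp only: 0)
  qed
  show "(\<Prod>q\<in>F. ramp \<delta> (y q)) \<le> of_bool (\<forall>q\<in>F. 0 < y q)"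
  proof (cases "\<forall>q\<in>F. 0 < y q")
    case False
    then obtain q where "q \<in> F" "ramp \<delta> (y q) = 0" using assms by (auto simp: not_less ramp_eq_0)
    then have "(\<Prod>q\<in>F. ramp \<delta> (y q)) = 0" using assms(1) by (intro prod_zero) auto
    then show ?thesis by simp
  qed (use 1 in simp)
qed

lemma prod_ramp_tendsto:
  assumes "finite F"
  shows "(\<lambda>m. \<Prod>q\<in>F. ramp (1 / real (Suc m)) (y q)) \<longlonglongrightarrow> of_bool (\<forall>q\<in>F. 0 < y q)"
proof (cases "\<forall>q\<in>F. 0 < y q")
  case False
  then have 0: "of_bool (\<forall>q\<in>F. 0 < y q) = (0::real)" by simp
  have "(\<Prod>q\<in>F. ramp (1 / real (Suc m)) (y q)) = 0" for m
    using prod_ramp_bounds(2,3)[OF assms, of "1 / real (Suc m)" y] unfolding 0 by (intro antisym) auto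
  then show ?thesis unfolding 0 by simp
next
  case True
  have "(\<lambda>m. \<Prod>q\<in>F. ramp (1 / real (Suc m)) (y q)) \<longlonglongrightarrow> (\<Prod>q\<in>F. 1)"
  proof (rule tendsto_prod)
    fix q assume "q \<in> F"
    then have "0 < y q" using True by blast
    have "(\<lambda>m. 1 / real (Suc m)) \<longlonglongrightarrow> 0" by (rule LIMSEQ_Suc[OF lim_1_over_n])
    then have "eventually (\<lambda>m. 1 / real (Suc m) < y q) sequentially"
      using \<open>0 < y q\<close> by (rule order_tendstoD(2))
    then show "(\<lambda>m. ramp (1 / real (Suc m)) (y q)) \<longlonglongrightarrow> 1"
      by (intro tendsto_eventually) (auto elim!: eventually_mono intro!: ramp_eq_1)
  qed
  then show ?thesis using True by simp
qed

lemma subordinator_path_shift: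
  assumes "subordinator_path f" "0 \<le> x"
  shows "subordinator_path (\<lambda>t. f (x + t) - f x)"
  unfolding subordinator_path_def
proof (intro conjI allI impI)
  fix t :: real assume t: "0 \<le> t"
  have "filterlim (\<lambda>u. x + u) (at_right (x + t)) (at_right t)"
    unfolding filterlim_at
    by (auto intro!: tendsto_intros simp: eventually_at_right_field intro: exI[of _ "t + 1"])
  then have "((\<lambda>u. f (x + u)) \<longlongrightarrow> f (x + t)) (at_right t)"
    using subordinator_pathD(3)[OF assms(1), of "x + t"] assms(2) t by (auto intro: filterlim_compose)
  then show "((\<lambda>t. f (x + t) - f x) \<longlongrightarrow> f (x + t) - f x) (at_right t)"
    by (intro tendsto_diff tendsto_const)
qed (use subordinator_pathD(2)[OF assms(1)] assms(2) in auto)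

context exiting
begin

section \<open>From grid times to the exit time\<close>

definition pairs :: "(nat set \<times> nat set) set" where
  "pairs = {(B, A). B \<in> G \<and> A \<subseteq> {1..n} \<and> A \<notin> G \<and> B \<subseteq> A}"

lemma finite_pairs: "finite pairs"
  by (rule finite_subset[of _ "G \<times> Pow {1..n}"]) (auto simp: pairs_def working_family_finite[OF G])

definition grid_weight :: "(nat set \<Rightarrow> real) \<Rightarrow> real \<Rightarrow> nat \<Rightarrow> 'a \<Rightarrow> real" where
  "grid_weight f \<beta> k \<omega> = f (failed n L E (grid k (\<tau> \<omega>)) \<omega>) + \<beta> * grid k (\<tau> \<omega>)"

definition grid_future ::
  "nat \<Rightarrow> (nat \<times> nat) set \<Rightarrow> (nat \<times> nat \<Rightarrow> nat) \<Rightarrow> (nat \<times> nat \<Rightarrow> nat) \<Rightarrow> (nat \<times> nat \<Rightarrow> real) \<Rightarrow> 'a \<Rightarrow> bool" where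
  "grid_future k F a b u \<omega> = future_event k (grid_step k (\<tau> \<omega>)) (failed n L E (grid k (\<tau> \<omega>)) \<omega>) F a b u \<omega>"

lemma failed_measurable:
  assumes "0 \<le> t" shows "(\<lambda>\<omega>. failed n L E t \<omega>) \<in> measurable M (count_space UNIV)"
proof -
  have "(\<lambda>\<omega>. failed n L E t \<omega>) \<in> measurable M (count_space (Pow {1..n}))"
    using predE[OF pred_failed[OF assms]]
    by (subst measurable_count_space_eq2) (auto simp: vimage_def Int_def conj_commute failed_def[of n L E t])
  then show ?thesis by (rule measurable_compose) simp
qed

lemma failed_grid_measurable: "(\<lambda>\<omega>. failed n L E (grid k (\<tau> \<omega>)) \<omega>) \<in> measurable M (count_space UNIV)"
  by (rule measurable_compose_countable[where f="\<lambda>a \<omega>. failed n L E (real a / 2 ^ k) \<omega>" and g="\<lambda>\<omega>. grid_step k (\<tau> \<omega>)"])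
     (auto intro!: failed_measurable)

lemma grid_weight_measurable [measurable]: "grid_weight f \<beta> k \<in> borel_measurable M"
  unfolding grid_weight_def[abs_def]
  by (intro borel_measurable_add measurable_compose[OF failed_grid_measurable] borel_measurable_times) auto

lemma pred_grid_future:
  assumes "law_index n F a b J u"
  shows "Measurable.pred M (grid_future k F a b u)"
proof -
  have "Measurable.pred M (\<lambda>\<omega>. future_event k d (failed n L E (real d / 2 ^ k) \<omega>) F a b u \<omega>)" for d
  proof -
    have "future_event k d (failed n L E (real d / 2 ^ k) \<omega>) F a b u \<omega> \<longleftrightarrow>
        (\<exists>A\<in>Pow {1..n}. failed n L E (real d / 2 ^ k) \<omega> = A \<and> future_event k d A F a b u \<omega>)" for \<omega>
      by (auto simp: failed_def)
    moreover have "Measurable.pred M (\<lambda>\<omega>. \<exists>A\<in>Pow {1..n}. failed n L E (real d / 2 ^ k) \<omega> = A \<and> future_event k d A F a b u \<omega>)"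
      by (intro pred_intros_finite pred_intros_logic pred_failed pred_future_event[OF assms]) auto
    ultimately show ?thesis by simp
  qed
  from measurable_compose_countable[OF this grid_step_measurable[of k]] show ?thesis
    unfolding grid_future_def[abs_def] .
qed

text \<open>For a fixed cell and fixed failed sets at its two ends the density is constant and
  \<open>past_future\<close> applies; the factor for the future is the same in all terms and leaves
  the series. Nonnegative integrals allow all exchanges of sum and integral.\<close>

lemma nn_integral_grid_future:
  assumes F: "law_index n F a b J u"
  shows "(\<integral>\<^sup>+\<omega>. ennreal (grid_weight f \<beta> k \<omega>) * indicator {\<omega>\<in>space M. grid_future k F a b u \<omega>} \<omega> \<partial>M) =
    (\<Sum>x. \<Sum>(B, A)\<in>pairs. ennreal (f A + \<beta> * (real (Suc x) / 2 ^ k)) *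
      ennreal \<P>(\<omega> in M. failed n L E (real x / 2 ^ k) \<omega> = B \<and> failed n L E (real (Suc x) / 2 ^ k) \<omega> = A)) *
    ennreal (law_weight \<psi> k F a b J u)"
proof -
  let ?D = "\<lambda>x \<omega>. failed n L E (real x / 2 ^ k) \<omega>"
  let ?ev = "\<lambda>x B A. {\<omega>\<in>space M. ?D x \<omega> = B \<and> ?D (Suc x) \<omega> = A \<and> future_event k (Suc x) A F a b u \<omega>}"
  let ?c = "\<lambda>x A. ennreal (f A + \<beta> * (real (Suc x) / 2 ^ k))"
  have ev: "?ev x B A \<in> events" for x B A
    by (intro predE pred_intros_logic pred_failed pred_future_event[OF F]) auto
  have "AE \<omega> in M. ennreal (grid_weight f \<beta> k \<omega>) * indicator {\<omega>\<in>space M. grid_future k F a b u \<omega>} \<omega> =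
     (\<Sum>x. \<Sum>(B, A)\<in>pairs. ?c x A * indicator (?ev x B A) \<omega>)"
    using AE_regular
  proof eventually_elim
    case (elim \<omega>)
    \<comment> \<open>The cell that contains the exit; it selects the only term of the series that
      does not vanish at this path.\<close>
    obtain x0 where x0: "grid_step k (\<tau> \<omega>) = Suc x0" using grid_step_pos[OF elim, of k] gr0_implies_Suc by blast
    have sp: "\<omega> \<in> space M" by (rule regularD(1)[OF elim])
    have D0: "?D x0 \<omega> \<in> G" "?D (Suc x0) \<omega> \<notin> G" using grid_step_eq_Suc_iff[OF elim, of k x0] x0 by auto
    have p0: "(?D x0 \<omega>, ?D (Suc x0) \<omega>) \<in> pairs"
      unfolding pairs_def using D0 failed_mono_space[OF sp, of "real x0 / 2 ^ k" "real (Suc x0) / 2 ^ k"]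
      by (auto simp: divide_right_mono failed_def[of n L E "real (Suc x0) / 2 ^ k"] simp del: of_nat_Suc)
    have other: "(\<Sum>(B, A)\<in>pairs. ?c x A * indicator (?ev x B A) \<omega>) = 0" if "x \<noteq> x0" for x
    proof (rule sum.neutral, rule ballI)
      fix p assume p: "p \<in> pairs"
      have "\<not> (?D x \<omega> \<in> G \<and> ?D (Suc x) \<omega> \<notin> G)" using grid_step_eq_Suc_iff[OF elim, of k x] x0 that by auto
      then show "(case p of (B, A) \<Rightarrow> ?c x A * indicator (?ev x B A) \<omega>) = 0"
        using p by (auto simp: pairs_def indicator_def)
    qed
    have "(\<Sum>x. \<Sum>(B, A)\<in>pairs. ?c x A * indicator (?ev x B A) \<omega>) =
       (\<Sum>x\<in>{x0}. \<Sum>(B, A)\<in>pairs. ?c x A * indicator (?ev x B A) \<omega>)"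
      by (rule suminf_finite) (use other in auto)
    also have "\<dots> = (\<Sum>(B, A)\<in>pairs. ?c x0 A * indicator (?ev x0 B A) \<omega>)" by simp
    also have "\<dots> = (\<Sum>(B, A)\<in>{(?D x0 \<omega>, ?D (Suc x0) \<omega>)}. ?c x0 A * indicator (?ev x0 B A) \<omega>)"
      using p0 finite_pairs by (intro sum.mono_neutral_right) (auto simp: indicator_def)
    also have "\<dots> = ennreal (grid_weight f \<beta> k \<omega>) * indicator {\<omega>\<in>space M. grid_future k F a b u \<omega>} \<omega>"
      using sp by (simp add: grid_weight_def grid_future_def x0 indicator_def)
    finally show ?case by simp
  qed
  then have "(\<integral>\<^sup>+\<omega>. ennreal (grid_weight f \<beta> k \<omega>) * indicator {\<omega>\<in>space M. grid_future k F a b u \<omega>} \<omega> \<partial>M) =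
     (\<integral>\<^sup>+\<omega>. (\<Sum>x. \<Sum>p\<in>pairs. ?c x (snd p) * indicator (?ev x (fst p) (snd p)) \<omega>) \<partial>M)"
    by (intro nn_integral_cong_AE) (simp add: case_prod_beta)
  also have "\<dots> = (\<Sum>x. \<Sum>p\<in>pairs. ?c x (snd p) * emeasure M (?ev x (fst p) (snd p)))"
    using ev by (simp add: nn_integral_suminf nn_integral_sum nn_integral_cmult_indicator del: of_nat_Suc)
  also have "\<dots> = (\<Sum>x. (\<Sum>p\<in>pairs. ?c x (snd p) * ennreal \<P>(\<omega> in M. ?D x \<omega> = fst p \<and> ?D (Suc x) \<omega> = snd p)) *
     ennreal (law_weight \<psi> k F a b J u))"
  proof -
    have "emeasure M (?ev x (fst p) (snd p)) = ennreal \<P>(\<omega> in M. ?D x \<omega> = fst p \<and> ?D (Suc x) \<omega> = snd p) *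
        ennreal (law_weight \<psi> k F a b J u)" if "p \<in> pairs" for x p
      unfolding emeasure_eq_measure
      using past_future[OF F, of "snd p" "fst p" x "Suc x" k] that
      by (auto simp: pairs_def ennreal_mult'' law_weight_nonneg simp del: of_nat_Suc)
    then show ?thesis by (simp add: sum_distrib_right mult.assoc del: of_nat_Suc)
  qed
  also have "\<dots> = (\<Sum>x. \<Sum>p\<in>pairs. ?c x (snd p) * ennreal \<P>(\<omega> in M. ?D x \<omega> = fst p \<and> ?D (Suc x) \<omega> = snd p)) *
     ennreal (law_weight \<psi> k F a b J u)"
    by (rule ennreal_suminf_multc)
  finally show ?thesis by (simp add: case_prod_beta del: of_nat_Suc)
qed

lemma nn_integral_grid_future':
  assumes F: "law_index n F a b J u"
  shows "(\<integral>\<^sup>+\<omega>. ennreal (grid_weight f \<beta> k \<omega>) * indicator {\<omega>\<in>space M. grid_future k F a b u \<omega>} \<omega> \<partial>M) =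
    (\<integral>\<^sup>+\<omega>. ennreal (grid_weight f \<beta> k \<omega>) \<partial>M) * ennreal (law_weight \<psi> k F a b J u)"
proof -
  \<comment> \<open>With no triggers to watch, the future event is trivial and the series is
    recognised as the total weight.\<close>
  have "law_index n {} a b 0 u" by (simp add: law_index_def)
  from nn_integral_grid_future[OF this, of f \<beta> k]
  have "(\<integral>\<^sup>+\<omega>. ennreal (grid_weight f \<beta> k \<omega>) \<partial>M) =
    (\<Sum>x. \<Sum>(B, A)\<in>pairs. ennreal (f A + \<beta> * (real (Suc x) / 2 ^ k)) *
      ennreal \<P>(\<omega> in M. failed n L E (real x / 2 ^ k) \<omega> = B \<and> failed n L E (real (Suc x) / 2 ^ k) \<omega> = A))"
    by (simp add: grid_future_def future_event_def law_weight_empty cong: nn_integral_cong_simp)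
  then show ?thesis using nn_integral_grid_future[OF F, of f \<beta> k] by simp
qed

text \<open>Arbitrary in the exit set and linear in the exit time: enough to treat costs, indicators
  of exit sets and cycle lengths by one statement.\<close>

definition weight :: "(nat set \<Rightarrow> real) \<Rightarrow> real \<Rightarrow> 'a \<Rightarrow> real" where
  "weight f \<beta> \<omega> = f (X \<omega>) + \<beta> * \<tau> \<omega>"

lemma weight_measurable [measurable]: "weight f \<beta> \<in> borel_measurable M"
  unfolding weight_def[abs_def]
  by (intro borel_measurable_add measurable_compose[OF X_measurable] borel_measurable_times) auto

lemma weight_bound_integrable: "integrable M (\<lambda>\<omega>. (\<Sum>A\<in>Pow {1..n}. f A) + \<beta> * (\<tau> \<omega> + 1))"
  using integrable_\<tau> by simp

lemma abs_mono: "0 \<le> (x::real) \<Longrightarrow> x \<le> y \<Longrightarrow> \<bar>x\<bar> \<le> \<bar>y\<bar>"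
  by simp

lemma weight_bounds:
  assumes "\<forall>A. 0 \<le> f A" "0 \<le> \<beta>"
  shows "0 \<le> grid_weight f \<beta> k \<omega>" "grid_weight f \<beta> k \<omega> \<le> (\<Sum>A\<in>Pow {1..n}. f A) + \<beta> * (\<tau> \<omega> + 1)"
    "0 \<le> weight f \<beta> \<omega>" "weight f \<beta> \<omega> \<le> (\<Sum>A\<in>Pow {1..n}. f A) + \<beta> * (\<tau> \<omega> + 1)"
proof -
  have f: "f A \<le> (\<Sum>A\<in>Pow {1..n}. f A)" if "A \<subseteq> {1..n}" for A
    using that assms by (intro member_le_sum) auto
  show "0 \<le> grid_weight f \<beta> k \<omega>" using assms by (simp add: grid_weight_def)
  show "0 \<le> weight f \<beta> \<omega>" using assms \<tau>_nonneg by (simp add: weight_def)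
  have "grid k (\<tau> \<omega>) \<le> \<tau> \<omega> + 1 / 2 ^ k" by (rule grid_le[OF \<tau>_nonneg])
  also have "(1::real) / 2 ^ k \<le> 1" by simp
  finally have "\<beta> * grid k (\<tau> \<omega>) \<le> \<beta> * (\<tau> \<omega> + 1)" using assms(2) by (intro mult_left_mono) auto
  then show "grid_weight f \<beta> k \<omega> \<le> (\<Sum>A\<in>Pow {1..n}. f A) + \<beta> * (\<tau> \<omega> + 1)"
    unfolding grid_weight_def
  proof (intro add_mono f)
    show "failed n L E (grid k (\<tau> \<omega>)) \<omega> \<subseteq> {1..n}" by (auto simp: failed_def)
  qed
  have "\<beta> * \<tau> \<omega> \<le> \<beta> * (\<tau> \<omega> + 1)" using assms(2) by (intro mult_left_mono) auto
  then show "weight f \<beta> \<omega> \<le> (\<Sum>A\<in>Pow {1..n}. f A) + \<beta> * (\<tau> \<omega> + 1)"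
    unfolding weight_def using f[OF X_subset] by (intro add_mono)
qed

lemma integrable_weights:
  assumes "\<forall>A. 0 \<le> f A" "0 \<le> \<beta>"
  shows "integrable M (grid_weight f \<beta> k)" "integrable M (weight f \<beta>)"
proof -
  note bounds = weight_bounds[OF assms]
  show "integrable M (grid_weight f \<beta> k)"
  proof (rule Bochner_Integration.integrable_bound[OF weight_bound_integrable[of f \<beta>]])
    show "AE \<omega> in M. norm (grid_weight f \<beta> k \<omega>) \<le> norm ((\<Sum>A\<in>Pow {1..n}. f A) + \<beta> * (\<tau> \<omega> + 1))"
      unfolding real_norm_def using bounds(1,2)[of k] by (intro AE_I2 abs_mono) simp_all
  qed simp
  show "integrable M (weight f \<beta>)"
  proof (rule Bochner_Integration.integrable_bound[OF weight_bound_integrable[of f \<beta>]])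
    show "AE \<omega> in M. norm (weight f \<beta> \<omega>) \<le> norm ((\<Sum>A\<in>Pow {1..n}. f A) + \<beta> * (\<tau> \<omega> + 1))"
      unfolding real_norm_def using bounds(3,4) by (intro AE_I2 abs_mono) simp_all
  qed simp
qed

lemma grid_weight_tendsto:
  assumes "regular \<omega>" shows "(\<lambda>k. grid_weight f \<beta> k \<omega>) \<longlonglongrightarrow> weight f \<beta> \<omega>"
  unfolding grid_weight_def weight_def
proof (intro tendsto_add tendsto_mult tendsto_const grid_tendsto \<tau>_nonneg)
  show "(\<lambda>k. f (failed n L E (grid k (\<tau> \<omega>)) \<omega>)) \<longlonglongrightarrow> f (X \<omega>)"
    by (rule tendsto_eventually, rule eventually_mono[OF eventually_failed_grid_eq[OF assms]]) simp
qed

lemma integral_grid_future: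
  assumes F: "law_index n F a b J u" and f: "\<forall>A. 0 \<le> f A" "0 \<le> \<beta>"
  shows "(\<integral>\<omega>. grid_weight f \<beta> k \<omega> * of_bool (grid_future k F a b u \<omega>) \<partial>M) =
    (\<integral>\<omega>. grid_weight f \<beta> k \<omega> \<partial>M) * law_weight \<psi> k F a b J u"
proof -
  have ind: "ennreal (grid_weight f \<beta> k \<omega> * of_bool (grid_future k F a b u \<omega>)) =
     ennreal (grid_weight f \<beta> k \<omega>) * indicator {\<omega>\<in>space M. grid_future k F a b u \<omega>} \<omega>" if "\<omega> \<in> space M" for \<omega>
    using that by (simp add: indicator_def)
  have m: "(\<lambda>\<omega>. grid_weight f \<beta> k \<omega> * of_bool (grid_future k F a b u \<omega>)) \<in> borel_measurable M"
    using pred_grid_future[OF F, of k] by measurable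
  have "(\<integral>\<omega>. grid_weight f \<beta> k \<omega> * of_bool (grid_future k F a b u \<omega>) \<partial>M) =
     enn2real (\<integral>\<^sup>+\<omega>. ennreal (grid_weight f \<beta> k \<omega> * of_bool (grid_future k F a b u \<omega>)) \<partial>M)"
    by (rule integral_eq_nn_integral[OF m]) (use weight_bounds[OF f] in auto)
  also have "\<dots> = enn2real ((\<integral>\<^sup>+\<omega>. ennreal (grid_weight f \<beta> k \<omega>) \<partial>M) * ennreal (law_weight \<psi> k F a b J u))"
    unfolding nn_integral_grid_future'[OF F, symmetric] using ind by (intro arg_cong[where f=enn2real] nn_integral_cong)
  also have "\<dots> = enn2real (\<integral>\<^sup>+\<omega>. ennreal (grid_weight f \<beta> k \<omega>) \<partial>M) * law_weight \<psi> k F a b J u"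
    by (simp add: enn2real_mult law_weight_nonneg)
  also have "enn2real (\<integral>\<^sup>+\<omega>. ennreal (grid_weight f \<beta> k \<omega>) \<partial>M) = (\<integral>\<omega>. grid_weight f \<beta> k \<omega> \<partial>M)"
    by (rule integral_eq_nn_integral[symmetric]) (use weight_bounds[OF f] in auto)
  finally show ?thesis .
qed

text \<open>The margin by which a resumed trigger outlives its increment and offset. The future
  event says that all margins are positive.\<close>

definition grid_excess ::
  "nat \<Rightarrow> (nat \<times> nat \<Rightarrow> real) \<Rightarrow> (nat \<times> nat \<Rightarrow> real) \<Rightarrow> (nat \<times> nat \<Rightarrow> real) \<Rightarrow> nat \<times> nat \<Rightarrow> 'a \<Rightarrow> real" where
  "grid_excess k s t u q \<omega> =
     resumed L E (grid k (\<tau> \<omega>)) (failed n L E (grid k (\<tau> \<omega>)) \<omega>) q \<omega> -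
     (L (grid k (\<tau> \<omega>) + t q) \<omega> - L (grid k (\<tau> \<omega>) + s q) \<omega>) - u q"

definition excess ::
  "(nat \<times> nat \<Rightarrow> real) \<Rightarrow> (nat \<times> nat \<Rightarrow> real) \<Rightarrow> (nat \<times> nat \<Rightarrow> real) \<Rightarrow> nat \<times> nat \<Rightarrow> 'a \<Rightarrow> real" where
  "excess s t u q \<omega> =
     resumed L E (\<tau> \<omega>) (X \<omega>) q \<omega> - (L (\<tau> \<omega> + t q) \<omega> - L (\<tau> \<omega> + s q) \<omega>) - u q"

lemma resumed_measurable:
  assumes "fst q \<in> {1..n}"
  shows "(\<lambda>\<omega>. resumed L E (\<tau> \<omega>) (X \<omega>) q \<omega>) \<in> borel_measurable M"
    and "(\<lambda>\<omega>. resumed L E (grid k (\<tau> \<omega>)) (failed n L E (grid k (\<tau> \<omega>)) \<omega>) q \<omega>) \<in> borel_measurable M"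
proof -
  have [measurable]: "Measurable.pred M (\<lambda>\<omega>. fst q \<in> X \<omega>)" "Measurable.pred M (\<lambda>\<omega>. fst q \<in> failed n L E (grid k (\<tau> \<omega>)) \<omega>)"
    by (auto intro: measurable_compose[OF X_measurable] measurable_compose[OF failed_grid_measurable])
  have [measurable]: "(\<lambda>\<omega>. L (\<tau> \<omega>) \<omega>) \<in> borel_measurable M" "(\<lambda>\<omega>. L (grid k (\<tau> \<omega>)) \<omega>) \<in> borel_measurable M"
    using L_\<tau>_measurable[of 0] L_grid_measurable[of 0 k] by simp_all
  have [measurable]: "E (fst q) m \<in> borel_measurable M" for m using E_measurable[OF assms] .
  show "(\<lambda>\<omega>. resumed L E (\<tau> \<omega>) (X \<omega>) q \<omega>) \<in> borel_measurable M"
    unfolding resumed_def by measurable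
  show "(\<lambda>\<omega>. resumed L E (grid k (\<tau> \<omega>)) (failed n L E (grid k (\<tau> \<omega>)) \<omega>) q \<omega>) \<in> borel_measurable M"
    unfolding resumed_def by measurable
qed

lemma excess_measurable:
  assumes "fst q \<in> {1..n}" "0 \<le> s q" "0 \<le> t q"
  shows "excess s t u q \<in> borel_measurable M" "grid_excess k s t u q \<in> borel_measurable M"
  unfolding excess_def[abs_def] grid_excess_def[abs_def]
  by (intro borel_measurable_diff resumed_measurable L_\<tau>_measurable L_grid_measurable borel_measurable_const assms)+

lemma grid_excess_tendsto:
  assumes "regular \<omega>" "0 \<le> s q" "0 \<le> t q"
  shows "(\<lambda>k. grid_excess k s t u q \<omega>) \<longlonglongrightarrow> excess s t u q \<omega>"
  unfolding grid_excess_def excess_def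
proof (intro tendsto_diff tendsto_const L_grid_tendsto regularD(1)[OF assms(1)] assms(2,3))
  have L: "(\<lambda>k. L (grid k (\<tau> \<omega>)) \<omega>) \<longlonglongrightarrow> L (\<tau> \<omega>) \<omega>"
    using L_grid_tendsto[OF regularD(1)[OF assms(1)], of 0] by simp
  have "(\<lambda>k. resumed L E (grid k (\<tau> \<omega>)) (X \<omega>) q \<omega>) \<longlonglongrightarrow> resumed L E (\<tau> \<omega>) (X \<omega>) q \<omega>"
    unfolding resumed_def using L by (auto intro!: tendsto_intros)
  then show "(\<lambda>k. resumed L E (grid k (\<tau> \<omega>)) (failed n L E (grid k (\<tau> \<omega>)) \<omega>) q \<omega>) \<longlonglongrightarrow> resumed L E (\<tau> \<omega>) (X \<omega>) q \<omega>"
    by (rule Lim_transform_eventually) (rule eventually_mono[OF eventually_failed_grid_eq[OF assms(1)]], simp)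
qed

text \<open>On the grid the formula is exact for every threshold. A cut-off of width \<delta> lies
  between the thresholds \<delta> and 0, and its integral passes to the limit in the grid; the two
  resulting bounds merge as \<delta> tends to 0.\<close>

lemma integral_excess:
  fixes k0 :: nat and a b :: "nat \<times> nat \<Rightarrow> nat"
  assumes F: "law_index n F a b J u" and f: "\<forall>A. 0 \<le> f A" "0 \<le> \<beta>"
  defines "s \<equiv> \<lambda>q. real (a q) / 2 ^ k0" and "t \<equiv> \<lambda>q. real (b q) / 2 ^ k0"
  shows "(\<integral>\<omega>. weight f \<beta> \<omega> * of_bool (\<forall>q\<in>F. 0 < excess s t u q \<omega>) \<partial>M) =
    (\<integral>\<omega>. weight f \<beta> \<omega> \<partial>M) * law_weight \<psi> k0 F a b J u"
proof -
  let ?w = "\<lambda>\<omega>. (\<Sum>A\<in>Pow {1..n}. f A) + \<beta> * (\<tau> \<omega> + 1)"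
  let ?W = "law_weight \<psi> k0 F a b J u" and ?c = "\<integral>\<omega>. weight f \<beta> \<omega> \<partial>M"
  note Fd = F[unfolded law_index_def]
  have fin: "finite F" using Fd by blast
  have q1: "fst q \<in> {1..n}" if "q \<in> F" for q using Fd that by auto
  have st: "0 \<le> s q" "0 \<le> t q" for q by (auto simp: s_def t_def)
  have [measurable]: "excess s t u q \<in> borel_measurable M" "grid_excess k s t u q \<in> borel_measurable M" if "q \<in> F" for q k
    using excess_measurable[OF q1[OF that] st] by auto
  note bounds = weight_bounds[OF f]
  have c: "(\<lambda>k. \<integral>\<omega>. grid_weight f \<beta> k \<omega> \<partial>M) \<longlonglongrightarrow> ?c"
  proof (rule integral_dominated_convergence[where w="?w"])
    show "AE \<omega> in M. (\<lambda>k. grid_weight f \<beta> k \<omega>) \<longlonglongrightarrow> weight f \<beta> \<omega>"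
      using AE_regular by eventually_elim (rule grid_weight_tendsto)
  qed (use bounds weight_bound_integrable in auto)
  have between: "?c * (?W * exp (- (real (card F) * \<delta>))) \<le> (\<integral>\<omega>. weight f \<beta> \<omega> * (\<Prod>q\<in>F. ramp \<delta> (excess s t u q \<omega>)) \<partial>M)"
    "(\<integral>\<omega>. weight f \<beta> \<omega> * (\<Prod>q\<in>F. ramp \<delta> (excess s t u q \<omega>)) \<partial>M) \<le> ?c * ?W" if \<delta>: "0 < \<delta>" for \<delta>
  proof -
    let ?I = "\<lambda>k. \<integral>\<omega>. grid_weight f \<beta> k \<omega> * (\<Prod>q\<in>F. ramp \<delta> (grid_excess k s t u q \<omega>)) \<partial>M"
    have I: "?I \<longlonglongrightarrow> (\<integral>\<omega>. weight f \<beta> \<omega> * (\<Prod>q\<in>F. ramp \<delta> (excess s t u q \<omega>)) \<partial>M)"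
    proof (rule integral_dominated_convergence[where w="?w"])
      show "AE \<omega> in M. (\<lambda>k. grid_weight f \<beta> k \<omega> * (\<Prod>q\<in>F. ramp \<delta> (grid_excess k s t u q \<omega>))) \<longlonglongrightarrow>
          weight f \<beta> \<omega> * (\<Prod>q\<in>F. ramp \<delta> (excess s t u q \<omega>))"
        using AE_regular
        by eventually_elim (intro tendsto_mult tendsto_prod ramp_tendsto grid_weight_tendsto grid_excess_tendsto st \<delta>)
      show "AE \<omega> in M. norm (grid_weight f \<beta> k \<omega> * (\<Prod>q\<in>F. ramp \<delta> (grid_excess k s t u q \<omega>))) \<le> ?w \<omega>" for k
      proof (rule AE_I2)
        fix \<omega>
        have "grid_weight f \<beta> k \<omega> * (\<Prod>q\<in>F. ramp \<delta> (grid_excess k s t u q \<omega>)) \<le> grid_weight f \<beta> k \<omega> * 1"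
          using bounds(1) prod_ramp_bounds(4)[OF fin \<delta>] by (intro mult_left_mono)
        then show "norm (grid_weight f \<beta> k \<omega> * (\<Prod>q\<in>F. ramp \<delta> (grid_excess k s t u q \<omega>))) \<le> ?w \<omega>"
          using bounds(1,2)[of k \<omega>] prod_ramp_bounds(3)[OF fin \<delta>, of "\<lambda>q. grid_excess k s t u q \<omega>"]
          by (simp add: abs_mult)
      qed
    qed (use weight_bound_integrable in \<open>auto intro!: borel_measurable_times borel_measurable_prod ramp_measurable\<close>)
    \<comment> \<open>A positive threshold is absorbed into the offsets, so it is again an event of
      the same kind; for \<open>k \<ge> k0\<close> the interval ends are grid points of level
      \<open>k\<close>.\<close>
    have future: "(\<integral>\<omega>. grid_weight f \<beta> k \<omega> * of_bool (\<forall>q\<in>F. \<epsilon> < grid_excess k s t u q \<omega>) \<partial>M) =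
        (\<integral>\<omega>. grid_weight f \<beta> k \<omega> \<partial>M) * (?W * exp (- (real (card F) * \<epsilon>)))" if k: "k0 \<le> k" and e: "0 \<le> \<epsilon>" for k \<epsilon>
    proof -
      obtain i where i: "k = k0 + i" using le_Suc_ex[OF k] by blast
      have eq: "real (x + y * 2 ^ (k - k0)) / 2 ^ k = real x / 2 ^ k + real y / 2 ^ k0" for x y
        by (simp add: i power_add add_divide_distrib)
      have idx: "law_index n F (\<lambda>q. a q * 2 ^ (k - k0)) (\<lambda>q. b q * 2 ^ (k - k0)) (J * 2 ^ (k - k0)) (\<lambda>q. u q + \<epsilon>)"
        using F e by (auto simp: law_index_def)
      have "(\<forall>q\<in>F. \<epsilon> < grid_excess k s t u q \<omega>) \<longleftrightarrow>
          grid_future k F (\<lambda>q. a q * 2 ^ (k - k0)) (\<lambda>q. b q * 2 ^ (k - k0)) (\<lambda>q. u q + \<epsilon>) \<omega>" for \<omega>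
        unfolding grid_future_def future_event_def eq grid_excess_def s_def t_def by (intro ball_cong refl) linarith
      then show ?thesis
        using integral_grid_future[OF idx f, of k] law_weight_refine[OF F k]
        by (simp add: law_weight_offset)
    qed
    have int: "integrable M (\<lambda>\<omega>. grid_weight f \<beta> k \<omega> * of_bool (\<forall>q\<in>F. \<epsilon> < grid_excess k s t u q \<omega>))" for k \<epsilon>
    proof (rule Bochner_Integration.integrable_bound[OF integrable_weights(1)[OF f, of k]])
      have "Measurable.pred M (\<lambda>\<omega>. \<forall>q\<in>F. \<epsilon> < grid_excess k s t u q \<omega>)"
        by (intro pred_intros_finite fin) measurable
      then show "(\<lambda>\<omega>. grid_weight f \<beta> k \<omega> * of_bool (\<forall>q\<in>F. \<epsilon> < grid_excess k s t u q \<omega>)) \<in> borel_measurable M"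
        by measurable
    qed (use bounds(1) in auto)
    have int': "integrable M (\<lambda>\<omega>. grid_weight f \<beta> k \<omega> * (\<Prod>q\<in>F. ramp \<delta> (grid_excess k s t u q \<omega>)))" for k
    proof (rule Bochner_Integration.integrable_bound[OF integrable_weights(1)[OF f, of k]])
      show "(\<lambda>\<omega>. grid_weight f \<beta> k \<omega> * (\<Prod>q\<in>F. ramp \<delta> (grid_excess k s t u q \<omega>))) \<in> borel_measurable M"
        by (intro borel_measurable_times borel_measurable_prod ramp_measurable) auto
      show "AE \<omega> in M. norm (grid_weight f \<beta> k \<omega> * (\<Prod>q\<in>F. ramp \<delta> (grid_excess k s t u q \<omega>))) \<le> norm (grid_weight f \<beta> k \<omega>)"
        using bounds(1) prod_ramp_bounds(3,4)[OF fin \<delta>]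
        by (intro AE_I2) (auto simp: abs_mult intro!: mult_left_le)
    qed
    show "?c * (?W * exp (- (real (card F) * \<delta>))) \<le> (\<integral>\<omega>. weight f \<beta> \<omega> * (\<Prod>q\<in>F. ramp \<delta> (excess s t u q \<omega>)) \<partial>M)"
    proof (rule LIMSEQ_le[OF tendsto_mult_right[OF c] I])
      have "(\<integral>\<omega>. grid_weight f \<beta> k \<omega> \<partial>M) * (?W * exp (- (real (card F) * \<delta>))) \<le> ?I k" if "k0 \<le> k" for k
        unfolding future[OF that order_less_imp_le[OF \<delta>], symmetric]
        using bounds(1) prod_ramp_bounds(1)[OF fin \<delta>] by (intro integral_mono int int' mult_left_mono)
      then show "\<exists>N. \<forall>k\<ge>N. (\<integral>\<omega>. grid_weight f \<beta> k \<omega> \<partial>M) * (?W * exp (- (real (card F) * \<delta>))) \<le> ?I k" by blast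
    qed
    show "(\<integral>\<omega>. weight f \<beta> \<omega> * (\<Prod>q\<in>F. ramp \<delta> (excess s t u q \<omega>)) \<partial>M) \<le> ?c * ?W"
    proof (rule LIMSEQ_le[OF I tendsto_mult_right[OF c]])
      have "?I k \<le> (\<integral>\<omega>. grid_weight f \<beta> k \<omega> \<partial>M) * ?W" if "k0 \<le> k" for k
      proof -
        have "?I k \<le> (\<integral>\<omega>. grid_weight f \<beta> k \<omega> * of_bool (\<forall>q\<in>F. 0 < grid_excess k s t u q \<omega>) \<partial>M)"
          using bounds(1) prod_ramp_bounds(2)[OF fin \<delta>] by (intro integral_mono int int' mult_left_mono)
        then show ?thesis using future[OF that, of 0] by simp
      qed
      then show "\<exists>N. \<forall>k\<ge>N. ?I k \<le> (\<integral>\<omega>. grid_weight f \<beta> k \<omega> \<partial>M) * ?W" by blast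
    qed
  qed
  \<comment> \<open>The grid limit is finished for each fixed width; the widths
    \<open>1 / Suc m\<close> now tend to 0.\<close>
  let ?R = "\<lambda>m. \<integral>\<omega>. weight f \<beta> \<omega> * (\<Prod>q\<in>F. ramp (1 / real (Suc m)) (excess s t u q \<omega>)) \<partial>M"
  have "?R \<longlonglongrightarrow> (\<integral>\<omega>. weight f \<beta> \<omega> * of_bool (\<forall>q\<in>F. 0 < excess s t u q \<omega>) \<partial>M)"
  proof (rule integral_dominated_convergence[where w="weight f \<beta>"])
    show "AE \<omega> in M. norm (weight f \<beta> \<omega> * (\<Prod>q\<in>F. ramp (1 / real (Suc m)) (excess s t u q \<omega>))) \<le> weight f \<beta> \<omega>" for m
      using bounds(3) prod_ramp_bounds(3,4)[OF fin, of "1 / real (Suc m)"]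
      by (intro AE_I2) (auto simp: abs_mult simp del: of_nat_Suc intro!: mult_left_le)
    show "AE \<omega> in M. (\<lambda>m. weight f \<beta> \<omega> * (\<Prod>q\<in>F. ramp (1 / real (Suc m)) (excess s t u q \<omega>))) \<longlonglongrightarrow>
        weight f \<beta> \<omega> * of_bool (\<forall>q\<in>F. 0 < excess s t u q \<omega>)"
      by (intro AE_I2 tendsto_mult tendsto_const prod_ramp_tendsto fin)
    have "Measurable.pred M (\<lambda>\<omega>. \<forall>q\<in>F. 0 < excess s t u q \<omega>)"
      by (intro pred_intros_finite fin) measurable
    then show "(\<lambda>\<omega>. weight f \<beta> \<omega> * of_bool (\<forall>q\<in>F. 0 < excess s t u q \<omega>)) \<in> borel_measurable M"
      by measurable
    show "(\<lambda>\<omega>. weight f \<beta> \<omega> * (\<Prod>q\<in>F. ramp (1 / real (Suc m)) (excess s t u q \<omega>))) \<in> borel_measurable M" for m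
      by (intro borel_measurable_times borel_measurable_prod ramp_measurable) auto
  qed (use integrable_weights(2)[OF f] in auto)
  moreover have "?R \<longlonglongrightarrow> ?c * ?W"
  proof (rule tendsto_sandwich)
    show "eventually (\<lambda>m. ?c * (?W * exp (- (real (card F) * (1 / real (Suc m))))) \<le> ?R m) sequentially"
      by (intro always_eventually allI between(1)) simp
    show "eventually (\<lambda>m. ?R m \<le> ?c * ?W) sequentially"
      by (intro always_eventually allI between(2)) simp
    have "(\<lambda>m. ?c * (?W * exp (- (real (card F) * (1 / real (Suc m)))))) \<longlonglongrightarrow> ?c * (?W * exp (- (real (card F) * 0)))"
      by (intro tendsto_intros LIMSEQ_Suc[OF lim_1_over_n])
    then show "(\<lambda>m. ?c * (?W * exp (- (real (card F) * (1 / real (Suc m)))))) \<longlonglongrightarrow> ?c * ?W" by simp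
  qed simp
  ultimately show ?thesis by (rule LIMSEQ_unique)
qed

text \<open>After the exit time the system behaves as a new one, even under a change of measure whose density
  depends on the exit time and the exit set only: this expresses independence of past and future.\<close>

theorem regeneration:
  assumes f: "\<forall>A. 0 \<le> f A" "0 \<le> \<beta>" and c: "c = (\<integral>\<omega>. weight f \<beta> \<omega> \<partial>M)" "0 < c"
  shows "frailty (density M (\<lambda>\<omega>. ennreal (weight f \<beta> \<omega> / c))) (shiftL n G L E) (shiftE n G L E) n \<psi>"
proof -
  let ?M = "density M (\<lambda>\<omega>. ennreal (weight f \<beta> \<omega> / c))"
  have nonneg: "0 \<le> weight f \<beta> \<omega> / c" for \<omega> using weight_bounds(3)[OF f] c(2) by simp
  have int: "integrable M (\<lambda>\<omega>. weight f \<beta> \<omega> / c)" using integrable_weights(2)[OF f] by simp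
  \<comment> \<open>Puts probabilities under the tilted measure into the form of a real integral
    against \<open>weight\<close>, which \<open>integral_excess\<close> evaluates.\<close>
  have em: "emeasure ?M S = ennreal (\<integral>\<omega>. weight f \<beta> \<omega> / c * indicator S \<omega> \<partial>M)" if "S \<in> events" for S
  proof -
    have "emeasure ?M S = (\<integral>\<^sup>+\<omega>. ennreal (weight f \<beta> \<omega> / c) * indicator S \<omega> \<partial>M)"
      using that by (subst emeasure_density) auto
    also have "\<dots> = (\<integral>\<^sup>+\<omega>. ennreal (weight f \<beta> \<omega> / c * indicator S \<omega>) \<partial>M)"
      by (intro nn_integral_cong) (auto simp: indicator_def)
    also have "\<dots> = ennreal (\<integral>\<omega>. weight f \<beta> \<omega> / c * indicator S \<omega> \<partial>M)"
      using that weight_bounds(3)[OF f] c(2) int by (intro nn_integral_eq_integral integrable_real_mult_indicator) auto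
    finally show ?thesis .
  qed
  interpret M': prob_space ?M
  proof
    have "emeasure ?M (space M) = ennreal (\<integral>\<omega>. weight f \<beta> \<omega> / c * indicator (space M) \<omega> \<partial>M)" by (rule em) simp
    also have "(\<integral>\<omega>. weight f \<beta> \<omega> / c * indicator (space M) \<omega> \<partial>M) = (\<integral>\<omega>. weight f \<beta> \<omega> / c \<partial>M)"
      by (intro Bochner_Integration.integral_cong) auto
    finally show "emeasure ?M (space ?M) = 1" using c by simp
  qed
  show ?thesis
  proof unfold_locales
    fix t :: real assume "0 \<le> t"
    then show "shiftL n G L E t \<in> borel_measurable ?M"
      unfolding shiftL_def[abs_def] using L_\<tau>_measurable[of t] L_\<tau>_measurable[of 0] by simp
  next
    fix i m assume "i \<in> {1..n}"
    then show "shiftE n G L E i m \<in> borel_measurable ?M"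
      unfolding shiftE_def[abs_def] using resumed_measurable(1)[of "(i, m)"] by simp
  next
    fix \<omega> assume "\<omega> \<in> space ?M"
    then show "subordinator_path (\<lambda>t. shiftL n G L E t \<omega>)"
      unfolding shiftL_def by (intro subordinator_path_shift L_path \<tau>_nonneg) simp
  next
    fix F :: "(nat \<times> nat) set" and a b :: "nat \<times> nat \<Rightarrow> nat" and J k :: nat and u :: "nat \<times> nat \<Rightarrow> real"
    assume F: "finite F" "F \<subseteq> {1..n} \<times> UNIV" "\<And>q. q \<in> F \<Longrightarrow> a q \<le> b q \<and> b q \<le> J \<and> 0 \<le> u q \<and> (snd q = 0 \<longrightarrow> a q = 0)"
    then have idx: "law_index n F a b J u" by (auto simp: law_index_def)
    let ?s = "\<lambda>q. real (a q) / 2 ^ k" and ?t = "\<lambda>q. real (b q) / 2 ^ k"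
    let ?S = "{\<omega>\<in>space M. \<forall>q\<in>F. 0 < excess ?s ?t u q \<omega>}"
    have S: "?S \<in> events"
    proof (intro predE pred_intros_finite F(1))
      fix q assume "q \<in> F"
      then have "fst q \<in> {1..n}" using F(2) by auto
      then have "excess ?s ?t u q \<in> borel_measurable M" by (intro excess_measurable) auto
      then show "Measurable.pred M (\<lambda>\<omega>. 0 < excess ?s ?t u q \<omega>)" by measurable
    qed
    have "M'.prob {\<omega>\<in>space ?M. \<forall>q\<in>F. shiftL n G L E (?t q) \<omega> - shiftL n G L E (?s q) \<omega> + u q < shiftE n G L E (fst q) (snd q) \<omega>}
        = M'.prob ?S"
    proof (intro arg_cong[where f=M'.prob] Collect_cong conj_cong ball_cong refl)
      fix q \<omega>
      show "shiftL n G L E (?t q) \<omega> - shiftL n G L E (?s q) \<omega> + u q < shiftE n G L E (fst q) (snd q) \<omega> \<longleftrightarrow> 0 < excess ?s ?t u q \<omega>"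
        by (simp add: shiftL_def shiftE_def excess_def) linarith
    qed simp
    also have "\<dots> = (\<integral>\<omega>. weight f \<beta> \<omega> / c * indicator ?S \<omega> \<partial>M)"
      unfolding measure_def em[OF S] using weight_bounds(3)[OF f] c(2) by (intro enn2real_ennreal Bochner_Integration.integral_nonneg) auto
    also have "\<dots> = (\<integral>\<omega>. weight f \<beta> \<omega> * of_bool (\<forall>q\<in>F. 0 < excess ?s ?t u q \<omega>) / c \<partial>M)"
      by (intro Bochner_Integration.integral_cong) (auto simp: indicator_def)
    also have "\<dots> = law_weight \<psi> k F a b J u"
      using integral_excess[OF idx f, of k] c by simp
    finally show "M'.prob {\<omega>\<in>space ?M. \<forall>q\<in>F. shiftL n G L E (?t q) \<omega> - shiftL n G L E (?s q) \<omega> + u q < shiftE n G L E (fst q) (snd q) \<omega>}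
       = exp (- (\<Sum>q\<in>F. u q) - (\<Sum>j<J. \<psi> (card {q\<in>F. a q \<le> j \<and> j < b q})) / 2 ^ k)"
      by (simp only: law_weight_def)
  qed (use \<psi>_0 \<psi>_pos in auto)
qed

end

section \<open>Strong law and renewal reward limit\<close>

text \<open>Between consecutive squares a nonnegative increasing sum is sandwiched by its values at
  the two squares, and the ratio of consecutive squares tends to 1.\<close>

lemma average_tendsto_of_squares:
  fixes S :: "nat \<Rightarrow> real"
  assumes mono: "mono S" and nonneg: "\<And>m. 0 \<le> S m"
    and lim: "(\<lambda>k. S (k\<^sup>2) / real (k\<^sup>2)) \<longlonglongrightarrow> \<mu>"
  shows "(\<lambda>m. S m / real m) \<longlonglongrightarrow> \<mu>"
proof -
  \<comment> \<open>The integer square root, so that \<open>m\<close> lies between the squares of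
    \<open>r m\<close> and of its successor.\<close>
  define r where "r = (\<lambda>m. nat \<lfloor>sqrt (real m)\<rfloor>)"
  have r_le: "(r m)\<^sup>2 \<le> m" for m
  proof -
    have "real (r m) \<le> sqrt (real m)" by (simp add: r_def)
    then have "(real (r m))\<^sup>2 \<le> (sqrt (real m))\<^sup>2" by (intro power_mono) auto
    then show ?thesis by (simp flip: of_nat_power)
  qed
  have r_ge: "m \<le> (Suc (r m))\<^sup>2" for m
  proof -
    have "sqrt (real m) \<le> real (Suc (r m))" unfolding r_def by (simp add: of_nat_nat) linarith
    then have "(sqrt (real m))\<^sup>2 \<le> (real (Suc (r m)))\<^sup>2" by (intro power_mono) auto
    then show ?thesis by (simp flip: of_nat_power del: of_nat_Suc)
  qed
  have r_lim: "filterlim r at_top sequentially"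
    unfolding filterlim_at_top
  proof
    fix K
    show "eventually (\<lambda>m. K \<le> r m) sequentially"
    proof (rule eventually_sequentiallyI[of "K\<^sup>2"])
      fix m assume "K\<^sup>2 \<le> m"
      then have "(real K)\<^sup>2 \<le> real m" by (simp flip: of_nat_power)
      then have "real K \<le> sqrt (real m)" by (rule real_le_rsqrt)
      then show "K \<le> r m" unfolding r_def by (simp add: le_nat_iff le_floor_iff)
    qed
  qed
  have ratio: "(\<lambda>k. real (k\<^sup>2) / real ((Suc k)\<^sup>2)) \<longlonglongrightarrow> 1"
  proof -
    have "(\<lambda>k. (real k / real (Suc k))\<^sup>2) \<longlonglongrightarrow> 1\<^sup>2"
      by (intro tendsto_power LIMSEQ_n_over_Suc_n)
    then show ?thesis by (simp add: power_divide)
  qed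
  have ratio': "(\<lambda>k. real ((Suc k)\<^sup>2) / real (k\<^sup>2)) \<longlonglongrightarrow> 1"
  proof -
    have "(\<lambda>k. (real (Suc k) / real k)\<^sup>2) \<longlonglongrightarrow> 1\<^sup>2"
      by (intro tendsto_power LIMSEQ_Suc_n_over_n)
    then show ?thesis by (simp add: power_divide)
  qed
  show ?thesis
  proof (rule tendsto_sandwich)
    have "(\<lambda>k. S (k\<^sup>2) / real (k\<^sup>2) * (real (k\<^sup>2) / real ((Suc k)\<^sup>2))) \<longlonglongrightarrow> \<mu> * 1"
      by (intro tendsto_mult lim ratio)
    from filterlim_compose[OF this r_lim]
    show "(\<lambda>m. S ((r m)\<^sup>2) / real ((r m)\<^sup>2) * (real ((r m)\<^sup>2) / real ((Suc (r m))\<^sup>2))) \<longlonglongrightarrow> \<mu>" by simp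
    have "(\<lambda>k. S ((Suc k)\<^sup>2) / real ((Suc k)\<^sup>2) * (real ((Suc k)\<^sup>2) / real (k\<^sup>2))) \<longlonglongrightarrow> \<mu> * 1"
      by (intro tendsto_mult ratio' LIMSEQ_Suc[OF lim])
    from filterlim_compose[OF this r_lim]
    show "(\<lambda>m. S ((Suc (r m))\<^sup>2) / real ((Suc (r m))\<^sup>2) * (real ((Suc (r m))\<^sup>2) / real ((r m)\<^sup>2))) \<longlonglongrightarrow> \<mu>" by simp
    have r_pos: "eventually (\<lambda>m. 0 < r m) sequentially"
      using r_lim[unfolded filterlim_at_top, rule_format, of 1] by (auto elim!: eventually_mono)
    show "eventually (\<lambda>m. S ((r m)\<^sup>2) / real ((r m)\<^sup>2) * (real ((r m)\<^sup>2) / real ((Suc (r m))\<^sup>2)) \<le> S m / real m) sequentially"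
      using r_pos eventually_gt_at_top[of 0]
    proof eventually_elim
      case (elim m)
      have "S ((r m)\<^sup>2) / real ((r m)\<^sup>2) * (real ((r m)\<^sup>2) / real ((Suc (r m))\<^sup>2)) = S ((r m)\<^sup>2) / real ((Suc (r m))\<^sup>2)"
        using elim by simp
      also have "\<dots> \<le> S m / real m"
        using elim r_le[of m] r_ge[of m] nonneg monoD[OF mono r_le[of m]]
        by (intro frac_le) (auto simp del: of_nat_Suc of_nat_power)
      finally show ?case .
    qed
    show "eventually (\<lambda>m. S m / real m \<le> S ((Suc (r m))\<^sup>2) / real ((Suc (r m))\<^sup>2) * (real ((Suc (r m))\<^sup>2) / real ((r m)\<^sup>2))) sequentially"
      using r_pos eventually_gt_at_top[of 0]
    proof eventually_elim
      case (elim m)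
      have "S m / real m \<le> S ((Suc (r m))\<^sup>2) / real ((r m)\<^sup>2)"
        using elim r_le[of m] r_ge[of m] nonneg monoD[OF mono r_ge[of m]]
        by (intro frac_le) (auto simp del: of_nat_Suc of_nat_power)
      also have "\<dots> = S ((Suc (r m))\<^sup>2) / real ((Suc (r m))\<^sup>2) * (real ((Suc (r m))\<^sup>2) / real ((r m)\<^sup>2))"
        by (simp del: of_nat_Suc)
      finally show ?case .
    qed
  qed
qed

text \<open>Nonnegativity allows to interpolate between squares, so that pairwise uncorrelatedness and bounded
  second moments suffice.\<close>

lemma (in prob_space) strong_law_uncorrelated:
  fixes X :: "nat \<Rightarrow> 'a \<Rightarrow> real"
  assumes X [measurable]: "\<And>a. X a \<in> borel_measurable M" and nonneg: "\<And>a \<omega>. 0 \<le> X a \<omega>"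
    and mean: "\<And>a. (\<integral>\<^sup>+\<omega>. ennreal (X a \<omega>) \<partial>M) = ennreal \<mu>" and \<mu>: "0 \<le> \<mu>"
    and uncorr: "\<And>a b. a \<noteq> b \<Longrightarrow> (\<integral>\<^sup>+\<omega>. ennreal (X a \<omega> * X b \<omega>) \<partial>M) = ennreal (\<mu> * \<mu>)"
    and second: "\<And>a. (\<integral>\<^sup>+\<omega>. ennreal ((X a \<omega>)\<^sup>2) \<partial>M) \<le> ennreal C"
  shows "AE \<omega> in M. (\<lambda>m. (\<Sum>a<m. X a \<omega>) / real m) \<longlonglongrightarrow> \<mu>"
proof -
  have int: "integrable M (X a)" and exp: "expectation (X a) = \<mu>" for a
  proof -
    show "integrable M (X a)" by (rule integrableI_nn_integral_finite[OF _ _ mean]) (auto simp: nonneg)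
    show "expectation (X a) = \<mu>"
      by (subst integral_eq_nn_integral) (auto simp: nonneg mean \<mu>)
  qed
  have int2: "integrable M (\<lambda>\<omega>. X a \<omega> * X b \<omega>)" for a b
  proof (rule integrableI_bounded)
    have "(\<integral>\<^sup>+\<omega>. ennreal (norm (X a \<omega> * X b \<omega>)) \<partial>M) = (\<integral>\<^sup>+\<omega>. ennreal (X a \<omega> * X b \<omega>) \<partial>M)"
      by (simp add: nonneg)
    also have "\<dots> < \<infinity>"
    proof (cases "a = b")
      case True
      then show ?thesis using second[of a] by (simp add: power2_eq_square le_less_trans)
    qed (simp add: uncorr)
    finally show "(\<integral>\<^sup>+\<omega>. ennreal (norm (X a \<omega> * X b \<omega>)) \<partial>M) < \<infinity>" .
  qed simp
  have exp2: "expectation (\<lambda>\<omega>. X a \<omega> * X b \<omega>) = \<mu> * \<mu>" if "a \<noteq> b" for a b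
    by (subst integral_eq_nn_integral) (auto simp: nonneg uncorr[OF that] \<mu>)
  \<comment> \<open>The hypothesis reads \<open>C\<close> through \<open>ennreal\<close>, where a
    negative value counts as 0; hence \<open>max C 0\<close>.\<close>
  have C: "expectation (\<lambda>\<omega>. X a \<omega> * X a \<omega>) \<le> max C 0" for a
  proof -
    have "expectation (\<lambda>\<omega>. X a \<omega> * X a \<omega>) = enn2real (\<integral>\<^sup>+\<omega>. ennreal ((X a \<omega>)\<^sup>2) \<partial>M)"
      by (subst integral_eq_nn_integral) (auto simp: power2_eq_square)
    also have "\<dots> \<le> enn2real (ennreal (max C 0))"
      using second[of a] by (intro enn2real_mono) (auto simp: max_def ennreal_neg split: if_splits)
    finally show ?thesis by (simp only: enn2real_ennreal max.cobounded2)
  qed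
  define Y where "Y = (\<lambda>a \<omega>. X a \<omega> - \<mu>)"
  have intY: "integrable M (\<lambda>\<omega>. Y a \<omega> * Y b \<omega>)" for a b
    unfolding Y_def by (simp add: algebra_simps int int2)
  have expY: "expectation (\<lambda>\<omega>. Y a \<omega> * Y b \<omega>) = expectation (\<lambda>\<omega>. X a \<omega> * X b \<omega>) - \<mu> * \<mu>" for a b
    unfolding Y_def by (simp add: algebra_simps int int2 exp prob_space)
  have var: "expectation (\<lambda>\<omega>. (\<Sum>a<m. Y a \<omega>)\<^sup>2) \<le> real m * max C 0" "integrable M (\<lambda>\<omega>. (\<Sum>a<m. Y a \<omega>)\<^sup>2)" for m
  proof -
    have eq: "(\<Sum>a<m. Y a \<omega>)\<^sup>2 = (\<Sum>a<m. \<Sum>b<m. Y a \<omega> * Y b \<omega>)" for \<omega>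
      by (simp add: power2_eq_square sum_product)
    show "integrable M (\<lambda>\<omega>. (\<Sum>a<m. Y a \<omega>)\<^sup>2)" unfolding eq by (intro Bochner_Integration.integrable_sum intY)
    have "expectation (\<lambda>\<omega>. (\<Sum>a<m. Y a \<omega>)\<^sup>2) = (\<Sum>a<m. \<Sum>b<m. expectation (\<lambda>\<omega>. Y a \<omega> * Y b \<omega>))"
      unfolding eq by (simp add: intY Bochner_Integration.integrable_sum)
    also have "\<dots> \<le> (\<Sum>a<m. max C 0)"
    proof (rule sum_mono)
      fix a assume "a \<in> {..<m}"
      have "(\<Sum>b<m. expectation (\<lambda>\<omega>. Y a \<omega> * Y b \<omega>)) = (\<Sum>b\<in>{a}. expectation (\<lambda>\<omega>. Y a \<omega> * Y b \<omega>))"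
        by (rule sum.mono_neutral_right) (use \<open>a \<in> {..<m}\<close> in \<open>auto simp: expY exp2\<close>)
      also have "\<dots> \<le> max C 0" using C[of a] \<mu> by (simp add: expY) (smt (verit) mult_nonneg_nonneg)
      finally show "(\<Sum>b<m. expectation (\<lambda>\<omega>. Y a \<omega> * Y b \<omega>)) \<le> max C 0" .
    qed
    finally show "expectation (\<lambda>\<omega>. (\<Sum>a<m. Y a \<omega>)\<^sup>2) \<le> real m * max C 0" by simp
  qed
  \<comment> \<open>Squared deviations of the averages along squares: the variance bound at
    \<open>(Suc k)\<^sup>2\<close> terms is of order \<open>1 / (Suc k)\<^sup>2\<close>, which is
    summable. Starting at \<open>Suc k\<close> avoids an average of no terms.\<close>
  define Z where "Z = (\<lambda>k \<omega>. ((\<Sum>a<(Suc k)\<^sup>2. Y a \<omega>) / real ((Suc k)\<^sup>2))\<^sup>2)"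
  have Z_meas [measurable]: "Z k \<in> borel_measurable M" for k unfolding Z_def Y_def by measurable
  have Z_nonneg: "0 \<le> Z k \<omega>" for k \<omega> by (simp add: Z_def)
  have Z_bound: "(\<integral>\<^sup>+\<omega>. ennreal (Z k \<omega>) \<partial>M) \<le> ennreal (max C 0 * (1 / real ((Suc k)\<^sup>2)))" for k
  proof -
    have "(\<integral>\<^sup>+\<omega>. ennreal (Z k \<omega>) \<partial>M) = ennreal (expectation (Z k))"
      by (intro nn_integral_eq_integral) (auto simp: Z_def power_divide var)
    also have "expectation (Z k) = expectation (\<lambda>\<omega>. (\<Sum>a<(Suc k)\<^sup>2. Y a \<omega>)\<^sup>2) / (real ((Suc k)\<^sup>2))\<^sup>2"
      by (simp add: Z_def power_divide del: of_nat_power of_nat_Suc)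
    also have "\<dots> \<le> (real ((Suc k)\<^sup>2) * max C 0) / (real ((Suc k)\<^sup>2))\<^sup>2"
      by (intro divide_right_mono var) auto
    also have "\<dots> = max C 0 * (1 / real ((Suc k)\<^sup>2))"
      by (simp add: power2_eq_square)
    finally show ?thesis by (simp add: ennreal_leI)
  qed
  have sq: "summable (\<lambda>k. max C 0 * (1 / real ((Suc k)\<^sup>2)))"
  proof (rule summable_mult)
    have "summable (\<lambda>k. 1 / real k ^ 2)" using inverse_power_summable[of 2, where 'a=real] by (simp add: field_simps)
    then show "summable (\<lambda>k. 1 / real ((Suc k)\<^sup>2))" by (subst (asm) summable_Suc_iff[symmetric]) simp
  qed
  have "(\<integral>\<^sup>+\<omega>. (\<Sum>k. ennreal (Z k \<omega>)) \<partial>M) = (\<Sum>k. \<integral>\<^sup>+\<omega>. ennreal (Z k \<omega>) \<partial>M)"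
    by (rule nn_integral_suminf) measurable
  also have "\<dots> \<le> (\<Sum>k. ennreal (max C 0 * (1 / real ((Suc k)\<^sup>2))))"
    by (intro suminf_le Z_bound) auto
  also have "\<dots> < \<infinity>" using sq by (subst suminf_ennreal2) auto
  \<comment> \<open>A series with finite mean is almost surely finite, so its terms tend to 0; no
    Borel-Cantelli argument is required.\<close>
  finally have "(\<integral>\<^sup>+\<omega>. (\<Sum>k. ennreal (Z k \<omega>)) \<partial>M) \<noteq> \<infinity>" by simp
  then have "AE \<omega> in M. (\<Sum>k. ennreal (Z k \<omega>)) \<noteq> \<infinity>"
    by (intro nn_integral_PInf_AE) auto
  then show ?thesis
  proof eventually_elim
    case (elim \<omega>)
    have "summable (\<lambda>k. Z k \<omega>)" using elim Z_nonneg by (intro summable_suminf_not_top) auto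
    then have "(\<lambda>k. sqrt (Z k \<omega>)) \<longlonglongrightarrow> sqrt 0" by (intro tendsto_real_sqrt summable_LIMSEQ_zero)
    then have "(\<lambda>k. \<bar>(\<Sum>a<(Suc k)\<^sup>2. Y a \<omega>) / real ((Suc k)\<^sup>2)\<bar>) \<longlonglongrightarrow> 0" by (simp add: Z_def)
    then have "(\<lambda>k. (\<Sum>a<(Suc k)\<^sup>2. Y a \<omega>) / real ((Suc k)\<^sup>2)) \<longlonglongrightarrow> 0" by (rule tendsto_rabs_zero_cancel)
    then have "(\<lambda>k. (\<Sum>a<(Suc k)\<^sup>2. Y a \<omega>) / real ((Suc k)\<^sup>2) + \<mu>) \<longlonglongrightarrow> 0 + \<mu>" by (intro tendsto_intros)
    moreover have "(\<Sum>a<(Suc k)\<^sup>2. Y a \<omega>) / real ((Suc k)\<^sup>2) + \<mu> = (\<Sum>a<(Suc k)\<^sup>2. X a \<omega>) / real ((Suc k)\<^sup>2)" for k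
      by (simp add: Y_def sum_subtractf diff_divide_distrib del: of_nat_Suc)
    ultimately have "(\<lambda>k. (\<Sum>a<(Suc k)\<^sup>2. X a \<omega>) / real ((Suc k)\<^sup>2)) \<longlonglongrightarrow> \<mu>" by (simp only: add_0)
    then have "(\<lambda>k. (\<Sum>a<k\<^sup>2. X a \<omega>) / real (k\<^sup>2)) \<longlonglongrightarrow> \<mu>" by (rule LIMSEQ_imp_Suc)
    then show ?case
      by (intro average_tendsto_of_squares) (auto intro!: monoI sum_mono2 sum_nonneg simp: nonneg)
  qed
qed

text \<open>A statement about single sequences: \<open>t\<close> lies between two consecutive
  renewals, so \<open>t\<close> divided by the number of renewals has the same limit as the average
  cycle length, and the reward up to \<open>t\<close> is a partial sum over that number of
  cycles.\<close>

lemma renewal_reward_limit: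
  fixes R Z :: "nat \<Rightarrow> real"
  assumes R0: "R 0 = 0" and R: "strict_mono R" and R_lim: "(\<lambda>m. R m / real m) \<longlonglongrightarrow> \<mu>" and \<mu>: "0 < \<mu>"
    and Z_lim: "(\<lambda>m. (\<Sum>a<m. z a) / real m) \<longlonglongrightarrow> c"
  shows "((\<lambda>t. (\<Sum>m\<in>{m. 1 \<le> m \<and> R m \<le> t}. z (m - 1)) / t) \<longlongrightarrow> c / \<mu>) at_top"
proof -
  have unbounded: "\<exists>m. t < R m" for t
  proof -
    have "filterlim (\<lambda>m. R m / real m * real m) at_top sequentially"
      by (rule filterlim_tendsto_pos_mult_at_top[OF R_lim \<mu> filterlim_real_sequentially])
    then have "eventually (\<lambda>m. t < R m / real m * real m) sequentially"
      by (simp add: filterlim_at_top_dense)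
    then obtain m where "t < R m / real m * real m" by (auto simp: eventually_sequentially)
    then show ?thesis using R0 by (cases "m = 0") (auto intro: exI[of _ 0])
  qed
  \<comment> \<open>The number of renewals up to time \<open>t\<close>, with the renewal at time 0
    not counted.\<close>
  define K where "K = (\<lambda>t. LEAST m. t < R (Suc m))"
  have K: "t < R (Suc (K t))" "R (K t) \<le> t" if "0 \<le> t" for t
  proof -
    obtain m where m: "t < R m" using unbounded by blast
    then obtain m' where "m = Suc m'" using \<open>0 \<le> t\<close> R0 by (cases m) auto
    then have ex: "t < R (Suc m')" using m by simp
    show "t < R (Suc (K t))" unfolding K_def by (rule LeastI[of "\<lambda>m. t < R (Suc m)", OF ex])
    show "R (K t) \<le> t"
    proof (cases "K t")
      case 0
      then show ?thesis using R0 \<open>0 \<le> t\<close> by simp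
    next
      case (Suc j)
      then have "\<not> t < R (Suc j)" using not_less_Least[of j "\<lambda>m. t < R (Suc m)"] by (simp add: K_def)
      then show ?thesis using Suc by simp
    qed
  qed
  have set: "{m. 1 \<le> m \<and> R m \<le> t} = {1..K t}" if "0 \<le> t" for t
  proof -
    have "R m \<le> t \<longleftrightarrow> m \<le> K t" for m
    proof
      assume "R m \<le> t"
      then have "R m < R (Suc (K t))" using K(1)[OF that] by simp
      then show "m \<le> K t" using R by (simp add: strict_mono_less)
    next
      assume "m \<le> K t"
      then have "R m \<le> R (K t)" using R by (simp add: strict_mono_less_eq)
      then show "R m \<le> t" using K(2)[OF that] by simp
    qed
    then show ?thesis by (simp only: atLeastAtMost_def atLeast_def atMost_def Collect_conj_eq)
  qed
  have K_lim: "filterlim K at_top at_top"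
    unfolding filterlim_at_top
  proof
    fix j
    show "eventually (\<lambda>t. j \<le> K t) at_top"
      using eventually_ge_at_top[of "max 0 (R j)"]
    proof eventually_elim
      case (elim t)
      then have "R j < R (Suc (K t))" using K(1)[of t] by simp
      then show ?case using R by (simp add: strict_mono_less)
    qed
  qed
  have K_pos: "eventually (\<lambda>t. 0 < K t) at_top"
    using K_lim[unfolded filterlim_at_top, rule_format, of 1] by (auto elim!: eventually_mono)
  have quot: "((\<lambda>t. t / real (K t)) \<longlongrightarrow> \<mu>) at_top"
  proof (rule tendsto_sandwich)
    show "((\<lambda>t. R (K t) / real (K t)) \<longlongrightarrow> \<mu>) at_top" by (rule filterlim_compose[OF R_lim K_lim])
    have "(\<lambda>m. R (Suc m) / real (Suc m) * (real (Suc m) / real m)) \<longlonglongrightarrow> \<mu> * 1"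
      by (intro tendsto_mult LIMSEQ_Suc[OF R_lim] LIMSEQ_Suc_n_over_n)
    from filterlim_compose[OF this K_lim]
    show "((\<lambda>t. R (Suc (K t)) / real (Suc (K t)) * (real (Suc (K t)) / real (K t))) \<longlongrightarrow> \<mu>) at_top" by simp
    show "eventually (\<lambda>t. R (K t) / real (K t) \<le> t / real (K t)) at_top"
      using eventually_ge_at_top[of 0] by eventually_elim (auto intro!: divide_right_mono K)
    show "eventually (\<lambda>t. t / real (K t) \<le> R (Suc (K t)) / real (Suc (K t)) * (real (Suc (K t)) / real (K t))) at_top"
      using eventually_ge_at_top[of 0]
    proof eventually_elim
      case (elim t)
      have "t / real (K t) \<le> R (Suc (K t)) / real (K t)"
        using K(1)[OF elim] by (intro divide_right_mono) auto
      then show ?case by (simp del: of_nat_Suc)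
    qed
  qed
  have "((\<lambda>t. ((\<Sum>a<K t. z a) / real (K t)) / (t / real (K t))) \<longlongrightarrow> c / \<mu>) at_top"
    using \<mu> by (intro tendsto_divide filterlim_compose[OF Z_lim K_lim] quot) auto
  moreover have "eventually (\<lambda>t. ((\<Sum>a<K t. z a) / real (K t)) / (t / real (K t)) = (\<Sum>m\<in>{m. 1 \<le> m \<and> R m \<le> t}. z (m - 1)) / t) at_top"
    using eventually_gt_at_top[of 0] K_pos
  proof eventually_elim
    case (elim t)
    have "(\<Sum>m\<in>{1..K t}. z (m - 1)) = (\<Sum>a<K t. z a)"
      by (intro sum.reindex_bij_witness[of _ Suc "\<lambda>m. m - 1"]) auto
    then show ?case using elim set[of t] by simp
  qed
  ultimately show ?thesis by (rule Lim_transform_eventually)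
qed

section \<open>Successive cycles\<close>

text \<open>Closed form of the mean of \<open>weight\<close>. It mentions neither measure nor
  process, which is why all cycles share it, even under a change of measure.\<close>

definition weight_mean :: "(nat \<Rightarrow> real) \<Rightarrow> nat \<Rightarrow> nat set set \<Rightarrow> (nat set \<Rightarrow> real) \<Rightarrow> real \<Rightarrow> real" where
  "weight_mean \<psi> n G f \<beta> = (\<Sum>A\<in>Pow {1..n} - G. f A * exit_law \<psi> n G A) + \<beta> * exit_mean \<psi> n G"

definition renewed ::
  "nat \<Rightarrow> nat set set \<Rightarrow> (real \<Rightarrow> 'a \<Rightarrow> real) \<Rightarrow> (nat \<Rightarrow> nat \<Rightarrow> 'a \<Rightarrow> real) \<Rightarrow> nat \<Rightarrow>
   (real \<Rightarrow> 'a \<Rightarrow> real) \<times> (nat \<Rightarrow> nat \<Rightarrow> 'a \<Rightarrow> real)" where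
  "renewed n G L E m = ((\<lambda>(L, E). (shiftL n G L E, shiftE n G L E)) ^^ m) (L, E)"

definition cycle_time ::
  "nat \<Rightarrow> nat set set \<Rightarrow> (real \<Rightarrow> 'a \<Rightarrow> real) \<Rightarrow> (nat \<Rightarrow> nat \<Rightarrow> 'a \<Rightarrow> real) \<Rightarrow> nat \<Rightarrow> 'a \<Rightarrow> real" where
  "cycle_time n G L E m = exit_time n G (fst (renewed n G L E m)) (snd (renewed n G L E m))"

definition cycle_set ::
  "nat \<Rightarrow> nat set set \<Rightarrow> (real \<Rightarrow> 'a \<Rightarrow> real) \<Rightarrow> (nat \<Rightarrow> nat \<Rightarrow> 'a \<Rightarrow> real) \<Rightarrow> nat \<Rightarrow> 'a \<Rightarrow> nat set" where
  "cycle_set n G L E m = exit_set n G (fst (renewed n G L E m)) (snd (renewed n G L E m))"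

lemma renewed_0: "renewed n G L E 0 = (L, E)"
  by (simp add: renewed_def)

lemma renewed_Suc:
  "renewed n G L E (Suc m) =
     (shiftL n G (fst (renewed n G L E m)) (snd (renewed n G L E m)),
      shiftE n G (fst (renewed n G L E m)) (snd (renewed n G L E m)))"
  by (simp add: renewed_def case_prod_beta)

text \<open>Peels the first renewal off at the inner end, so that an induction can discard the first
  cycle and continue with the shifted system.\<close>

lemma renewed_shift: "renewed n G (shiftL n G L E) (shiftE n G L E) m = renewed n G L E (Suc m)"
  by (simp add: renewed_def funpow_Suc_right del: funpow.simps)

lemma cycle_shift:
  "cycle_time n G (shiftL n G L E) (shiftE n G L E) m = cycle_time n G L E (Suc m)"
  "cycle_set n G (shiftL n G L E) (shiftE n G L E) m = cycle_set n G L E (Suc m)"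
  by (simp_all add: cycle_time_def cycle_set_def renewed_shift)

lemma cycle_0: "cycle_time n G L E 0 = exit_time n G L E" "cycle_set n G L E 0 = exit_set n G L E"
  by (simp_all add: cycle_time_def cycle_set_def renewed_0)

context exiting
begin

lemma integral_weight: "(\<integral>\<omega>. weight f \<beta> \<omega> \<partial>M) = weight_mean \<psi> n G f \<beta>"
proof -
  let ?S = "Pow {1..n} - G"
  have ae: "AE \<omega> in M. weight f \<beta> \<omega> = (\<Sum>A\<in>?S. f A * indicator {\<omega>\<in>space M. X \<omega> = A} \<omega>) + \<beta> * \<tau> \<omega>"
    using AE_regular
  proof eventually_elim
    case (elim \<omega>)
    have "(\<Sum>A\<in>?S. f A * indicator {\<omega>\<in>space M. X \<omega> = A} \<omega>) =
       (\<Sum>A\<in>{X \<omega>}. f A * indicator {\<omega>\<in>space M. X \<omega> = A} \<omega>)"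
      using X_notin[OF elim] X_subset[of \<omega>] by (intro sum.mono_neutral_right) (auto simp: indicator_def)
    then show ?case using regularD(1)[OF elim] by (simp add: weight_def indicator_def)
  qed
  have ev: "{\<omega>\<in>space M. X \<omega> = A} \<in> events" for A by (intro predE pred_X_eq)
  have "(\<integral>\<omega>. weight f \<beta> \<omega> \<partial>M) = (\<integral>\<omega>. (\<Sum>A\<in>?S. f A * indicator {\<omega>\<in>space M. X \<omega> = A} \<omega>) + \<beta> * \<tau> \<omega> \<partial>M)"
  proof (rule integral_cong_AE)
    show "(\<lambda>\<omega>. (\<Sum>A\<in>?S. f A * indicator {\<omega>\<in>space M. X \<omega> = A} \<omega>) + \<beta> * \<tau> \<omega>) \<in> borel_measurable M"
      by (intro borel_measurable_add borel_measurable_sum borel_measurable_times borel_measurable_const borel_measurable_indicator ev \<tau>_measurable)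
  qed (use ae in auto)
  also have "\<dots> = (\<Sum>A\<in>?S. f A * \<P>(\<omega> in M. X \<omega> = A)) + \<beta> * (\<integral>\<omega>. \<tau> \<omega> \<partial>M)"
  proof -
    have int: "integrable M (\<lambda>\<omega>. f A * indicator {\<omega>\<in>space M. X \<omega> = A} \<omega>)" for A
      by (intro integrable_mult_right integrable_real_indicator ev) (simp add: emeasure_eq_measure)
    have val: "(\<integral>\<omega>. f A * indicator {\<omega>\<in>space M. X \<omega> = A} \<omega> \<partial>M) = f A * \<P>(\<omega> in M. X \<omega> = A)" for A
      using ev[of A] by (simp only: integral_mult_right_zero integral_indicator) (simp add: Int_absorb2)
    have "(\<integral>\<omega>. (\<Sum>A\<in>?S. f A * indicator {\<omega>\<in>space M. X \<omega> = A} \<omega>) + \<beta> * \<tau> \<omega> \<partial>M) =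
      (\<integral>\<omega>. (\<Sum>A\<in>?S. f A * indicator {\<omega>\<in>space M. X \<omega> = A} \<omega>) \<partial>M) + (\<integral>\<omega>. \<beta> * \<tau> \<omega> \<partial>M)"
      by (intro Bochner_Integration.integral_add Bochner_Integration.integrable_sum int integrable_mult_right integrable_\<tau>)
    also have "(\<integral>\<omega>. (\<Sum>A\<in>?S. f A * indicator {\<omega>\<in>space M. X \<omega> = A} \<omega>) \<partial>M) = (\<Sum>A\<in>?S. f A * \<P>(\<omega> in M. X \<omega> = A))"
      unfolding val[symmetric] by (intro Bochner_Integration.integral_sum int)
    finally show ?thesis by simp
  qed
  also have "\<dots> = weight_mean \<psi> n G f \<beta>"
    unfolding weight_mean_def integral_\<tau> by (intro arg_cong2[where f="(+)"] sum.cong refl) (auto simp: prob_X)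
  finally show ?thesis .
qed

text \<open>That the exit law has total mass 1 is read off from probability rather than from the
  finite differences.\<close>

lemma weight_mean_one: "weight_mean \<psi> n G (\<lambda>_. 1) 0 = 1"
  using integral_weight[of "\<lambda>_. 1" 0] by (simp add: weight_def prob_space)

lemma weight_mean_nonneg: "\<forall>A. 0 \<le> f A \<Longrightarrow> 0 \<le> \<beta> \<Longrightarrow> 0 \<le> weight_mean \<psi> n G f \<beta>"
  unfolding integral_weight[symmetric] using weight_bounds(3) by (intro Bochner_Integration.integral_nonneg) auto

lemma frailty_shift: "frailty M (shiftL n G L E) (shiftE n G L E) n \<psi>"
proof -
  have "frailty (density M (\<lambda>\<omega>. ennreal (weight (\<lambda>_. 1) 0 \<omega> / 1))) (shiftL n G L E) (shiftE n G L E) n \<psi>"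
    by (rule regeneration) (simp_all add: weight_def prob_space)
  then show ?thesis by (simp add: weight_def density_1)
qed

lemma exiting_shift: "exiting M (shiftL n G L E) (shiftE n G L E) n \<psi> G"
  using frailty_shift G by (simp add: exiting_def exiting_axioms_def)

end

lemma exiting_renewed:
  assumes "exiting M L E n \<psi> G"
  shows "exiting M (fst (renewed n G L E m)) (snd (renewed n G L E m)) n \<psi> G"
proof (induction m)
  case 0
  then show ?case using assms by (simp add: renewed_0)
next
  case (Suc m)
  then show ?case unfolding renewed_Suc by (simp add: exiting.exiting_shift)
qed

lemma cycle_measurable:
  assumes "exiting M L E n \<psi> G"
  shows "cycle_time n G L E m \<in> borel_measurable M"
    and "cycle_set n G L E m \<in> measurable M (count_space UNIV)"
  unfolding cycle_time_def cycle_set_def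
  using exiting.\<tau>_measurable[OF exiting_renewed[OF assms]] exiting.X_measurable[OF exiting_renewed[OF assms]]
  by auto

lemma cycle_weight_measurable:
  assumes "exiting M L E n \<psi> G"
  shows "(\<lambda>\<omega>. f (cycle_set n G L E m \<omega>) + \<beta> * cycle_time n G L E m \<omega> :: real) \<in> borel_measurable M"
  by (intro borel_measurable_add borel_measurable_times borel_measurable_const
      measurable_compose[OF cycle_measurable(2)[OF assms]] cycle_measurable(1)[OF assms]) simp

lemma cycle_time_nonneg: "0 \<le> cycle_time n G L E m \<omega>"
  by (auto simp: cycle_time_def exit_time_def intro!: cInf_greatest)

text \<open>The first factor is normalised and becomes a density; under the new measure the
  remaining factors are those of a system with the same \<psi>, so measure, process and triggers are
  all general in the induction. The conclusion expresses the independence of the cycles.\<close>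

theorem cycle_product:
  assumes "exiting M L E n \<psi> G" and "\<And>l. l < m \<Longrightarrow> (\<forall>A. 0 \<le> f l A) \<and> 0 \<le> \<beta> l"
  shows "(\<integral>\<^sup>+\<omega>. (\<Prod>l<m. ennreal (f l (cycle_set n G L E l \<omega>) + \<beta> l * cycle_time n G L E l \<omega>)) \<partial>M) =
    (\<Prod>l<m. ennreal (weight_mean \<psi> n G (f l) (\<beta> l)))"
  using assms
proof (induction m arbitrary: M L E f \<beta>)
  case 0
  then interpret exiting M L E n \<psi> G by simp
  show ?case by (simp add: emeasure_space_1)
next
  case (Suc m)
  interpret exiting M L E n \<psi> G by fact
  have f0: "\<forall>A. 0 \<le> f 0 A" "0 \<le> \<beta> 0" using Suc.prems(2)[of 0] by auto
  let ?c = "weight_mean \<psi> n G (f 0) (\<beta> 0)"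
  let ?H = "\<lambda>\<omega>. \<Prod>l<m. ennreal (f (Suc l) (cycle_set n G (shiftL n G L E) (shiftE n G L E) l \<omega>) +
     \<beta> (Suc l) * cycle_time n G (shiftL n G L E) (shiftE n G L E) l \<omega>)"
  have H [measurable]: "?H \<in> borel_measurable M"
  proof -
    have [measurable]: "(\<lambda>\<omega>. f (Suc l) (cycle_set n G (shiftL n G L E) (shiftE n G L E) l \<omega>) +
       \<beta> (Suc l) * cycle_time n G (shiftL n G L E) (shiftE n G L E) l \<omega>) \<in> borel_measurable M" for l
      by (rule cycle_weight_measurable[OF exiting_shift])
    show ?thesis by measurable
  qed
  have split: "(\<Prod>l<Suc m. ennreal (f l (cycle_set n G L E l \<omega>) + \<beta> l * cycle_time n G L E l \<omega>)) =
      ennreal (weight (f 0) (\<beta> 0) \<omega>) * ?H \<omega>" for \<omega>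
    unfolding prod.lessThan_Suc_shift by (simp add: cycle_shift cycle_0 weight_def)
  have nonneg: "0 \<le> weight (f 0) (\<beta> 0) \<omega>" for \<omega> by (rule weight_bounds(3)[OF f0])
  show ?case
  proof (cases "?c = 0")
    \<comment> \<open>A weight of mean 0 cannot be normalised, but it vanishes almost surely and so
      does the product.\<close>
    case True
    then have "AE \<omega> in M. weight (f 0) (\<beta> 0) \<omega> = 0"
      using integral_nonneg_eq_0_iff_AE[OF integrable_weights(2)[OF f0]] nonneg by (simp add: integral_weight)
    then have "(\<integral>\<^sup>+\<omega>. ennreal (weight (f 0) (\<beta> 0) \<omega>) * ?H \<omega> \<partial>M) = (\<integral>\<^sup>+\<omega>. 0 \<partial>M)"
      by (intro nn_integral_cong_AE) auto
    then show ?thesis unfolding split unfolding prod.lessThan_Suc_shift using True by simp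
  next
    case False
    then have c: "0 < ?c" using weight_mean_nonneg[OF f0] by simp
    let ?M = "density M (\<lambda>\<omega>. ennreal (weight (f 0) (\<beta> 0) \<omega> / ?c))"
    have "frailty ?M (shiftL n G L E) (shiftE n G L E) n \<psi>"
      by (rule regeneration[OF f0]) (simp_all add: integral_weight c)
    then have ex: "exiting ?M (shiftL n G L E) (shiftE n G L E) n \<psi> G"
      using G by (simp add: exiting_def exiting_axioms_def)
    have "(\<integral>\<^sup>+\<omega>. ennreal (weight (f 0) (\<beta> 0) \<omega>) * ?H \<omega> \<partial>M) =
        (\<integral>\<^sup>+\<omega>. ennreal ?c * (ennreal (weight (f 0) (\<beta> 0) \<omega> / ?c) * ?H \<omega>) \<partial>M)"
      using c nonneg by (intro nn_integral_cong) (simp add: mult.assoc[symmetric] ennreal_mult[symmetric])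
    also have "\<dots> = ennreal ?c * (\<integral>\<^sup>+\<omega>. ennreal (weight (f 0) (\<beta> 0) \<omega> / ?c) * ?H \<omega> \<partial>M)"
      by (rule nn_integral_cmult) measurable
    also have "(\<integral>\<^sup>+\<omega>. ennreal (weight (f 0) (\<beta> 0) \<omega> / ?c) * ?H \<omega> \<partial>M) = (\<integral>\<^sup>+\<omega>. ?H \<omega> \<partial>?M)"
      by (rule nn_integral_density[symmetric]) measurable
    also have "\<dots> = (\<Prod>l<m. ennreal (weight_mean \<psi> n G (f (Suc l)) (\<beta> (Suc l))))"
      by (rule Suc.IH[OF ex]) (use Suc.prems(2) in auto)
    finally show ?thesis unfolding split unfolding prod.lessThan_Suc_shift by simp
  qed
qed

section \<open>Averages over cycles and Wald's identity\<close>

context exiting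
begin

abbreviation D :: "nat \<Rightarrow> 'a \<Rightarrow> real" where "D \<equiv> cycle_time n G L E"
abbreviation S :: "nat \<Rightarrow> 'a \<Rightarrow> nat set" where "S \<equiv> cycle_set n G L E"

lemmas cycle_measurable' [measurable] = cycle_measurable[OF exiting_axioms]

lemma cycle_mean:
  assumes "\<forall>A. 0 \<le> f A" "0 \<le> \<beta>"
  shows "(\<integral>\<^sup>+\<omega>. ennreal (f (S a \<omega>) + \<beta> * D a \<omega>) \<partial>M) = ennreal (weight_mean \<psi> n G f \<beta>)"
proof -
  interpret R: exiting M "fst (renewed n G L E a)" "snd (renewed n G L E a)" n \<psi> G
    by (rule exiting_renewed[OF exiting_axioms])
  have "(\<integral>\<^sup>+\<omega>. ennreal (R.weight f \<beta> \<omega>) \<partial>M) = ennreal (\<integral>\<omega>. R.weight f \<beta> \<omega> \<partial>M)"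
    by (rule nn_integral_eq_integral[OF R.integrable_weights(2)[OF assms]]) (use R.weight_bounds(3)[OF assms] in auto)
  then show ?thesis unfolding R.integral_weight by (simp add: R.weight_def cycle_set_def cycle_time_def)
qed

lemma cycle_uncorrelated:
  assumes f: "\<forall>A. 0 \<le> f A" "0 \<le> \<beta>" and "a \<noteq> b"
  shows "(\<integral>\<^sup>+\<omega>. ennreal ((f (S a \<omega>) + \<beta> * D a \<omega>) * (f (S b \<omega>) + \<beta> * D b \<omega>)) \<partial>M) =
    ennreal (weight_mean \<psi> n G f \<beta> * weight_mean \<psi> n G f \<beta>)"
proof -
  define m where "m = Suc (max a b)"
  \<comment> \<open>All cycles other than the two of interest get the constant weight 1, whose mean
    is 1.\<close>
  let ?f = "\<lambda>l. if l = a \<or> l = b then f else (\<lambda>_. 1)" and ?\<beta> = "\<lambda>l. if l = a \<or> l = b then \<beta> else 0"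
  have ab: "{a, b} \<subseteq> {..<m}" by (auto simp: m_def)
  have prod: "(\<Prod>l<m. g l) = g a * g b" if "\<And>l. l \<noteq> a \<Longrightarrow> l \<noteq> b \<Longrightarrow> g l = (1::ennreal)" for g
  proof -
    have "(\<Prod>l<m. g l) = (\<Prod>l\<in>{a, b}. g l)" using ab that by (intro prod.mono_neutral_right) auto
    then show ?thesis using \<open>a \<noteq> b\<close> by simp
  qed
  have nonneg: "0 \<le> f (S l \<omega>) + \<beta> * D l \<omega>" for l \<omega> using f cycle_time_nonneg[of n G L E l \<omega>] by simp
  have "(\<integral>\<^sup>+\<omega>. (\<Prod>l<m. ennreal (?f l (S l \<omega>) + ?\<beta> l * D l \<omega>)) \<partial>M) =
    (\<Prod>l<m. ennreal (weight_mean \<psi> n G (?f l) (?\<beta> l)))"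
    by (rule cycle_product[OF exiting_axioms]) (use f in auto)
  also have "(\<Prod>l<m. ennreal (weight_mean \<psi> n G (?f l) (?\<beta> l))) =
     ennreal (weight_mean \<psi> n G (?f a) (?\<beta> a)) * ennreal (weight_mean \<psi> n G (?f b) (?\<beta> b))"
    by (rule prod) (simp add: weight_mean_one)
  also have "\<dots> = ennreal (weight_mean \<psi> n G f \<beta> * weight_mean \<psi> n G f \<beta>)"
    using weight_mean_nonneg[OF f] by (simp add: ennreal_mult)
  also have "(\<lambda>\<omega>. \<Prod>l<m. ennreal (?f l (S l \<omega>) + ?\<beta> l * D l \<omega>)) =
     (\<lambda>\<omega>. ennreal ((f (S a \<omega>) + \<beta> * D a \<omega>) * (f (S b \<omega>) + \<beta> * D b \<omega>)))"
    by (subst prod) (simp_all add: ennreal_mult nonneg)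
  finally show ?thesis .
qed

text \<open>Uses \<open>(x + y)\<^sup>2 \<le> 2 * x\<^sup>2 + 2 * y\<^sup>2\<close>; what matters is
  that the bound does not depend on the cycle \<open>a\<close>.\<close>

lemma cycle_second_moment:
  assumes f: "\<forall>A. 0 \<le> f A" "0 \<le> \<beta>"
  shows "(\<integral>\<^sup>+\<omega>. ennreal ((f (S a \<omega>) + \<beta> * D a \<omega>)\<^sup>2) \<partial>M) \<le>
    ennreal (2 * (\<Sum>A\<in>Pow {1..n}. f A)\<^sup>2 + 2 * \<beta>\<^sup>2 * max 0 (exit_square_bound \<psi> n))"
proof -
  interpret R: exiting M "fst (renewed n G L E a)" "snd (renewed n G L E a)" n \<psi> G
    by (rule exiting_renewed[OF exiting_axioms])
  define s where "s = max 0 (exit_square_bound \<psi> n)"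
  have s: "0 \<le> s" "ennreal (exit_square_bound \<psi> n) \<le> ennreal s" by (auto simp: s_def intro!: ennreal_leI)
  have bound: "(f (S a \<omega>) + \<beta> * D a \<omega>)\<^sup>2 \<le> 2 * (\<Sum>A\<in>Pow {1..n}. f A)\<^sup>2 + 2 * \<beta>\<^sup>2 * (D a \<omega>)\<^sup>2" for \<omega>
  proof -
    have "f (S a \<omega>) \<le> (\<Sum>A\<in>Pow {1..n}. f A)"
      using R.X_subset[of \<omega>] f by (intro member_le_sum) (auto simp: cycle_set_def)
    then have "(f (S a \<omega>) + \<beta> * D a \<omega>)\<^sup>2 \<le> ((\<Sum>A\<in>Pow {1..n}. f A) + \<beta> * D a \<omega>)\<^sup>2"
      using f cycle_time_nonneg[of n G L E a \<omega>] by (intro power_mono) auto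
    also have "\<dots> \<le> 2 * (\<Sum>A\<in>Pow {1..n}. f A)\<^sup>2 + 2 * (\<beta> * D a \<omega>)\<^sup>2"
      using sum_squares_bound[of "\<Sum>A\<in>Pow {1..n}. f A" "\<beta> * D a \<omega>"] by (simp add: power2_sum)
    finally show ?thesis by (simp add: power_mult_distrib)
  qed
  have "(\<integral>\<^sup>+\<omega>. ennreal ((f (S a \<omega>) + \<beta> * D a \<omega>)\<^sup>2) \<partial>M) \<le>
     (\<integral>\<^sup>+\<omega>. ennreal (2 * (\<Sum>A\<in>Pow {1..n}. f A)\<^sup>2) + ennreal (2 * \<beta>\<^sup>2) * ennreal ((D a \<omega>)\<^sup>2) \<partial>M)"
    using bound by (intro nn_integral_mono) (simp add: ennreal_plus[symmetric] ennreal_mult[symmetric] ennreal_leI del: ennreal_plus)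
  also have "\<dots> = ennreal (2 * (\<Sum>A\<in>Pow {1..n}. f A)\<^sup>2) + ennreal (2 * \<beta>\<^sup>2) * (\<integral>\<^sup>+\<omega>. ennreal ((D a \<omega>)\<^sup>2) \<partial>M)"
    by (subst nn_integral_add) (auto simp: nn_integral_cmult emeasure_space_1)
  also have "\<dots> \<le> ennreal (2 * (\<Sum>A\<in>Pow {1..n}. f A)\<^sup>2) + ennreal (2 * \<beta>\<^sup>2) * ennreal s"
    unfolding cycle_time_def
    by (intro add_left_mono mult_left_mono order_trans[OF R.nn_integral_\<tau>_square s(2)]) auto
  also have "\<dots> = ennreal (2 * (\<Sum>A\<in>Pow {1..n}. f A)\<^sup>2 + 2 * \<beta>\<^sup>2 * s)"
    using s(1) by (simp add: ennreal_plus[symmetric] ennreal_mult[symmetric] del: ennreal_plus)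
  finally show ?thesis by (simp only: s_def)
qed

lemma cycle_average_nonneg:
  assumes f: "\<forall>A. 0 \<le> f A" "0 \<le> \<beta>"
  shows "AE \<omega> in M. (\<lambda>m. (\<Sum>a<m. f (S a \<omega>) + \<beta> * D a \<omega>) / real m) \<longlonglongrightarrow> weight_mean \<psi> n G f \<beta>"
proof (rule strong_law_uncorrelated[OF _ _ cycle_mean[OF f] weight_mean_nonneg[OF f] cycle_uncorrelated[OF f] cycle_second_moment[OF f]])
  show "0 \<le> f (S a \<omega>) + \<beta> * D a \<omega>" for a \<omega> using f cycle_time_nonneg[of n G L E a \<omega>] by simp
qed (rule cycle_weight_measurable[OF exiting_axioms])

lemma weight_mean_add_const: "weight_mean \<psi> n G (\<lambda>A. f A + k) \<beta> = weight_mean \<psi> n G f \<beta> + k"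
  using weight_mean_one
  by (simp add: weight_mean_def algebra_simps sum.distrib flip: sum_distrib_left)

lemma weight_mean_cong:
  "(\<And>A. A \<subseteq> {1..n} \<Longrightarrow> A \<notin> G \<Longrightarrow> f A = g A) \<Longrightarrow> weight_mean \<psi> n G f \<beta> = weight_mean \<psi> n G g \<beta>"
  unfolding weight_mean_def by (intro arg_cong2[where f="(+)"] sum.cong) auto

text \<open>Costs may be negative, whereas the strong law is for nonnegative variables; as there are
  finitely many exit sets, a constant makes them nonnegative and is subtracted again in the
  limit.\<close>

lemma cycle_reward_average:
  "AE \<omega> in M. (\<lambda>m. (\<Sum>a<m. f (S a \<omega>)) / real m) \<longlonglongrightarrow> weight_mean \<psi> n G f 0"
proof -
  define k where "k = (\<Sum>A\<in>Pow {1..n}. \<bar>f A\<bar>)"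
  \<comment> \<open>\<open>k\<close> makes the sum nonnegative on subsets of \<open>{1..n}\<close>
    only, while the law asks for it on all sets; on exit sets the maximum changes nothing.\<close>
  let ?g = "\<lambda>A. max 0 (f A + k)"
  have k: "0 \<le> f A + k" if "A \<subseteq> {1..n}" for A
  proof -
    have "\<bar>f A\<bar> \<le> k" unfolding k_def using that by (intro member_le_sum) auto
    then show ?thesis by linarith
  qed
  have Ssub: "S a \<omega> \<subseteq> {1..n}" for a \<omega> by (auto simp: cycle_set_def exit_set_def failed_def)
  have "AE \<omega> in M. (\<lambda>m. (\<Sum>a<m. ?g (S a \<omega>) + 0 * D a \<omega>) / real m) \<longlonglongrightarrow> weight_mean \<psi> n G ?g 0"
    by (rule cycle_average_nonneg) auto
  moreover have "weight_mean \<psi> n G ?g 0 = weight_mean \<psi> n G f 0 + k"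
    unfolding weight_mean_add_const[symmetric] using k by (intro weight_mean_cong) (auto simp: max_def)
  ultimately show ?thesis
  proof (elim AE_mp, intro AE_I2 impI)
    fix \<omega>
    assume m: "weight_mean \<psi> n G ?g 0 = weight_mean \<psi> n G f 0 + k"
      and l: "(\<lambda>m. (\<Sum>a<m. ?g (S a \<omega>) + 0 * D a \<omega>) / real m) \<longlonglongrightarrow> weight_mean \<psi> n G ?g 0"
    have "(\<lambda>m. (\<Sum>a<m. ?g (S a \<omega>) + 0 * D a \<omega>) / real m - k) \<longlonglongrightarrow> weight_mean \<psi> n G f 0 + k - k"
      by (intro tendsto_diff tendsto_const l[unfolded m])
    moreover have "eventually (\<lambda>m. (\<Sum>a<m. ?g (S a \<omega>) + 0 * D a \<omega>) / real m - k = (\<Sum>a<m. f (S a \<omega>)) / real m) sequentially"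
      using eventually_gt_at_top[of 0]
    proof eventually_elim
      case (elim m)
      have "(\<Sum>a<m. ?g (S a \<omega>) + 0 * D a \<omega>) = (\<Sum>a<m. f (S a \<omega>)) + real m * k"
        using k[OF Ssub] by (simp add: sum.distrib max_absorb2)
      then show ?case using elim by (simp add: field_simps)
    qed
    ultimately have "(\<lambda>m. (\<Sum>a<m. f (S a \<omega>)) / real m) \<longlonglongrightarrow> weight_mean \<psi> n G f 0 + k - k"
      by (rule Lim_transform_eventually)
    then show "(\<lambda>m. (\<Sum>a<m. f (S a \<omega>)) / real m) \<longlonglongrightarrow> weight_mean \<psi> n G f 0"
      by (simp only: add_diff_cancel_right')
  qed
qed

lemma cycle_time_average: "AE \<omega> in M. (\<lambda>m. (\<Sum>a<m. D a \<omega>) / real m) \<longlonglongrightarrow> exit_mean \<psi> n G"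
  using cycle_average_nonneg[of "\<lambda>_. 0" 1] by (simp add: weight_mean_def)

text \<open>The term of index \<open>m\<close> is present iff no earlier cycle ended in \<open>Q\<close>, so the series is the total weight up
  to and including the first cycle that ends in \<open>Q\<close>.\<close>

lemma wald:
  assumes f: "\<forall>A. 0 \<le> f A" "0 \<le> \<beta>" and p: "p = weight_mean \<psi> n G (\<lambda>A. of_bool (A \<in> Q)) 0" "0 < p"
  shows "(\<integral>\<^sup>+\<omega>. (\<Sum>m. ennreal (of_bool (\<forall>l<m. S l \<omega> \<notin> Q) * (f (S m \<omega>) + \<beta> * D m \<omega>))) \<partial>M) =
    ennreal (weight_mean \<psi> n G f \<beta> / p)"
proof -
  let ?c = "weight_mean \<psi> n G f \<beta>"
  have q: "weight_mean \<psi> n G (\<lambda>A. of_bool (A \<notin> Q)) 0 = 1 - p"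
  proof -
    have "weight_mean \<psi> n G (\<lambda>A. of_bool (A \<notin> Q)) 0 + p = weight_mean \<psi> n G (\<lambda>_. 1) 0"
      unfolding p(1) weight_mean_def by (simp add: sum.distrib[symmetric] distrib_right[symmetric] of_bool_def) (intro sum.cong, auto)
    then show ?thesis using weight_mean_one by simp
  qed
  have q0: "0 \<le> 1 - p" unfolding q[symmetric] by (rule weight_mean_nonneg) auto
  have c0: "0 \<le> ?c" by (rule weight_mean_nonneg[OF f])
  have summand: "(\<integral>\<^sup>+\<omega>. ennreal (of_bool (\<forall>l<m. S l \<omega> \<notin> Q) * (f (S m \<omega>) + \<beta> * D m \<omega>)) \<partial>M) = ennreal (?c * (1 - p) ^ m)" for m
  proof -
    \<comment> \<open>Earlier cycles carry the indicator of not ending in \<open>Q\<close>, cycle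
      \<open>m\<close> the weight itself; by the product formula the terms form a geometric sequence
      of ratio \<open>1 - p\<close>.\<close>
    let ?f = "\<lambda>l. if l = m then f else (\<lambda>A. of_bool (A \<notin> Q))" and ?\<beta> = "\<lambda>l. if l = m then \<beta> else 0"
    have "ennreal (of_bool (\<forall>l<m. S l \<omega> \<notin> Q) * (f (S m \<omega>) + \<beta> * D m \<omega>)) =
       (\<Prod>l<Suc m. ennreal (?f l (S l \<omega>) + ?\<beta> l * D l \<omega>))" for \<omega>
    proof -
      have "(\<Prod>l<m. ennreal (of_bool (S l \<omega> \<notin> Q))) = ennreal (of_bool (\<forall>l<m. S l \<omega> \<notin> Q))"
      proof (cases "\<forall>l<m. S l \<omega> \<notin> Q")
        case False
        then obtain l where "l < m" "S l \<omega> \<in> Q" by blast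
        then have "(\<Prod>l<m. ennreal (of_bool (S l \<omega> \<notin> Q))) = 0" by (intro prod_zero) (auto intro!: bexI[of _ l])
        then show ?thesis using False by simp
      qed simp
      moreover have "(\<Prod>l<m. ennreal (?f l (S l \<omega>) + ?\<beta> l * D l \<omega>)) = (\<Prod>l<m. ennreal (of_bool (S l \<omega> \<notin> Q)))"
        by (intro prod.cong) auto
      ultimately show ?thesis by (simp add: ennreal_mult'' f cycle_time_nonneg)
    qed
    then have "(\<integral>\<^sup>+\<omega>. ennreal (of_bool (\<forall>l<m. S l \<omega> \<notin> Q) * (f (S m \<omega>) + \<beta> * D m \<omega>)) \<partial>M) =
       (\<Prod>l<Suc m. ennreal (weight_mean \<psi> n G (?f l) (?\<beta> l)))"
      unfolding cycle_product[OF exiting_axioms, of "Suc m" ?f ?\<beta>, symmetric] using f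
      by (subst cycle_product[OF exiting_axioms, symmetric]) auto
    also have "\<dots> = (\<Prod>l<m. ennreal (1 - p)) * ennreal ?c" by (simp add: q)
    also have "\<dots> = ennreal (?c * (1 - p) ^ m)"
      using q0 c0 by (simp add: ennreal_power ennreal_mult'' mult.commute)
    finally show ?thesis .
  qed
  have "(\<integral>\<^sup>+\<omega>. (\<Sum>m. ennreal (of_bool (\<forall>l<m. S l \<omega> \<notin> Q) * (f (S m \<omega>) + \<beta> * D m \<omega>))) \<partial>M) =
     (\<Sum>m. \<integral>\<^sup>+\<omega>. ennreal (of_bool (\<forall>l<m. S l \<omega> \<notin> Q) * (f (S m \<omega>) + \<beta> * D m \<omega>)) \<partial>M)"
  proof (rule nn_integral_suminf)
    fix m
    have [measurable]: "Measurable.pred M (\<lambda>\<omega>. S l \<omega> \<notin> Q)" for l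
      by (rule measurable_compose[OF cycle_measurable'(2)]) simp
    have [measurable]: "(\<lambda>\<omega>. f (S m \<omega>) + \<beta> * D m \<omega>) \<in> borel_measurable M"
      by (rule cycle_weight_measurable[OF exiting_axioms])
    show "(\<lambda>\<omega>. ennreal (of_bool (\<forall>l<m. S l \<omega> \<notin> Q) * (f (S m \<omega>) + \<beta> * D m \<omega>))) \<in> borel_measurable M"
      by measurable
  qed
  also have "\<dots> = ennreal (?c / p)"
    unfolding summand
  proof (rule suminf_ennreal_eq)
    have "(\<lambda>m. ?c * (1 - p) ^ m) sums (?c * (1 / (1 - (1 - p))))"
      using p(2) q0 by (intro sums_mult geometric_sums) auto
    then show "(\<lambda>m. ?c * (1 - p) ^ m) sums (?c / p)" by simp
  qed (use q0 c0 in simp)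
  finally show ?thesis .
qed

end

section \<open>The repair process as a sequence of cycles\<close>

declare repair_time.simps [simp del] trigger.simps [simp del]

definition state_of :: "nat \<Rightarrow> nat set \<Rightarrow> nat \<Rightarrow> nat" where
  "state_of n B = (\<lambda>i\<in>{1..n}. if i \<in> B then 0 else 1)"

definition no_repair_family :: "nat \<Rightarrow> ((nat \<Rightarrow> nat) \<Rightarrow> nat) \<Rightarrow> nat \<Rightarrow> nat set set" where
  "no_repair_family n \<Phi> r = {B \<in> Pow {1..n}. card B < r \<and> \<Phi> (state_of n B) \<noteq> 0}"

lemma comp_state_eq: "comp_state n L \<epsilon> t \<omega> = state_of n {i\<in>{1..n}. \<epsilon> i \<le> L t \<omega>}"
  by (auto simp: comp_state_def state_of_def restrict_def not_less)

lemma state_of_in_states: "state_of n B \<in> states n"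
  by (auto simp: state_of_def)

lemma state_of_eq_0_iff: "i \<in> {1..n} \<Longrightarrow> state_of n B i = 0 \<longleftrightarrow> i \<in> B"
  by (simp add: state_of_def)

lemma sum_state_of: "B \<subseteq> {1..n} \<Longrightarrow> (\<Sum>i=1..n. 1 - state_of n B i) = card B"
proof -
  assume B: "B \<subseteq> {1..n}"
  have "(\<Sum>i=1..n. 1 - state_of n B i) = (\<Sum>i\<in>{1..n}. if i \<in> B then 1 else 0)"
    by (intro sum.cong) (auto simp: state_of_def)
  also have "\<dots> = card ({1..n} \<inter> B)" by (simp add: sum.If_cases)
  finally show ?thesis using B by (simp add: Int_absorb1)
qed

lemma semi_coherent_mono:
  assumes "semi_coherent n \<Phi>" "B \<subseteq> A"
  shows "\<Phi> (state_of n A) \<le> \<Phi> (state_of n B)"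
proof -
  have le: "\<forall>i\<in>{1..n}. state_of n A i \<le> state_of n B i" using assms(2) by (auto simp: state_of_def)
  have mono: "\<forall>x\<in>states n. \<forall>y\<in>states n. (\<forall>i\<in>{1..n}. x i \<le> y i) \<longrightarrow> \<Phi> x \<le> \<Phi> y"
    using assms(1) by (simp add: semi_coherent_def)
  show ?thesis
    by (rule mp[OF bspec[OF bspec[OF mono state_of_in_states] state_of_in_states] le])
qed

lemma semi_coherent_values:
  assumes "semi_coherent n \<Phi>"
  shows "\<Phi> (state_of n B) \<in> {0, 1}" "\<Phi> (state_of n {}) = 1" "\<Phi> (state_of n {1..n}) = 0"
proof -
  have "\<Phi> \<in> states n \<rightarrow> {0, 1}" using assms by (simp add: semi_coherent_def)
  then show "\<Phi> (state_of n B) \<in> {0, 1}" by (rule funcset_mem[OF _ state_of_in_states])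
  have "state_of n {} = (\<lambda>i\<in>{1..n}. 1)" "state_of n {1..n} = (\<lambda>i\<in>{1..n}. 0)"
    by (auto simp: state_of_def restrict_def)
  then show "\<Phi> (state_of n {}) = 1" "\<Phi> (state_of n {1..n}) = 0"
    using assms by (auto simp: semi_coherent_def)
qed

lemma working_family_no_repair:
  assumes \<Phi>: "semi_coherent n \<Phi>" and r: "r \<in> {1..n}"
  shows "working_family n (no_repair_family n \<Phi> r)"
  unfolding working_family_def
proof (intro conjI ballI allI impI)
  show "no_repair_family n \<Phi> r \<subseteq> Pow {1..n}" by (auto simp: no_repair_family_def)
  show "{} \<in> no_repair_family n \<Phi> r" using r semi_coherent_values[OF \<Phi>] by (simp add: no_repair_family_def)
  show "{1..n} \<notin> no_repair_family n \<Phi> r" using r by (simp add: no_repair_family_def)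
  fix A B assume A: "A \<in> no_repair_family n \<Phi> r" and B: "B \<subseteq> A"
  then have sub: "A \<subseteq> {1..n}" by (simp add: no_repair_family_def)
  have "finite A" by (rule finite_subset[OF sub]) simp
  then have "card B \<le> card A" using B by (rule card_mono)
  moreover have "\<Phi> (state_of n A) \<le> \<Phi> (state_of n B)" by (rule semi_coherent_mono[OF \<Phi> B])
  ultimately show "B \<in> no_repair_family n \<Phi> r" using A B sub by (auto simp: no_repair_family_def)
qed

locale repair = frailty M L E n \<psi>
  for M :: "'a measure" and L :: "real \<Rightarrow> 'a \<Rightarrow> real" and E :: "nat \<Rightarrow> nat \<Rightarrow> 'a \<Rightarrow> real" and n :: nat
    and \<psi> :: "nat \<Rightarrow> real" +
  fixes \<Phi> :: "(nat \<Rightarrow> nat) \<Rightarrow> nat" and r :: nat and c_cmp :: "nat \<Rightarrow> real" and c_sys :: real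
  assumes \<Phi>: "semi_coherent n \<Phi>" and r: "r \<in> {1..n}"
begin

sublocale exiting M L E n \<psi> "no_repair_family n \<Phi> r"
  by unfold_locales (rule working_family_no_repair[OF \<Phi> r])

abbreviation G :: "nat set set" where "G \<equiv> no_repair_family n \<Phi> r"
abbreviation L' :: "nat \<Rightarrow> real \<Rightarrow> 'a \<Rightarrow> real" where "L' m \<equiv> fst (renewed n G L E m)"
abbreviation E' :: "nat \<Rightarrow> nat \<Rightarrow> nat \<Rightarrow> 'a \<Rightarrow> real" where "E' m \<equiv> snd (renewed n G L E m)"

definition R :: "nat \<Rightarrow> 'a \<Rightarrow> real" where "R m \<omega> = (\<Sum>l<m. D l \<omega>)"

definition fail_sets :: "nat set set" where "fail_sets = {B. \<Phi> (state_of n B) = 0}"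

definition cost :: "nat set \<Rightarrow> real" where
  "cost A = c_cmp (card A) + (if A \<in> fail_sets then c_sys else 0)"

text \<open>Regularity of all renewed systems at once, so that every repair can be followed on the
  same path.\<close>

definition good :: "'a \<Rightarrow> bool" where
  "good \<omega> \<longleftrightarrow> (\<forall>m. exiting.regular M (L' m) (E' m) n \<omega>)"

lemma AE_good: "AE \<omega> in M. good \<omega>"
  unfolding good_def AE_all_countable
  using exiting.AE_regular[OF exiting_renewed[OF exiting_axioms]] by blast

lemma R_0: "R 0 \<omega> = 0" and R_Suc: "R (Suc m) \<omega> = R m \<omega> + D m \<omega>"
  by (simp_all add: R_def)

text \<open>The case \<open>m = 0\<close> is separate because \<open>L 0\<close> vanishes only on
  \<open>space M\<close>, while this identity is for arbitrary \<omega>.\<close>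

lemma L'_eq: "L' m t \<omega> = L (R m \<omega> + t) \<omega> - (if m = 0 then 0 else L (R m \<omega>) \<omega>)"
proof (induction m arbitrary: t)
  case 0
  then show ?case by (simp add: renewed_0 R_0)
next
  case (Suc m)
  have "L' (Suc m) t \<omega> = L' m (D m \<omega> + t) \<omega> - L' m (D m \<omega>) \<omega>"
    by (simp add: renewed_Suc shiftL_def cycle_time_def)
  also have "\<dots> = L (R m \<omega> + (D m \<omega> + t)) \<omega> - L (R m \<omega> + D m \<omega>) \<omega>" by (simp only: Suc.IH)
  finally show ?case by (simp add: R_Suc add.assoc)
qed

text \<open>Each renewal discards one generation, so triggers of positive index are the original
  ones shifted by the number of renewals.\<close>

lemma E'_Suc: "E' m i (Suc l) \<omega> = E i (m + Suc l) \<omega>"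
proof (induction m arbitrary: l)
  case 0
  then show ?case by (simp add: renewed_0)
next
  case (Suc m)
  have "E' (Suc m) i (Suc l) \<omega> = E' m i (Suc (Suc l)) \<omega>"
    by (simp add: renewed_Suc shiftE_def resumed_def)
  then show ?case using Suc.IH[of "Suc l"] by simp
qed

text \<open>A repaired component receives exactly the trigger \<open>E i (Suc m)\<close> that the
  repair process prescribes; the others keep what is left of their current one.\<close>

lemma E'_0:
  "E' (Suc m) i 0 \<omega> = (if i \<in> S m \<omega> then E i (Suc m) \<omega> else E' m i 0 \<omega> - L' m (D m \<omega>) \<omega>)"
  using E'_Suc[of m i 0 \<omega>]
  by (simp add: renewed_Suc shiftE_def resumed_def cycle_time_def cycle_set_def)

lemma S_eq: "S m \<omega> = {i\<in>{1..n}. E' m i 0 \<omega> \<le> L' m (D m \<omega>) \<omega>}"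
  by (simp add: cycle_set_def exit_set_def failed_def cycle_time_def)

section \<open>Repair times, triggers and costs on a good path\<close>

context
  fixes \<omega> assumes good: "good \<omega>"
begin

lemma good_regular: "exiting.regular M (L' m) (E' m) n \<omega>"
  using good by (simp add: good_def)

lemma D_pos: "0 < D m \<omega>"
  unfolding cycle_time_def
  by (rule exiting.\<tau>_pos[OF exiting_renewed[OF exiting_axioms] good_regular])

lemma S_notin: "S m \<omega> \<notin> G"
  unfolding cycle_set_def
  by (rule exiting.X_notin[OF exiting_renewed[OF exiting_axioms] good_regular])

lemma S_subset: "S m \<omega> \<subseteq> {1..n}"
  by (auto simp: S_eq)

lemma D_le_iff: "0 \<le> t \<Longrightarrow> D m \<omega> \<le> t \<longleftrightarrow> failed n (L' m) (E' m) t \<omega> \<notin> G"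
  unfolding cycle_time_def
  by (rule exiting.\<tau>_le_iff[OF exiting_renewed[OF exiting_axioms] good_regular])

lemma R_strict_mono: "strict_mono (\<lambda>m. R m \<omega>)"
  unfolding strict_mono_Suc_iff by (simp add: R_Suc D_pos)

lemma L_0_good: "L 0 \<omega> = 0"
proof -
  have "\<omega> \<in> space M" using exiting.regularD(1)[OF exiting_renewed[OF exiting_axioms] good_regular] .
  then show ?thesis using subordinator_pathD(1)[OF L_path] by simp
qed

lemma L'_eq_good: "L' m t \<omega> = L (R m \<omega> + t) \<omega> - L (R m \<omega>) \<omega>"
  using L'_eq[of m t \<omega>] L_0_good by (simp add: R_0)

lemma needs_repair_iff:
  assumes "B \<subseteq> {1..n}"
  shows "r \<le> (\<Sum>i=1..n. 1 - state_of n B i) \<or> \<Phi> (state_of n B) = 0 \<longleftrightarrow> B \<notin> G"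
  using assms unfolding sum_state_of[OF assms] by (auto simp: no_repair_family_def)

text \<open>The bridge between the prescribed recursion, with absolute trigger levels, and the
  renewed systems, with levels relative to the last repair. Times and triggers refer to each other
  and need a joint induction.\<close>

lemma repair_time_trigger:
  "repair_time n \<Phi> r L E m \<omega> = ereal (R m \<omega>) \<and>
   (\<forall>i\<in>{1..n}. trigger n \<Phi> r L E m \<omega> i = L (R m \<omega>) \<omega> + E' m i 0 \<omega>)"
proof (induction m)
  case 0
  then show ?case by (simp add: R_0 renewed_0 L_0_good repair_time.simps trigger.simps)
next
  case (Suc m)
  let ?\<epsilon> = "trigger n \<Phi> r L E m \<omega>"
  have failed: "{i\<in>{1..n}. ?\<epsilon> i \<le> L t \<omega>} = failed n (L' m) (E' m) (t - R m \<omega>) \<omega>" for t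
    using Suc.IH by (auto simp: failed_def L'_eq_good)
  \<comment> \<open>Cycle lengths are strictly positive, so being strictly later than the previous
    repair is implied by the cycle being over.\<close>
  have "{t. repair_time n \<Phi> r L E m \<omega> < ereal t \<and>
       (r \<le> (\<Sum>i=1..n. 1 - comp_state n L ?\<epsilon> t \<omega> i) \<or> \<Phi> (comp_state n L ?\<epsilon> t \<omega>) = 0)} = {R m \<omega> + D m \<omega>..}"
    (is "?T = _")
  proof -
    have "t \<in> ?T \<longleftrightarrow> R m \<omega> < t \<and> failed n (L' m) (E' m) (t - R m \<omega>) \<omega> \<notin> G" for t
      unfolding mem_Collect_eq comp_state_eq failed using Suc.IH
      by (subst needs_repair_iff) (auto simp: failed_def)
    also have "\<dots>t \<longleftrightarrow> R m \<omega> + D m \<omega> \<le> t" for t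
      using D_le_iff[of "t - R m \<omega>" m] D_pos[of m] by auto
    finally show ?thesis by auto
  qed
  then have rt: "repair_time n \<Phi> r L E (Suc m) \<omega> = ereal (R (Suc m) \<omega>)"
    by (simp add: repair_time.simps Let_def R_Suc) (intro antisym INF_lower INF_greatest; simp)
  have set: "{i\<in>{1..n}. ?\<epsilon> i \<le> L (R (Suc m) \<omega>) \<omega>} = S m \<omega>"
    unfolding failed S_eq by (simp add: R_Suc failed_def)
  have "trigger n \<Phi> r L E (Suc m) \<omega> i = L (R (Suc m) \<omega>) \<omega> + E' (Suc m) i 0 \<omega>" if "i \<in> {1..n}" for i
  proof -
    have "trigger n \<Phi> r L E (Suc m) \<omega> i =
        (if i \<in> S m \<omega> then L (R (Suc m) \<omega>) \<omega> + E i (Suc m) \<omega> else ?\<epsilon> i)"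
      using that by (simp only: trigger.simps Let_def rt real_of_ereal.simps comp_state_eq set state_of_eq_0_iff)
    then show ?thesis using Suc.IH that by (simp add: E'_0 L'_eq_good R_Suc)
  qed
  then show ?case using rt by blast
qed

lemma repair_time_eq: "repair_time n \<Phi> r L E m \<omega> = ereal (R m \<omega>)"
  using repair_time_trigger by blast

lemma state_at_repair_eq: "state_at_repair n \<Phi> r L E (Suc m) \<omega> = state_of n (S m \<omega>)"
proof -
  have "{i\<in>{1..n}. trigger n \<Phi> r L E m \<omega> i \<le> L (R (Suc m) \<omega>) \<omega>} = S m \<omega>"
    using repair_time_trigger[of m] by (auto simp: S_eq L'_eq_good R_Suc)
  then show ?thesis by (simp add: state_at_repair_def comp_state_eq repair_time_eq)
qed

lemma num_repaired_eq: "num_repaired n \<Phi> r L E (Suc m) \<omega> = card (S m \<omega>)"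
  unfolding num_repaired_def state_at_repair_eq by (rule sum_state_of[OF S_subset])

lemma system_failure_iff: "system_failure n \<Phi> r L E m \<omega> \<longleftrightarrow> 1 \<le> m \<and> S (m - 1) \<omega> \<in> fail_sets"
  by (cases m) (auto simp: system_failure_def repair_time_eq state_at_repair_eq fail_sets_def)

lemma total_cost_eq:
  "total_cost n \<Phi> r L E c_cmp c_sys t \<omega> = (\<Sum>m\<in>{m. 1 \<le> m \<and> ereal (R m \<omega>) \<le> t}. cost (S (m - 1) \<omega>))"
  unfolding total_cost_def
proof (intro sum.cong)
  fix m assume "m \<in> {m. 1 \<le> m \<and> ereal (R m \<omega>) \<le> t}"
  then obtain l where "m = Suc l" by (cases m) auto
  then show "c_cmp (num_repaired n \<Phi> r L E m \<omega>) + (if system_failure n \<Phi> r L E m \<omega> then c_sys else 0) = cost (S (m - 1) \<omega>)"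
    by (simp add: num_repaired_eq system_failure_iff cost_def)
qed (auto simp: repair_time_eq)

lemma total_cost_at_repair:
  "total_cost n \<Phi> r L E c_cmp c_sys (ereal (R m \<omega>)) \<omega> = (\<Sum>l<m. cost (S l \<omega>))"
proof -
  have "{j. 1 \<le> j \<and> ereal (R j \<omega>) \<le> ereal (R m \<omega>)} = {1..m}"
    using strict_mono_less_eq[OF R_strict_mono] by auto
  then have "total_cost n \<Phi> r L E c_cmp c_sys (ereal (R m \<omega>)) \<omega> = (\<Sum>j\<in>{1..m}. cost (S (j - 1) \<omega>))"
    by (simp only: total_cost_eq)
  also have "\<dots> = (\<Sum>l<m. cost (S l \<omega>))"
    by (rule sum.reindex_bij_witness[of _ Suc "\<lambda>j. j - 1"]) auto
  finally show ?thesis .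
qed

text \<open>Cycles are counted from 0 and repairs from 1, so a failure in cycle \<open>K\<close> is
  seen at repair \<open>Suc K\<close>.\<close>

lemma fail_time_cases:
  obtains (never) "\<And>m. S m \<omega> \<notin> fail_sets" "fail_time n \<Phi> r L E \<omega> = \<infinity>"
  | (fails) K where "S K \<omega> \<in> fail_sets" "\<And>l. l < K \<Longrightarrow> S l \<omega> \<notin> fail_sets"
      "fail_time n \<Phi> r L E \<omega> = ereal (R (Suc K) \<omega>)" "first_failure n \<Phi> r L E \<omega> = Suc K"
proof (cases "\<exists>m. S m \<omega> \<in> fail_sets")
  case False
  then have "\<not> system_failure n \<Phi> r L E m \<omega>" for m by (simp add: system_failure_iff)
  then show ?thesis using False never by (simp add: fail_time_def)
next
  case True
  define K where "K = (LEAST m. S m \<omega> \<in> fail_sets)"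
  have K: "S K \<omega> \<in> fail_sets" unfolding K_def using True by (rule LeastI_ex)
  have less: "S l \<omega> \<notin> fail_sets" if "l < K" for l using not_less_Least that unfolding K_def by blast
  have sf: "system_failure n \<Phi> r L E (Suc K) \<omega>" using K by (simp add: system_failure_iff)
  have ff: "first_failure n \<Phi> r L E \<omega> = Suc K"
    unfolding first_failure_def
  proof (rule Least_equality[of "\<lambda>m. system_failure n \<Phi> r L E m \<omega>", OF sf])
    fix m assume "system_failure n \<Phi> r L E m \<omega>"
    then have m: "1 \<le> m" "S (m - 1) \<omega> \<in> fail_sets" by (auto simp: system_failure_iff)
    then have "\<not> m - 1 < K" using less by blast
    then show "Suc K \<le> m" using m(1) by simp
  qed
  then have "fail_time n \<Phi> r L E \<omega> = ereal (R (Suc K) \<omega>)"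
    using sf by (auto simp: fail_time_def repair_time_eq)
  then show ?thesis using fails K less ff by blast
qed

text \<open>Equality of the two times, not of repair indices, is at issue; repair times increase
  strictly, so a failure at a later repair is at a later time.\<close>

lemma repair_is_failure_iff:
  "repair_time n \<Phi> r L E 1 \<omega> = fail_time n \<Phi> r L E \<omega> \<longleftrightarrow> S 0 \<omega> \<in> fail_sets"
  "repair_time n \<Phi> r L E 1 \<omega> < fail_time n \<Phi> r L E \<omega> \<longleftrightarrow> S 0 \<omega> \<notin> fail_sets"
proof -
  have "(repair_time n \<Phi> r L E 1 \<omega> = fail_time n \<Phi> r L E \<omega> \<longleftrightarrow> S 0 \<omega> \<in> fail_sets) \<and>
    (repair_time n \<Phi> r L E 1 \<omega> < fail_time n \<Phi> r L E \<omega> \<longleftrightarrow> S 0 \<omega> \<notin> fail_sets)"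
  proof (cases rule: fail_time_cases)
    case never
    then show ?thesis by (simp add: repair_time_eq)
  next
    case (fails K)
    show ?thesis
    proof (cases "K = 0")
      case True
      then show ?thesis using fails by (simp add: repair_time_eq)
    next
      case False
      then have "R 1 \<omega> < R (Suc K) \<omega>" using strict_mono_less[OF R_strict_mono, of 1 "Suc K"] by simp
      moreover have "S 0 \<omega> \<notin> fail_sets" using fails(2) False by simp
      ultimately show ?thesis using fails by (simp add: repair_time_eq)
    qed
  qed
  then show "repair_time n \<Phi> r L E 1 \<omega> = fail_time n \<Phi> r L E \<omega> \<longleftrightarrow> S 0 \<omega> \<in> fail_sets"
    "repair_time n \<Phi> r L E 1 \<omega> < fail_time n \<Phi> r L E \<omega> \<longleftrightarrow> S 0 \<omega> \<notin> fail_sets" by blast+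
qed

end

end

section \<open>Signatures\<close>

definition level_family :: "nat \<Rightarrow> nat \<Rightarrow> nat set set" where
  "level_family n m = {B \<in> Pow {1..n}. card B < m}"

text \<open>The probability of \<open>j\<close> failed components at the \<open>m\<close>-th
  failure, split by the number \<open>b\<close> just before it; the closed form of
  \<open>exit_prob\<close> with index \<open>m - 1\<close>.\<close>

definition level_prob :: "(nat \<Rightarrow> real) \<Rightarrow> nat \<Rightarrow> nat \<Rightarrow> nat \<Rightarrow> real" where
  "level_prob \<psi> n m j =
     (if m \<le> j then \<Sum>b<m. real (n choose b) * real ((n - b) choose (j - b)) * jump_prob \<psi> n b j else 0)"

abbreviation subsets :: "nat \<Rightarrow> nat \<Rightarrow> nat set set" where
  "subsets n k \<equiv> {B. B \<subseteq> {1..n} \<and> card B = k}"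

lemma finite_below: "A \<subseteq> {1..n::nat} \<Longrightarrow> finite A"
  by (rule finite_subset[OF _ finite_atLeastAtMost])

lemma finite_subsets: "finite (subsets n k)"
  by (rule finite_subset[of _ "Pow {1..n}"]) auto

lemma working_family_level:
  assumes "m \<in> {1..n}" shows "working_family n (level_family n m)"
  unfolding working_family_def
proof (intro conjI ballI allI impI)
  fix A B assume A: "A \<in> level_family n m" and B: "B \<subseteq> A"
  then have sub: "A \<subseteq> {1..n}" by (simp add: level_family_def)
  have "finite A" by (rule finite_subset[OF sub]) simp
  then have "card B \<le> card A" using B by (rule card_mono)
  then show "B \<in> level_family n m" using A B sub by (auto simp: level_family_def)
qed (use assms in \<open>auto simp: level_family_def\<close>)

lemma level_prob_eq_exit_prob:
  fixes \<Psi> :: "real \<Rightarrow> real"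
  assumes "m \<in> {1..n}" "j \<in> {1..n}" "\<And>c. 1 \<le> c \<Longrightarrow> \<Psi> (real c) \<noteq> 0"
  shows "level_prob (\<lambda>c. \<Psi> (real c)) n m j = (if m \<le> j then exit_prob \<Psi> n (m - 1) j else 0)"
proof (cases "m \<le> j")
  case True
  have "{..m - 1} = {..<m}" using assms(1) by auto
  then show ?thesis using True assms by (simp add: level_prob_def exit_prob_eq)
qed (simp add: level_prob_def)

lemma signature_sum:
  "i \<le> j \<Longrightarrow> (\<Sum>k=Suc i..j. struct_signature n \<Phi> k) = tail_signature n \<Phi> i - tail_signature n \<Phi> j"
proof (induction j)
  case (Suc j)
  show ?case
  proof (cases "i \<le> j")
    case True
    then show ?thesis using Suc.IH by (simp add: struct_signature_def)
  next
    case False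
    then have "i = Suc j" using Suc.prems by simp
    then show ?thesis by simp
  qed
qed simp

text \<open>Passes from states with \<open>n - k\<close> ones to sets of \<open>k\<close> failed
  components, on which the exit laws live.\<close>

lemma sum_works:
  assumes "k \<le> n"
  shows "(\<Sum>B\<in>subsets n k. real (\<Phi> (state_of n B))) = real (n choose k) * tail_signature n \<Phi> k"
proof -
  let ?X = "{x \<in> states n. (\<Sum>i=1..n. x i) = n - k}"
  have sum_state: "(\<Sum>i=1..n. state_of n B i) = n - card B" if "B \<subseteq> {1..n}" for B
  proof -
    have "(\<Sum>i=1..n. state_of n B i) = (\<Sum>i\<in>{1..n}. if i \<in> - B then 1 else 0)"
      by (intro sum.cong) (auto simp: state_of_def)
    also have "\<dots> = card ({1..n} \<inter> - B)" by (simp add: sum.If_cases Compl_eq)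
    also have "{1..n} \<inter> - B = {1..n} - B" by blast
    finally show ?thesis using that by (simp add: card_Diff_subset finite_subset)
  qed
  have "(\<Sum>B\<in>subsets n k. real (\<Phi> (state_of n B))) = (\<Sum>x\<in>?X. real (\<Phi> x))"
  proof (rule sum.reindex_bij_witness[of _ "\<lambda>x. {i\<in>{1..n}. x i = 0}" "state_of n"])
    fix B assume "B \<in> subsets n k"
    then have B: "B \<subseteq> {1..n}" "card B = k" by auto
    show "{i\<in>{1..n}. state_of n B i = 0} = B" using B(1) state_of_eq_0_iff[of _ n B] by blast
    show "state_of n B \<in> ?X" unfolding mem_Collect_eq sum_state[OF B(1)] B(2) using state_of_in_states[of n B] by (intro conjI refl)
  next
    fix x assume x: "x \<in> ?X"
    then have x1: "x \<in> states n" and x2: "(\<Sum>i=1..n. x i) = n - k" by blast+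
    have vals: "x i = 0 \<or> x i = 1" if "i \<in> {1..n}" for i using PiE_mem[OF x1 that] by simp
    show eq: "state_of n {i\<in>{1..n}. x i = 0} = x"
    proof
      fix i show "state_of n {i\<in>{1..n}. x i = 0} i = x i"
        using vals[of i] PiE_arb[OF x1, of i] by (cases "i \<in> {1..n}") (auto simp: state_of_def)
    qed
    have "(\<Sum>i=1..n. x i) = n - card {i\<in>{1..n}. x i = 0}" using sum_state[of "{i\<in>{1..n}. x i = 0}"] unfolding eq by blast
    then have "n - card {i\<in>{1..n}. x i = 0} = n - k" using x2 by simp
    moreover have "card {i\<in>{1..n}. x i = 0} \<le> card {1..n}" by (rule card_mono) auto
    ultimately show "{i\<in>{1..n}. x i = 0} \<in> subsets n k" using assms by auto
  qed simp
  then show ?thesis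
    using assms by (simp add: tail_signature_def binomial_symmetric[of k n])
qed

lemma
  assumes "semi_coherent n \<Phi>"
  shows tail_signature_0: "tail_signature n \<Phi> 0 = 1" and tail_signature_n: "tail_signature n \<Phi> n = 0"
proof -
  have "B = {}" if "B \<in> subsets n 0" for B
  proof -
    have "finite B" using that finite_below[of B n] by blast
    then show ?thesis using that by simp
  qed
  then have "subsets n 0 = {{}}" by auto
  then show "tail_signature n \<Phi> 0 = 1"
    using sum_works[of 0 n \<Phi>] semi_coherent_values(2)[OF assms] by simp
  have "B = {1..n}" if "B \<in> subsets n n" for B using that card_subset_eq[of "{1..n}" B] by simp
  then have "subsets n n = {{1..n}}" by auto
  then show "tail_signature n \<Phi> n = 0"
    using sum_works[of n n \<Phi>] semi_coherent_values(3)[OF assms] by simp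
qed

lemma card_supersets:
  assumes "B \<subseteq> {1..n}" "card B = b" "b \<le> j"
  shows "card {A \<in> subsets n j. B \<subseteq> A} = (n - b) choose (j - b)"
proof -
  have fin: "finite B" by (rule finite_subset[OF assms(1)]) simp
  have "bij_betw (\<lambda>A. A - B) {A \<in> subsets n j. B \<subseteq> A} {C. C \<subseteq> {1..n} - B \<and> card C = j - b}"
  proof (rule bij_betw_byWitness[of _ "\<lambda>C. C \<union> B"])
    show "(\<lambda>A. A - B) ` {A \<in> subsets n j. B \<subseteq> A} \<subseteq> {C. C \<subseteq> {1..n} - B \<and> card C = j - b}"
      using fin assms(2) by (auto simp: card_Diff_subset)
    show "(\<lambda>C. C \<union> B) ` {C. C \<subseteq> {1..n} - B \<and> card C = j - b} \<subseteq> {A \<in> subsets n j. B \<subseteq> A}"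
    proof (rule image_subsetI)
      fix C assume C: "C \<in> {C. C \<subseteq> {1..n} - B \<and> card C = j - b}"
      then have "finite C" using finite_below[of C n] by blast
      moreover have "C \<inter> B = {}" using C by blast
      ultimately have "card (C \<union> B) = j" using C fin assms by (simp add: card_Un_disjoint)
      then show "C \<union> B \<in> {A \<in> subsets n j. B \<subseteq> A}" using C assms by auto
    qed
  qed auto
  then have "card {A \<in> subsets n j. B \<subseteq> A} = card {C. C \<subseteq> {1..n} - B \<and> card C = j - b}"
    by (rule bij_betw_same_card)
  also have "\<dots> = card ({1..n} - B) choose (j - b)" by (rule n_subsets) simp
  also have "card ({1..n} - B) = n - b" using assms fin by (simp add: card_Diff_subset)
  finally show ?thesis .
qed

text \<open>Counts pairs \<open>B \<subseteq> A\<close> of given sizes from the smaller set; the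
  next lemma counts them from the larger one. Together they average a difference of values at
  \<open>B\<close> and at \<open>A\<close>.\<close>

lemma sum_pairs_lower:
  fixes u :: "nat set \<Rightarrow> real"
  assumes "b \<le> j"
  shows "(\<Sum>A\<in>subsets n j. \<Sum>B\<in>{B \<in> subsets n b. B \<subseteq> A}. u B) = real ((n - b) choose (j - b)) * (\<Sum>B\<in>subsets n b. u B)"
proof -
  have "(\<Sum>A\<in>subsets n j. \<Sum>B\<in>{B \<in> subsets n b. B \<subseteq> A}. u B) = (\<Sum>B\<in>subsets n b. \<Sum>A\<in>{A \<in> subsets n j. B \<subseteq> A}. u B)"
    by (rule sum.swap_restrict) (rule finite_subsets)+
  also have "\<dots> = (\<Sum>B\<in>subsets n b. real ((n - b) choose (j - b)) * u B)"
    using card_supersets[OF _ _ assms] by (intro sum.cong) auto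
  finally show ?thesis by (simp add: sum_distrib_left)
qed

lemma sum_pairs_upper:
  fixes v :: "nat set \<Rightarrow> real"
  shows "(\<Sum>A\<in>subsets n j. \<Sum>B\<in>{B \<in> subsets n b. B \<subseteq> A}. v A) = real (j choose b) * (\<Sum>A\<in>subsets n j. v A)"
proof -
  have "card {B \<in> subsets n b. B \<subseteq> A} = j choose b" if "A \<in> subsets n j" for A
  proof -
    have "{B \<in> subsets n b. B \<subseteq> A} = {B. B \<subseteq> A \<and> card B = b}" using that by auto
    moreover have "finite A" using that finite_below[of A n] by blast
    ultimately show ?thesis using that by (simp add: n_subsets)
  qed
  then show ?thesis by (simp add: sum_distrib_left)
qed

text \<open>The rate of jumps between two given failure sets depends on their sizes only, so the exit law
  reduces to a count of the pairs \<open>B \<subseteq> A\<close> of these sizes.\<close>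

lemma sum_exit_law:
  assumes G: "working_family n G" and j: "j \<le> n"
  shows "(\<Sum>A\<in>{A \<in> subsets n j. A \<notin> G}. f A * exit_law \<psi> n G A) =
    (\<Sum>b<j. jump_prob \<psi> n b j * (\<Sum>A\<in>subsets n j. \<Sum>B\<in>{B \<in> subsets n b. B \<subseteq> A}. f A * of_bool (A \<notin> G \<and> B \<in> G)))"
proof -
  have inner: "of_bool (A \<notin> G) * exit_law \<psi> n G A =
     (\<Sum>b<j. \<Sum>B\<in>{B \<in> subsets n b. B \<subseteq> A}. jump_prob \<psi> n b j * of_bool (A \<notin> G \<and> B \<in> G))" if A: "A \<in> subsets n j" for A
  proof (cases "A \<in> G")
    case False
    have fin: "finite A" using A finite_below[of A n] by blast
    have "{B \<in> G. B \<subseteq> A} = (\<Union>b<j. {B \<in> subsets n b. B \<subseteq> A \<and> B \<in> G})"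
    proof (rule set_eqI, rule iffI)
      fix B assume B: "B \<in> {B \<in> G. B \<subseteq> A}"
      then have "B \<subset> A" using False by blast
      then have "card B < j" using psubset_card_mono[OF fin] A by auto
      moreover have "B \<subseteq> {1..n}" using A B by blast
      ultimately show "B \<in> (\<Union>b<j. {B \<in> subsets n b. B \<subseteq> A \<and> B \<in> G})" using B by auto
    qed auto
    then have "exit_law \<psi> n G A = (\<Sum>B\<in>(\<Union>b<j. {B \<in> subsets n b. B \<subseteq> A \<and> B \<in> G}). jump_prob \<psi> n (card B) j)"
      using A by (simp add: exit_law_def)
    also have "\<dots> = (\<Sum>b<j. \<Sum>B\<in>{B \<in> subsets n b. B \<subseteq> A \<and> B \<in> G}. jump_prob \<psi> n (card B) j)"
      by (rule sum.UNION_disjoint) (auto intro: finite_subset[OF _ finite_subsets])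
    also have "\<dots> = (\<Sum>b<j. \<Sum>B\<in>{B \<in> subsets n b. B \<subseteq> A}. jump_prob \<psi> n b j * of_bool (A \<notin> G \<and> B \<in> G))"
    proof (rule sum.cong[OF refl])
      fix b
      show "(\<Sum>B\<in>{B \<in> subsets n b. B \<subseteq> A \<and> B \<in> G}. jump_prob \<psi> n (card B) j) =
         (\<Sum>B\<in>{B \<in> subsets n b. B \<subseteq> A}. jump_prob \<psi> n b j * of_bool (A \<notin> G \<and> B \<in> G))"
        using False by (intro sum.mono_neutral_cong_left) (auto intro: finite_subset[OF _ finite_subsets])
    qed
    finally show ?thesis using False by simp
  qed simp
  have "(\<Sum>A\<in>{A \<in> subsets n j. A \<notin> G}. f A * exit_law \<psi> n G A) =
     (\<Sum>A\<in>subsets n j. f A * (of_bool (A \<notin> G) * exit_law \<psi> n G A))"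
    by (intro sum.mono_neutral_cong_left finite_subsets) auto
  also have "\<dots> = (\<Sum>A\<in>subsets n j. \<Sum>b<j. jump_prob \<psi> n b j * (\<Sum>B\<in>{B \<in> subsets n b. B \<subseteq> A}. f A * of_bool (A \<notin> G \<and> B \<in> G)))"
    by (intro sum.cong refl) (simp only: inner, simp add: sum_distrib_left mult_ac)
  also have "\<dots> = (\<Sum>b<j. jump_prob \<psi> n b j * (\<Sum>A\<in>subsets n j. \<Sum>B\<in>{B \<in> subsets n b. B \<subseteq> A}. f A * of_bool (A \<notin> G \<and> B \<in> G)))"
    by (subst sum.swap) (simp add: sum_distrib_left)
  finally show ?thesis .
qed

lemma weight_mean_card:
  "weight_mean \<psi> n G (\<lambda>A. of_bool (card A = j \<and> P A)) 0 = (\<Sum>A\<in>{A \<in> subsets n j. A \<notin> G}. of_bool (P A) * exit_law \<psi> n G A)"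
proof -
  have "(\<Sum>A\<in>{A \<in> subsets n j. A \<notin> G}. of_bool (P A) * exit_law \<psi> n G A) =
     (\<Sum>A\<in>Pow {1..n} - G. of_bool (card A = j \<and> P A) * exit_law \<psi> n G A)"
    by (rule sum.mono_neutral_cong_left) auto
  then show ?thesis by (simp add: weight_mean_def)
qed

lemma choose_pairs: "b \<le> j \<Longrightarrow> j \<le> n \<Longrightarrow>
  real (j choose b) * real (n choose j) = real (n choose b) * real ((n - b) choose (j - b))"
  using choose_mult[of b j n] by (metis mult.commute of_nat_mult)

text \<open>Membership in a level family depends on size only, so the pair count is a product of
  binomials.\<close>

lemma weight_mean_level:
  assumes m: "m \<in> {1..n}" and j: "j \<in> {1..n}"
  shows "weight_mean \<psi> n (level_family n m) (\<lambda>A. of_bool (card A = j)) 0 = level_prob \<psi> n m j"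
proof -
  have "weight_mean \<psi> n (level_family n m) (\<lambda>A. of_bool (card A = j)) 0 =
     (\<Sum>b<j. jump_prob \<psi> n b j * (\<Sum>A\<in>subsets n j. \<Sum>B\<in>{B \<in> subsets n b. B \<subseteq> A}. 1 * of_bool (A \<notin> level_family n m \<and> B \<in> level_family n m)))"
    using weight_mean_card[of \<psi> n "level_family n m" j "\<lambda>_. True"] j
      sum_exit_law[OF working_family_level[OF m], of j "\<lambda>_. 1"] by simp
  also have "\<dots> = (\<Sum>b<j. if m \<le> j \<and> b < m then jump_prob \<psi> n b j * (real (n choose b) * real ((n - b) choose (j - b))) else 0)"
  proof (rule sum.cong[OF refl])
    fix b assume b: "b \<in> {..<j}"
    have "(\<Sum>A\<in>subsets n j. \<Sum>B\<in>{B \<in> subsets n b. B \<subseteq> A}. 1 * of_bool (A \<notin> level_family n m \<and> B \<in> level_family n m)) =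
       (\<Sum>A\<in>subsets n j. \<Sum>B\<in>{B \<in> subsets n b. B \<subseteq> A}. of_bool (m \<le> j \<and> b < m) :: real)"
      by (intro sum.cong) (auto simp: level_family_def)
    also have "\<dots> = of_bool (m \<le> j \<and> b < m) * (real (n choose b) * real ((n - b) choose (j - b)))"
      using choose_pairs[of b j n] b j by (subst sum_pairs_upper) (simp add: n_subsets mult_ac)
    finally show "jump_prob \<psi> n b j * (\<Sum>A\<in>subsets n j. \<Sum>B\<in>{B \<in> subsets n b. B \<subseteq> A}. 1 * of_bool (A \<notin> level_family n m \<and> B \<in> level_family n m)) =
        (if m \<le> j \<and> b < m then jump_prob \<psi> n b j * (real (n choose b) * real ((n - b) choose (j - b))) else 0)"
      by simp
  qed
  also have "\<dots> = level_prob \<psi> n m j"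
  proof (cases "m \<le> j")
    case True
    then have "(\<Sum>b<j. if m \<le> j \<and> b < m then jump_prob \<psi> n b j * (real (n choose b) * real ((n - b) choose (j - b))) else 0) =
      (\<Sum>b<m. real (n choose b) * real ((n - b) choose (j - b)) * jump_prob \<psi> n b j)"
      by (intro sum.mono_neutral_cong_right) auto
    then show ?thesis using True by (simp add: level_prob_def)
  qed (simp add: level_prob_def)
  finally show ?thesis .
qed

section \<open>Mixtures over the signature\<close>

context
  fixes n r :: nat and \<Phi> :: "(nat \<Rightarrow> nat) \<Rightarrow> nat" and s :: "nat \<Rightarrow> real"
  assumes \<Phi>: "semi_coherent n \<Phi>" and r: "r \<in> {1..n}" and s: "s = struct_signature n \<Phi>"
begin

lemma \<Phi>_cases: "\<Phi> (state_of n B) = 0 \<or> \<Phi> (state_of n B) = 1"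
  using semi_coherent_values(1)[OF \<Phi>, of B] by simp

text \<open>Averaged over pairs of sizes \<open>b\<close> and \<open>j\<close>, the event that the
  smaller set works and the larger fails has frequency equal to a difference of tail signatures,
  that is the sum of \<open>s k\<close> over \<open>b < k \<le> j\<close>. Exchanging the sums
  combines \<open>b < k\<close> with \<open>b < r\<close> into \<open>b < min r k\<close>, the range
  defining a level probability.\<close>

lemma weight_mean_fail:
  assumes j: "j \<in> {1..n}"
  shows "weight_mean \<psi> n (no_repair_family n \<Phi> r) (\<lambda>A. of_bool (card A = j \<and> \<Phi> (state_of n A) = 0)) 0 =
    (\<Sum>k=1..j. s k * level_prob \<psi> n (min r k) j)"
proof -
  let ?G = "no_repair_family n \<Phi> r" and ?q = "\<lambda>b. real (n choose b) * real ((n - b) choose (j - b)) * jump_prob \<psi> n b j"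
  have "weight_mean \<psi> n ?G (\<lambda>A. of_bool (card A = j \<and> \<Phi> (state_of n A) = 0)) 0 =
     (\<Sum>b<j. jump_prob \<psi> n b j * (\<Sum>A\<in>subsets n j. \<Sum>B\<in>{B \<in> subsets n b. B \<subseteq> A}.
        of_bool (\<Phi> (state_of n A) = 0) * of_bool (A \<notin> ?G \<and> B \<in> ?G)))"
    unfolding weight_mean_card using j by (intro sum_exit_law working_family_no_repair \<Phi> r) simp
  also have "\<dots> = (\<Sum>b<j. of_bool (b < r) * (?q b * (tail_signature n \<Phi> b - tail_signature n \<Phi> j)))"
  proof (rule sum.cong[OF refl])
    fix b assume b: "b \<in> {..<j}"
    \<comment> \<open>By monotonicity, a working \<open>B\<close> inside a failed \<open>A\<close>
      is a difference of two values of \<Phi>; a failed \<open>A\<close> is outside the family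
      without regard to its size.\<close>
    have "(\<Sum>A\<in>subsets n j. \<Sum>B\<in>{B \<in> subsets n b. B \<subseteq> A}. of_bool (\<Phi> (state_of n A) = 0) * of_bool (A \<notin> ?G \<and> B \<in> ?G)) =
       (\<Sum>A\<in>subsets n j. \<Sum>B\<in>{B \<in> subsets n b. B \<subseteq> A}. of_bool (b < r) * real (\<Phi> (state_of n B))) -
       (\<Sum>A\<in>subsets n j. \<Sum>B\<in>{B \<in> subsets n b. B \<subseteq> A}. of_bool (b < r) * real (\<Phi> (state_of n A)))"
      unfolding sum_subtractf[symmetric]
    proof (intro sum.cong refl)
      fix A B assume "A \<in> subsets n j" "B \<in> {B \<in> subsets n b. B \<subseteq> A}"
      moreover have "\<Phi> (state_of n A) \<le> \<Phi> (state_of n B)" using calculation by (intro semi_coherent_mono[OF \<Phi>]) auto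
      ultimately show "of_bool (\<Phi> (state_of n A) = 0) * of_bool (A \<notin> ?G \<and> B \<in> ?G) =
         of_bool (b < r) * real (\<Phi> (state_of n B)) - of_bool (b < r) * real (\<Phi> (state_of n A))"
        using \<Phi>_cases[of A] \<Phi>_cases[of B] by (auto simp: no_repair_family_def)
    qed
    also have "\<dots> = of_bool (b < r) * (real (n choose b) * real ((n - b) choose (j - b)) * (tail_signature n \<Phi> b - tail_signature n \<Phi> j))"
    proof -
      have bj: "b \<le> j" "b \<le> n" "j \<le> n" using b j by auto
      show ?thesis
        unfolding sum_pairs_lower[OF bj(1)] sum_pairs_upper sum_distrib_left[symmetric] sum_works[OF bj(2)] sum_works[OF bj(3)]
        using choose_pairs[OF bj(1,3)] by (simp add: algebra_simps)
    qed
    finally show "jump_prob \<psi> n b j * (\<Sum>A\<in>subsets n j. \<Sum>B\<in>{B \<in> subsets n b. B \<subseteq> A}. of_bool (\<Phi> (state_of n A) = 0) * of_bool (A \<notin> ?G \<and> B \<in> ?G)) =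
       of_bool (b < r) * (?q b * (tail_signature n \<Phi> b - tail_signature n \<Phi> j))"
      by (simp add: mult_ac)
  qed
  also have "\<dots> = (\<Sum>b<j. \<Sum>k=1..j. of_bool (b < r) * of_bool (b < k) * (?q b * s k))"
  proof (rule sum.cong[OF refl])
    fix b assume b: "b \<in> {..<j}"
    have "(\<Sum>k=Suc b..j. s k) = (\<Sum>k=1..j. of_bool (b < k) * s k)"
      by (rule sum.mono_neutral_cong_left) auto
    then have eq: "tail_signature n \<Phi> b - tail_signature n \<Phi> j = (\<Sum>k=1..j. of_bool (b < k) * s k)"
      using b signature_sum[of b j n \<Phi>] by (simp only: s lessThan_iff less_imp_le)
    show "of_bool (b < r) * (?q b * (tail_signature n \<Phi> b - tail_signature n \<Phi> j)) =
       (\<Sum>k=1..j. of_bool (b < r) * of_bool (b < k) * (?q b * s k))"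
      unfolding eq sum_distrib_left by (intro sum.cong refl) (simp only: mult_ac)
  qed
  also have "\<dots> = (\<Sum>k=1..j. s k * (\<Sum>b<j. of_bool (b < r) * of_bool (b < k) * ?q b))"
    by (subst sum.swap) (simp add: sum_distrib_left mult_ac)
  also have "\<dots> = (\<Sum>k=1..j. s k * level_prob \<psi> n (min r k) j)"
  proof (rule sum.cong[OF refl])
    fix k assume k: "k \<in> {1..j}"
    have "(\<Sum>b<j. of_bool (b < r) * of_bool (b < k) * ?q b) = (\<Sum>b<min r k. ?q b)"
      using k by (intro sum.mono_neutral_cong_right) auto
    moreover have "min r k \<le> j" using k by auto
    ultimately show "s k * (\<Sum>b<j. of_bool (b < r) * of_bool (b < k) * ?q b) = s k * level_prob \<psi> n (min r k) j"
      by (simp only: level_prob_def if_True)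
  qed
  finally show ?thesis .
qed

text \<open>If \<open>A\<close> works, the exit is due to its size, so \<open>r \<le> j\<close>, and
  every \<open>B\<close> inside \<open>A\<close> works by monotonicity. Only the average of \<Phi>
  over sets of size \<open>j\<close> remains, which is the sum of \<open>s k\<close> over
  \<open>k > j\<close>.\<close>

lemma weight_mean_no_fail:
  assumes j: "j \<in> {1..n}"
  shows "weight_mean \<psi> n (no_repair_family n \<Phi> r) (\<lambda>A. of_bool (card A = j \<and> \<Phi> (state_of n A) \<noteq> 0)) 0 =
    (if r \<le> j then (\<Sum>k=j+1..n. s k * level_prob \<psi> n r j) else 0)"
proof -
  let ?G = "no_repair_family n \<Phi> r" and ?q = "\<lambda>b. real (n choose b) * real ((n - b) choose (j - b)) * jump_prob \<psi> n b j"
  have "weight_mean \<psi> n ?G (\<lambda>A. of_bool (card A = j \<and> \<Phi> (state_of n A) \<noteq> 0)) 0 =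
     (\<Sum>b<j. jump_prob \<psi> n b j * (\<Sum>A\<in>subsets n j. \<Sum>B\<in>{B \<in> subsets n b. B \<subseteq> A}.
        of_bool (\<Phi> (state_of n A) \<noteq> 0) * of_bool (A \<notin> ?G \<and> B \<in> ?G)))"
    unfolding weight_mean_card using j by (intro sum_exit_law working_family_no_repair \<Phi> r) simp
  also have "\<dots> = (\<Sum>b<j. of_bool (b < r \<and> r \<le> j) * (?q b * tail_signature n \<Phi> j))"
  proof (rule sum.cong[OF refl])
    fix b assume b: "b \<in> {..<j}"
    have "(\<Sum>A\<in>subsets n j. \<Sum>B\<in>{B \<in> subsets n b. B \<subseteq> A}. of_bool (\<Phi> (state_of n A) \<noteq> 0) * of_bool (A \<notin> ?G \<and> B \<in> ?G)) =
       (\<Sum>A\<in>subsets n j. \<Sum>B\<in>{B \<in> subsets n b. B \<subseteq> A}. of_bool (b < r \<and> r \<le> j) * real (\<Phi> (state_of n A)))"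
    proof (intro sum.cong refl)
      fix A B assume "A \<in> subsets n j" "B \<in> {B \<in> subsets n b. B \<subseteq> A}"
      moreover have "\<Phi> (state_of n A) \<le> \<Phi> (state_of n B)" using calculation by (intro semi_coherent_mono[OF \<Phi>]) auto
      ultimately show "of_bool (\<Phi> (state_of n A) \<noteq> 0) * of_bool (A \<notin> ?G \<and> B \<in> ?G) =
         of_bool (b < r \<and> r \<le> j) * real (\<Phi> (state_of n A))"
        using \<Phi>_cases[of A] \<Phi>_cases[of B] by (auto simp: no_repair_family_def)
    qed
    also have "\<dots> = of_bool (b < r \<and> r \<le> j) * (real (n choose b) * real ((n - b) choose (j - b)) * tail_signature n \<Phi> j)"
    proof -
      have bj: "b \<le> j" "j \<le> n" using b j by auto
      show ?thesis
        unfolding sum_pairs_upper sum_distrib_left[symmetric] sum_works[OF bj(2)]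
        using choose_pairs[OF bj] by (simp add: algebra_simps)
    qed
    finally show "jump_prob \<psi> n b j * (\<Sum>A\<in>subsets n j. \<Sum>B\<in>{B \<in> subsets n b. B \<subseteq> A}. of_bool (\<Phi> (state_of n A) \<noteq> 0) * of_bool (A \<notin> ?G \<and> B \<in> ?G)) =
       of_bool (b < r \<and> r \<le> j) * (?q b * tail_signature n \<Phi> j)"
      by (simp add: mult_ac)
  qed
  also have "\<dots> = (if r \<le> j then (\<Sum>k=j+1..n. s k * level_prob \<psi> n r j) else 0)"
  proof (cases "r \<le> j")
    case True
    have "(\<Sum>b<j. of_bool (b < r \<and> r \<le> j) * (?q b * tail_signature n \<Phi> j)) = (\<Sum>b<r. ?q b * tail_signature n \<Phi> j)"
      using True by (intro sum.mono_neutral_cong_right) auto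
    also have "\<dots> = (\<Sum>b<r. ?q b) * tail_signature n \<Phi> j" by (rule sum_distrib_right[symmetric])
    also have "(\<Sum>b<r. ?q b) = level_prob \<psi> n r j" using True by (simp add: level_prob_def)
    finally have sum: "(\<Sum>b<j. of_bool (b < r \<and> r \<le> j) * (?q b * tail_signature n \<Phi> j)) =
       level_prob \<psi> n r j * tail_signature n \<Phi> j" .
    have "tail_signature n \<Phi> j = (\<Sum>k=j+1..n. s k)"
      using j signature_sum[of j n n \<Phi>] tail_signature_n[OF \<Phi>] by (simp add: s)
    then have "level_prob \<psi> n r j * tail_signature n \<Phi> j = (\<Sum>k=j+1..n. s k * level_prob \<psi> n r j)"
      by (simp add: sum_distrib_left mult.commute)
    then show ?thesis unfolding sum using True by simp
  qed simp
  finally show ?thesis .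
qed

lemma exit_mean_level:
  "exit_mean \<psi> n (level_family n m) = (\<Sum>b<m. real (n choose b) * fdiff (\<lambda>c. 1 / \<psi> c) b (n - b))"
proof -
  have "level_family n m = (\<Union>b<m. subsets n b)" by (auto simp: level_family_def)
  then have "exit_mean \<psi> n (level_family n m) = (\<Sum>B\<in>(\<Union>b<m. subsets n b). fdiff (\<lambda>c. 1 / \<psi> c) (card B) (n - card B))"
    by (simp add: exit_mean_def)
  also have "\<dots> = (\<Sum>b<m. \<Sum>B\<in>subsets n b. fdiff (\<lambda>c. 1 / \<psi> c) (card B) (n - card B))"
    by (rule sum.UNION_disjoint) (auto intro: finite_subsets)
  also have "\<dots> = (\<Sum>b<m. real (n choose b) * fdiff (\<lambda>c. 1 / \<psi> c) b (n - b))"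
    by (intro sum.cong) (auto simp: n_subsets)
  finally show ?thesis .
qed

text \<open>The time spent in sets of size \<open>b < r\<close> is weighted by the fraction of them
  that work, which is the sum of \<open>s k\<close> over \<open>k > b\<close>; again the conditions
  on \<open>b\<close> combine to a minimum.\<close>

lemma exit_mean_no_repair:
  "exit_mean \<psi> n (no_repair_family n \<Phi> r) = (\<Sum>k=1..n. s k * exit_mean \<psi> n (level_family n (min k r)))"
proof -
  let ?G = "no_repair_family n \<Phi> r" and ?g = "\<lambda>b. fdiff (\<lambda>c. 1 / \<psi> c) b (n - b)"
  have "exit_mean \<psi> n ?G = (\<Sum>B\<in>(\<Union>b<r. subsets n b). real (\<Phi> (state_of n B)) * ?g (card B))"
    unfolding exit_mean_def
  proof (rule sum.mono_neutral_cong_left)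
    show "finite (\<Union>b<r. subsets n b)" using finite_subsets by auto
    show "\<forall>B\<in>(\<Union>b<r. subsets n b) - ?G. real (\<Phi> (state_of n B)) * ?g (card B) = 0"
      by (auto simp: no_repair_family_def)
    show "?g (card B) = real (\<Phi> (state_of n B)) * ?g (card B)" if "B \<in> ?G" for B
      using that \<Phi>_cases[of B] by (auto simp: no_repair_family_def)
  qed (auto simp: no_repair_family_def)
  also have "\<dots> = (\<Sum>b<r. \<Sum>B\<in>subsets n b. real (\<Phi> (state_of n B)) * ?g (card B))"
    by (rule sum.UNION_disjoint) (auto intro: finite_subsets)
  also have "\<dots> = (\<Sum>b<r. \<Sum>k=1..n. of_bool (b < k) * (s k * (real (n choose b) * ?g b)))"
  proof (rule sum.cong[OF refl])
    fix b assume "b \<in> {..<r}"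
    then have b: "b \<le> n" using r by simp
    have "(\<Sum>B\<in>subsets n b. real (\<Phi> (state_of n B)) * ?g (card B)) = real (n choose b) * tail_signature n \<Phi> b * ?g b"
      by (simp add: sum_works[OF b, symmetric] sum_distrib_right)
    also have "tail_signature n \<Phi> b = (\<Sum>k=Suc b..n. s k)"
      using signature_sum[OF b, of n \<Phi>] tail_signature_n[OF \<Phi>] by (simp add: s)
    also have "\<dots> = (\<Sum>k=1..n. of_bool (b < k) * s k)"
      by (rule sum.mono_neutral_cong_left) auto
    finally show "(\<Sum>B\<in>subsets n b. real (\<Phi> (state_of n B)) * ?g (card B)) =
       (\<Sum>k=1..n. of_bool (b < k) * (s k * (real (n choose b) * ?g b)))"
      by (simp only: sum_distrib_left sum_distrib_right mult_ac)
  qed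
  also have "\<dots> = (\<Sum>k=1..n. s k * (\<Sum>b<r. of_bool (b < k) * (real (n choose b) * ?g b)))"
    by (subst sum.swap) (simp add: sum_distrib_left mult_ac)
  also have "\<dots> = (\<Sum>k=1..n. s k * exit_mean \<psi> n (level_family n (min k r)))"
  proof (rule sum.cong[OF refl])
    fix k
    have "(\<Sum>b<r. of_bool (b < k) * (real (n choose b) * ?g b)) = (\<Sum>b<min k r. real (n choose b) * ?g b)"
      by (intro sum.mono_neutral_cong_right) auto
    then show "s k * (\<Sum>b<r. of_bool (b < k) * (real (n choose b) * ?g b)) = s k * exit_mean \<psi> n (level_family n (min k r))"
      by (simp add: exit_mean_level)
  qed
  finally show ?thesis .
qed

end

section \<open>Exponential triggers under a Levy subordinator\<close>

locale lfmo = prob_space M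
  for M :: "'a measure" +
  fixes L :: "real \<Rightarrow> 'a \<Rightarrow> real" and E :: "nat \<Rightarrow> nat \<Rightarrow> 'a \<Rightarrow> real" and n :: nat
  assumes subordinator: "levy_subordinator M L" and triggers: "exponential_triggers M n L E"
begin

definition \<psi> :: "nat \<Rightarrow> real" where "\<psi> c = laplace_exponent M L (real c)"

lemma L_meas: "0 \<le> t \<Longrightarrow> L t \<in> borel_measurable M"
  using subordinator by (simp add: levy_subordinator_def levy_process_def)

lemma L_subordinator_path: "\<omega> \<in> space M \<Longrightarrow> subordinator_path (\<lambda>t. L t \<omega>)"
  using subordinator unfolding levy_subordinator_def levy_process_def subordinator_path_def by simp

lemma L_nonneg: "\<omega> \<in> space M \<Longrightarrow> 0 \<le> t \<Longrightarrow> 0 \<le> L t \<omega>"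
  using subordinator_path_nonneg[OF L_subordinator_path] .

lemma L_increments:
  "0 \<le> ts 0 \<Longrightarrow> (\<And>i. i < k \<Longrightarrow> ts i \<le> ts (Suc i)) \<Longrightarrow>
   indep_vars (\<lambda>_. borel) (\<lambda>i \<omega>. L (ts (Suc i)) \<omega> - L (ts i) \<omega>) {..<k}" for k :: nat
  using subordinator unfolding levy_subordinator_def levy_process_def by blast

lemma L_stationary: "0 \<le> x \<Longrightarrow> 0 \<le> h \<Longrightarrow> distr M borel (\<lambda>\<omega>. L (x + h) \<omega> - L x \<omega>) = distr M borel (L h)"
  using subordinator unfolding levy_subordinator_def levy_process_def by simp

lemma E_distributed: "i \<in> {1..n} \<Longrightarrow> distributed M lborel (E i m) (exponential_density 1)"
  using triggers by (simp add: exponential_triggers_def)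

lemma E_meas: "i \<in> {1..n} \<Longrightarrow> E i m \<in> borel_measurable M"
  using distributed_measurable[OF E_distributed] by simp

lemma E_indep: "indep_vars (\<lambda>_. borel) (\<lambda>q. E (fst q) (snd q)) ({1..n} \<times> UNIV)"
  using triggers unfolding exponential_triggers_def case_prod_beta' by simp

lemma E_gt: "i \<in> {1..n} \<Longrightarrow> 0 \<le> x \<Longrightarrow> \<P>(\<omega> in M. x < E i m \<omega>) = exp (- x)"
  using exponential_distributedD_gt[OF E_distributed, of i x m] by simp

section \<open>Laplace transforms of dyadic increments\<close>

definition increment :: "nat \<Rightarrow> nat \<Rightarrow> 'a \<Rightarrow> real" where
  "increment k j \<omega> = L (real (Suc j) / 2 ^ k) \<omega> - L (real j / 2 ^ k) \<omega>"

lemma increment_indep: "indep_vars (\<lambda>_. borel) (increment k) {..<J}"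
  using L_increments[of "\<lambda>j. real j / 2 ^ k" J] by (simp add: increment_def[abs_def] divide_right_mono)

lemma increment_measurable: "increment k j \<in> borel_measurable M"
  unfolding increment_def[abs_def] by (intro borel_measurable_diff L_meas) auto

lemma increment_nonneg: "\<omega> \<in> space M \<Longrightarrow> 0 \<le> increment k j \<omega>"
  unfolding increment_def
  using subordinator_pathD(2)[OF L_subordinator_path, of \<omega> "real j / 2 ^ k" "real (Suc j) / 2 ^ k"]
  by (simp add: divide_right_mono)

lemma sum_increment:
  "a \<le> b \<Longrightarrow> (\<Sum>j=a..<b. increment k j \<omega>) = L (real b / 2 ^ k) \<omega> - L (real a / 2 ^ k) \<omega>"
  unfolding increment_def using sum_Suc_diff'[of a b "\<lambda>j. L (real j / 2 ^ k) \<omega>"] by simp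

lemma increment_laplace_int: "integrable M (\<lambda>\<omega>. exp (- (real c * increment k j \<omega>)))"
proof (rule integrable_const_bound[of _ 1])
  show "AE \<omega> in M. norm (exp (- (real c * increment k j \<omega>))) \<le> 1"
    using increment_nonneg by (intro AE_I2) simp
qed (use increment_measurable in simp)

lemma increments_laplace:
  "(\<integral>\<omega>. exp (- (\<Sum>j<J. real (c j) * increment k j \<omega>)) \<partial>M) =
   (\<Prod>j<J. (\<integral>\<omega>. exp (- (real (c j) * increment k j \<omega>)) \<partial>M))"
proof -
  have "indep_vars (\<lambda>_. borel) (\<lambda>j \<omega>. exp (- (real (c j) * increment k j \<omega>))) {..<J}"
    by (rule indep_vars_compose2[OF increment_indep]) simp
  then have "(\<integral>\<omega>. (\<Prod>j<J. exp (- (real (c j) * increment k j \<omega>))) \<partial>M) =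
     (\<Prod>j<J. (\<integral>\<omega>. exp (- (real (c j) * increment k j \<omega>)) \<partial>M))"
    by (intro indep_vars_lebesgue_integral increment_laplace_int) simp_all
  then show ?thesis by (simp add: exp_sum sum_negf[symmetric])
qed

lemma increment_distr:
  "(\<integral>\<omega>. exp (- (real c * increment k j \<omega>)) \<partial>M) = (\<integral>\<omega>. exp (- (real c * L (1 / 2 ^ k) \<omega>)) \<partial>M)"
proof -
  have "distr M borel (increment k j) = distr M borel (L (1 / 2 ^ k))"
    using L_stationary[of "real j / 2 ^ k" "1 / 2 ^ k"]
    by (simp add: increment_def[abs_def] add_divide_distrib add.commute)
  then have "(\<integral>x. exp (- (real c * x)) \<partial>distr M borel (increment k j)) = (\<integral>x. exp (- (real c * x)) \<partial>distr M borel (L (1 / 2 ^ k)))"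
    by simp
  then show ?thesis using increment_measurable L_meas[of "1 / 2 ^ k"] by (simp add: integral_distr)
qed

lemma L_laplace_pos: "0 \<le> t \<Longrightarrow> 0 < (\<integral>\<omega>. exp (- (real c * L t \<omega>)) \<partial>M)"
proof -
  assume t: "0 \<le> t"
  have int: "integrable M (\<lambda>\<omega>. exp (- (real c * L t \<omega>)))"
    using L_nonneg t L_meas[OF t] by (intro integrable_const_bound[of _ 1]) auto
  have "(\<integral>\<omega>. exp (- (real c * L t \<omega>)) \<partial>M) \<noteq> 0"
  proof
    assume "(\<integral>\<omega>. exp (- (real c * L t \<omega>)) \<partial>M) = 0"
    then have "AE \<omega> in M. exp (- (real c * L t \<omega>)) = 0"
      using integral_nonneg_eq_0_iff_AE[OF int] by simp
    then show False by simp
  qed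
  moreover have "0 \<le> (\<integral>\<omega>. exp (- (real c * L t \<omega>)) \<partial>M)" by simp
  ultimately show ?thesis by linarith
qed

text \<open>The unit interval consists of \<open>2 ^ k\<close> independent increments of equal law,
  so the transform at \<open>1 / 2 ^ k\<close> is a root of the one at 1. Dyadic times thus need no
  continuity argument in time.\<close>

lemma L_laplace: "(\<integral>\<omega>. exp (- (real c * L (1 / 2 ^ k) \<omega>)) \<partial>M) = exp (- (\<psi> c / 2 ^ k))"
proof -
  let ?x = "\<integral>\<omega>. exp (- (real c * L (1 / 2 ^ k) \<omega>)) \<partial>M"
  have x: "0 < ?x" by (rule L_laplace_pos) simp
  have "exp (- \<psi> c) = (\<integral>\<omega>. exp (- (real c * L 1 \<omega>)) \<partial>M)"
    using L_laplace_pos[of 1 c] by (simp add: \<psi>_def laplace_exponent_def)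
  also have "\<dots> = (\<integral>\<omega>. exp (- (\<Sum>j<2 ^ k. real c * increment k j \<omega>)) \<partial>M)"
  proof (rule Bochner_Integration.integral_cong[OF refl])
    fix \<omega> assume "\<omega> \<in> space M"
    then have "L 0 \<omega> = 0" using subordinator_pathD(1)[OF L_subordinator_path] by simp
    moreover have "(\<Sum>j<2 ^ k. real c * increment k j \<omega>) = real c * (\<Sum>j=0..<2 ^ k. increment k j \<omega>)"
      by (simp add: sum_distrib_left atLeast0LessThan)
    ultimately show "exp (- (real c * L 1 \<omega>)) = exp (- (\<Sum>j<2 ^ k. real c * increment k j \<omega>))"
      using sum_increment[of 0 "2 ^ k" k \<omega>] by simp
  qed
  also have "\<dots> = ?x ^ (2 ^ k)" by (simp add: increments_laplace increment_distr)
  finally have "- \<psi> c = 2 ^ k * ln ?x" using x by (metis ln_exp ln_realpow of_nat_numeral of_nat_power)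
  then have "ln ?x = - (\<psi> c / 2 ^ k)" by (simp add: field_simps)
  then show ?thesis using x by (metis exp_ln)
qed

lemma \<psi>_zero: "\<psi> 0 = 0"
  by (simp add: \<psi>_def laplace_exponent_def prob_space)

text \<open>If \<psi> vanished at a positive argument, \<open>L 1\<close> would be 0 almost surely;
  by stationarity all unit increments would vanish, and by monotonicity the whole path, which is
  excluded.\<close>

lemma \<psi>_positive:
  assumes "0 < c" shows "0 < \<psi> c"
proof -
  let ?f = "\<lambda>\<omega>. exp (- (real c * L 1 \<omega>))"
  have le: "?f \<omega> \<le> 1" if "\<omega> \<in> space M" for \<omega> using L_nonneg[OF that, of 1] by simp
  have int: "integrable M ?f" using le L_meas[of 1] by (intro integrable_const_bound[of _ 1]) auto
  have "(\<integral>\<omega>. ?f \<omega> \<partial>M) \<noteq> 1"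
  proof
    assume "(\<integral>\<omega>. ?f \<omega> \<partial>M) = 1"
    then have "(\<integral>\<omega>. 1 - ?f \<omega> \<partial>M) = 0" using int by (simp add: prob_space)
    then have "AE \<omega> in M. 1 - ?f \<omega> = 0"
      using integral_nonneg_eq_0_iff_AE[of M "\<lambda>\<omega>. 1 - ?f \<omega>"] int le by auto
    then have L1: "AE \<omega> in M. L 1 \<omega> = 0" by eventually_elim (use assms in simp)
    have incr: "AE \<omega> in M. increment 0 j \<omega> = 0" for j
    proof -
      have "distr M borel (increment 0 j) = distr M borel (L 1)"
        using L_stationary[of "real j" 1] by (simp add: increment_def[abs_def] add.commute)
      moreover have "AE x in distr M borel (L 1). x = 0" using L1 L_meas[of 1] by (subst AE_distr_iff) auto
      ultimately have "AE x in distr M borel (increment 0 j). x = 0" by (simp only:)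
      then show ?thesis by (rule AE_distrD[OF increment_measurable])
    qed
    then have "AE \<omega> in M. \<forall>j. increment 0 j \<omega> = 0" by (simp add: AE_all_countable)
    then have "AE \<omega> in M. \<forall>t\<ge>0. L t \<omega> = 0"
      using AE_space
    proof eventually_elim
      case (elim \<omega>)
      have "L 0 \<omega> = 0" using subordinator_pathD(1)[OF L_subordinator_path[OF elim(2)]] by simp
      then have nat: "L (real a) \<omega> = 0" for a using sum_increment[of 0 a 0 \<omega>] elim(1) by simp
      show ?case
      proof (intro allI impI)
        fix t :: real assume t: "0 \<le> t"
        obtain a :: nat where "t \<le> real a" using real_arch_simple by blast
        then have "L t \<omega> \<le> L (real a) \<omega>" by (rule subordinator_pathD(2)[OF L_subordinator_path[OF elim(2)] t])
        then show "L t \<omega> = 0" using nat L_nonneg[OF elim(2) t] by simp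
      qed
    qed
    then show False using subordinator by (simp add: levy_subordinator_def)
  qed
  moreover have "(\<integral>\<omega>. ?f \<omega> \<partial>M) \<le> 1"
    using integral_mono[OF int, of "\<lambda>_. 1"] le by (simp add: prob_space)
  moreover have "0 < (\<integral>\<omega>. ?f \<omega> \<partial>M)" by (rule L_laplace_pos) simp
  ultimately show ?thesis by (simp add: \<psi>_def laplace_exponent_def)
qed

text \<open>Overlapping increments are regrouped by cells: each cell occurs once for every interval
  that covers it, and distinct cells are independent.\<close>

lemma L_laplace_family:
  assumes F: "finite F" "\<And>q. q \<in> F \<Longrightarrow> a q \<le> b q \<and> b q \<le> J"
  shows "(\<integral>\<omega>. exp (- (\<Sum>q\<in>F. L (real (b q) / 2 ^ k) \<omega> - L (real (a q) / 2 ^ k) \<omega>)) \<partial>M) =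
    exp (- ((\<Sum>j<J. \<psi> (card {q\<in>F. a q \<le> j \<and> j < b q})) / 2 ^ k))"
proof -
  have "(\<Sum>q\<in>F. L (real (b q) / 2 ^ k) \<omega> - L (real (a q) / 2 ^ k) \<omega>) =
     (\<Sum>j<J. real (card {q\<in>F. a q \<le> j \<and> j < b q}) * increment k j \<omega>)" for \<omega>
  proof -
    have "(\<Sum>q\<in>F. L (real (b q) / 2 ^ k) \<omega> - L (real (a q) / 2 ^ k) \<omega>) =
       (\<Sum>q\<in>F. \<Sum>j\<in>{j\<in>{..<J}. a q \<le> j \<and> j < b q}. increment k j \<omega>)"
    proof (rule sum.cong[OF refl])
      fix q assume "q \<in> F"
      then have "{j\<in>{..<J}. a q \<le> j \<and> j < b q} = {a q..<b q}" "a q \<le> b q" using F(2)[of q] by auto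
      then show "L (real (b q) / 2 ^ k) \<omega> - L (real (a q) / 2 ^ k) \<omega> = (\<Sum>j\<in>{j\<in>{..<J}. a q \<le> j \<and> j < b q}. increment k j \<omega>)"
        using sum_increment[of "a q" "b q" k \<omega>] by simp
    qed
    also have "\<dots> = (\<Sum>j<J. \<Sum>q\<in>{q\<in>F. a q \<le> j \<and> j < b q}. increment k j \<omega>)"
      by (rule sum.swap_restrict[OF F(1) finite_lessThan])
    finally show ?thesis by simp
  qed
  then show ?thesis
    by (simp add: increments_laplace increment_distr L_laplace exp_sum[symmetric] sum_negf sum_divide_distrib)
qed

section \<open>Integrating the triggers for a fixed path of the process\<close>

text \<open>Independence of the generated \<sigma>-algebras is passed to finitely many coordinates,
  arranged so that both vectors have values in the same product space. Fubini then freezes the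
  process while the triggers are integrated against a product measure.\<close>

lemma triggers_process_indep:
  assumes F: "finite F" "F \<noteq> {}" "F \<subseteq> {1..n} \<times> UNIV"
    and Y: "\<And>q. q \<in> F \<Longrightarrow> 0 \<le> s q \<and> 0 \<le> t q"
    and A: "A \<in> sets ((\<Pi>\<^sub>M q\<in>F. borel) \<Otimes>\<^sub>M (\<Pi>\<^sub>M q\<in>F. borel))"
  shows "emeasure M {\<omega>\<in>space M. ((\<lambda>q\<in>F. E (fst q) (snd q) \<omega>), (\<lambda>q\<in>F. L (t q) \<omega> - L (s q) \<omega> + u q)) \<in> A} =
    (\<integral>\<^sup>+\<omega>. emeasure (\<Pi>\<^sub>M q\<in>F. distr M borel (E (fst q) (snd q)))
       ((\<lambda>x. (x, (\<lambda>q\<in>F. L (t q) \<omega> - L (s q) \<omega> + u q))) -` A) \<partial>M)"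
proof -
  let ?S = "\<Pi>\<^sub>M q\<in>F. (borel :: real measure)"
  let ?X = "\<lambda>\<omega>. \<lambda>q\<in>F. E (fst q) (snd q) \<omega>" and ?Y = "\<lambda>\<omega>. \<lambda>q\<in>F. L (t q) \<omega> - L (s q) \<omega> + u q"
  let ?f = "\<lambda>\<omega>. \<lambda>(i, m)\<in>{1..n} \<times> UNIV. E i m \<omega>" and ?g = "\<lambda>\<omega>. \<lambda>t\<in>{0..}. L t \<omega>"
  let ?VE = "vimage_algebra (space M) ?f (\<Pi>\<^sub>M q\<in>{1..n} \<times> UNIV. borel)"
  let ?VL = "vimage_algebra (space M) ?g (\<Pi>\<^sub>M t\<in>{0..}. borel)"
  have f: "?f \<in> ?VE \<rightarrow>\<^sub>M (\<Pi>\<^sub>M q\<in>{1..n} \<times> UNIV. borel)"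
    by (rule measurable_vimage_algebra1) (auto simp: space_PiM)
  have g: "?g \<in> ?VL \<rightarrow>\<^sub>M (\<Pi>\<^sub>M t\<in>{0..}. borel)"
    by (rule measurable_vimage_algebra1) (auto simp: space_PiM)
  have X_VE: "?X \<in> ?VE \<rightarrow>\<^sub>M ?S"
  proof (rule measurable_restrict)
    fix q assume "q \<in> F"
    then have q: "q \<in> {1..n} \<times> UNIV" using F by blast
    have "(\<lambda>\<omega>. ?f \<omega> q) \<in> borel_measurable ?VE"
      by (rule measurable_compose[OF f measurable_component_singleton[OF q]])
    then show "(\<lambda>\<omega>. E (fst q) (snd q) \<omega>) \<in> borel_measurable ?VE" using q by (simp add: case_prod_beta)
  qed
  have Y_VL: "?Y \<in> ?VL \<rightarrow>\<^sub>M ?S"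
  proof (rule measurable_restrict)
    fix q assume q: "q \<in> F"
    have comp: "L x \<in> borel_measurable ?VL" if "0 \<le> x" for x
    proof -
      have x: "x \<in> {0..}" using that by simp
      have "(\<lambda>\<omega>. ?g \<omega> x) \<in> borel_measurable ?VL"
        by (rule measurable_compose[OF g measurable_component_singleton[OF x]])
      then show ?thesis using that by simp
    qed
    show "(\<lambda>\<omega>. L (t q) \<omega> - L (s q) \<omega> + u q) \<in> borel_measurable ?VL"
      using Y[OF q] by (intro borel_measurable_add borel_measurable_diff comp borel_measurable_const) auto
  qed
  have indep: "indep_set (sets ?VE) (sets ?VL)" using triggers by (simp add: exponential_triggers_def)
  have X: "random_variable ?S ?X"
  proof (rule measurable_restrict)
    fix q assume "q \<in> F"
    then show "(\<lambda>\<omega>. E (fst q) (snd q) \<omega>) \<in> borel_measurable M" using F by (intro E_meas) auto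
  qed
  have Y': "random_variable ?S ?Y"
    by (intro measurable_restrict borel_measurable_add borel_measurable_diff L_meas borel_measurable_const) (use Y in auto)
  have sub: "sigma_sets (space M) {Z -` B \<inter> space M |B. B \<in> sets ?S} \<subseteq> sets V"
    if "Z \<in> V \<rightarrow>\<^sub>M ?S" "space V = space M" for Z V
    using that sets.sigma_sets_subset[of "{Z -` B \<inter> space M |B. B \<in> sets ?S}" V] measurable_sets[OF that(1)] by auto
  have "indep_var ?S ?X ?S ?Y"
    unfolding indep_var_eq
  proof (intro conjI X Y' indep_setI)
    have sE: "sigma_sets (space M) {?X -` B \<inter> space M |B. B \<in> sets ?S} \<subseteq> sets ?VE"
      by (rule sub[OF X_VE]) simp
    have sL: "sigma_sets (space M) {?Y -` B \<inter> space M |B. B \<in> sets ?S} \<subseteq> sets ?VL"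
      by (rule sub[OF Y_VL]) simp
    show "sigma_sets (space M) {?X -` B \<inter> space M |B. B \<in> sets ?S} \<subseteq> events"
      using sE indep_setD_ev1[OF indep] by (rule order_trans)
    show "sigma_sets (space M) {?Y -` B \<inter> space M |B. B \<in> sets ?S} \<subseteq> events"
      using sL indep_setD_ev2[OF indep] by (rule order_trans)
    fix a b assume "a \<in> sigma_sets (space M) {?X -` B \<inter> space M |B. B \<in> sets ?S}"
      "b \<in> sigma_sets (space M) {?Y -` B \<inter> space M |B. B \<in> sets ?S}"
    then show "prob (a \<inter> b) = prob a * prob b" using sE sL by (intro indep_setD[OF indep]) blast+
  qed
  then have pair: "distr M ?S ?X \<Otimes>\<^sub>M distr M ?S ?Y = distr M (?S \<Otimes>\<^sub>M ?S) (\<lambda>\<omega>. (?X \<omega>, ?Y \<omega>))"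
    by (simp only: indep_var_distribution_eq)
  have distr_X: "distr M ?S ?X = (\<Pi>\<^sub>M q\<in>F. distr M borel (E (fst q) (snd q)))"
  proof -
    have "indep_vars (\<lambda>_. borel) (\<lambda>q. E (fst q) (snd q)) F" by (rule indep_vars_subset[OF E_indep F(3)])
    moreover have "random_variable borel (E (fst q) (snd q))" if "q \<in> F" for q using that F by (intro E_meas) auto
    ultimately show ?thesis
      using indep_vars_iff_distr_eq_PiM'[where I=F and M'="\<lambda>_. borel" and X="\<lambda>q. E (fst q) (snd q)"] F(2) by simp
  qed
  interpret PX: prob_space "distr M ?S ?X" by (rule prob_space_distr[OF X])
  interpret PY: prob_space "distr M ?S ?Y" by (rule prob_space_distr[OF Y'])
  interpret P: pair_prob_space "distr M ?S ?X" "distr M ?S ?Y" ..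
  have A': "A \<in> sets (distr M ?S ?X \<Otimes>\<^sub>M distr M ?S ?Y)"
    using A by (simp cong: sets_pair_measure_cong)
  have "{\<omega>\<in>space M. (?X \<omega>, ?Y \<omega>) \<in> A} = (\<lambda>\<omega>. (?X \<omega>, ?Y \<omega>)) -` A \<inter> space M" by auto
  then have "emeasure M {\<omega>\<in>space M. (?X \<omega>, ?Y \<omega>) \<in> A} = emeasure (distr M (?S \<Otimes>\<^sub>M ?S) (\<lambda>\<omega>. (?X \<omega>, ?Y \<omega>))) A"
    using A by (subst emeasure_distr[OF measurable_Pair[OF X Y']]) auto
  also have "\<dots> = (\<integral>\<^sup>+y. emeasure (distr M ?S ?X) ((\<lambda>x. (x, y)) -` A) \<partial>distr M ?S ?Y)"
    unfolding pair[symmetric] by (rule P.emeasure_pair_measure_alt2[OF A'])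
  also have "\<dots> = (\<integral>\<^sup>+\<omega>. emeasure (distr M ?S ?X) ((\<lambda>x. (x, ?Y \<omega>)) -` A) \<partial>M)"
  proof (rule nn_integral_distr[OF Y'])
    show "(\<lambda>y. emeasure (distr M ?S ?X) ((\<lambda>x. (x, y)) -` A)) \<in> borel_measurable (distr M ?S ?Y)"
      by (rule P.measurable_emeasure_Pair2[OF A'])
  qed
  finally show ?thesis unfolding distr_X .
qed

text \<open>For a frozen path the event is a box of exponential tails, whose probability is the
  exponential of minus the total of increments and offsets; the mean over paths is the Laplace
  transform of \<open>L_laplace_family\<close>.\<close>

lemma frailty: "frailty M L E n \<psi>"
proof
  fix F :: "(nat \<times> nat) set" and a b :: "nat \<times> nat \<Rightarrow> nat" and J k :: nat and u :: "nat \<times> nat \<Rightarrow> real"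
  assume F: "finite F" "F \<subseteq> {1..n} \<times> UNIV"
    and ab: "\<And>q. q \<in> F \<Longrightarrow> a q \<le> b q \<and> b q \<le> J \<and> 0 \<le> u q \<and> (snd q = 0 \<longrightarrow> a q = 0)"
  let ?t = "\<lambda>q. real (b q) / 2 ^ k" and ?s = "\<lambda>q. real (a q) / 2 ^ k"
  show "\<P>(\<omega> in M. \<forall>q\<in>F. L (?t q) \<omega> - L (?s q) \<omega> + u q < E (fst q) (snd q) \<omega>) =
      exp (- (\<Sum>q\<in>F. u q) - (\<Sum>j<J. \<psi> (card {q\<in>F. a q \<le> j \<and> j < b q})) / 2 ^ k)"
  proof (cases "F = {}")
    case True
    then show ?thesis by (simp add: \<psi>_zero prob_space)
  next
    case False
    let ?S = "\<Pi>\<^sub>M q\<in>F. (borel :: real measure)"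
    let ?A = "{p \<in> space (?S \<Otimes>\<^sub>M ?S). \<forall>q\<in>F. snd p q < fst p q}"
    have A: "?A \<in> sets (?S \<Otimes>\<^sub>M ?S)"
    proof (intro predE pred_intros_finite F(1))
      fix q assume [measurable]: "q \<in> F"
      show "Measurable.pred (?S \<Otimes>\<^sub>M ?S) (\<lambda>p. snd p q < fst p q)" by measurable
    qed
    have Y: "0 \<le> L (?t q) \<omega> - L (?s q) \<omega> + u q" if "q \<in> F" "\<omega> \<in> space M" for q \<omega>
      using subordinator_pathD(2)[OF L_subordinator_path[OF that(2)], of "?s q" "?t q"] ab[OF that(1)]
      by (simp add: divide_right_mono)
    have E_meas': "E (fst q) (snd q) \<in> borel_measurable M" if "q \<in> F" for q
      using that F by (intro E_meas) auto
    \<comment> \<open>\<open>product_prob_space\<close> asks for a probability measure at every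
      index, so a point mass is placed outside \<open>F\<close>.\<close>
    let ?D = "\<lambda>q. if q \<in> F then distr M borel (E (fst q) (snd q)) else return borel 0"
    interpret PD: product_prob_space ?D F
      using E_meas' by (auto intro!: product_prob_spaceI prob_space_distr prob_space_return)
    have PiM_D: "(\<Pi>\<^sub>M q\<in>F. distr M borel (E (fst q) (snd q))) = PiM F ?D"
      by (rule PiM_cong) auto
    have box: "emeasure (\<Pi>\<^sub>M q\<in>F. distr M borel (E (fst q) (snd q))) ((\<lambda>x. (x, (\<lambda>q\<in>F. L (?t q) \<omega> - L (?s q) \<omega> + u q))) -` ?A) =
        ennreal (exp (- (\<Sum>q\<in>F. u q)) * exp (- (\<Sum>q\<in>F. L (?t q) \<omega> - L (?s q) \<omega>)))" if \<omega>: "\<omega> \<in> space M" for \<omega>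
    proof -
      have "(\<lambda>x. (x, (\<lambda>q\<in>F. L (?t q) \<omega> - L (?s q) \<omega> + u q))) -` ?A = (\<Pi>\<^sub>E q\<in>F. {L (?t q) \<omega> - L (?s q) \<omega> + u q<..})"
        by (auto simp: space_pair_measure space_PiM PiE_iff extensional_def)
      then have "emeasure (\<Pi>\<^sub>M q\<in>F. distr M borel (E (fst q) (snd q))) ((\<lambda>x. (x, (\<lambda>q\<in>F. L (?t q) \<omega> - L (?s q) \<omega> + u q))) -` ?A) =
         (\<Prod>q\<in>F. emeasure (?D q) {L (?t q) \<omega> - L (?s q) \<omega> + u q<..})"
        unfolding PiM_D by (simp only:) (rule PD.emeasure_PiM[OF F(1)], simp)
      also have "\<dots> = (\<Prod>q\<in>F. ennreal (exp (- (L (?t q) \<omega> - L (?s q) \<omega> + u q))))"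
      proof (rule prod.cong[OF refl])
        fix q assume q: "q \<in> F"
        have "emeasure (?D q) {L (?t q) \<omega> - L (?s q) \<omega> + u q<..} =
           emeasure M {\<omega>'\<in>space M. L (?t q) \<omega> - L (?s q) \<omega> + u q < E (fst q) (snd q) \<omega>'}"
          using q E_meas'[OF q] by (simp add: emeasure_distr vimage_def Int_def conj_commute)
        then show "emeasure (?D q) {L (?t q) \<omega> - L (?s q) \<omega> + u q<..} = ennreal (exp (- (L (?t q) \<omega> - L (?s q) \<omega> + u q)))"
          using E_gt[of "fst q" "L (?t q) \<omega> - L (?s q) \<omega> + u q" "snd q"] Y[OF q \<omega>] q F
          by (auto simp: emeasure_eq_measure)
      qed
      also have "\<dots> = ennreal (\<Prod>q\<in>F. exp (- (L (?t q) \<omega> - L (?s q) \<omega> + u q)))"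
        by (rule prod_ennreal) simp
      also have "(\<Prod>q\<in>F. exp (- (L (?t q) \<omega> - L (?s q) \<omega> + u q))) =
          exp (- (\<Sum>q\<in>F. u q)) * exp (- (\<Sum>q\<in>F. L (?t q) \<omega> - L (?s q) \<omega>))"
        by (simp add: exp_sum[OF F(1), symmetric] exp_add[symmetric] sum_negf[symmetric] sum.distrib[symmetric] algebra_simps)
      finally show ?thesis .
    qed
    let ?h = "\<lambda>\<omega>. exp (- (\<Sum>q\<in>F. L (?t q) \<omega> - L (?s q) \<omega>))"
    have h_meas: "?h \<in> borel_measurable M"
      by (intro borel_measurable_exp borel_measurable_uminus borel_measurable_sum borel_measurable_diff L_meas measurable_compose[OF _ borel_measurable_exp]) auto
    have h_int: "integrable M ?h"
    proof (rule integrable_const_bound[of _ 1])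
      show "AE \<omega> in M. norm (?h \<omega>) \<le> 1"
      proof (rule AE_I2)
        fix \<omega> assume \<omega>: "\<omega> \<in> space M"
        have "0 \<le> (\<Sum>q\<in>F. L (?t q) \<omega> - L (?s q) \<omega>)"
        proof (rule sum_nonneg)
          fix q assume "q \<in> F"
          then show "0 \<le> L (?t q) \<omega> - L (?s q) \<omega>"
            using subordinator_pathD(2)[OF L_subordinator_path[OF \<omega>], of "?s q" "?t q"] ab[of q] by (simp add: divide_right_mono)
        qed
        then show "norm (?h \<omega>) \<le> 1" by simp
      qed
    qed (rule h_meas)
    have "emeasure M {\<omega>\<in>space M. \<forall>q\<in>F. L (?t q) \<omega> - L (?s q) \<omega> + u q < E (fst q) (snd q) \<omega>} =
       emeasure M {\<omega>\<in>space M. ((\<lambda>q\<in>F. E (fst q) (snd q) \<omega>), (\<lambda>q\<in>F. L (?t q) \<omega> - L (?s q) \<omega> + u q)) \<in> ?A}"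
      by (rule arg_cong[where f="emeasure M"]) (auto simp: space_pair_measure space_PiM)
    also have "\<dots> = (\<integral>\<^sup>+\<omega>. emeasure (\<Pi>\<^sub>M q\<in>F. distr M borel (E (fst q) (snd q)))
       ((\<lambda>x. (x, (\<lambda>q\<in>F. L (?t q) \<omega> - L (?s q) \<omega> + u q))) -` ?A) \<partial>M)"
      by (rule triggers_process_indep[OF F(1) False F(2) _ A]) simp
    also have "\<dots> = (\<integral>\<^sup>+\<omega>. ennreal (exp (- (\<Sum>q\<in>F. u q)) * ?h \<omega>) \<partial>M)"
      by (rule nn_integral_cong[OF box])
    also have "\<dots> = ennreal (\<integral>\<omega>. exp (- (\<Sum>q\<in>F. u q)) * ?h \<omega> \<partial>M)"
      using h_int by (intro nn_integral_eq_integral) auto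
    also have "(\<integral>\<omega>. exp (- (\<Sum>q\<in>F. u q)) * ?h \<omega> \<partial>M) =
        exp (- (\<Sum>q\<in>F. u q) - (\<Sum>j<J. \<psi> (card {q\<in>F. a q \<le> j \<and> j < b q})) / 2 ^ k)"
    proof -
      have "(\<integral>\<omega>. exp (- (\<Sum>q\<in>F. u q)) * ?h \<omega> \<partial>M) = exp (- (\<Sum>q\<in>F. u q)) * (\<integral>\<omega>. ?h \<omega> \<partial>M)"
        by (rule integral_mult_right_zero)
      also have "(\<integral>\<omega>. ?h \<omega> \<partial>M) = exp (- ((\<Sum>j<J. \<psi> (card {q\<in>F. a q \<le> j \<and> j < b q})) / 2 ^ k))"
        by (rule L_laplace_family[OF F(1)]) (use ab in auto)
      finally show ?thesis by (simp add: exp_add[symmetric])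
    qed
    finally show ?thesis by (simp add: emeasure_eq_measure)
  qed
qed (use L_meas E_meas L_subordinator_path \<psi>_zero \<psi>_positive in auto)

text \<open>A trigger has a density and is independent of \<open>L x\<close>, so it misses that
  value almost surely; rational times keep the exceptional sets countable in number and suffice to
  reconcile strict and non-strict failure.\<close>

lemma no_ties: "AE \<omega> in M. \<forall>i\<in>{1..n}. \<forall>x\<in>\<rat> \<inter> {0..}. E i 0 \<omega> \<noteq> L x \<omega>"
proof -
  have "AE \<omega> in M. E i 0 \<omega> \<noteq> L x \<omega>" if i: "i \<in> {1..n}" and x: "0 \<le> x" for i x
  proof -
    let ?F = "{(i, 0::nat)}"
    let ?S = "\<Pi>\<^sub>M q\<in>?F. (borel :: real measure)"
    let ?A = "{p \<in> space (?S \<Otimes>\<^sub>M ?S). fst p (i, 0) = snd p (i, 0)}"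
    let ?D = "\<lambda>q. if q \<in> ?F then distr M borel (E (fst q) (snd q)) else return borel 0"
    have A: "?A \<in> sets (?S \<Otimes>\<^sub>M ?S)" by measurable
    have Em: "E i 0 \<in> borel_measurable M" by (rule E_meas[OF i])
    interpret PD: product_prob_space ?D ?F
      using Em by (auto intro!: product_prob_spaceI prob_space_distr prob_space_return)
    have PiM_D: "(\<Pi>\<^sub>M q\<in>?F. distr M borel (E (fst q) (snd q))) = PiM ?F ?D"
      by (rule PiM_cong) auto
    have L0: "L 0 \<omega> = 0" if "\<omega> \<in> space M" for \<omega>
      using subordinator_pathD(1)[OF L_subordinator_path[OF that]] by simp
    have point: "emeasure (distr M borel (E i 0)) {y} = 0" for y
    proof -
      have "emeasure M {\<omega>\<in>space M. E i 0 \<omega> = y} = 0"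
      proof -
        have "distr M lborel (E i 0) = density lborel (exponential_density 1)"
          using E_distributed[OF i] by (simp add: distributed_def)
        moreover have "emeasure (density lborel (exponential_density 1)) {y} = 0"
          by (subst emeasure_density) (auto simp: nn_integral_cmult_indicator)
        ultimately show ?thesis
          using emeasure_distr[of "E i 0" M lborel "{y}"] Em by (simp add: vimage_def Int_def conj_commute)
      qed
      then show ?thesis using Em by (simp add: emeasure_distr vimage_def Int_def conj_commute)
    qed
    have "emeasure M {\<omega>\<in>space M. E i 0 \<omega> = L x \<omega>} =
       emeasure M {\<omega>\<in>space M. ((\<lambda>q\<in>?F. E (fst q) (snd q) \<omega>), (\<lambda>q\<in>?F. L ((\<lambda>_. x) q) \<omega> - L ((\<lambda>_. 0) q) \<omega> + (\<lambda>_. 0) q)) \<in> ?A}"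
      by (rule arg_cong[where f="emeasure M"]) (auto simp: space_pair_measure space_PiM L0)
    also have "\<dots> = (\<integral>\<^sup>+\<omega>. emeasure (\<Pi>\<^sub>M q\<in>?F. distr M borel (E (fst q) (snd q)))
       ((\<lambda>y. (y, (\<lambda>q\<in>?F. L ((\<lambda>_. x) q) \<omega> - L ((\<lambda>_. 0) q) \<omega> + (\<lambda>_. 0) q))) -` ?A) \<partial>M)"
      by (rule triggers_process_indep[OF _ _ _ _ A]) (use i x in auto)
    also have "\<dots> = (\<integral>\<^sup>+\<omega>. 0 \<partial>M)"
    proof (rule nn_integral_cong)
      fix \<omega> assume "\<omega> \<in> space M"
      have "(\<lambda>y. (y, (\<lambda>q\<in>?F. L ((\<lambda>_. x) q) \<omega> - L ((\<lambda>_. 0) q) \<omega> + (\<lambda>_. 0) q))) -` ?A = (\<Pi>\<^sub>E q\<in>?F. {L x \<omega> - L 0 \<omega>})"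
        by (auto simp: space_pair_measure space_PiM PiE_iff extensional_def fun_eq_iff)
      moreover have "emeasure (PiM ?F ?D) (\<Pi>\<^sub>E q\<in>?F. {L x \<omega> - L 0 \<omega>}) = (\<Prod>q\<in>?F. emeasure (?D q) {L x \<omega> - L 0 \<omega>})"
        by (rule PD.emeasure_PiM) auto
      ultimately show "emeasure (\<Pi>\<^sub>M q\<in>?F. distr M borel (E (fst q) (snd q)))
         ((\<lambda>y. (y, (\<lambda>q\<in>?F. L ((\<lambda>_. x) q) \<omega> - L ((\<lambda>_. 0) q) \<omega> + (\<lambda>_. 0) q))) -` ?A) = 0"
        unfolding PiM_D by (simp only:) (simp add: point)
    qed
    finally have "emeasure M {\<omega>\<in>space M. E i 0 \<omega> = L x \<omega>} = 0" by simp
    moreover have "{\<omega>\<in>space M. E i 0 \<omega> = L x \<omega>} \<in> events"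
      using Em L_meas[OF x] by measurable
    ultimately have "{\<omega>\<in>space M. E i 0 \<omega> = L x \<omega>} \<in> null_sets M" by (rule null_setsI)
    then show ?thesis by (rule AE_I') auto
  qed
  then show ?thesis
    by (intro AE_ball_countable[THEN iffD2] ballI) (auto simp: countable_rat)
qed

end

section \<open>Measurability\<close>

text \<open>If every point of the set has a right neighbourhood inside it, rational points approach
  the infimum. This replaces an uncountable infimum by a countable, measurable one.\<close>

lemma INF_rational:
  fixes S :: "real set"
  assumes "\<And>t. t \<in> S \<Longrightarrow> \<exists>b>t. \<forall>u. t \<le> u \<and> u < b \<longrightarrow> u \<in> S"
  shows "(INF t\<in>S. ereal t) = (INF q\<in>\<rat>. if q \<in> S then ereal q else \<infinity>)"
proof (rule antisym)
  show "(INF t\<in>S. ereal t) \<le> (INF q\<in>\<rat>. if q \<in> S then ereal q else \<infinity>)"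
    by (rule INF_greatest) (auto intro: INF_lower)
  show "(INF q\<in>\<rat>. if q \<in> S then ereal q else \<infinity>) \<le> (INF t\<in>S. ereal t)"
  proof (rule INF_greatest)
    fix t assume "t \<in> S"
    then obtain b where b: "t < b" "\<forall>u. t \<le> u \<and> u < b \<longrightarrow> u \<in> S" using assms by blast
    show "(INF q\<in>\<rat>. if q \<in> S then ereal q else \<infinity>) \<le> ereal t"
    proof (rule ccontr)
      assume "\<not> (INF q\<in>\<rat>. if q \<in> S then ereal q else \<infinity>) \<le> ereal t"
      then have "ereal t < (INF q\<in>\<rat>. if q \<in> S then ereal q else \<infinity>)" by (simp only: not_le)
      then obtain z where z: "ereal t < ereal z" "ereal z < (INF q\<in>\<rat>. if q \<in> S then ereal q else \<infinity>)"
        using ereal_dense2 by blast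
      obtain q where q: "q \<in> \<rat>" "t < q" "q < min b z" using Rats_dense_in_real[of t "min b z"] b z by auto
      then have "q \<in> S" using b by simp
      then have "(INF q\<in>\<rat>. if q \<in> S then ereal q else \<infinity>) \<le> ereal q" using q(1) by (intro INF_lower2[of q]) auto
      also have "\<dots> < ereal z" using q by simp
      finally show False using z(2) by simp
    qed
  qed
qed

text \<open>A sum over an infinite index set is 0 by convention, so that case is split off;
  otherwise it is a finite sum of measurable random length.\<close>

lemma borel_measurable_random_sum:
  fixes g :: "nat \<Rightarrow> 'a \<Rightarrow> real"
  assumes P [measurable]: "\<And>m. Measurable.pred M (P m)" and g [measurable]: "\<And>m. g m \<in> borel_measurable M"
  shows "(\<lambda>\<omega>. \<Sum>m\<in>{m. P m \<omega>}. g m \<omega>) \<in> borel_measurable M"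
proof -
  define K where "K = (\<lambda>\<omega>. LEAST b. \<forall>m. b \<le> m \<longrightarrow> \<not> P m \<omega>)"
  define bdd where "bdd = (\<lambda>\<omega>. \<exists>b. \<forall>m. b \<le> m \<longrightarrow> \<not> P m \<omega>)"
  have K [measurable]: "K \<in> measurable M (count_space UNIV)" unfolding K_def by measurable
  have bdd [measurable]: "Measurable.pred M bdd" unfolding bdd_def by measurable
  have part: "(\<lambda>\<omega>. \<Sum>m<b. of_bool (P m \<omega>) * g m \<omega>) \<in> borel_measurable M" for b by measurable
  have "(\<lambda>\<omega>. \<Sum>m<K \<omega>. of_bool (P m \<omega>) * g m \<omega>) \<in> borel_measurable M"
    by (rule measurable_compose_countable[OF part K])
  then have "(\<lambda>\<omega>. if bdd \<omega> then \<Sum>m<K \<omega>. of_bool (P m \<omega>) * g m \<omega> else 0) \<in> borel_measurable M" by measurable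
  also have "(\<lambda>\<omega>. if bdd \<omega> then \<Sum>m<K \<omega>. of_bool (P m \<omega>) * g m \<omega> else 0) = (\<lambda>\<omega>. \<Sum>m\<in>{m. P m \<omega>}. g m \<omega>)"
  proof
    fix \<omega>
    show "(if bdd \<omega> then \<Sum>m<K \<omega>. of_bool (P m \<omega>) * g m \<omega> else 0) = (\<Sum>m\<in>{m. P m \<omega>}. g m \<omega>)"
    proof (cases "bdd \<omega>")
      case True
      then have "\<forall>m. K \<omega> \<le> m \<longrightarrow> \<not> P m \<omega>" unfolding K_def bdd_def by (rule LeastI_ex)
      then have sub: "{m. P m \<omega>} \<subseteq> {..<K \<omega>}" by (auto simp: not_le[symmetric])
      have "(\<Sum>m\<in>{m. P m \<omega>}. g m \<omega>) = (\<Sum>m<K \<omega>. of_bool (P m \<omega>) * g m \<omega>)"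
        using sub by (intro sum.mono_neutral_cong_left) auto
      then show ?thesis using True by simp
    next
      case False
      have "infinite {m. P m \<omega>}"
      proof
        assume "finite {m. P m \<omega>}"
        then obtain b where b: "\<forall>m\<in>{m. P m \<omega>}. m < b" using finite_nat_set_iff_bounded by blast
        then have "\<forall>m. b \<le> m \<longrightarrow> \<not> P m \<omega>" by (auto simp: not_le[symmetric])
        then show False using False by (auto simp: bdd_def)
      qed
      then show ?thesis using False by simp
    qed
  qed
  finally show ?thesis .
qed

lemma measurable_Collect_finite:
  fixes P :: "nat \<Rightarrow> 'a \<Rightarrow> bool"
  assumes "\<And>i. i \<in> {1..n} \<Longrightarrow> Measurable.pred M (P i)"
  shows "(\<lambda>\<omega>. {i\<in>{1..n}. P i \<omega>}) \<in> measurable M (count_space UNIV)"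
proof -
  have "{\<omega>\<in>space M. {i\<in>{1..n}. P i \<omega>} = B} \<in> sets M" if "B \<in> Pow {1..n}" for B
  proof -
    have eq: "{i\<in>{1..n}. P i \<omega>} = B \<longleftrightarrow> (\<forall>i\<in>{1..n}. (i \<in> B) = P i \<omega>)" for \<omega>
      using that by blast
    have "Measurable.pred M (\<lambda>\<omega>. \<forall>i\<in>{1..n}. (i \<in> B) = P i \<omega>)"
    proof (rule pred_intros_finite)
      fix i assume "i \<in> {1..n}"
      then have [measurable]: "Measurable.pred M (P i)" by (rule assms)
      show "Measurable.pred M (\<lambda>\<omega>. (i \<in> B) = P i \<omega>)" by measurable
    qed simp
    then show ?thesis unfolding eq by (rule predE)
  qed
  then have "(\<lambda>\<omega>. {i\<in>{1..n}. P i \<omega>}) \<in> measurable M (count_space (Pow {1..n}))"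
    by (subst measurable_count_space_eq2) (auto simp: vimage_def Int_def conj_commute)
  then show ?thesis by (rule measurable_compose) simp
qed

context frailty
begin

text \<open>The grid approximation again, now for an arbitrary nonnegative measurable time in place
  of an exit time.\<close>

lemma L_at_measurable:
  assumes x [measurable]: "x \<in> borel_measurable M" and nonneg: "\<And>\<omega>. \<omega> \<in> space M \<Longrightarrow> 0 \<le> x \<omega>"
  shows "(\<lambda>\<omega>. L (x \<omega>) \<omega>) \<in> borel_measurable M"
proof (rule borel_measurable_LIMSEQ_real)
  have [measurable]: "(\<lambda>\<omega>. grid_step k (x \<omega>)) \<in> measurable M (count_space UNIV)" for k
    unfolding grid_step_def by measurable
  show "(\<lambda>\<omega>. L (grid k (x \<omega>)) \<omega>) \<in> borel_measurable M" for k
    by (rule measurable_compose_countable[where f="\<lambda>a. L (real a / 2 ^ k)" and g="\<lambda>\<omega>. grid_step k (x \<omega>)"])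
       (auto intro!: L_measurable)
  show "(\<lambda>k. L (grid k (x \<omega>)) \<omega>) \<longlonglongrightarrow> L (x \<omega>) \<omega>" if "\<omega> \<in> space M" for \<omega>
    by (rule subordinator_path_limit[OF L_path[OF that] nonneg[OF that] grid_tendsto[OF nonneg[OF that]] grid_ge])
qed

lemma lifetime_eq_INF:
  assumes "\<omega> \<in> space M"
  shows "lifetime L E i \<omega> = (INF q\<in>\<rat>. if 0 \<le> q \<and> E i 0 \<omega> < L q \<omega> then ereal q else \<infinity>)"
proof -
  have "lifetime L E i \<omega> = (INF q\<in>\<rat>. if q \<in> {t. 0 \<le> t \<and> E i 0 \<omega> < L t \<omega>} then ereal q else \<infinity>)"
    unfolding lifetime_def
  proof (rule INF_rational)
    fix t assume t: "t \<in> {t. 0 \<le> t \<and> E i 0 \<omega> < L t \<omega>}"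
    have "\<forall>u. t \<le> u \<and> u < t + 1 \<longrightarrow> u \<in> {t. 0 \<le> t \<and> E i 0 \<omega> < L t \<omega>}"
      using t subordinator_pathD(2)[OF L_path[OF assms], of t] by force
    then show "\<exists>b>t. \<forall>u. t \<le> u \<and> u < b \<longrightarrow> u \<in> {t. 0 \<le> t \<and> E i 0 \<omega> < L t \<omega>}"
      by (intro exI[of _ "t + 1"]) simp
  qed
  then show ?thesis by simp
qed

lemma lifetime_measurable:
  assumes "i \<in> {1..n}" shows "lifetime L E i \<in> borel_measurable M"
proof -
  have "(\<lambda>\<omega>. INF q\<in>\<rat>. if 0 \<le> q \<and> E i 0 \<omega> < L q \<omega> then ereal q else \<infinity>) \<in> borel_measurable M"
  proof (rule borel_measurable_INF[OF countable_rat])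
    fix q :: real
    show "(\<lambda>\<omega>. if 0 \<le> q \<and> E i 0 \<omega> < L q \<omega> then ereal q else \<infinity>) \<in> borel_measurable M"
    proof (cases "0 \<le> q")
      case True
      then show ?thesis using L_measurable[of q] E_measurable[OF assms, of 0] by simp
    qed simp
  qed
  then show ?thesis by (subst measurable_cong[OF lifetime_eq_INF])
qed

lemma sorted_nth_le_iff:
  fixes t :: "'b :: linorder"
  assumes "sorted ys" "k < length ys"
  shows "ys ! k \<le> t \<longleftrightarrow> k < length (filter (\<lambda>x. x \<le> t) ys)"
  using assms
proof (induction ys arbitrary: k)
  case (Cons y ys)
  show ?case
  proof (cases "y \<le> t")
    case True
    then show ?thesis using Cons by (cases k) auto
  next
    case False
    then have "\<forall>x\<in>set (y # ys). \<not> x \<le> t" using Cons.prems(1) by auto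
    moreover then have "filter (\<lambda>x. x \<le> t) (y # ys) = []" by (simp only: filter_empty_conv)
    ultimately show ?thesis using Cons.prems(2) nth_mem[of k "y # ys"] by auto
  qed
qed simp

lemma ord_lifetime_le_iff:
  assumes "m \<in> {1..n}"
  shows "ord_lifetime n L E m \<omega> \<le> t \<longleftrightarrow> m \<le> card {i\<in>{1..n}. lifetime L E i \<omega> \<le> t}"
proof -
  let ?xs = "map (\<lambda>i. lifetime L E i \<omega>) [1..<Suc n]"
  have "ord_lifetime n L E m \<omega> \<le> t \<longleftrightarrow> m - 1 < length (filter (\<lambda>x. x \<le> t) (sort ?xs))"
    unfolding ord_lifetime_def using assms by (intro sorted_nth_le_iff) auto
  also have "length (filter (\<lambda>x. x \<le> t) (sort ?xs)) = length (filter (\<lambda>x. x \<le> t) ?xs)"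
    by (metis mset_filter mset_sort size_mset)
  also have "\<dots> = length (filter (\<lambda>i. lifetime L E i \<omega> \<le> t) [1..<Suc n])"
    by (simp add: filter_map o_def)
  also have "\<dots> = card ({i. lifetime L E i \<omega> \<le> t} \<inter> set [1..<Suc n])"
    by (rule distinct_length_filter) simp
  also have "{i. lifetime L E i \<omega> \<le> t} \<inter> set [1..<Suc n] = {i\<in>{1..n}. lifetime L E i \<omega> \<le> t}" by auto
  finally show ?thesis using assms by auto
qed

lemma lifetime_nonneg: "0 \<le> lifetime L E i \<omega>"
  unfolding lifetime_def by (rule INF_greatest) auto

lemma ord_lifetime_nonneg:
  assumes "m \<in> {1..n}" shows "0 \<le> ord_lifetime n L E m \<omega>"
proof -
  let ?xs = "map (\<lambda>i. lifetime L E i \<omega>) [1..<Suc n]"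
  have "sort ?xs ! (m - 1) \<in> set (sort ?xs)" using assms by (intro nth_mem) auto
  then show ?thesis using lifetime_nonneg by (auto simp: ord_lifetime_def)
qed

lemma ord_lifetime_measurable:
  assumes "m \<in> {1..n}" shows "ord_lifetime n L E m \<in> borel_measurable M"
proof (rule borel_measurableI_le)
  fix t
  have "(\<lambda>\<omega>. {i\<in>{1..n}. lifetime L E i \<omega> \<le> t}) \<in> measurable M (count_space UNIV)"
  proof (rule measurable_Collect_finite)
    fix i assume "i \<in> {1..n}"
    then show "Measurable.pred M (\<lambda>\<omega>. lifetime L E i \<omega> \<le> t)" using lifetime_measurable[of i] by measurable
  qed
  then have "Measurable.pred M (\<lambda>\<omega>. m \<le> card {i\<in>{1..n}. lifetime L E i \<omega> \<le> t})"
    by (rule measurable_compose) simp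
  then show "{\<omega>\<in>space M. ord_lifetime n L E m \<omega> \<le> t} \<in> events"
    unfolding ord_lifetime_le_iff[OF assms] by (rule predE)
qed

lemma num_failed_ord_measurable:
  assumes "m \<in> {1..n}" shows "num_failed_ord n L E m \<in> measurable M (count_space UNIV)"
proof -
  have [measurable]: "ord_lifetime n L E m \<in> borel_measurable M" by (rule ord_lifetime_measurable[OF assms])
  have [measurable]: "(\<lambda>\<omega>. L (real_of_ereal (ord_lifetime n L E m \<omega>)) \<omega>) \<in> borel_measurable M"
    by (rule L_at_measurable) (use ord_lifetime_nonneg[OF assms] in \<open>auto intro: real_of_ereal_pos\<close>)
  have "(\<lambda>\<omega>. of_bool (E i 0 \<omega> \<le> L (real_of_ereal (ord_lifetime n L E m \<omega>)) \<omega>)) \<in> M \<rightarrow>\<^sub>M count_space (UNIV :: nat set)"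
    if "i \<in> {1..n}" for i
    using E_measurable[OF that, of 0] by measurable
  then show ?thesis
    unfolding num_failed_ord_def[abs_def] num_failed_def by measurable
qed

end

section \<open>Measurability of the repair process\<close>

context repair
begin

lemma repair_time_nonneg: "0 \<le> repair_time n \<Phi> r L E m \<omega>"
proof (induction m)
  case (Suc m)
  have "0 \<le> ereal t" if "repair_time n \<Phi> r L E m \<omega> < ereal t" for t
    using order.trans[OF Suc.IH less_imp_le[OF that]] .
  then show ?case by (auto simp: repair_time.simps Let_def intro!: INF_greatest)
qed (simp add: repair_time.simps)

lemma real_repair_time_nonneg: "0 \<le> real_of_ereal (repair_time n \<Phi> r L E m \<omega>)"
  by (rule real_of_ereal_pos[OF repair_time_nonneg])

text \<open>Measurability holds for the recursion as defined, not just for its almost sure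
  representation by cycles. Times and triggers depend on each other, hence the conjunction.\<close>

lemma repair_trigger_measurable:
  "repair_time n \<Phi> r L E m \<in> borel_measurable M \<and>
   (\<forall>i\<in>{1..n}. (\<lambda>\<omega>. trigger n \<Phi> r L E m \<omega> i) \<in> borel_measurable M)"
proof (induction m)
  case 0
  have "repair_time n \<Phi> r L E 0 = (\<lambda>_. 0)" by (simp add: fun_eq_iff repair_time.simps)
  then show ?case using E_measurable by (simp add: trigger.simps)
next
  case (Suc m)
  let ?rt = "repair_time n \<Phi> r L E m" and ?\<epsilon> = "trigger n \<Phi> r L E m"
  have [measurable]: "?rt \<in> borel_measurable M" using Suc.IH by blast
  have \<epsilon>: "(\<lambda>\<omega>. ?\<epsilon> \<omega> i) \<in> borel_measurable M" if "i \<in> {1..n}" for i using Suc.IH that by blast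
  let ?set = "\<lambda>t \<omega>. {i\<in>{1..n}. ?\<epsilon> \<omega> i \<le> L t \<omega>}"
  define cond where "cond = (\<lambda>B. r \<le> (\<Sum>i=1..n. 1 - state_of n B i) \<or> \<Phi> (state_of n B) = 0)"
  have eq: "repair_time n \<Phi> r L E (Suc m) \<omega> =
      (INF q\<in>\<rat>. if ?rt \<omega> < ereal q \<and> cond (?set q \<omega>) then ereal q else \<infinity>)" if \<omega>: "\<omega> \<in> space M" for \<omega>
  proof -
    let ?S = "{t. ?rt \<omega> < ereal t \<and> cond (?set t \<omega>)}"
    have "(INF t\<in>?S. ereal t) = (INF q\<in>\<rat>. if q \<in> ?S then ereal q else \<infinity>)"
    proof (rule INF_rational)
      fix t assume t: "t \<in> ?S"
      then have rt_t: "?rt \<omega> < ereal t" and cond_t: "cond (?set t \<omega>)" by blast+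
      have "0 < ereal t" by (rule le_less_trans[OF repair_time_nonneg rt_t])
      then have t0: "0 \<le> t" by simp
      \<comment> \<open>The current triggers at this path are treated as constants, which makes the
        right-constancy of failed sets available in a later cycle.\<close>
      obtain b where b: "t < b" "\<And>u. t \<le> u \<Longrightarrow> u < b \<Longrightarrow>
          failed n L (\<lambda>i _ _. ?\<epsilon> \<omega> i) u \<omega> = failed n L (\<lambda>i _ _. ?\<epsilon> \<omega> i) t \<omega>"
        using failed_right_constant[of L \<omega> t n "\<lambda>i _ _. ?\<epsilon> \<omega> i", OF L_path[OF \<omega>] t0] by blast
      have "u \<in> ?S" if u: "t \<le> u" "u < b" for u
      proof -
        have "?set u \<omega> = ?set t \<omega>" using b(2)[OF u] by (simp add: failed_def)
        moreover have "?rt \<omega> < ereal u" by (rule less_le_trans[OF rt_t]) (simp add: u(1))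
        ultimately show ?thesis unfolding mem_Collect_eq using cond_t by (simp only:)
      qed
      then show "\<exists>b>t. \<forall>u. t \<le> u \<and> u < b \<longrightarrow> u \<in> ?S" using b(1) by blast
    qed
    then show ?thesis unfolding repair_time.simps Let_def comp_state_eq mem_Collect_eq cond_def .
  qed
  have rt [measurable]: "repair_time n \<Phi> r L E (Suc m) \<in> borel_measurable M"
  proof -
    have "(\<lambda>\<omega>. INF q\<in>\<rat>. if ?rt \<omega> < ereal q \<and> cond (?set q \<omega>) then ereal q else \<infinity>) \<in> borel_measurable M"
    proof (rule borel_measurable_INF[OF countable_rat])
      fix q :: real
      show "(\<lambda>\<omega>. if ?rt \<omega> < ereal q \<and> cond (?set q \<omega>) then ereal q else \<infinity>) \<in> borel_measurable M"
      proof (cases "0 \<le> q")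
        case True
        have "(\<lambda>\<omega>. ?set q \<omega>) \<in> measurable M (count_space UNIV)"
        proof (rule measurable_Collect_finite)
          fix i assume "i \<in> {1..n}"
          then show "Measurable.pred M (\<lambda>\<omega>. ?\<epsilon> \<omega> i \<le> L q \<omega>)" using \<epsilon>[of i] L_measurable[OF True] by measurable
        qed
        then have "(\<lambda>\<omega>. cond (?set q \<omega>)) \<in> measurable M (count_space UNIV)"
          by (rule measurable_compose) simp
        then show ?thesis by measurable
      next
        case False
        have "\<not> ?rt \<omega> < ereal q" for \<omega>
        proof
          assume "?rt \<omega> < ereal q"
          then have "0 < ereal q" by (rule le_less_trans[OF repair_time_nonneg])
          then show False using False by simp
        qed
        then show ?thesis by simp
      qed
    qed
    then show ?thesis by (subst measurable_cong[OF eq])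
  qed
  have "(\<lambda>\<omega>. trigger n \<Phi> r L E (Suc m) \<omega> i) \<in> borel_measurable M" if i: "i \<in> {1..n}" for i
  proof -
    let ?t = "\<lambda>\<omega>. real_of_ereal (repair_time n \<Phi> r L E (Suc m) \<omega>)"
    have [measurable]: "(\<lambda>\<omega>. L (?t \<omega>) \<omega>) \<in> borel_measurable M"
      by (rule L_at_measurable) (auto intro: real_repair_time_nonneg)
    have [measurable]: "E i (Suc m) \<in> borel_measurable M" by (rule E_measurable[OF i])
    have [measurable]: "(\<lambda>\<omega>. ?\<epsilon> \<omega> i) \<in> borel_measurable M" by (rule \<epsilon>[OF i])
    have "trigger n \<Phi> r L E (Suc m) \<omega> i = (if ?\<epsilon> \<omega> i \<le> L (?t \<omega>) \<omega> then L (?t \<omega>) \<omega> + E i (Suc m) \<omega> else ?\<epsilon> \<omega> i)" for \<omega>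
      using i by (simp add: trigger.simps Let_def comp_state_eq state_of_eq_0_iff)
    then show ?thesis by simp
  qed
  then show ?case using rt by blast
qed

lemmas repair_time_measurable [measurable] = repair_trigger_measurable[THEN conjunct1]

lemma repair_set_measurable:
  "(\<lambda>\<omega>. {i\<in>{1..n}. trigger n \<Phi> r L E (m - 1) \<omega> i \<le> L (real_of_ereal (repair_time n \<Phi> r L E m \<omega>)) \<omega>})
    \<in> measurable M (count_space UNIV)"
proof (rule measurable_Collect_finite)
  fix i assume "i \<in> {1..n}"
  then have [measurable]: "(\<lambda>\<omega>. trigger n \<Phi> r L E (m - 1) \<omega> i) \<in> borel_measurable M"
    using repair_trigger_measurable[of "m - 1"] by blast
  have [measurable]: "(\<lambda>\<omega>. L (real_of_ereal (repair_time n \<Phi> r L E m \<omega>)) \<omega>) \<in> borel_measurable M"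
    by (rule L_at_measurable) (auto intro: real_repair_time_nonneg)
  show "Measurable.pred M (\<lambda>\<omega>. trigger n \<Phi> r L E (m - 1) \<omega> i \<le> L (real_of_ereal (repair_time n \<Phi> r L E m \<omega>)) \<omega>)"
    by measurable
qed

lemma num_repaired_measurable [measurable]: "num_repaired n \<Phi> r L E m \<in> measurable M (count_space UNIV)"
  unfolding num_repaired_def[abs_def] state_at_repair_def comp_state_eq
  by (rule measurable_compose[OF repair_set_measurable]) simp

lemma pred_system_failure [measurable]: "Measurable.pred M (system_failure n \<Phi> r L E m)"
proof -
  have [measurable]: "Measurable.pred M (\<lambda>\<omega>. \<Phi> (state_at_repair n \<Phi> r L E m \<omega>) = 0)"
    unfolding state_at_repair_def comp_state_eq by (rule measurable_compose[OF repair_set_measurable]) simp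
  show ?thesis unfolding system_failure_def[abs_def] by measurable
qed

lemma first_failure_measurable [measurable]: "first_failure n \<Phi> r L E \<in> measurable M (count_space UNIV)"
  unfolding first_failure_def[abs_def] by measurable

lemma num_repaired_first_failure_measurable [measurable]:
  "(\<lambda>\<omega>. num_repaired n \<Phi> r L E (first_failure n \<Phi> r L E \<omega>) \<omega>) \<in> measurable M (count_space UNIV)"
  by (rule measurable_compose_countable[OF num_repaired_measurable first_failure_measurable])

lemma fail_time_measurable [measurable]: "fail_time n \<Phi> r L E \<in> borel_measurable M"
proof -
  have [measurable]: "(\<lambda>\<omega>. repair_time n \<Phi> r L E (first_failure n \<Phi> r L E \<omega>) \<omega>) \<in> borel_measurable M"
    by (rule measurable_compose_countable[OF repair_time_measurable first_failure_measurable])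
  show ?thesis unfolding fail_time_def[abs_def] by measurable
qed

lemma total_cost_measurable:
  assumes [measurable]: "t \<in> borel_measurable M"
  shows "(\<lambda>\<omega>. total_cost n \<Phi> r L E c_cmp c_sys (t \<omega>) \<omega>) \<in> borel_measurable M"
  unfolding total_cost_def
proof (rule borel_measurable_random_sum)
  have [measurable]: "(\<lambda>\<omega>. c_cmp (num_repaired n \<Phi> r L E m \<omega>)) \<in> borel_measurable M" for m
    by (rule measurable_compose[OF num_repaired_measurable]) simp
  show "(\<lambda>\<omega>. c_cmp (num_repaired n \<Phi> r L E m \<omega>) + (if system_failure n \<Phi> r L E m \<omega> then c_sys else 0)) \<in> borel_measurable M" for m
    by measurable
  show "Measurable.pred M (\<lambda>\<omega>. 1 \<le> m \<and> repair_time n \<Phi> r L E m \<omega> < \<infinity> \<and> repair_time n \<Phi> r L E m \<omega> \<le> t \<omega>)" for m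
    by measurable
qed

end

section \<open>Laws at the ordered lifetimes and at the first repair\<close>

lemma (in exiting) prob_X_in: "\<P>(\<omega> in M. Q (X \<omega>)) = weight_mean \<psi> n G (\<lambda>A. of_bool (Q A)) 0"
proof -
  have ev: "{\<omega>\<in>space M. Q (X \<omega>)} \<in> events" by (intro predE measurable_compose[OF X_measurable]) simp
  have "weight_mean \<psi> n G (\<lambda>A. of_bool (Q A)) 0 = (\<integral>\<omega>. indicator {\<omega>\<in>space M. Q (X \<omega>)} \<omega> \<partial>M)"
    unfolding integral_weight[symmetric]
    by (intro Bochner_Integration.integral_cong) (auto simp: weight_def indicator_def)
  then show ?thesis using ev by simp
qed

lemma (in prob_space) prob_cong_AE:
  assumes "AE \<omega> in M. P \<omega> \<longleftrightarrow> Q \<omega>" "Measurable.pred M P" "Measurable.pred M Q"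
  shows "\<P>(\<omega> in M. P \<omega>) = \<P>(\<omega> in M. Q \<omega>)"
proof (rule measure_eq_AE)
  show "AE \<omega> in M. (\<omega> \<in> {\<omega>\<in>space M. P \<omega>}) = (\<omega> \<in> {\<omega>\<in>space M. Q \<omega>})"
    using assms(1) by eventually_elim auto
qed (use assms(2,3) in \<open>auto intro: predE\<close>)

locale lfmo_repair = lfmo M L E n
  for M :: "'a measure" and L :: "real \<Rightarrow> 'a \<Rightarrow> real" and E :: "nat \<Rightarrow> nat \<Rightarrow> 'a \<Rightarrow> real" and n :: nat +
  fixes \<Phi> :: "(nat \<Rightarrow> nat) \<Rightarrow> nat" and r :: nat and c_cmp :: "nat \<Rightarrow> real" and c_sys :: real
  assumes \<Phi>: "semi_coherent n \<Phi>" and r: "r \<in> {1..n}"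
begin

sublocale repair M L E n \<psi> \<Phi> r c_cmp c_sys
  using frailty \<Phi> r by (simp add: repair_def repair_axioms_def)

abbreviation T :: "nat \<Rightarrow> 'a \<Rightarrow> ereal" where "T \<equiv> ord_lifetime n L E"
abbreviation N :: "nat \<Rightarrow> 'a \<Rightarrow> nat" where "N \<equiv> num_failed_ord n L E"
abbreviation Trep :: "'a \<Rightarrow> ereal" where "Trep \<equiv> repair_time n \<Phi> r L E 1"
abbreviation Tfail :: "'a \<Rightarrow> ereal" where "Tfail \<equiv> fail_time n \<Phi> r L E"
abbreviation Nrep :: "'a \<Rightarrow> nat" where "Nrep \<equiv> num_repaired n \<Phi> r L E 1"
abbreviation Nfail :: "'a \<Rightarrow> nat" where
  "Nfail \<equiv> \<lambda>\<omega>. num_repaired n \<Phi> r L E (first_failure n \<Phi> r L E \<omega>) \<omega>"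
abbreviation C :: "ereal \<Rightarrow> 'a \<Rightarrow> real" where "C \<equiv> total_cost n \<Phi> r L E c_cmp c_sys"
abbreviation s :: "nat \<Rightarrow> real" where "s \<equiv> struct_signature n \<Phi>"
abbreviation V :: "nat \<Rightarrow> nat set set" where "V \<equiv> level_family n"

lemma exiting_level: "m \<in> {1..n} \<Longrightarrow> exiting M L E n \<psi> (V m)"
  using frailty working_family_level by (simp add: exiting_def exiting_axioms_def)

text \<open>Below its trigger, \<open>L\<close> stays below for a while, so the lifetime is later
  than \<open>t\<close>. Once the trigger is reached, it is strictly exceeded at every later
  rational time, because there are no ties there.\<close>

lemma lifetime_le_iff:
  assumes \<omega>: "\<omega> \<in> space M" and ties: "\<forall>x\<in>\<rat> \<inter> {0..}. E i 0 \<omega> \<noteq> L x \<omega>" and t: "0 \<le> t"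
  shows "lifetime L E i \<omega> \<le> ereal t \<longleftrightarrow> E i 0 \<omega> \<le> L t \<omega>"
proof
  assume le: "lifetime L E i \<omega> \<le> ereal t"
  show "E i 0 \<omega> \<le> L t \<omega>"
  proof (rule ccontr)
    assume "\<not> E i 0 \<omega> \<le> L t \<omega>"
    then have "eventually (\<lambda>u. L u \<omega> < E i 0 \<omega>) (at_right t)"
      using subordinator_pathD(3)[OF L_path[OF \<omega>] t] by (intro order_tendstoD(2)) auto
    then obtain b where b: "t < b" "\<And>u. t < u \<Longrightarrow> u < b \<Longrightarrow> L u \<omega> < E i 0 \<omega>"
      unfolding eventually_at_right_field by auto
    have "ereal b \<le> lifetime L E i \<omega>"
      unfolding lifetime_def
    proof (rule INF_greatest)
      fix u assume u: "u \<in> {t. 0 \<le> t \<and> E i 0 \<omega> < L t \<omega>}"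
      have "\<not> u < b"
      proof
        assume "u < b"
        show False
        proof (cases "t < u")
          case True
          then show False using b(2)[of u] \<open>u < b\<close> u by simp
        next
          case False
          then have "L u \<omega> \<le> L t \<omega>" using u by (intro subordinator_pathD(2)[OF L_path[OF \<omega>]]) auto
          then show False using u \<open>\<not> E i 0 \<omega> \<le> L t \<omega>\<close> by simp
        qed
      qed
      then show "ereal b \<le> ereal u" by simp
    qed
    then have "ereal b \<le> ereal t" using le by (rule order_trans)
    then show False using b(1) by simp
  qed
next
  assume E: "E i 0 \<omega> \<le> L t \<omega>"
  show "lifetime L E i \<omega> \<le> ereal t"
  proof (rule ccontr)
    assume "\<not> lifetime L E i \<omega> \<le> ereal t"
    then obtain z where z: "ereal t < ereal z" "ereal z < lifetime L E i \<omega>"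
      using ereal_dense2[of "ereal t"] by (auto simp: not_le)
    then obtain q where q: "q \<in> \<rat>" "t < q" "q < z" using Rats_dense_in_real[of t z] by auto
    have "L t \<omega> \<le> L q \<omega>" using t q by (intro subordinator_pathD(2)[OF L_path[OF \<omega>]]) auto
    then have "E i 0 \<omega> < L q \<omega>" using E ties q t by force
    then have "lifetime L E i \<omega> \<le> ereal q" using q t unfolding lifetime_def by (intro INF_lower) auto
    also have "\<dots> < ereal z" using q by simp
    finally show False using z(2) by simp
  qed
qed

text \<open>The \<open>m\<close>-th lifetime is the exit time of the sets with fewer than
  \<open>m\<close> members. All ranks share one almost sure event, so that two of them can be
  compared on the same path.\<close>

lemma ord_lifetime_exit:
  "AE \<omega> in M. \<forall>m\<in>{1..n}. T m \<omega> = ereal (exit_time n (V m) L E \<omega>) \<and> N m \<omega> = card (exit_set n (V m) L E \<omega>) \<and>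
     N m \<omega> \<in> {m..n} \<and> (\<forall>t\<ge>0. T m \<omega> \<le> ereal t \<longleftrightarrow> m \<le> card (failed n L E t \<omega>))"
  using AE_regular no_ties
proof eventually_elim
  case (elim \<omega>)
  show ?case
  proof
    fix m assume m: "m \<in> {1..n}"
    interpret X: exiting M L E n \<psi> "V m" by (rule exiting_level[OF m])
    have \<omega>: "\<omega> \<in> space M" by (rule regularD(1)[OF elim(1)])
    have le_iff: "T m \<omega> \<le> ereal t \<longleftrightarrow> m \<le> card (failed n L E t \<omega>)" if t: "0 \<le> t" for t
    proof -
      have "{i\<in>{1..n}. lifetime L E i \<omega> \<le> ereal t} = failed n L E t \<omega>"
        unfolding failed_def using lifetime_le_iff[OF \<omega> _ t] elim(2) by blast
      then show ?thesis by (simp add: ord_lifetime_le_iff[OF m])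
    qed
    let ?\<tau> = "exit_time n (V m) L E \<omega>"
    have exit_le: "?\<tau> \<le> t \<longleftrightarrow> m \<le> card (failed n L E t \<omega>)" if t: "0 \<le> t" for t
    proof -
      have "failed n L E t \<omega> \<subseteq> {1..n}" by (auto simp: failed_def)
      then show ?thesis using X.\<tau>_le_iff[OF elim(1) t] by (auto simp: level_family_def)
    qed
    have T: "T m \<omega> = ereal ?\<tau>"
    proof (rule antisym)
      have "m \<le> card (failed n L E ?\<tau> \<omega>)" using exit_le[of ?\<tau>] X.\<tau>_nonneg[of \<omega>] by simp
      then show "T m \<omega> \<le> ereal ?\<tau>" using le_iff[of ?\<tau>] X.\<tau>_nonneg[of \<omega>] by simp
      then obtain t where t: "T m \<omega> = ereal t" "0 \<le> t"
        using ord_lifetime_nonneg[OF m, of \<omega>] by (cases "T m \<omega>") auto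
      then have "m \<le> card (failed n L E t \<omega>)" using le_iff[OF t(2)] by simp
      then show "ereal ?\<tau> \<le> T m \<omega>" using exit_le[OF t(2)] t by simp
    qed
    have "N m \<omega> = card {i\<in>{1..n}. E i 0 \<omega> \<le> L ?\<tau> \<omega>}"
      by (simp add: num_failed_ord_def num_failed_def T sum.If_cases of_bool_def Int_def)
    then have N: "N m \<omega> = card (X.X \<omega>)" by (simp add: exit_set_def failed_def)
    have "m \<le> card (X.X \<omega>)" using exit_le[of ?\<tau>] X.\<tau>_nonneg[of \<omega>] by (simp add: exit_set_def)
    moreover have "card (X.X \<omega>) \<le> card {1..n}" by (rule card_mono[OF _ X.X_subset]) simp
    ultimately show "T m \<omega> = ereal ?\<tau> \<and> N m \<omega> = card (X.X \<omega>) \<and> N m \<omega> \<in> {m..n} \<and>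
        (\<forall>t\<ge>0. T m \<omega> \<le> ereal t \<longleftrightarrow> m \<le> card (failed n L E t \<omega>))"
      using T N le_iff by simp
  qed
qed

lemma pred_N: "m \<in> {1..n} \<Longrightarrow> Measurable.pred M (\<lambda>\<omega>. Q (N m \<omega>))"
  by (rule measurable_compose[OF num_failed_ord_measurable]) auto

lemma prob_N:
  assumes m: "m \<in> {1..n}" and j: "j \<in> {1..n}"
  shows "\<P>(\<omega> in M. N m \<omega> = j) = level_prob \<psi> n m j"
proof -
  interpret X: exiting M L E n \<psi> "V m" by (rule exiting_level[OF m])
  have "\<P>(\<omega> in M. N m \<omega> = j) = \<P>(\<omega> in M. card (X.X \<omega>) = j)"
  proof (rule prob_cong_AE)
    show "AE \<omega> in M. (N m \<omega> = j) = (card (X.X \<omega>) = j)"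
      using ord_lifetime_exit by eventually_elim (use m in auto)
    show "Measurable.pred M (\<lambda>\<omega>. card (X.X \<omega>) = j)" by (rule measurable_compose[OF X.X_measurable]) simp
  qed (rule pred_N[OF m])
  also have "\<dots> = level_prob \<psi> n m j" unfolding X.prob_X_in[of "\<lambda>A. card A = j"] by (rule weight_mean_level[OF m j])
  finally show ?thesis .
qed

lemma prob_N_exit_prob:
  assumes m: "m \<in> {1..n}" and j: "j \<in> {1..n}"
  shows "\<P>(\<omega> in M. N m \<omega> = j) = (if m \<le> j then exit_prob (laplace_exponent M L) n (m - 1) j else 0)"
proof -
  have "\<psi> = (\<lambda>c. laplace_exponent M L (real c))" by (simp add: fun_eq_iff \<psi>_def)
  moreover have "laplace_exponent M L (real c) \<noteq> 0" if "1 \<le> c" for c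
    using \<psi>_positive[of c] that by (simp add: \<psi>_def)
  ultimately show ?thesis using level_prob_eq_exit_prob[OF m j, of "laplace_exponent M L"] prob_N[OF m j] by simp
qed

lemma prob_N_in:
  assumes m: "m \<in> {1..n}" and I: "I \<subseteq> {1..n}"
  shows "\<P>(\<omega> in M. N m \<omega> \<in> I) = (\<Sum>j\<in>I. \<P>(\<omega> in M. N m \<omega> = j))"
proof -
  have "{\<omega>\<in>space M. N m \<omega> \<in> I} = (\<Union>j\<in>I. {\<omega>\<in>space M. N m \<omega> = j})" by auto
  then show ?thesis
    using finite_below[OF I] by (simp, intro finite_measure_finite_Union) (auto simp: disjoint_family_on_def intro!: predE pred_N m)
qed

text \<open>For \<open>a \<le> k\<close> the times coincide exactly when the jump that brings the
  \<open>a\<close>-th failure brings at least \<open>k\<close> failures; comparisons of times become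
  events about \<open>N a\<close>.\<close>

lemma ord_lifetime_compare:
  assumes a: "a \<in> {1..n}" and k: "k \<in> {1..n}" and "a \<le> k"
  shows "AE \<omega> in M. (T a \<omega> = T k \<omega> \<longleftrightarrow> N a \<omega> \<in> {k..n}) \<and> (T a \<omega> < T k \<omega> \<longleftrightarrow> N a \<omega> \<in> {a..k-1})"
  using ord_lifetime_exit
proof eventually_elim
  case (elim \<omega>)
  let ?t = "exit_time n (V a) L E \<omega>" and ?u = "exit_time n (V k) L E \<omega>"
  have Ta: "T a \<omega> = ereal ?t" and Na: "N a \<omega> = card (failed n L E ?t \<omega>)" and Nan: "N a \<omega> \<in> {a..n}"
    using bspec[OF elim a] unfolding exit_set_def by blast+
  have nonneg: "0 \<le> exit_time n G L E \<omega>" for G by (auto simp: exit_time_def intro!: cInf_greatest)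
  have iffs: "T m \<omega> \<le> ereal t \<longleftrightarrow> m \<le> card (failed n L E t \<omega>)" if "m \<in> {1..n}" "0 \<le> t" for m t
    using bspec[OF elim that(1)] that(2) by blast
  have Tk: "T k \<omega> = ereal ?u" using bspec[OF elim k] by blast
  have "k \<le> card (failed n L E ?u \<omega>)" using iffs[OF k nonneg[of "V k"]] Tk by simp
  then have "a \<le> card (failed n L E ?u \<omega>)" using \<open>a \<le> k\<close> by simp
  then have le: "T a \<omega> \<le> T k \<omega>" unfolding Tk using iffs[OF a nonneg[of "V k"]] by blast
  have iff: "T k \<omega> \<le> T a \<omega> \<longleftrightarrow> k \<le> N a \<omega>" unfolding Ta Na by (rule iffs[OF k nonneg[of "V a"]])
  have "T a \<omega> = T k \<omega> \<longleftrightarrow> k \<le> N a \<omega>" using le iff by auto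
  moreover have "T a \<omega> < T k \<omega> \<longleftrightarrow> \<not> k \<le> N a \<omega>" using iff by (simp add: not_le[symmetric])
  ultimately show ?case using Nan k by auto
qed

lemma
  assumes a: "a \<in> {1..n}" and k: "k \<in> {1..n}" and "a \<le> k"
  shows prob_ord_eq: "\<P>(\<omega> in M. T a \<omega> = T k \<omega>) = (\<Sum>j=k..n. \<P>(\<omega> in M. N a \<omega> = j))"
    and prob_ord_less: "\<P>(\<omega> in M. T a \<omega> < T k \<omega>) = (\<Sum>j=a..k-1. \<P>(\<omega> in M. N a \<omega> = j))"
    and prob_ord_total: "\<P>(\<omega> in M. T a \<omega> < T k \<omega>) = 1 - \<P>(\<omega> in M. T a \<omega> = T k \<omega>)"
proof -
  have [measurable]: "T a \<in> borel_measurable M" "T k \<in> borel_measurable M"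
    using ord_lifetime_measurable a k by auto
  note cmp = ord_lifetime_compare[OF assms]
  have "\<P>(\<omega> in M. T a \<omega> = T k \<omega>) = \<P>(\<omega> in M. N a \<omega> \<in> {k..n})"
    by (rule prob_cong_AE) (use cmp pred_N[OF a] in auto)
  then show "\<P>(\<omega> in M. T a \<omega> = T k \<omega>) = (\<Sum>j=k..n. \<P>(\<omega> in M. N a \<omega> = j))"
    using prob_N_in[OF a, of "{k..n}"] k by simp
  have sub: "{a..k-1} \<subseteq> {1..n}" using a k by auto
  have "\<P>(\<omega> in M. T a \<omega> < T k \<omega>) = \<P>(\<omega> in M. N a \<omega> \<in> {a..k-1})"
    by (rule prob_cong_AE) (use cmp pred_N[OF a] in auto)
  then show "\<P>(\<omega> in M. T a \<omega> < T k \<omega>) = (\<Sum>j=a..k-1. \<P>(\<omega> in M. N a \<omega> = j))"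
    using prob_N_in[OF a, of "{a..k-1}"] sub by simp
  have "AE \<omega> in M. (T a \<omega> < T k \<omega>) = (\<not> T a \<omega> = T k \<omega>)"
    using cmp ord_lifetime_exit
  proof eventually_elim
    case (elim \<omega>)
    then have "N a \<omega> \<in> {a..n}" using a by blast
    then show ?case using elim(1) \<open>a \<le> k\<close> k by auto
  qed
  then have "\<P>(\<omega> in M. T a \<omega> < T k \<omega>) = \<P>(\<omega> in M. \<not> T a \<omega> = T k \<omega>)"
    by (rule prob_cong_AE) auto
  also have "\<dots> = 1 - \<P>(\<omega> in M. T a \<omega> = T k \<omega>)" by (rule prob_neg) measurable
  finally show "\<P>(\<omega> in M. T a \<omega> < T k \<omega>) = 1 - \<P>(\<omega> in M. T a \<omega> = T k \<omega>)" .
qed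

lemma mean_ord_lifetime:
  assumes m: "m \<in> {1..n}"
  shows "has_finite_mean M (T m)" "mean_time M (T m) = exit_mean \<psi> n (V m)"
    "mean_time M (T m) = (\<Sum>i=n-m+1..n. real (n choose i) * real ((i - 1) choose (n - m)) *
             (-1) ^ (i + m - n - 1) * (1 / laplace_exponent M L (real i)))"
proof -
  interpret X: exiting M L E n \<psi> "V m" by (rule exiting_level[OF m])
  have T: "AE \<omega> in M. T m \<omega> = ereal (X.\<tau> \<omega>)" using ord_lifetime_exit by eventually_elim (use m in blast)
  have meas [measurable]: "T m \<in> borel_measurable M" by (rule ord_lifetime_measurable[OF m])
  have real: "AE \<omega> in M. real_of_ereal (T m \<omega>) = X.\<tau> \<omega>" using T by eventually_elim simp
  have "integrable M (\<lambda>\<omega>. real_of_ereal (T m \<omega>)) \<longleftrightarrow> integrable M X.\<tau>"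
    by (rule integrable_cong_AE) (use real in auto)
  moreover have "AE \<omega> in M. \<bar>T m \<omega>\<bar> \<noteq> \<infinity>" using T by eventually_elim simp
  ultimately show "has_finite_mean M (T m)" using X.integrable_\<tau> by (simp add: has_finite_mean_def)
  have "mean_time M (T m) = (\<integral>\<omega>. X.\<tau> \<omega> \<partial>M)"
    unfolding mean_time_def by (rule integral_cong_AE) (use real in auto)
  then show mean: "mean_time M (T m) = exit_mean \<psi> n (V m)" by (simp add: X.integral_\<tau>)
  show "mean_time M (T m) = (\<Sum>i=n-m+1..n. real (n choose i) * real ((i - 1) choose (n - m)) *
             (-1) ^ (i + m - n - 1) * (1 / laplace_exponent M L (real i)))"
    unfolding mean exit_mean_level[OF \<Phi> r refl] using m sum_choose_fdiff[of m n "\<lambda>c. 1 / \<psi> c"]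
    by (simp add: \<psi>_def)
qed

section \<open>The first repair\<close>

text \<open>Introduced as a mean over the exit law and only then identified with the probability,
  since Wald's identity takes it in this form.\<close>

definition p :: real where "p = weight_mean \<psi> n G (\<lambda>A. of_bool (A \<in> fail_sets)) 0"

lemma S_0: "S 0 = X" by (simp add: cycle_0)

lemma AE_first_repair:
  "AE \<omega> in M. (Trep \<omega> = Tfail \<omega> \<longleftrightarrow> X \<omega> \<in> fail_sets) \<and> (Trep \<omega> < Tfail \<omega> \<longleftrightarrow> X \<omega> \<notin> fail_sets) \<and>
     Nrep \<omega> = card (X \<omega>) \<and> X \<omega> \<notin> G \<and> Trep \<omega> = ereal (\<tau> \<omega>) \<and> C (Trep \<omega>) \<omega> = cost (X \<omega>)"
  using AE_good
proof eventually_elim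
  case (elim \<omega>)
  have R1: "R 1 \<omega> = \<tau> \<omega>" by (simp add: R_def cycle_0)
  have "Trep \<omega> = ereal (R 1 \<omega>)" by (rule repair_time_eq[OF elim])
  moreover have "C (ereal (R 1 \<omega>)) \<omega> = cost (X \<omega>)" unfolding total_cost_at_repair[OF elim] by (simp add: cycle_0)
  ultimately show ?case
    using repair_is_failure_iff[OF elim] num_repaired_eq[OF elim, of 0] S_notin[OF elim, of 0] R1
    by (simp add: S_0)
qed

lemma pred_X: "Measurable.pred M (\<lambda>\<omega>. Q (X \<omega>))"
  by (rule measurable_compose[OF X_measurable]) simp

lemma prob_fail: "\<P>(\<omega> in M. Trep \<omega> = Tfail \<omega>) = p"
proof -
  have "\<P>(\<omega> in M. Trep \<omega> = Tfail \<omega>) = \<P>(\<omega> in M. X \<omega> \<in> fail_sets)"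
    by (rule prob_cong_AE) (use AE_first_repair pred_X in auto)
  then show ?thesis unfolding p_def prob_X_in[of "\<lambda>A. A \<in> fail_sets"] .
qed

lemma prob_no_fail: "\<P>(\<omega> in M. Trep \<omega> < Tfail \<omega>) = 1 - p"
proof -
  have "\<P>(\<omega> in M. Trep \<omega> < Tfail \<omega>) = \<P>(\<omega> in M. \<not> X \<omega> \<in> fail_sets)"
    by (rule prob_cong_AE) (use AE_first_repair pred_X in auto)
  also have "\<dots> = 1 - \<P>(\<omega> in M. X \<omega> \<in> fail_sets)" by (rule prob_neg) (rule predE[OF pred_X])
  finally show ?thesis unfolding p_def prob_X_in[of "\<lambda>A. A \<in> fail_sets"] .
qed

text \<open>The second conclusion is kept apart because the same mean also yields \<open>p\<close>
  and the law of the number of components at the first system failure.\<close>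

lemma prob_repair_fail:
  assumes j: "j \<in> {1..n}"
  shows "\<P>(\<omega> in M. Nrep \<omega> = j \<and> Trep \<omega> = Tfail \<omega>) = (\<Sum>k=1..j. s k * \<P>(\<omega> in M. N (min r k) \<omega> = j))"
    and "weight_mean \<psi> n G (\<lambda>A. of_bool (card A = j \<and> A \<in> fail_sets)) 0 = (\<Sum>k=1..j. s k * \<P>(\<omega> in M. N (min r k) \<omega> = j))"
proof -
  have "\<P>(\<omega> in M. Nrep \<omega> = j \<and> Trep \<omega> = Tfail \<omega>) = \<P>(\<omega> in M. card (X \<omega>) = j \<and> X \<omega> \<in> fail_sets)"
    by (rule prob_cong_AE) (use AE_first_repair pred_X in auto)
  also have "\<dots> = weight_mean \<psi> n G (\<lambda>A. of_bool (card A = j \<and> A \<in> fail_sets)) 0" by (rule prob_X_in)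
  finally have 1: "\<P>(\<omega> in M. Nrep \<omega> = j \<and> Trep \<omega> = Tfail \<omega>) = weight_mean \<psi> n G (\<lambda>A. of_bool (card A = j \<and> A \<in> fail_sets)) 0" .
  show 2: "weight_mean \<psi> n G (\<lambda>A. of_bool (card A = j \<and> A \<in> fail_sets)) 0 = (\<Sum>k=1..j. s k * \<P>(\<omega> in M. N (min r k) \<omega> = j))"
    unfolding fail_sets_def mem_Collect_eq weight_mean_fail[OF \<Phi> r refl j]
    using j r by (intro sum.cong refl) (auto simp: prob_N)
  show "\<P>(\<omega> in M. Nrep \<omega> = j \<and> Trep \<omega> = Tfail \<omega>) = (\<Sum>k=1..j. s k * \<P>(\<omega> in M. N (min r k) \<omega> = j))"
    using 1 2 by simp
qed

lemma prob_repair_no_fail: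
  assumes j: "j \<in> {1..n}"
  shows "\<P>(\<omega> in M. Nrep \<omega> = j \<and> Trep \<omega> < Tfail \<omega>) =
    (if r \<le> j then \<Sum>k=j+1..n. s k * \<P>(\<omega> in M. N r \<omega> = j) else 0)"
proof -
  have "\<P>(\<omega> in M. Nrep \<omega> = j \<and> Trep \<omega> < Tfail \<omega>) = \<P>(\<omega> in M. card (X \<omega>) = j \<and> X \<omega> \<notin> fail_sets)"
    by (rule prob_cong_AE) (use AE_first_repair pred_X in auto)
  also have "\<dots> = weight_mean \<psi> n G (\<lambda>A. of_bool (card A = j \<and> A \<notin> fail_sets)) 0" by (rule prob_X_in)
  finally show ?thesis
    unfolding fail_sets_def mem_Collect_eq weight_mean_no_fail[OF \<Phi> r refl j] prob_N[OF r j] .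
qed

text \<open>A repair of fewer than \<open>r\<close> components can only be due to a system
  failure.\<close>

lemma prob_early_no_fail:
  assumes "j < r" shows "\<P>(\<omega> in M. Nrep \<omega> = j \<and> Trep \<omega> < Tfail \<omega>) = 0"
proof -
  have "\<P>(\<omega> in M. Nrep \<omega> = j \<and> Trep \<omega> < Tfail \<omega>) = \<P>(\<omega> in M. False)"
  proof (rule prob_cong_AE)
    show "AE \<omega> in M. (Nrep \<omega> = j \<and> Trep \<omega> < Tfail \<omega>) = False"
      using AE_first_repair
      by eventually_elim (use assms X_subset in \<open>auto simp: no_repair_family_def fail_sets_def\<close>)
  qed auto
  then show ?thesis by simp
qed

text \<open>Adds the cases with and without system failure. For \<open>k > j\<close> the minimum of
  \<open>r\<close> and \<open>k\<close> is \<open>r\<close> if \<open>r \<le> j\<close>, and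
  otherwise exceeds \<open>j\<close>, so that the terms vanish.\<close>

lemma prob_repair:
  assumes j: "j \<in> {1..n}"
  shows "\<P>(\<omega> in M. Nrep \<omega> = j) = (\<Sum>k=1..n. s k * \<P>(\<omega> in M. N (min r k) \<omega> = j))"
    and "\<P>(\<omega> in M. Nrep \<omega> = j) =
      (\<Sum>k=1..j * of_bool (j < r) + n * of_bool (r \<le> j). s k * \<P>(\<omega> in M. N (min r k) \<omega> = j))"
proof -
  let ?g = "\<lambda>k. s k * \<P>(\<omega> in M. N (min r k) \<omega> = j)"
  have "\<P>(\<omega> in M. Nrep \<omega> = j) =
     \<P>(\<omega> in M. Nrep \<omega> = j \<and> Trep \<omega> = Tfail \<omega>) + \<P>(\<omega> in M. Nrep \<omega> = j \<and> Trep \<omega> < Tfail \<omega>)"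
  proof -
    have "\<P>(\<omega> in M. Nrep \<omega> = j) = \<P>(\<omega> in M. (Nrep \<omega> = j \<and> Trep \<omega> = Tfail \<omega>) \<or> (Nrep \<omega> = j \<and> Trep \<omega> < Tfail \<omega>))"
      by (rule prob_cong_AE) (use AE_first_repair in auto)
    also have "\<dots> = prob ({\<omega>\<in>space M. Nrep \<omega> = j \<and> Trep \<omega> = Tfail \<omega>} \<union> {\<omega>\<in>space M. Nrep \<omega> = j \<and> Trep \<omega> < Tfail \<omega>})"
      by (rule arg_cong[where f=prob]) auto
    also have "\<dots> = \<P>(\<omega> in M. Nrep \<omega> = j \<and> Trep \<omega> = Tfail \<omega>) + \<P>(\<omega> in M. Nrep \<omega> = j \<and> Trep \<omega> < Tfail \<omega>)"
      by (rule finite_measure_Union) auto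
    finally show ?thesis .
  qed
  also have "\<dots> = (\<Sum>k=1..j. ?g k) + (\<Sum>k=j+1..n. ?g k)"
  proof -
    have "(\<Sum>k=j+1..n. ?g k) = (if r \<le> j then \<Sum>k=j+1..n. s k * \<P>(\<omega> in M. N r \<omega> = j) else 0)"
    proof (cases "r \<le> j")
      case True
      then have "(\<Sum>k=j+1..n. ?g k) = (\<Sum>k=j+1..n. s k * \<P>(\<omega> in M. N r \<omega> = j))"
        by (intro sum.cong refl) (simp add: min_def)
      then show ?thesis using True by simp
    next
      case False
      have "(\<Sum>k=j+1..n. ?g k) = 0"
      proof (intro sum.neutral ballI)
        fix k assume "k \<in> {j+1..n}"
        then show "?g k = 0" using prob_N[of "min r k" j] False j r by (auto simp: level_prob_def)
      qed
      then show ?thesis using False by simp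
    qed
    then show ?thesis unfolding prob_repair_fail(1)[OF j] prob_repair_no_fail[OF j] by simp
  qed
  finally have sum: "\<P>(\<omega> in M. Nrep \<omega> = j) = (\<Sum>k=1..j. ?g k) + (\<Sum>k=j+1..n. ?g k)" .
  have "{1..n} = {1..j} \<union> {j+1..n}" using j by auto
  then have "(\<Sum>k=1..n. ?g k) = (\<Sum>k=1..j. ?g k) + (\<Sum>k=j+1..n. ?g k)"
    by (simp only:) (rule sum.union_disjoint; auto)
  then show 1: "\<P>(\<omega> in M. Nrep \<omega> = j) = (\<Sum>k=1..n. ?g k)" using sum by simp
  show "\<P>(\<omega> in M. Nrep \<omega> = j) = (\<Sum>k=1..j * of_bool (j < r) + n * of_bool (r \<le> j). ?g k)"
  proof (cases "r \<le> j")
    case True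
    then show ?thesis using 1 by simp
  next
    case False
    have "(\<Sum>k=j+1..n. ?g k) = 0"
    proof (intro sum.neutral ballI)
      fix k assume "k \<in> {j+1..n}"
      then show "?g k = 0" using prob_N[of "min r k" j] False j r by (auto simp: level_prob_def)
    qed
    then show ?thesis using sum False by simp
  qed
qed

lemma sum_signature: "(\<Sum>k=1..n. s k) = 1"
  using signature_sum[of 0 n n \<Phi>] tail_signature_0[OF \<Phi>] tail_signature_n[OF \<Phi>] by simp

lemma weight_mean_by_card:
  "weight_mean \<psi> n G (\<lambda>A. h (card A) * of_bool (Q A)) 0 = (\<Sum>j=1..n. h j * weight_mean \<psi> n G (\<lambda>A. of_bool (card A = j \<and> Q A)) 0)"
proof -
  have "h (card A) * of_bool (Q A) = (\<Sum>j=1..n. h j * of_bool (card A = j \<and> Q A))" if A: "A \<subseteq> {1..n}" "A \<notin> G" for A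
  proof -
    have "A \<noteq> {}" using A(2) G by (auto simp: working_family_def)
    then have "card A \<in> {1..n}" using card_mono[OF _ A(1)] finite_below[OF A(1)] by (auto simp: Suc_le_eq card_gt_0_iff)
    then have "(\<Sum>j=1..n. h j * of_bool (card A = j \<and> Q A)) = (\<Sum>j\<in>{card A}. h j * of_bool (card A = j \<and> Q A))"
      by (intro sum.mono_neutral_right) auto
    then show ?thesis by simp
  qed
  then have "weight_mean \<psi> n G (\<lambda>A. h (card A) * of_bool (Q A)) 0 =
     weight_mean \<psi> n G (\<lambda>A. \<Sum>j=1..n. h j * of_bool (card A = j \<and> Q A)) 0"
    by (intro weight_mean_cong) auto
  also have "\<dots> = (\<Sum>j=1..n. h j * weight_mean \<psi> n G (\<lambda>A. of_bool (card A = j \<and> Q A)) 0)"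
    unfolding weight_mean_def by (simp only: sum_distrib_left sum_distrib_right mult_zero_left add_0_right mult.assoc) (rule sum.swap)
  finally show ?thesis .
qed

lemma min_range: "k \<in> {1..n} \<Longrightarrow> min k r \<in> {1..n}"
  using r by auto

text \<open>Summing the failure law over \<open>j\<close> and exchanging the sums leaves, for each
  \<open>k\<close>, the probability that at least \<open>k\<close> components have failed at the
  lifetime of rank \<open>min k r\<close>; this says that the two lifetimes coincide.\<close>

lemma p_eq: "p = (\<Sum>k=1..n. s k * \<P>(\<omega> in M. T (min k r) \<omega> = T k \<omega>))"
proof -
  have "p = (\<Sum>j=1..n. \<Sum>k=1..j. s k * \<P>(\<omega> in M. N (min r k) \<omega> = j))"
    using weight_mean_by_card[of "\<lambda>_. 1" "\<lambda>A. A \<in> fail_sets"] by (simp add: p_def prob_repair_fail(2))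
  also have "\<dots> = (\<Sum>j=1..n. \<Sum>k\<in>{k\<in>{1..n}. k \<le> j}. s k * \<P>(\<omega> in M. N (min r k) \<omega> = j))"
    by (intro sum.cong refl) auto
  also have "\<dots> = (\<Sum>k=1..n. \<Sum>j\<in>{j\<in>{1..n}. k \<le> j}. s k * \<P>(\<omega> in M. N (min r k) \<omega> = j))"
    by (rule sum.swap_restrict) auto
  also have "\<dots> = (\<Sum>k=1..n. s k * \<P>(\<omega> in M. T (min k r) \<omega> = T k \<omega>))"
  proof (rule sum.cong[OF refl])
    fix k assume k: "k \<in> {1..n}"
    have "{j\<in>{1..n}. k \<le> j} = {k..n}" using k by auto
    then show "(\<Sum>j\<in>{j\<in>{1..n}. k \<le> j}. s k * \<P>(\<omega> in M. N (min r k) \<omega> = j)) = s k * \<P>(\<omega> in M. T (min k r) \<omega> = T k \<omega>)"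
      using prob_ord_eq[OF min_range[OF k] k] by (simp add: sum_distrib_left min.commute[of r k])
  qed
  finally show ?thesis .
qed

lemma split_at_r: "(\<Sum>k=1..n. f k) = (\<Sum>k=1..r. f k) + (\<Sum>k=r+1..n. f k)" for f :: "nat \<Rightarrow> real"
proof -
  have "{1..n} = {1..r} \<union> {r+1..n}" using r by auto
  then show ?thesis by (simp only:) (rule sum.union_disjoint; auto)
qed

lemma p_split: "p = (\<Sum>k=1..r. s k) + (\<Sum>k=r+1..n. s k * \<P>(\<omega> in M. T r \<omega> = T k \<omega>))"
proof -
  have "(\<Sum>k=1..r. s k * \<P>(\<omega> in M. T (min k r) \<omega> = T k \<omega>)) = (\<Sum>k=1..r. s k)"
    by (intro sum.cong refl) (simp add: min_absorb1 prob_space)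
  moreover have "(\<Sum>k=r+1..n. s k * \<P>(\<omega> in M. T (min k r) \<omega> = T k \<omega>)) =
      (\<Sum>k=r+1..n. s k * \<P>(\<omega> in M. T r \<omega> = T k \<omega>))"
    by (intro sum.cong refl) (simp add: min_absorb2)
  ultimately show ?thesis unfolding p_eq split_at_r by simp
qed

lemma one_minus_p: "1 - p = (\<Sum>k=1..n. s k * \<P>(\<omega> in M. T (min k r) \<omega> < T k \<omega>))"
proof -
  have "(\<Sum>k=1..n. s k * \<P>(\<omega> in M. T (min k r) \<omega> < T k \<omega>)) =
      (\<Sum>k=1..n. s k - s k * \<P>(\<omega> in M. T (min k r) \<omega> = T k \<omega>))"
  proof (rule sum.cong[OF refl])
    fix k assume k: "k \<in> {1..n}"
    show "s k * \<P>(\<omega> in M. T (min k r) \<omega> < T k \<omega>) = s k - s k * \<P>(\<omega> in M. T (min k r) \<omega> = T k \<omega>)"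
      unfolding prob_ord_total[OF min_range[OF k] k min.cobounded1] by (simp add: right_diff_distrib)
  qed
  then show ?thesis unfolding sum_subtractf sum_signature p_eq[symmetric] by simp
qed

lemma one_minus_p_split: "1 - p = (\<Sum>k=r+1..n. s k * \<P>(\<omega> in M. T r \<omega> < T k \<omega>))"
proof -
  have "(\<Sum>k=1..r. s k * \<P>(\<omega> in M. T (min k r) \<omega> < T k \<omega>)) = 0"
    by (intro sum.neutral ballI) (simp add: min_absorb1)
  moreover have "(\<Sum>k=r+1..n. s k * \<P>(\<omega> in M. T (min k r) \<omega> < T k \<omega>)) =
      (\<Sum>k=r+1..n. s k * \<P>(\<omega> in M. T r \<omega> < T k \<omega>))"
    by (intro sum.cong refl) (simp add: min_absorb2)
  ultimately show ?thesis unfolding one_minus_p split_at_r by simp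
qed

lemma prob_ord_exit_prob_range:
  assumes k: "k \<in> {r+1..n}"
  shows "\<P>(\<omega> in M. T r \<omega> = T k \<omega>) = exit_prob_range (laplace_exponent M L) n (r - 1) k n"
    and "\<P>(\<omega> in M. T r \<omega> < T k \<omega>) = exit_prob_range (laplace_exponent M L) n (r - 1) r (k - 1)"
proof -
  have k': "k \<in> {1..n}" "r \<le> k" using k by auto
  show "\<P>(\<omega> in M. T r \<omega> = T k \<omega>) = exit_prob_range (laplace_exponent M L) n (r - 1) k n"
    unfolding prob_ord_eq[OF r k'] exit_prob_range_def
    by (rule sum.cong[OF refl], subst prob_N_exit_prob[OF r]) (use k r in auto)
  show "\<P>(\<omega> in M. T r \<omega> < T k \<omega>) = exit_prob_range (laplace_exponent M L) n (r - 1) r (k - 1)"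
    unfolding prob_ord_less[OF r k'] exit_prob_range_def
    by (rule sum.cong[OF refl], subst prob_N_exit_prob[OF r]) (use k r in auto)
qed

text \<open>If \<open>p = 1\<close>, both sides are 0 because division by 0 gives 0.\<close>

lemma cond_prob_repair_no_fail:
  assumes j: "j \<in> {r..n}"
  shows "\<P>(\<omega> in M. Nrep \<omega> = j \<bar> Trep \<omega> < Tfail \<omega>) =
    1 / (1 - p) * (\<Sum>k=j+1..n. s k * \<P>(\<omega> in M. N r \<omega> = j))"
proof -
  have "j \<in> {1..n}" "r \<le> j" using j r by auto
  then show ?thesis unfolding cond_prob_def prob_no_fail using prob_repair_no_fail[of j] by simp
qed

lemma cond_prob_early_no_fail: "j < r \<Longrightarrow> \<P>(\<omega> in M. Nrep \<omega> = j \<bar> Trep \<omega> < Tfail \<omega>) = 0"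
  unfolding cond_prob_def by (simp only: prob_early_no_fail div_0)

lemma mean_cost: "weight_mean \<psi> n G cost 0 = (\<Sum>j=1..n. c_cmp j * \<P>(\<omega> in M. Nrep \<omega> = j)) + c_sys * p"
proof -
  have Nrep: "weight_mean \<psi> n G (\<lambda>A. of_bool (card A = j)) 0 = \<P>(\<omega> in M. Nrep \<omega> = j)" for j
  proof -
    have "\<P>(\<omega> in M. Nrep \<omega> = j) = \<P>(\<omega> in M. card (X \<omega>) = j)"
      by (rule prob_cong_AE) (use AE_first_repair pred_X in auto)
    then show ?thesis by (simp only: prob_X_in[of "\<lambda>A. card A = j"])
  qed
  have "weight_mean \<psi> n G cost 0 =
      weight_mean \<psi> n G (\<lambda>A. c_cmp (card A)) 0 + c_sys * weight_mean \<psi> n G (\<lambda>A. of_bool (A \<in> fail_sets)) 0"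
    unfolding weight_mean_def mult_zero_left add_0_right sum_distrib_left sum.distrib[symmetric]
    by (intro sum.cong refl) (simp add: cost_def algebra_simps)
  also have "weight_mean \<psi> n G (\<lambda>A. c_cmp (card A)) 0 = (\<Sum>j=1..n. c_cmp j * \<P>(\<omega> in M. Nrep \<omega> = j))"
    using weight_mean_by_card[of c_cmp "\<lambda>_. True"] by (simp add: Nrep)
  finally show ?thesis by (simp add: p_def)
qed

lemma first_repair_mean:
  shows "integrable M (\<lambda>\<omega>. C (Trep \<omega>) \<omega>)" "(\<integral>\<omega>. C (Trep \<omega>) \<omega> \<partial>M) = weight_mean \<psi> n G cost 0"
    "has_finite_mean M Trep" "mean_time M Trep = exit_mean \<psi> n G"
    "exit_mean \<psi> n G = (\<Sum>k=1..n. s k * mean_time M (T (min k r)))"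
proof -
  have AE_C: "AE \<omega> in M. C (Trep \<omega>) \<omega> = cost (X \<omega>)" using AE_first_repair by eventually_elim blast
  have costX: "(\<lambda>\<omega>. cost (X \<omega>)) \<in> borel_measurable M" by (rule measurable_compose[OF X_measurable]) simp
  have meas: "(\<lambda>\<omega>. C (Trep \<omega>) \<omega>) \<in> borel_measurable M" by (rule total_cost_measurable) (rule repair_time_measurable)
  have int: "integrable M (\<lambda>\<omega>. cost (X \<omega>))"
  proof (rule integrable_const_bound)
    show "AE \<omega> in M. norm (cost (X \<omega>)) \<le> (\<Sum>A\<in>Pow {1..n}. norm (cost A))"
      using X_subset by (intro AE_I2 member_le_sum) auto
  qed (rule costX)
  show "integrable M (\<lambda>\<omega>. C (Trep \<omega>) \<omega>)"
    using int integrable_cong_AE[OF meas costX AE_C] by simp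
  have "(\<integral>\<omega>. C (Trep \<omega>) \<omega> \<partial>M) = (\<integral>\<omega>. cost (X \<omega>) \<partial>M)" by (rule integral_cong_AE[OF meas costX AE_C])
  then show "(\<integral>\<omega>. C (Trep \<omega>) \<omega> \<partial>M) = weight_mean \<psi> n G cost 0" using integral_weight[of cost 0] by (simp add: weight_def)
  have AE_T: "AE \<omega> in M. Trep \<omega> = ereal (\<tau> \<omega>)" using AE_first_repair by eventually_elim blast
  have real: "AE \<omega> in M. real_of_ereal (Trep \<omega>) = \<tau> \<omega>" using AE_T by eventually_elim simp
  have measT: "(\<lambda>\<omega>. real_of_ereal (Trep \<omega>)) \<in> borel_measurable M"
    using repair_time_measurable by (intro borel_measurable_real_of_ereal)
  have "AE \<omega> in M. \<bar>Trep \<omega>\<bar> \<noteq> \<infinity>" using AE_T by eventually_elim simp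
  then show "has_finite_mean M Trep"
    using integrable_\<tau> integrable_cong_AE[OF measT \<tau>_measurable real] by (simp add: has_finite_mean_def)
  show "mean_time M Trep = exit_mean \<psi> n G"
    unfolding mean_time_def integral_cong_AE[OF measT \<tau>_measurable real] by (rule integral_\<tau>)
  show "exit_mean \<psi> n G = (\<Sum>k=1..n. s k * mean_time M (T (min k r)))"
    unfolding exit_mean_no_repair[OF \<Phi> r refl]
    by (intro sum.cong refl) (simp only: mean_ord_lifetime(2)[OF min_range])
qed

end

section \<open>Sums stopped at the first cycle that ends in a given class\<close>

context exiting
begin

text \<open>Counted from 0, so a stopped sum has one term more than this index. On paths that never
  meet \<open>Q\<close> the value is arbitrary.\<close>

definition stop_cycle :: "nat set set \<Rightarrow> 'a \<Rightarrow> nat" where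
  "stop_cycle Q \<omega> = (LEAST m. S m \<omega> \<in> Q)"

definition stopped_sum :: "nat set set \<Rightarrow> (nat set \<Rightarrow> real) \<Rightarrow> real \<Rightarrow> 'a \<Rightarrow> real" where
  "stopped_sum Q f \<beta> \<omega> = (\<Sum>l<Suc (stop_cycle Q \<omega>). f (S l \<omega>) + \<beta> * D l \<omega>)"

lemma stopped_sum_measurable: "stopped_sum Q f \<beta> \<in> borel_measurable M"
proof -
  have P: "Measurable.pred M (\<lambda>\<omega>. S m \<omega> \<in> Q)" for m
    by (rule measurable_compose[OF cycle_measurable(2)[OF exiting_axioms]]) simp
  have "stop_cycle Q \<in> measurable M (count_space UNIV)"
    unfolding stop_cycle_def[abs_def] by (intro measurable_Least P)
  moreover have "(\<lambda>\<omega>. \<Sum>l<Suc k. f (S l \<omega>) + \<beta> * D l \<omega>) \<in> borel_measurable M" for k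
    by (intro borel_measurable_sum cycle_weight_measurable[OF exiting_axioms])
  ultimately show ?thesis
    unfolding stopped_sum_def[abs_def] by (rule measurable_compose_countable[rotated])
qed

lemma stop_cycle_props:
  assumes "S m \<omega> \<in> Q"
  shows "S (stop_cycle Q \<omega>) \<omega> \<in> Q" "l < stop_cycle Q \<omega> \<Longrightarrow> S l \<omega> \<notin> Q"
    "(\<forall>l<k. S l \<omega> \<notin> Q) \<longleftrightarrow> k < Suc (stop_cycle Q \<omega>)"
proof -
  show 1: "S (stop_cycle Q \<omega>) \<omega> \<in> Q" unfolding stop_cycle_def by (rule LeastI[of "\<lambda>m. S m \<omega> \<in> Q", OF assms])
  have 2: "S l \<omega> \<notin> Q" if "l < stop_cycle Q \<omega>" for l
    using not_less_Least[of l "\<lambda>m. S m \<omega> \<in> Q"] that by (simp add: stop_cycle_def)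
  then show "l < stop_cycle Q \<omega> \<Longrightarrow> S l \<omega> \<notin> Q" .
  show "(\<forall>l<k. S l \<omega> \<notin> Q) \<longleftrightarrow> k < Suc (stop_cycle Q \<omega>)"
    using 1 2 by (meson less_Suc_eq_le less_le_trans not_le)
qed

lemma stopped_series:
  assumes f: "\<forall>A. 0 \<le> f A" "0 \<le> \<beta>" and m: "S m \<omega> \<in> Q"
  shows "(\<Sum>k. ennreal (of_bool (\<forall>l<k. S l \<omega> \<notin> Q) * (f (S k \<omega>) + \<beta> * D k \<omega>))) = ennreal (stopped_sum Q f \<beta> \<omega>)"
proof -
  let ?K = "stop_cycle Q \<omega>"
  have "(\<Sum>k. ennreal (of_bool (\<forall>l<k. S l \<omega> \<notin> Q) * (f (S k \<omega>) + \<beta> * D k \<omega>))) =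
      (\<Sum>k<Suc ?K. ennreal (of_bool (\<forall>l<k. S l \<omega> \<notin> Q) * (f (S k \<omega>) + \<beta> * D k \<omega>)))"
    by (rule suminf_finite) (simp_all add: stop_cycle_props(3)[OF m])
  also have "\<dots> = (\<Sum>k<Suc ?K. ennreal (f (S k \<omega>) + \<beta> * D k \<omega>))"
    by (rule sum.cong[OF refl]) (simp add: stop_cycle_props(3)[OF m])
  also have "\<dots> = ennreal (stopped_sum Q f \<beta> \<omega>)"
    unfolding stopped_sum_def using f
    by (intro sum_ennreal) (simp add: cycle_time_nonneg)
  finally show ?thesis .
qed

context
  fixes Q :: "nat set set" and p :: real
  assumes p: "p = weight_mean \<psi> n G (\<lambda>A. of_bool (A \<in> Q)) 0" "0 < p"
begin

text \<open>Wald's identity for the indicator of \<open>Q\<close>: the series is 1 on stopping paths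
  and 0 on the others, and its mean is \<open>p / p\<close>.\<close>

lemma AE_stops: "AE \<omega> in M. \<exists>m. S m \<omega> \<in> Q"
proof -
  have P: "Measurable.pred M (\<lambda>\<omega>. S m \<omega> \<in> Q)" for m
    by (rule measurable_compose[OF cycle_measurable(2)[OF exiting_axioms]]) simp
  have ev: "{\<omega>\<in>space M. \<exists>m. S m \<omega> \<in> Q} \<in> events" by (intro predE pred_intros_countable P)
  have series: "(\<Sum>k. ennreal (of_bool (\<forall>l<k. S l \<omega> \<notin> Q) * (of_bool (S k \<omega> \<in> Q) + 0 * D k \<omega>))) =
      indicator {\<omega>\<in>space M. \<exists>m. S m \<omega> \<in> Q} \<omega>" if "\<omega> \<in> space M" for \<omega>
  proof (cases "\<exists>m. S m \<omega> \<in> Q")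
    case True
    then obtain m where m: "S m \<omega> \<in> Q" ..
    have "(\<Sum>l<stop_cycle Q \<omega>. of_bool (S l \<omega> \<in> Q) :: real) = 0"
      by (intro sum.neutral ballI) (simp add: stop_cycle_props(2)[OF m])
    then have one: "stopped_sum Q (\<lambda>A. of_bool (A \<in> Q)) 0 \<omega> = 1"
      by (simp add: stopped_sum_def stop_cycle_props(1)[OF m])
    have "(\<Sum>k. ennreal (of_bool (\<forall>l<k. S l \<omega> \<notin> Q) * (of_bool (S k \<omega> \<in> Q) + 0 * D k \<omega>))) = ennreal 1"
      unfolding one[symmetric] by (rule stopped_series[OF _ _ m]) auto
    moreover have "\<omega> \<in> {\<omega>\<in>space M. \<exists>m. S m \<omega> \<in> Q}" using that True by blast
    ultimately show ?thesis by simp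
  next
    case False
    then have zero: "ennreal (of_bool (\<forall>l<k. S l \<omega> \<notin> Q) * (of_bool (S k \<omega> \<in> Q) + 0 * D k \<omega>)) = 0" for k by simp
    have "\<omega> \<notin> {\<omega>\<in>space M. \<exists>m. S m \<omega> \<in> Q}" using False by blast
    then show ?thesis unfolding zero by simp
  qed
  have "emeasure M {\<omega>\<in>space M. \<exists>m. S m \<omega> \<in> Q} = (\<integral>\<^sup>+\<omega>. indicator {\<omega>\<in>space M. \<exists>m. S m \<omega> \<in> Q} \<omega> \<partial>M)"
    by (rule nn_integral_indicator[OF ev, symmetric])
  also have "\<dots> = (\<integral>\<^sup>+\<omega>. (\<Sum>k. ennreal (of_bool (\<forall>l<k. S l \<omega> \<notin> Q) * (of_bool (S k \<omega> \<in> Q) + 0 * D k \<omega>))) \<partial>M)"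
    by (rule nn_integral_cong) (rule series[symmetric])
  also have "\<dots> = ennreal (weight_mean \<psi> n G (\<lambda>A. of_bool (A \<in> Q)) 0 / p)" by (rule wald[OF _ _ p]) auto
  also have "\<dots> = 1" using p by simp
  finally have "prob {\<omega>\<in>space M. \<exists>m. S m \<omega> \<in> Q} = 1" by (simp add: measure_def)
  then show ?thesis by (rule prob_Collect_eq_1[OF ev, THEN iffD1])
qed

lemma stopped_sum_mean_nonneg:
  assumes f: "\<forall>A. 0 \<le> f A" "0 \<le> \<beta>"
  shows "integrable M (stopped_sum Q f \<beta>)" "(\<integral>\<omega>. stopped_sum Q f \<beta> \<omega> \<partial>M) = weight_mean \<psi> n G f \<beta> / p"
proof -
  have nonneg: "0 \<le> stopped_sum Q f \<beta> \<omega>" for \<omega>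
    unfolding stopped_sum_def using f
    by (intro sum_nonneg) (simp add: cycle_time_nonneg)
  have "(\<integral>\<^sup>+\<omega>. ennreal (stopped_sum Q f \<beta> \<omega>) \<partial>M) =
     (\<integral>\<^sup>+\<omega>. (\<Sum>k. ennreal (of_bool (\<forall>l<k. S l \<omega> \<notin> Q) * (f (S k \<omega>) + \<beta> * D k \<omega>))) \<partial>M)"
  proof (rule nn_integral_cong_AE)
    show "AE \<omega> in M. ennreal (stopped_sum Q f \<beta> \<omega>) =
      (\<Sum>k. ennreal (of_bool (\<forall>l<k. S l \<omega> \<notin> Q) * (f (S k \<omega>) + \<beta> * D k \<omega>)))"
      using AE_stops
    proof eventually_elim
      case (elim \<omega>)
      then obtain m where "S m \<omega> \<in> Q" ..
      from stopped_series[OF f this] show ?case by simp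
    qed
  qed
  also have "\<dots> = ennreal (weight_mean \<psi> n G f \<beta> / p)" by (rule wald[OF f p])
  finally have eq: "(\<integral>\<^sup>+\<omega>. ennreal (stopped_sum Q f \<beta> \<omega>) \<partial>M) = ennreal (weight_mean \<psi> n G f \<beta> / p)" .
  have val: "0 \<le> weight_mean \<psi> n G f \<beta> / p" using weight_mean_nonneg[OF f] p(2) by simp
  show "integrable M (stopped_sum Q f \<beta>)"
    using eq nonneg by (intro integrableI_nonneg stopped_sum_measurable) auto
  show "(\<integral>\<omega>. stopped_sum Q f \<beta> \<omega> \<partial>M) = weight_mean \<psi> n G f \<beta> / p"
    using integral_eq_nn_integral[OF stopped_sum_measurable AE_I2, of Q f \<beta>] nonneg eq val by simp
qed

text \<open>Signed costs are split into positive and negative parts; the time term goes with the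
  positive part only, so that both parts are nonnegative.\<close>

lemma stopped_sum_mean:
  assumes \<beta>: "0 \<le> \<beta>"
  shows "integrable M (stopped_sum Q f \<beta>)" "(\<integral>\<omega>. stopped_sum Q f \<beta> \<omega> \<partial>M) = weight_mean \<psi> n G f \<beta> / p"
proof -
  let ?u = "\<lambda>A. max 0 (f A)" and ?v = "\<lambda>A. max 0 (- f A)"
  have u: "\<forall>A. 0 \<le> ?u A" and v: "\<forall>A. 0 \<le> ?v A" by auto
  have f: "f A = ?u A - ?v A" for A by auto
  have split: "stopped_sum Q f \<beta> = (\<lambda>\<omega>. stopped_sum Q ?u \<beta> \<omega> - stopped_sum Q ?v 0 \<omega>)"
    unfolding stopped_sum_def sum_subtractf[symmetric] by (intro ext sum.cong refl) (simp add: max_def)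
  have "weight_mean \<psi> n G f \<beta> = weight_mean \<psi> n G ?u \<beta> - weight_mean \<psi> n G ?v 0"
  proof -
    have "(\<Sum>A\<in>Pow {1..n} - G. f A * exit_law \<psi> n G A) =
       (\<Sum>A\<in>Pow {1..n} - G. ?u A * exit_law \<psi> n G A) - (\<Sum>A\<in>Pow {1..n} - G. ?v A * exit_law \<psi> n G A)"
      unfolding sum_subtractf[symmetric] by (intro sum.cong refl) (subst f, rule left_diff_distrib)
    then show ?thesis by (simp add: weight_mean_def)
  qed
  then show "integrable M (stopped_sum Q f \<beta>)" "(\<integral>\<omega>. stopped_sum Q f \<beta> \<omega> \<partial>M) = weight_mean \<psi> n G f \<beta> / p"
    unfolding split
    using stopped_sum_mean_nonneg[OF u \<beta>] stopped_sum_mean_nonneg[OF v order_refl]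
    by (simp_all add: diff_divide_distrib)
qed

end

lemma AE_never_stops:
  assumes "weight_mean \<psi> n G (\<lambda>A. of_bool (A \<in> Q)) 0 = 0"
  shows "AE \<omega> in M. \<forall>m. S m \<omega> \<notin> Q"
  unfolding AE_all_countable
proof
  fix m
  have P: "Measurable.pred M (\<lambda>\<omega>. S m \<omega> \<in> Q)"
    by (rule measurable_compose[OF cycle_measurable(2)[OF exiting_axioms]]) simp
  have "(\<integral>\<^sup>+\<omega>. ennreal (of_bool (S m \<omega> \<in> Q) + 0 * D m \<omega>) \<partial>M) = 0"
    using cycle_mean[of "\<lambda>A. of_bool (A \<in> Q)" 0 m] assms by simp
  then have "AE \<omega> in M. ennreal (of_bool (S m \<omega> \<in> Q) + 0 * D m \<omega>) = 0"
    using P by (subst (asm) nn_integral_0_iff_AE) (simp_all, measurable)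
  then show "AE \<omega> in M. S m \<omega> \<notin> Q" by eventually_elim (simp split: if_splits)
qed

end

context lfmo_repair
begin

text \<open>On almost every path the averages of costs and of cycle lengths converge, and the
  renewal reward limit is a statement about single paths. Neither \<open>p > 0\<close> nor
  \<open>p = 0\<close> is assumed, so both cases of the final result use it.\<close>

lemma cost_rate:
  "AE \<omega> in M. ((\<lambda>t. C (ereal t) \<omega> / t) \<longlongrightarrow> weight_mean \<psi> n G cost 0 / exit_mean \<psi> n G) at_top"
  using AE_good cycle_reward_average[of cost] cycle_time_average
proof eventually_elim
  case (elim \<omega>)
  have "(\<lambda>m. R m \<omega> / real m) \<longlonglongrightarrow> exit_mean \<psi> n G" using elim(3) by (simp add: R_def)
  from renewal_reward_limit[OF R_0 R_strict_mono[OF elim(1)] this exit_mean_pos elim(2)]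
  show ?case unfolding total_cost_eq[OF elim(1)] ereal_less_eq .
qed

text \<open>Time, cost and number of components at the first failure are all stopped sums, hence
  covered by one mean formula. For the number of components the summand vanishes except in the last
  cycle, so the sum is an indicator.\<close>

lemma AE_first_failure:
  assumes "0 < p"
  shows "AE \<omega> in M. Tfail \<omega> = ereal (stopped_sum fail_sets (\<lambda>_. 0) 1 \<omega>) \<and>
    C (Tfail \<omega>) \<omega> = stopped_sum fail_sets cost 0 \<omega> \<and>
    of_bool (Nfail \<omega> = j) = stopped_sum fail_sets (\<lambda>A. of_bool (card A = j \<and> A \<in> fail_sets)) 0 \<omega>"
  using AE_good AE_stops[OF p_def assms]
proof eventually_elim
  case (elim \<omega>)
  then obtain m where m: "S m \<omega> \<in> fail_sets" by blast
  note good = elim(1)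
  show ?case
  proof (rule fail_time_cases[OF good])
    assume "\<And>m. S m \<omega> \<notin> fail_sets"
    then show ?thesis using m by blast
  next
    fix K assume K: "S K \<omega> \<in> fail_sets" and less: "\<And>l. l < K \<Longrightarrow> S l \<omega> \<notin> fail_sets"
      and T: "Tfail \<omega> = ereal (R (Suc K) \<omega>)" and ff: "first_failure n \<Phi> r L E \<omega> = Suc K"
    have stop: "stop_cycle fail_sets \<omega> = K"
      unfolding stop_cycle_def using K less by (intro Least_equality) (auto simp: not_less[symmetric])
    have "(\<Sum>l<K. of_bool (card (S l \<omega>) = j \<and> S l \<omega> \<in> fail_sets) :: real) = 0"
      using less by (intro sum.neutral) auto
    then have "stopped_sum fail_sets (\<lambda>A. of_bool (card A = j \<and> A \<in> fail_sets)) 0 \<omega> = of_bool (card (S K \<omega>) = j)"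
      using K by (simp add: stopped_sum_def stop)
    moreover have "Nfail \<omega> = card (S K \<omega>)" unfolding ff by (rule num_repaired_eq[OF good])
    moreover have "C (Tfail \<omega>) \<omega> = stopped_sum fail_sets cost 0 \<omega>"
      unfolding T total_cost_at_repair[OF good] by (simp add: stopped_sum_def stop)
    moreover have "Tfail \<omega> = ereal (stopped_sum fail_sets (\<lambda>_. 0) 1 \<omega>)"
      unfolding T R_def by (simp add: stopped_sum_def stop)
    ultimately show ?thesis by simp
  qed
qed

lemma first_failure_mean:
  assumes p: "0 < p"
  shows "AE \<omega> in M. Tfail \<omega> < \<infinity>"
    and "integrable M (\<lambda>\<omega>. C (Tfail \<omega>) \<omega>)" "(\<integral>\<omega>. C (Tfail \<omega>) \<omega> \<partial>M) = weight_mean \<psi> n G cost 0 / p"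
    and "has_finite_mean M Tfail" "mean_time M Tfail = exit_mean \<psi> n G / p"
    and "j \<in> {1..n} \<Longrightarrow> \<P>(\<omega> in M. Nfail \<omega> = j) = 1 / p * (\<Sum>k=1..j. s k * \<P>(\<omega> in M. N (min r k) \<omega> = j))"
proof -
  note first = AE_first_failure[OF p] and mean = stopped_sum_mean[OF p_def p]
  have meas [measurable]: "Tfail \<in> borel_measurable M" by (rule fail_time_measurable)
  have T: "AE \<omega> in M. Tfail \<omega> = ereal (stopped_sum fail_sets (\<lambda>_. 0) 1 \<omega>)" using first by eventually_elim blast
  show "AE \<omega> in M. Tfail \<omega> < \<infinity>" using T by eventually_elim simp
  have C: "AE \<omega> in M. C (Tfail \<omega>) \<omega> = stopped_sum fail_sets cost 0 \<omega>" using first by eventually_elim blast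
  have measC: "(\<lambda>\<omega>. C (Tfail \<omega>) \<omega>) \<in> borel_measurable M" by (rule total_cost_measurable[OF meas])
  show "integrable M (\<lambda>\<omega>. C (Tfail \<omega>) \<omega>)"
    using integrable_cong_AE[OF measC stopped_sum_measurable C] mean(1)[of 0 cost] by simp
  show "(\<integral>\<omega>. C (Tfail \<omega>) \<omega> \<partial>M) = weight_mean \<psi> n G cost 0 / p"
    unfolding integral_cong_AE[OF measC stopped_sum_measurable C] by (rule mean(2)) simp
  have real: "AE \<omega> in M. real_of_ereal (Tfail \<omega>) = stopped_sum fail_sets (\<lambda>_. 0) 1 \<omega>" using T by eventually_elim simp
  have measT: "(\<lambda>\<omega>. real_of_ereal (Tfail \<omega>)) \<in> borel_measurable M" by measurable
  have "AE \<omega> in M. \<bar>Tfail \<omega>\<bar> \<noteq> \<infinity>" using T by eventually_elim simp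
  then show "has_finite_mean M Tfail"
    using integrable_cong_AE[OF measT stopped_sum_measurable real] mean(1)[of 1 "\<lambda>_. 0"] by (simp add: has_finite_mean_def)
  show "mean_time M Tfail = exit_mean \<psi> n G / p"
    unfolding mean_time_def integral_cong_AE[OF measT stopped_sum_measurable real] using mean(2)[of 1 "\<lambda>_. 0"]
    by (simp add: weight_mean_def)
  assume j: "j \<in> {1..n}"
  let ?f = "\<lambda>A. of_bool (card A = j \<and> A \<in> fail_sets)"
  have predN: "Measurable.pred M (\<lambda>\<omega>. Nfail \<omega> = j)"
    by (rule measurable_compose[OF num_repaired_first_failure_measurable]) simp
  have N: "AE \<omega> in M. of_bool (Nfail \<omega> = j) = stopped_sum fail_sets ?f 0 \<omega>" using first[of j] by eventually_elim blast
  have measN: "(\<lambda>\<omega>. of_bool (Nfail \<omega> = j) :: real) \<in> borel_measurable M" using predN by measurable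
  have "\<P>(\<omega> in M. Nfail \<omega> = j) = (\<integral>\<omega>. indicator {\<omega>\<in>space M. Nfail \<omega> = j} \<omega> \<partial>M)"
    using predE[OF predN] by simp
  also have "\<dots> = (\<integral>\<omega>. of_bool (Nfail \<omega> = j) \<partial>M)"
    by (intro Bochner_Integration.integral_cong) (auto simp: indicator_def)
  also have "\<dots> = weight_mean \<psi> n G ?f 0 / p"
    unfolding integral_cong_AE[OF measN stopped_sum_measurable N] by (rule mean(2)) simp
  finally show "\<P>(\<omega> in M. Nfail \<omega> = j) = 1 / p * (\<Sum>k=1..j. s k * \<P>(\<omega> in M. N (min r k) \<omega> = j))"
    unfolding prob_repair_fail(2)[OF j] by simp
qed

lemma cond_prob_repair_fail:
  assumes p: "0 < p" and j: "j \<in> {1..n}"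
  shows "\<P>(\<omega> in M. Nrep \<omega> = j \<bar> Trep \<omega> = Tfail \<omega>) = \<P>(\<omega> in M. Nfail \<omega> = j)"
  unfolding cond_prob_def prob_fail prob_repair_fail(1)[OF j] first_failure_mean(6)[OF p j] by simp

lemma never_fails:
  assumes "p = 0"
  shows "AE \<omega> in M. Tfail \<omega> = \<infinity>"
proof -
  have "AE \<omega> in M. \<forall>m. S m \<omega> \<notin> fail_sets" by (rule AE_never_stops) (simp add: p_def[symmetric] assms)
  then show ?thesis using AE_good
  proof eventually_elim
    case (elim \<omega>)
    show ?case by (rule fail_time_cases[OF elim(2)]) (use elim(1) in auto)
  qed
qed

end

theorem theorem3p1:
  fixes M :: "'a measure"
    and L :: "real \<Rightarrow> 'a \<Rightarrow> real"
    and E :: "nat \<Rightarrow> nat \<Rightarrow> 'a \<Rightarrow> real"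
    and n r :: nat
    and \<Phi> :: "(nat \<Rightarrow> nat) \<Rightarrow> nat"
    and c_cmp :: "nat \<Rightarrow> real" and c_sys :: real
    and \<Psi> :: "real \<Rightarrow> real" and s :: "nat \<Rightarrow> real"
    and T :: "nat \<Rightarrow> 'a \<Rightarrow> ereal" and N :: "nat \<Rightarrow> 'a \<Rightarrow> nat"
    and Trep Tfail :: "'a \<Rightarrow> ereal" and Nrep Nfail :: "'a \<Rightarrow> nat"
    and C :: "ereal \<Rightarrow> 'a \<Rightarrow> real" and p ECrep ECfail ETrep ETfail :: real
  assumes "prob_space M"
    and "levy_subordinator M L"
    and "exponential_triggers M n L E"
    and "1 < n"
    and "semi_coherent n \<Phi>"
    and "r \<in> {1..n}"
  defines "\<Psi> \<equiv> laplace_exponent M L"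
    and "s \<equiv> struct_signature n \<Phi>"
    and "T \<equiv> ord_lifetime n L E"
    and "N \<equiv> num_failed_ord n L E"
    and "Trep \<equiv> repair_time n \<Phi> r L E 1"
    and "Tfail \<equiv> fail_time n \<Phi> r L E"
    and "Nrep \<equiv> num_repaired n \<Phi> r L E 1"
    and "Nfail \<equiv> (\<lambda>\<omega>. num_repaired n \<Phi> r L E (first_failure n \<Phi> r L E \<omega>) \<omega>)"
    and "C \<equiv> total_cost n \<Phi> r L E c_cmp c_sys"
    and "p \<equiv> \<P>(\<omega> in M. Trep \<omega> = Tfail \<omega>)"
    and "ECrep \<equiv> \<integral>\<omega>. C (Trep \<omega>) \<omega> \<partial>M"
    and "ECfail \<equiv> \<integral>\<omega>. C (Tfail \<omega>) \<omega> \<partial>M"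
    and "ETrep \<equiv> mean_time M Trep"
    and "ETfail \<equiv> mean_time M Tfail"
  shows
    "(p = (\<Sum>k=1..n. s k * \<P>(\<omega> in M. T (min k r) \<omega> = T k \<omega>)) \<and>
      p = (\<Sum>k=1..r. s k) + (\<Sum>k=r+1..n. s k * \<P>(\<omega> in M. T r \<omega> = T k \<omega>)) \<and>
      1 - p = (\<Sum>k=1..n. s k * \<P>(\<omega> in M. T (min k r) \<omega> < T k \<omega>)) \<and>
      1 - p = (\<Sum>k=r+1..n. s k * \<P>(\<omega> in M. T r \<omega> < T k \<omega>)) \<and>
      (\<forall>k\<in>{r+1..n}.
         \<P>(\<omega> in M. T r \<omega> = T k \<omega>) = exit_prob_range \<Psi> n (r - 1) k n \<and>
         \<P>(\<omega> in M. T r \<omega> < T k \<omega>) = exit_prob_range \<Psi> n (r - 1) r (k - 1)))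
     \<and>
     (\<forall>j\<in>{1..n}.
        \<P>(\<omega> in M. Nrep \<omega> = j) = (\<Sum>k=1..n. s k * \<P>(\<omega> in M. N (min r k) \<omega> = j)) \<and>
        \<P>(\<omega> in M. Nrep \<omega> = j) =
          (\<Sum>k=1..j * of_bool (j < r) + n * of_bool (r \<le> j). s k * \<P>(\<omega> in M. N (min r k) \<omega> = j)) \<and>
        (\<forall>m\<in>{1..n}. \<P>(\<omega> in M. N m \<omega> = j) = (if m \<le> j then exit_prob \<Psi> n (m - 1) j else 0)))
     \<and>
     (p > 0 \<longrightarrow>
        (\<forall>j\<in>{1..n}.
           \<P>(\<omega> in M. Nrep \<omega> = j \<bar> Trep \<omega> = Tfail \<omega>) = \<P>(\<omega> in M. Nfail \<omega> = j) \<and>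
           \<P>(\<omega> in M. Nfail \<omega> = j) = 1 / p * (\<Sum>k=1..j. s k * \<P>(\<omega> in M. N (min r k) \<omega> = j))) \<and>
        (\<forall>j\<in>{r..n}.
           \<P>(\<omega> in M. Nrep \<omega> = j \<bar> Trep \<omega> < Tfail \<omega>) =
             1 / (1 - p) * (\<Sum>k=j+1..n. s k * \<P>(\<omega> in M. N r \<omega> = j))) \<and>
        (\<forall>j<r. \<P>(\<omega> in M. Nrep \<omega> = j \<bar> Trep \<omega> < Tfail \<omega>) = 0))
     \<and>
     (p > 0 \<longrightarrow>
        (AE \<omega> in M. Tfail \<omega> < \<infinity>) \<and>
        (AE \<omega> in M. ((\<lambda>t. C (ereal t) \<omega> / t) \<longlongrightarrow> ECfail / ETfail) at_top) \<and>
        ECfail / ETfail = ECrep / ETrep \<and>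
        integrable M (\<lambda>\<omega>. C (Tfail \<omega>) \<omega>) \<and> integrable M (\<lambda>\<omega>. C (Trep \<omega>) \<omega>) \<and>
        ECfail = 1 / p * ECrep \<and>
        ECfail = c_sys + 1 / p * (\<Sum>j=1..n. c_cmp j * \<P>(\<omega> in M. Nrep \<omega> = j)) \<and>
        has_finite_mean M Tfail \<and> has_finite_mean M Trep \<and>
        ETfail = 1 / p * ETrep \<and>
        ETfail = 1 / p * (\<Sum>k=1..n. s k * mean_time M (T (min k r))))
     \<and>
     (\<forall>m\<in>{1..n}.
        has_finite_mean M (T m) \<and>
        mean_time M (T m) =
          (\<Sum>i=n-m+1..n. real (n choose i) * real ((i - 1) choose (n - m)) *
             (-1) ^ (i + m - n - 1) * (1 / \<Psi> (real i))))
     \<and>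
     (p = 0 \<longrightarrow>
        (AE \<omega> in M. Tfail \<omega> = \<infinity>) \<and>
        (AE \<omega> in M. ((\<lambda>t. C (ereal t) \<omega> / t) \<longlongrightarrow> ECrep / ETrep) at_top) \<and>
        integrable M (\<lambda>\<omega>. C (Trep \<omega>) \<omega>) \<and>
        ECrep = (\<Sum>j=1..n. c_cmp j * \<P>(\<omega> in M. Nrep \<omega> = j)) \<and>
        has_finite_mean M Trep \<and>
        ETrep = (\<Sum>k=1..n. s k * mean_time M (T (min k r))))"
proof -
  interpret prob_space M by fact
  interpret I: lfmo_repair M L E n \<Phi> r c_cmp c_sys
    by unfold_locales fact+
  note defs = \<Psi>_def s_def T_def N_def Trep_def Tfail_def Nrep_def Nfail_def C_def
  have p: "p = I.p" unfolding p_def Trep_def Tfail_def by (rule I.prob_fail)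
  have ECrep: "ECrep = weight_mean I.\<psi> n I.G I.cost 0"
    unfolding ECrep_def C_def Trep_def by (rule I.first_repair_mean(2))
  have ETrep: "ETrep = exit_mean I.\<psi> n I.G"
    unfolding ETrep_def Trep_def by (rule I.first_repair_mean(4))
  have ETrep_pos: "0 < ETrep" unfolding ETrep by (rule I.exit_mean_pos)
  have ECrep_eq: "ECrep = (\<Sum>j=1..n. c_cmp j * \<P>(\<omega> in M. Nrep \<omega> = j)) + c_sys * p"
    unfolding ECrep p Nrep_def by (rule I.mean_cost)
  have ETrep_eq: "ETrep = (\<Sum>k=1..n. s k * mean_time M (T (min k r)))"
    unfolding ETrep s_def T_def by (rule I.first_repair_mean(5))
  have rate: "AE \<omega> in M. ((\<lambda>t. C (ereal t) \<omega> / t) \<longlongrightarrow> ECrep / ETrep) at_top"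
    unfolding C_def ECrep ETrep by (rule I.cost_rate)
  have intrep: "integrable M (\<lambda>\<omega>. C (Trep \<omega>) \<omega>)"
    unfolding C_def Trep_def by (rule I.first_repair_mean(1))
  have finrep: "has_finite_mean M Trep"
    unfolding Trep_def by (rule I.first_repair_mean(3))
  have part1: "p = (\<Sum>k=1..n. s k * \<P>(\<omega> in M. T (min k r) \<omega> = T k \<omega>)) \<and>
      p = (\<Sum>k=1..r. s k) + (\<Sum>k=r+1..n. s k * \<P>(\<omega> in M. T r \<omega> = T k \<omega>)) \<and>
      1 - p = (\<Sum>k=1..n. s k * \<P>(\<omega> in M. T (min k r) \<omega> < T k \<omega>)) \<and>
      1 - p = (\<Sum>k=r+1..n. s k * \<P>(\<omega> in M. T r \<omega> < T k \<omega>)) \<and>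
      (\<forall>k\<in>{r+1..n}.
         \<P>(\<omega> in M. T r \<omega> = T k \<omega>) = exit_prob_range \<Psi> n (r - 1) k n \<and>
         \<P>(\<omega> in M. T r \<omega> < T k \<omega>) = exit_prob_range \<Psi> n (r - 1) r (k - 1))"
    unfolding p defs
    by (intro conjI ballI I.p_eq I.p_split I.one_minus_p I.one_minus_p_split I.prob_ord_exit_prob_range)
  have part2: "\<forall>j\<in>{1..n}.
        \<P>(\<omega> in M. Nrep \<omega> = j) = (\<Sum>k=1..n. s k * \<P>(\<omega> in M. N (min r k) \<omega> = j)) \<and>
        \<P>(\<omega> in M. Nrep \<omega> = j) =
          (\<Sum>k=1..j * of_bool (j < r) + n * of_bool (r \<le> j). s k * \<P>(\<omega> in M. N (min r k) \<omega> = j)) \<and>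
        (\<forall>m\<in>{1..n}. \<P>(\<omega> in M. N m \<omega> = j) = (if m \<le> j then exit_prob \<Psi> n (m - 1) j else 0))"
    unfolding defs by (intro ballI conjI I.prob_repair I.prob_N_exit_prob)
  have part3: "p > 0 \<longrightarrow>
        (\<forall>j\<in>{1..n}.
           \<P>(\<omega> in M. Nrep \<omega> = j \<bar> Trep \<omega> = Tfail \<omega>) = \<P>(\<omega> in M. Nfail \<omega> = j) \<and>
           \<P>(\<omega> in M. Nfail \<omega> = j) = 1 / p * (\<Sum>k=1..j. s k * \<P>(\<omega> in M. N (min r k) \<omega> = j))) \<and>
        (\<forall>j\<in>{r..n}.
           \<P>(\<omega> in M. Nrep \<omega> = j \<bar> Trep \<omega> < Tfail \<omega>) =
             1 / (1 - p) * (\<Sum>k=j+1..n. s k * \<P>(\<omega> in M. N r \<omega> = j))) \<and>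
        (\<forall>j<r. \<P>(\<omega> in M. Nrep \<omega> = j \<bar> Trep \<omega> < Tfail \<omega>) = 0)"
    unfolding p defs
    by (intro impI conjI ballI allI I.cond_prob_repair_fail I.first_failure_mean(6)
        I.cond_prob_repair_no_fail I.cond_prob_early_no_fail)
  have part4: "p > 0 \<longrightarrow>
        (AE \<omega> in M. Tfail \<omega> < \<infinity>) \<and>
        (AE \<omega> in M. ((\<lambda>t. C (ereal t) \<omega> / t) \<longlongrightarrow> ECfail / ETfail) at_top) \<and>
        ECfail / ETfail = ECrep / ETrep \<and>
        integrable M (\<lambda>\<omega>. C (Tfail \<omega>) \<omega>) \<and> integrable M (\<lambda>\<omega>. C (Trep \<omega>) \<omega>) \<and>
        ECfail = 1 / p * ECrep \<and>
        ECfail = c_sys + 1 / p * (\<Sum>j=1..n. c_cmp j * \<P>(\<omega> in M. Nrep \<omega> = j)) \<and>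
        has_finite_mean M Tfail \<and> has_finite_mean M Trep \<and>
        ETfail = 1 / p * ETrep \<and>
        ETfail = 1 / p * (\<Sum>k=1..n. s k * mean_time M (T (min k r)))"
  proof
    assume pos: "p > 0"
    note fail = I.first_failure_mean[OF pos[unfolded p]]
    have ECfail: "ECfail = 1 / p * ECrep" unfolding ECfail_def C_def Tfail_def ECrep p fail(3) by simp
    have ETfail: "ETfail = 1 / p * ETrep" unfolding ETfail_def Tfail_def ETrep p fail(5) by simp
    have ratio: "ECfail / ETfail = ECrep / ETrep" unfolding ECfail ETfail using pos by simp
    have split: "ECfail = c_sys + 1 / p * (\<Sum>j=1..n. c_cmp j * \<P>(\<omega> in M. Nrep \<omega> = j))"
      unfolding ECfail ECrep_eq using pos by (simp add: field_simps)
    show "(AE \<omega> in M. Tfail \<omega> < \<infinity>) \<and>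
        (AE \<omega> in M. ((\<lambda>t. C (ereal t) \<omega> / t) \<longlongrightarrow> ECfail / ETfail) at_top) \<and>
        ECfail / ETfail = ECrep / ETrep \<and>
        integrable M (\<lambda>\<omega>. C (Tfail \<omega>) \<omega>) \<and> integrable M (\<lambda>\<omega>. C (Trep \<omega>) \<omega>) \<and>
        ECfail = 1 / p * ECrep \<and>
        ECfail = c_sys + 1 / p * (\<Sum>j=1..n. c_cmp j * \<P>(\<omega> in M. Nrep \<omega> = j)) \<and>
        has_finite_mean M Tfail \<and> has_finite_mean M Trep \<and>
        ETfail = 1 / p * ETrep \<and>
        ETfail = 1 / p * (\<Sum>k=1..n. s k * mean_time M (T (min k r)))"
      unfolding ETrep_eq[symmetric] ratio
      by (intro conjI refl rate intrep finrep ECfail ETfail split fail(1,2,4)[folded Tfail_def C_def])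
  qed
  have part4': "\<forall>m\<in>{1..n}.
        has_finite_mean M (T m) \<and>
        mean_time M (T m) =
          (\<Sum>i=n-m+1..n. real (n choose i) * real ((i - 1) choose (n - m)) *
             (-1) ^ (i + m - n - 1) * (1 / \<Psi> (real i)))"
    unfolding \<Psi>_def T_def by (intro ballI conjI I.mean_ord_lifetime(1,3))
  have part5: "p = 0 \<longrightarrow>
        (AE \<omega> in M. Tfail \<omega> = \<infinity>) \<and>
        (AE \<omega> in M. ((\<lambda>t. C (ereal t) \<omega> / t) \<longlongrightarrow> ECrep / ETrep) at_top) \<and>
        integrable M (\<lambda>\<omega>. C (Trep \<omega>) \<omega>) \<and>
        ECrep = (\<Sum>j=1..n. c_cmp j * \<P>(\<omega> in M. Nrep \<omega> = j)) \<and>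
        has_finite_mean M Trep \<and>
        ETrep = (\<Sum>k=1..n. s k * mean_time M (T (min k r)))"
    using rate intrep finrep ECrep_eq ETrep_eq I.never_fails unfolding p Tfail_def by (intro impI conjI) simp_all
  show ?thesis
    by (intro conjI part1[THEN conjunct1] part1[THEN conjunct2] part2 part3 part4 part4' part5)
qed

end
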